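(* Let $G$ be a Lie group and $A$ a smooth $G$-module. Then the natural map $$H^2_{lsm}(G,A)\to H^2_{lcm}(G,A)$$ is an isomorphism.
   Context: A smooth $G$-module is an abelian Lie group $A$ (written additively) with an action of $G$ by group automorphisms such that $G\times A\to A$ is smooth. Set $C^0_{lcm}(G,A)=C^0_{lsm}(G,A)=A$, and for $n\ge1$ let $C^n_{lcm}(G,A)$ (resp. $C^n_{lsm}(G,A)$) be the group of all (Borel) measurable functions $f\colon G^n\to A$ which are continuous (resp. smooth) in some neighbourhood of the identity of $G^n$. On both complexes the coboundary is $$d^nf(s_1,\dots,s_{n+1})=s_1\cdot f(s_2,\dots,s_{n+1})+\sum_{i=1}^n(-1)^i f(s_1,\dots,s_is_{i+1},\dots,s_{n+1})+(-1)^{n+1}f(s_1,\dots,s_n),$$ and $H^n_{lcm}(G,A)$, $H^n_{lsm}(G,A)$ are the $n$-th cohomology groups of the respective complexes. The natural map is induced by the inclusion $C^\bullet_{lsm}(G,A)\subset C^\bullet_{lcm}(G,A)$. *)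

theory Defs
  imports "HOL-Analysis.Analysis" "HOL-Algebra.Algebra"
begin

section \<open>Smooth functions on open subsets of a coordinate space\<close>

text \<open>
  The model space is \<open>powertop_real I\<close> for a finite index set \<open>I\<close>, i.e. the space of real
  tuples indexed by \<open>I\<close>, of dimension \<open>card I\<close>. Its points are the functions that are
  \<open>undefined\<close> outside \<open>I\<close>. Using index sets rather than types covers dimension 0 and
  all finite powers of a manifold.
\<close>

definition partial_deriv :: "'i \<Rightarrow> (('i \<Rightarrow> real) \<Rightarrow> real) \<Rightarrow> ('i \<Rightarrow> real) \<Rightarrow> real" where
  "partial_deriv i f x = deriv (\<lambda>t. f (x(i := t))) (x i)"

definition has_partial :: "'i \<Rightarrow> (('i \<Rightarrow> real) \<Rightarrow> real) \<Rightarrow> ('i \<Rightarrow> real) \<Rightarrow> bool" where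
  "has_partial i f x \<longleftrightarrow> (\<lambda>t. f (x(i := t))) field_differentiable at (x i)"

text \<open>\<open>C_on k I V f\<close>: all partial derivatives of \<open>f\<close> of order at most \<open>k\<close> exist and are
  continuous on \<open>V\<close>; it is meant for open \<open>V\<close>.\<close>

primrec C_on :: "nat \<Rightarrow> 'i set \<Rightarrow> ('i \<Rightarrow> real) set \<Rightarrow> (('i \<Rightarrow> real) \<Rightarrow> real) \<Rightarrow> bool" where
  "C_on 0 I V f \<longleftrightarrow> continuous_map (subtopology (powertop_real I) V) euclideanreal f"
| "C_on (Suc k) I V f \<longleftrightarrow>
     continuous_map (subtopology (powertop_real I) V) euclideanreal f \<and>
     (\<forall>i\<in>I. (\<forall>x\<in>V. has_partial i f x) \<and> C_on k I V (partial_deriv i f))"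

definition coord_smooth_on ::
  "'i set \<Rightarrow> 'j set \<Rightarrow> ('i \<Rightarrow> real) set \<Rightarrow> (('i \<Rightarrow> real) \<Rightarrow> ('j \<Rightarrow> real)) \<Rightarrow> bool" where
  "coord_smooth_on I J V f \<longleftrightarrow> (\<forall>j\<in>J. \<forall>k. C_on k I V (\<lambda>x. f x j))"


section \<open>Smooth manifolds\<close>

text \<open>An atlas is a set of pairs (domain, chart map); it need not be maximal.\<close>

record ('a, 'i) manifold =
  mtop :: "'a topology"
  midx :: "'i set"
  matlas :: "('a set \<times> ('a \<Rightarrow> 'i \<Rightarrow> real)) set"

definition is_chart :: "'a topology \<Rightarrow> 'i set \<Rightarrow> 'a set \<Rightarrow> ('a \<Rightarrow> 'i \<Rightarrow> real) \<Rightarrow> bool" where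
  "is_chart T I U \<phi> \<longleftrightarrow>
     openin T U \<and> openin (powertop_real I) (\<phi> ` U) \<and>
     homeomorphic_map (subtopology T U) (subtopology (powertop_real I) (\<phi> ` U)) \<phi>"

definition smooth_manifold :: "('a, 'i) manifold \<Rightarrow> bool" where
  "smooth_manifold M \<longleftrightarrow>
     finite (midx M) \<and>
     Hausdorff_space (mtop M) \<and> second_countable (mtop M) \<and>
     (\<Union>(U, \<phi>)\<in>matlas M. U) = topspace (mtop M) \<and>
     (\<forall>(U, \<phi>)\<in>matlas M. is_chart (mtop M) (midx M) U \<phi>) \<and>
     (\<forall>(U, \<phi>)\<in>matlas M. \<forall>(V, \<psi>)\<in>matlas M.
        coord_smooth_on (midx M) (midx M) (\<phi> ` (U \<inter> V)) (\<lambda>p. \<psi> (inv_into U \<phi> p)))"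

text \<open>Smoothness on an open subset \<open>W\<close> of \<open>M\<close>. Continuity makes the sets on which the
  coordinate expressions are tested open.\<close>

definition smooth_map_on ::
  "('a, 'i) manifold \<Rightarrow> ('b, 'j) manifold \<Rightarrow> 'a set \<Rightarrow> ('a \<Rightarrow> 'b) \<Rightarrow> bool" where
  "smooth_map_on M N W f \<longleftrightarrow>
     openin (mtop M) W \<and>
     continuous_map (subtopology (mtop M) W) (mtop N) f \<and>
     (\<forall>(U, \<phi>)\<in>matlas M. \<forall>(V, \<psi>)\<in>matlas N.
        coord_smooth_on (midx M) (midx N) (\<phi> ` {x \<in> U \<inter> W. f x \<in> V})
          (\<lambda>p. \<psi> (f (inv_into U \<phi> p))))"

definition smooth_map :: "('a, 'i) manifold \<Rightarrow> ('b, 'j) manifold \<Rightarrow> ('a \<Rightarrow> 'b) \<Rightarrow> bool" where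
  "smooth_map M N f \<longleftrightarrow> smooth_map_on M N (topspace (mtop M)) f"

definition prod_manifold ::
  "('a, 'i) manifold \<Rightarrow> ('b, 'j) manifold \<Rightarrow> ('a \<times> 'b, 'i + 'j) manifold" where
  "prod_manifold M N =
     \<lparr> mtop = prod_topology (mtop M) (mtop N),
       midx = midx M <+> midx N,
       matlas = {(U \<times> V, \<lambda>(x, y). restrict (case_sum (\<phi> x) (\<psi> y)) (midx M <+> midx N))
                 | U \<phi> V \<psi>. (U, \<phi>) \<in> matlas M \<and> (V, \<psi>) \<in> matlas N} \<rparr>"

text \<open>The \<open>n\<close>-th power of \<open>M\<close>; its points are tuples indexed by \<open>{..<n}\<close> and the charts
  are the products of \<open>n\<close> charts of \<open>M\<close>.\<close>

definition pow_manifold ::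
  "nat \<Rightarrow> ('a, 'i) manifold \<Rightarrow> (nat \<Rightarrow> 'a, nat \<times> 'i) manifold" where
  "pow_manifold n M =
     \<lparr> mtop = product_topology (\<lambda>_. mtop M) {..<n},
       midx = {..<n} \<times> midx M,
       matlas = {(\<Pi>\<^sub>E j\<in>{..<n}. U j, \<lambda>x. \<lambda>(j, i)\<in>{..<n} \<times> midx M. \<phi> j (x j) i)
                 | U \<phi>. \<forall>j<n. (U j, \<phi> j) \<in> matlas M} \<rparr>"


section \<open>Lie groups and smooth modules\<close>

definition lie_group :: "('g, 'c) monoid_scheme \<Rightarrow> ('g, 'i) manifold \<Rightarrow> bool" where
  "lie_group G M \<longleftrightarrow>
     group G \<and> smooth_manifold M \<and> topspace (mtop M) = carrier G \<and>
     smooth_map (prod_manifold M M) M (\<lambda>(x, y). x \<otimes>\<^bsub>G\<^esub> y) \<and>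
     smooth_map M M (\<lambda>x. inv\<^bsub>G\<^esub> x)"

text \<open>The module \<open>A\<close> is a commutative group in the multiplicative notation of HOL-Algebra.
  Membership in \<open>AutoGroup A\<close> makes \<open>act g\<close> \<open>undefined\<close> outside the carrier.\<close>

definition smooth_module ::
  "('g, 'c) monoid_scheme \<Rightarrow> ('g, 'i) manifold \<Rightarrow> ('a, 'd) monoid_scheme \<Rightarrow> ('a, 'j) manifold
     \<Rightarrow> ('g \<Rightarrow> 'a \<Rightarrow> 'a) \<Rightarrow> bool" where
  "smooth_module G M A N act \<longleftrightarrow>
     comm_group A \<and> lie_group A N \<and>
     act \<in> hom G (AutoGroup A) \<and>
     smooth_map (prod_manifold M N) N (\<lambda>(g, a). act g a)"


section \<open>Cochains\<close>

definition borel_of :: "'a topology \<Rightarrow> 'a measure" where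
  "borel_of T = sigma (topspace T) {U. openin T U}"

definition tuples :: "('g, 'c) monoid_scheme \<Rightarrow> nat \<Rightarrow> (nat \<Rightarrow> 'g) set" where
  "tuples G n = (\<Pi>\<^sub>E j\<in>{..<n}. carrier G)"

definition id_tuple :: "('g, 'c) monoid_scheme \<Rightarrow> nat \<Rightarrow> nat \<Rightarrow> 'g" where
  "id_tuple G n = (\<lambda>j\<in>{..<n}. \<one>\<^bsub>G\<^esub>)"

text \<open>Cochains are functions defined exactly on \<open>tuples G n\<close>. As \<open>tuples G 0\<close> has one point,
  both kinds of 0-cochains amount to elements of \<open>A\<close>.\<close>

definition measurable_cochains ::
  "('g, 'c) monoid_scheme \<Rightarrow> ('g, 'i) manifold \<Rightarrow> ('a, 'd) monoid_scheme \<Rightarrow> ('a, 'j) manifold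
     \<Rightarrow> nat \<Rightarrow> ((nat \<Rightarrow> 'g) \<Rightarrow> 'a) set" where
  "measurable_cochains G M A N n =
     {f \<in> tuples G n \<rightarrow>\<^sub>E carrier A.
        f \<in> measurable (borel_of (mtop (pow_manifold n M))) (borel_of (mtop N))}"

definition lcm_cochains ::
  "('g, 'c) monoid_scheme \<Rightarrow> ('g, 'i) manifold \<Rightarrow> ('a, 'd) monoid_scheme \<Rightarrow> ('a, 'j) manifold
     \<Rightarrow> nat \<Rightarrow> ((nat \<Rightarrow> 'g) \<Rightarrow> 'a) set" where
  "lcm_cochains G M A N n =
     {f \<in> measurable_cochains G M A N n.
        \<exists>W. openin (mtop (pow_manifold n M)) W \<and> id_tuple G n \<in> W \<and>
            continuous_map (subtopology (mtop (pow_manifold n M)) W) (mtop N) f}"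

definition lsm_cochains ::
  "('g, 'c) monoid_scheme \<Rightarrow> ('g, 'i) manifold \<Rightarrow> ('a, 'd) monoid_scheme \<Rightarrow> ('a, 'j) manifold
     \<Rightarrow> nat \<Rightarrow> ((nat \<Rightarrow> 'g) \<Rightarrow> 'a) set" where
  "lsm_cochains G M A N n =
     {f \<in> measurable_cochains G M A N n.
        \<exists>W. openin (mtop (pow_manifold n M)) W \<and> id_tuple G n \<in> W \<and>
            smooth_map_on (pow_manifold n M) N W f}"

definition cochain_group ::
  "('g, 'c) monoid_scheme \<Rightarrow> ('a, 'd) monoid_scheme \<Rightarrow> nat \<Rightarrow> ((nat \<Rightarrow> 'g) \<Rightarrow> 'a) set
     \<Rightarrow> ((nat \<Rightarrow> 'g) \<Rightarrow> 'a) monoid" where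
  "cochain_group G A n S = (product_group (tuples G n) (\<lambda>_. A)) \<lparr>carrier := S\<rparr>"


section \<open>Coboundary and cohomology\<close>

text \<open>Tuples are indexed from 0, so the argument \<open>s\<^sub>i\<close> of the usual formula is \<open>s (i - 1)\<close>.
  For \<open>1 \<le> i \<le> n\<close>, \<open>inner_face G n i\<close> multiplies the \<open>i\<close>-th and \<open>(i+1)\<close>-st arguments.\<close>

definition inner_face ::
  "('g, 'c) monoid_scheme \<Rightarrow> nat \<Rightarrow> nat \<Rightarrow> (nat \<Rightarrow> 'g) \<Rightarrow> nat \<Rightarrow> 'g" where
  "inner_face G n i s =
     (\<lambda>j\<in>{..<n}. if j < i - 1 then s j
                 else if j = i - 1 then s (i - 1) \<otimes>\<^bsub>G\<^esub> s i
                 else s (j + 1))"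

definition coboundary ::
  "('g, 'c) monoid_scheme \<Rightarrow> ('a, 'd) monoid_scheme \<Rightarrow> ('g \<Rightarrow> 'a \<Rightarrow> 'a) \<Rightarrow> nat
     \<Rightarrow> ((nat \<Rightarrow> 'g) \<Rightarrow> 'a) \<Rightarrow> (nat \<Rightarrow> 'g) \<Rightarrow> 'a" where
  "coboundary G A act n f =
     (\<lambda>s\<in>tuples G (n + 1).
        act (s 0) (f (\<lambda>j\<in>{..<n}. s (j + 1)))
        \<otimes>\<^bsub>A\<^esub> (\<Otimes>\<^bsub>A\<^esub>i\<in>{1..n}. f (inner_face G n i s) [^]\<^bsub>A\<^esub> ((- 1) ^ i :: int))
        \<otimes>\<^bsub>A\<^esub> f (\<lambda>j\<in>{..<n}. s j) [^]\<^bsub>A\<^esub> ((- 1) ^ (n + 1) :: int))"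

text \<open>Below, \<open>C\<close> is the family of cochain sets of a complex, e.g. \<open>lcm_cochains G M A N\<close>.\<close>

definition cocycles ::
  "('g, 'c) monoid_scheme \<Rightarrow> ('a, 'd) monoid_scheme \<Rightarrow> ('g \<Rightarrow> 'a \<Rightarrow> 'a)
     \<Rightarrow> (nat \<Rightarrow> ((nat \<Rightarrow> 'g) \<Rightarrow> 'a) set) \<Rightarrow> nat \<Rightarrow> ((nat \<Rightarrow> 'g) \<Rightarrow> 'a) set" where
  "cocycles G A act C n =
     kernel (cochain_group G A n (C n)) (cochain_group G A (n + 1) (C (n + 1)))
       (coboundary G A act n)"

definition coboundaries ::
  "('g, 'c) monoid_scheme \<Rightarrow> ('a, 'd) monoid_scheme \<Rightarrow> ('g \<Rightarrow> 'a \<Rightarrow> 'a)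
     \<Rightarrow> (nat \<Rightarrow> ((nat \<Rightarrow> 'g) \<Rightarrow> 'a) set) \<Rightarrow> nat \<Rightarrow> ((nat \<Rightarrow> 'g) \<Rightarrow> 'a) set" where
  "coboundaries G A act C n =
     (case n of 0 \<Rightarrow> {\<one>\<^bsub>cochain_group G A 0 (C 0)\<^esub>}
              | Suc m \<Rightarrow> coboundary G A act m ` C m)"

definition cohomology ::
  "('g, 'c) monoid_scheme \<Rightarrow> ('a, 'd) monoid_scheme \<Rightarrow> ('g \<Rightarrow> 'a \<Rightarrow> 'a)
     \<Rightarrow> (nat \<Rightarrow> ((nat \<Rightarrow> 'g) \<Rightarrow> 'a) set) \<Rightarrow> nat \<Rightarrow> ((nat \<Rightarrow> 'g) \<Rightarrow> 'a) set monoid" where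
  "cohomology G A act C n =
     cochain_group G A n (cocycles G A act C n) Mod coboundaries G A act C n"

text \<open>The map on cohomology induced by an inclusion of complexes into \<open>C'\<close>: the class of a
  cocycle \<open>f\<close> goes to the class of \<open>f\<close> in the cohomology of \<open>C'\<close>.\<close>

definition inclusion_map ::
  "('g, 'c) monoid_scheme \<Rightarrow> ('a, 'd) monoid_scheme \<Rightarrow> ('g \<Rightarrow> 'a \<Rightarrow> 'a)
     \<Rightarrow> (nat \<Rightarrow> ((nat \<Rightarrow> 'g) \<Rightarrow> 'a) set) \<Rightarrow> nat
     \<Rightarrow> ((nat \<Rightarrow> 'g) \<Rightarrow> 'a) set \<Rightarrow> ((nat \<Rightarrow> 'g) \<Rightarrow> 'a) set" where
  "inclusion_map G A act C' n c =
     the_elem ((\<lambda>f. coboundaries G A act C' n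
                     #>\<^bsub>cochain_group G A n (cocycles G A act C' n)\<^esub> f) ` c)"

definition H_lcm ::
  "('g, 'c) monoid_scheme \<Rightarrow> ('g, 'i) manifold \<Rightarrow> ('a, 'd) monoid_scheme \<Rightarrow> ('a, 'j) manifold
     \<Rightarrow> ('g \<Rightarrow> 'a \<Rightarrow> 'a) \<Rightarrow> nat \<Rightarrow> ((nat \<Rightarrow> 'g) \<Rightarrow> 'a) set monoid" where
  "H_lcm G M A N act n = cohomology G A act (lcm_cochains G M A N) n"

definition H_lsm ::
  "('g, 'c) monoid_scheme \<Rightarrow> ('g, 'i) manifold \<Rightarrow> ('a, 'd) monoid_scheme \<Rightarrow> ('a, 'j) manifold
     \<Rightarrow> ('g \<Rightarrow> 'a \<Rightarrow> 'a) \<Rightarrow> nat \<Rightarrow> ((nat \<Rightarrow> 'g) \<Rightarrow> 'a) set monoid" where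
  "H_lsm G M A N act n = cohomology G A act (lsm_cochains G M A N) n"

definition natural_map ::
  "('g, 'c) monoid_scheme \<Rightarrow> ('g, 'i) manifold \<Rightarrow> ('a, 'd) monoid_scheme \<Rightarrow> ('a, 'j) manifold
     \<Rightarrow> ('g \<Rightarrow> 'a \<Rightarrow> 'a) \<Rightarrow> nat
     \<Rightarrow> ((nat \<Rightarrow> 'g) \<Rightarrow> 'a) set \<Rightarrow> ((nat \<Rightarrow> 'g) \<Rightarrow> 'a) set" where
  "natural_map G M A N act n = inclusion_map G A act (lcm_cochains G M A N) n"

end

theory Submission
  imports Defs
begin

text \<open>
  Near the identity the module is linearised by a logarithm: the halving map of the commutative
  local group has the iterated rescaling limit \<open>L\<close>, which is additive, and \<open>L\<close> and its
  inverse are smooth. Cochains that are small near the identity thus become vector valued, and can be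
  averaged over small coordinate cubes with bump weights instead of a Haar measure.

  Injectivity: if \<open>b\<close> is continuous near 1 and \<open>db\<close> is smooth near 1, then averaging
  \<open>b(s) = b(su) - s b(u) + db(s,u)\<close> over \<open>u\<close> expresses \<open>b(s)\<close> by smooth terms and by an average of
  \<open>b(su)\<close>, which is smooth in \<open>s\<close> after integration by parts, although \<open>b\<close> is only continuous.

  Surjectivity: for a cocycle \<open>f\<close> put \<open>P(s,t) = \<integral> f(s,tu) du\<close> and \<open>b(s) = P(s,1)\<close>. Then
  \<open>f - db\<close> equals \<open>P(s,t) - P(s,1)\<close>, and averaging the cocycle identity over a further left
  factor \<open>r\<close> writes this as integrals of \<open>f(r \<sigma>, \<tau> u)\<close> over \<open>r\<close> and \<open>u\<close>, which are smooth in the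
  parameters of \<open>\<sigma>\<close> and \<open>\<tau>\<close>.
\<close>

section \<open>Calculus in coordinate spaces\<close>

text \<open>The obstacle is to obtain smooth averages of integrands that are merely continuous. A
  displacement of a parameter of \<open>r \<sigma>\<close> can be absorbed by moving
  \<open>r\<close>, and one of a parameter of \<open>\<tau> u\<close> by moving \<open>u\<close>.
  Hence parameter derivatives of a function of these two products are combinations, with smooth
  coefficients, of derivatives in the integration variables; integration by parts accepts any smooth
  weight, so no invariance of the measure is involved. This dictates the two averages in degree 2:
  averaging over \<open>u\<close> smooths only the second argument of \<open>f\<close>, and the
  first is reached only through a left factor \<open>r\<close>. The values \<open>f(r,s)\<close>
  that appear on the way are not smooth, but they cancel. The logarithm serves twice: averages need
  a vector space, and the action of \<open>g\<close> becomes a matrix depending smoothly on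
  \<open>g\<close>. Cochains are first normalised by constants, because the logarithm exists only
  near the identity. Injectivity holds in the strong form that a continuous 1-cochain with smooth
  coboundary is itself smooth. All of this is local; a primitive found near 1 is extended by the
  unit, which keeps it measurable.\<close>

abbreviation "pd \<equiv> partial_deriv"
abbreviation "RR \<equiv> powertop_real"

lemma PiE_UNIV_eq_extensional [simp]: "I \<rightarrow>\<^sub>E UNIV = extensional I"
 by (simp add: PiE_def)

text \<open>Coordinates off \<open>I\<close> have the constant value \<open>undefined\<close> and
  contribute nothing to the topology. This turns continuity on \<open>RR I\<close> into
  \<open>continuous_on\<close> for the type-class topology of functions.\<close>

lemma powertop_real_eq_top_of_set: "RR I = top_of_set (extensional I)"
proof -
 have 1: "continuous_map (RR I) (top_of_set (extensional I)) id"
  unfolding continuous_map_in_subtopology euclidean_product_topology[symmetric]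
 proof (intro conjI continuous_map_coordinatewise_then_product)
  fix i :: 'a
  show "continuous_map (RR I) euclideanreal (%x. id x i)"
  proof (cases "i : I")
   case True
   thus ?thesis using continuous_map_product_coordinates[of i I "%_. euclideanreal"] by simp
  next
   case False
   have "continuous_map (RR I) euclideanreal (%x. undefined)"
    by simp
   thus ?thesis
    by (rule continuous_map_eq) (use False in \<open>auto simp: extensional_def\<close>)
  qed
 qed auto
 have 2: "continuous_map (top_of_set (extensional I)) (RR I) id"
 proof (intro continuous_map_coordinatewise_then_product)
  fix i assume "i : I"
  have "continuous_on (extensional I) (%x::'a => real. x i)"
   by (rule continuous_on_subset[OF continuous_on_product_coordinates]) auto
  thus "continuous_map (top_of_set (extensional I)) euclideanreal (%x. id x i)"
   by simp
 qed (auto simp: extensional_def)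
 have "homeomorphic_maps (RR I) (top_of_set (extensional I)) id id"
  unfolding homeomorphic_maps_def using 1 2 by auto
 thus ?thesis
  using homeomorphic_map_id homeomorphic_maps_map by metis
qed

lemma continuous_map_powertop_real_iff:
 "continuous_map (subtopology (RR I) V) euclideanreal f \<longleftrightarrow> continuous_on (extensional I \<inter> V) f"
 by (simp add: powertop_real_eq_top_of_set subtopology_subtopology)

definition cube :: "'i set => ('i => real) => real => ('i => real) set" where
 "cube I c r = (\<Pi>\<^sub>E i\<in>I. {c i - r <..< c i + r})"

lemma mem_cube: "x : cube I c r \<longleftrightarrow> x : extensional I & (\<forall>i\<in>I. \<bar>x i - c i\<bar> < r)"
 by (auto simp: cube_def PiE_iff abs_less_iff)

lemma openin_cube: "finite I ==> openin (RR I) (cube I c r)"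
 unfolding cube_def by (subst openin_PiE) auto

lemma openin_contains_cube:
 assumes "finite I" "openin (RR I) V" "x : V"
 shows "\<exists>r>0. cube I x r \<subseteq> V"
proof -
 obtain U where U: "!!i. i : I ==> open (U i)" "x : PiE I U" "PiE I U \<subseteq> V"
 proof -
  have "\<forall>x\<in>V. \<exists>U. finite {i : I. U i ~= topspace euclideanreal} & (\<forall>i\<in>I. openin euclideanreal (U i)) \<and>
    x : PiE I U & PiE I U \<subseteq> V"
   using assms(2) unfolding openin_product_topology_alt .
  with assms(3) that show thesis by (metis open_openin)
 qed
 have "\<exists>r>0. {x i - r <..< x i + r} \<subseteq> U i" if "i : I" for i
  using U(1)[OF that] U(2) that
  by (metis PiE_mem ball_eq_greaterThanLessThan open_contains_ball)
 then obtain r where r: "!!i. i : I ==> r i > 0 & {x i - r i <..< x i + r i} \<subseteq> U i"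
  by metis
 \<comment> \<open>The element 1 keeps the minimum meaningful when \<open>I\<close> is empty, that
   is in dimension 0.\<close>
 define s where "s = Min (insert 1 (r ` I))"
 have s: "s > 0" "!!i. i : I ==> s <= r i"
  using assms(1) r by (auto simp: s_def)
 have "cube I x s \<subseteq> PiE I U"
  unfolding cube_def
 proof (rule PiE_mono)
  fix i assume i: "i : I"
  show "{x i - s <..< x i + s} \<subseteq> U i"
   using r[OF i] s(2)[OF i] by (force simp: subset_iff)
 qed
 thus ?thesis using s U by blast
qed

lemma cube_mono: "r <= s ==> cube I c r \<subseteq> cube I c s"
 by (force simp: mem_cube subset_iff)

lemma center_in_cube: "c : extensional I ==> r > 0 ==> c : cube I c r"
 by (simp add: mem_cube)

lemma openin_subset_extensional: "openin (RR I) V ==> V \<subseteq> extensional I"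
 using openin_subset by fastforce

lemma fun_upd_extensional: "x : extensional I ==> i : I ==> x(i := t) : extensional I"
 by (auto simp: extensional_def)

lemma open_line_slice:
 assumes "openin (RR I) V" "i : I" "x : extensional I"
 shows "open {t. x(i := t) : V}"
proof -
 have "continuous_map euclideanreal (RR I) (%t. x(i := t))"
 proof (rule continuous_map_coordinatewise_then_product)
  fix k assume "k : I"
  thus "continuous_map euclideanreal euclideanreal (%t. (x(i := t)) k)"
   by (cases "k = i") (auto simp: continuous_map_iff_continuous2)
 next
  fix k t assume "k \<notin> I"
  thus "(x(i := t)) k = undefined" using assms by (auto simp: extensional_def)
 qed
 hence "openin euclideanreal {t : topspace euclideanreal. (%t. x(i := t)) t : V}"
  using assms(1) by (rule openin_continuous_map_preimage)
 hence "openin euclideanreal {t. x(i := t) : V}"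
  unfolding topspace_euclidean by auto
 thus ?thesis
  using open_openin by blast
qed

lemma eventually_line_in:
 assumes "openin (RR I) V" "i : I" "x : V"
 shows "eventually (%t. x(i := t) : V) (nhds (x i))"
proof -
 have "x : extensional I" using assms openin_subset_extensional by blast
 hence "open {t. x(i := t) : V}" using assms(1,2) by (intro open_line_slice)
 moreover have "x i : {t. x(i := t) : V}" using assms by simp
 ultimately have "eventually (%t. t : {t. x(i := t) : V}) (nhds (x i))" by (rule eventually_nhds_in_open)
 thus ?thesis by simp
qed

text \<open>A partial derivative sees only a short piece of a coordinate line, and an open
  \<open>V\<close> contains such a piece around each of its points. Functions here are total, so
  their values off \<open>V\<close> must be irrelevant.\<close>

lemma partial_cong:
 assumes "openin (RR I) V" "!!y. y : V ==> f y = g y" "x : V" "i : I"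
 shows "has_partial i f x \<longleftrightarrow> has_partial i g x" "pd i f x = pd i g x"
proof -
 have ev: "eventually (%t. f (x(i := t)) = g (x(i := t))) (nhds (x i))"
  using eventually_line_in[OF assms(1,4,3)] by eventually_elim (use assms in auto)
 thus "pd i f x = pd i g x"
  unfolding partial_deriv_def by (intro deriv_cong_ev) auto
 show "has_partial i f x \<longleftrightarrow> has_partial i g x"
  unfolding has_partial_def field_differentiable_def using DERIV_cong_ev[OF refl ev] by simp
qed

lemma has_partialD:
 "has_partial i f x ==> ((%t. f (x(i := t))) has_real_derivative pd i f x) (at (x i))"
 unfolding has_partial_def partial_deriv_def by (simp add: DERIV_deriv_iff_field_differentiable)

lemma has_partialI:
 assumes "((%t. f (x(i := t))) has_real_derivative D) (at (x i))"
 shows "has_partial i f x" "pd i f x = D"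
 using assms unfolding has_partial_def partial_deriv_def field_differentiable_def
 by (auto simp: DERIV_imp_deriv)

section \<open>Closure properties of the classes C^k on open sets\<close>

lemma C_on_cont: "C_on k I V f ==> continuous_on (extensional I \<inter> V) f"
 by (cases k) (auto simp: continuous_map_powertop_real_iff)

lemma C_on_Suc_iff:
 "C_on (Suc k) I V f \<longleftrightarrow> continuous_on (extensional I \<inter> V) f \<and>
   (\<forall>i\<in>I. (\<forall>x\<in>V. has_partial i f x) & C_on k I V (pd i f))"
 by (simp add: continuous_map_powertop_real_iff)

lemma C_on_0_iff: "C_on 0 I V f \<longleftrightarrow> continuous_on (extensional I \<inter> V) f"
 by (simp add: continuous_map_powertop_real_iff)

declare C_on.simps [simp del]

lemma C_on_SucD: "C_on (Suc k) I V f ==> C_on k I V f"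
 by (induction k arbitrary: f) (auto simp: C_on_Suc_iff C_on_0_iff)

lemma C_on_mono: "C_on m I V f ==> k <= m ==> C_on k I V f"
 by (induction m) (auto simp: le_Suc_eq dest: C_on_SucD)

lemma C_on_subset: "C_on k I V f ==> V' \<subseteq> V ==> C_on k I V' f"
proof (induction k arbitrary: f)
 case 0 thus ?case by (auto simp: C_on_0_iff elim!: continuous_on_subset)
next
 case (Suc k)
 thus ?case
  unfolding C_on_Suc_iff by (blast intro: continuous_on_subset)
qed

lemma C_on_cong:
 assumes "openin (RR I) V" "!!y. y : V ==> f y = g y"
 shows "C_on k I V f \<longleftrightarrow> C_on k I V g"
 using assms(2)
proof (induction k arbitrary: f g)
 case 0
 have "continuous_on (extensional I \<inter> V) f = continuous_on (extensional I \<inter> V) g"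
  by (rule continuous_on_cong) (use 0 in auto)
 thus ?case by (simp add: C_on_0_iff)
next
 case (Suc k)
 have 1: "continuous_on (extensional I \<inter> V) f = continuous_on (extensional I \<inter> V) g"
  by (rule continuous_on_cong) (use Suc in auto)
 have 2: "C_on k I V (pd i f) = C_on k I V (pd i g)" if "i : I" for i
  by (rule Suc.IH) (use partial_cong(2)[OF assms(1) Suc.prems] that in auto)
 show ?case
  unfolding C_on_Suc_iff 1 using 2 partial_cong(1)[OF assms(1) Suc.prems] by auto
qed

lemma continuous_on_local:
 assumes "!!x. x : V ==> \<exists>V'. openin (RR I) V' & x : V' & continuous_on (extensional I \<inter> (V \<inter> V')) f"
 shows "continuous_on (extensional I \<inter> V) f"
 unfolding continuous_on_def
proof
 fix x assume x: "x : extensional I \<inter> V"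
 then obtain V' where V': "openin (RR I) V'" "x : V'" "continuous_on (extensional I \<inter> (V \<inter> V')) f"
  using assms by blast
 obtain T where T: "open T" "V' = extensional I \<inter> T"
  using V'(1) unfolding powertop_real_eq_top_of_set openin_open by auto
 have "(f \<longlongrightarrow> f x) (at x within (extensional I \<inter> (V \<inter> V')))"
  using V' x by (auto simp: continuous_on_def)
 moreover have "at x within (extensional I \<inter> (V \<inter> V')) = at x within (extensional I \<inter> V)"
  by (rule at_within_nhd[of x T]) (use T x V' in auto)
 ultimately show "(f \<longlongrightarrow> f x) (at x within extensional I \<inter> V)" by simp
qed

lemma C_on_local:
 assumes "!!x. x : V ==> \<exists>V'. openin (RR I) V' & x : V' & C_on k I (V \<inter> V') f"
 shows "C_on k I V f"
 using assms
proof (induction k arbitrary: f)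
 case 0
 show ?case unfolding C_on_0_iff
  by (rule continuous_on_local, drule 0) (auto simp: C_on_0_iff)
next
 case (Suc k)
 have 1: "continuous_on (extensional I \<inter> V) f"
  by (rule continuous_on_local, drule Suc.prems) (use C_on_cont in blast)
 show ?case unfolding C_on_Suc_iff
 proof (intro conjI ballI 1)
  fix i x assume "i : I" "x : V"
  thus "has_partial i f x" using Suc.prems[of x] by (auto simp: C_on_Suc_iff)
 next
  fix i assume "i : I"
  thus "C_on k I V (pd i f)"
   by (intro Suc.IH) (use Suc.prems in \<open>fastforce simp: C_on_Suc_iff\<close>)
 qed
qed

lemma C_on_const:
 fixes I :: "'i set"
 shows "C_on k I V (%x. c)"
proof (induction k arbitrary: c)
 case (Suc k)
 have "pd i (%x. c) = (%x. 0)" for i :: 'i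
  by (rule ext, rule has_partialI(2)) auto
 moreover have "has_partial i (%x. c) x" for i :: 'i and x
  by (rule has_partialI(1)[where D=0]) auto
 ultimately show ?case using Suc by (auto simp: C_on_Suc_iff)
qed (simp add: C_on_0_iff)

lemma C_on_coord: "C_on k I V (%x. x i)"
proof (cases k)
 case 0
 thus ?thesis
  by (auto simp: C_on_0_iff intro: continuous_on_subset[OF continuous_on_product_coordinates])
next
 case (Suc m)
 have *: "((%t. (x(k := t)) i) has_real_derivative (if i = k then 1 else 0)) (at (x k))" for x :: "'a => real" and k
  by auto
 have "pd k (%x. x i) = (%x. if i = k then 1 else 0)" for k
  by (rule ext, rule has_partialI(2)[OF *])
 moreover have "has_partial k (%x. x i) x" for k x
  by (rule has_partialI(1)[OF *])
 ultimately show ?thesis unfolding Suc C_on_Suc_iff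
  by (auto intro: continuous_on_subset[OF continuous_on_product_coordinates] C_on_const)
qed

lemma C_on_add:
 assumes V: "openin (RR I) V"
 shows "C_on k I V f ==> C_on k I V g ==> C_on k I V (%x. f x + g x)"
proof (induction k arbitrary: f g)
 case 0 thus ?case by (auto simp: C_on_0_iff intro: continuous_intros)
next
 case (Suc k)
 have D: "((%t. f (x(i := t)) + g (x(i := t))) has_real_derivative (pd i f x + pd i g x)) (at (x i))"
  if "i : I" "x : V" for i x
  by (intro DERIV_add has_partialD) (use Suc.prems that in \<open>auto simp: C_on_Suc_iff\<close>)
 show ?case unfolding C_on_Suc_iff
 proof (intro conjI ballI)
  show "continuous_on (extensional I \<inter> V) (%x. f x + g x)"
   using Suc.prems by (auto simp: C_on_Suc_iff intro: continuous_intros)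
  fix i assume i: "i : I"
  show "has_partial i (%x. f x + g x) x" if "x : V" for x
   using has_partialI(1)[OF D[OF i that]] .
  have "C_on k I V (%x. pd i f x + pd i g x)"
   by (rule Suc.IH) (use Suc.prems i in \<open>auto simp: C_on_Suc_iff\<close>)
  thus "C_on k I V (pd i (%x. f x + g x))"
   by (subst C_on_cong[OF V has_partialI(2)[OF D[OF i]]]) auto
 qed
qed

lemma C_on_mult:
 assumes V: "openin (RR I) V"
 shows "C_on k I V f ==> C_on k I V g ==> C_on k I V (%x. f x * g x)"
proof (induction k arbitrary: f g)
 case 0 thus ?case by (auto simp: C_on_0_iff intro: continuous_intros)
next
 case (Suc k)
 have D: "((%t. f (x(i := t)) * g (x(i := t))) has_real_derivative (pd i f x * g x + f x * pd i g x)) (at (x i))"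
  if "i : I" "x : V" for i x
 proof -
  have "((%t. f (x(i := t)) * g (x(i := t))) has_real_derivative
    (pd i f x * g (x(i := x i)) + pd i g x * f (x(i := x i)))) (at (x i))"
   by (intro DERIV_mult has_partialD) (use Suc.prems that in \<open>auto simp: C_on_Suc_iff\<close>)
  thus ?thesis by (simp add: mult.commute)
 qed
 show ?case unfolding C_on_Suc_iff
 proof (intro conjI ballI)
  show "continuous_on (extensional I \<inter> V) (%x. f x * g x)"
   using Suc.prems by (auto simp: C_on_Suc_iff intro: continuous_intros)
  fix i assume i: "i : I"
  show "has_partial i (%x. f x * g x) x" if "x : V" for x
   using has_partialI(1)[OF D[OF i that]] .
  have "C_on k I V (%x. pd i f x * g x + f x * pd i g x)"
   by (intro C_on_add[OF V] Suc.IH C_on_SucD[OF Suc.prems(1)] C_on_SucD[OF Suc.prems(2)])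
    (use Suc.prems i in \<open>auto simp: C_on_Suc_iff\<close>)
  thus "C_on k I V (pd i (%x. f x * g x))"
   by (subst C_on_cong[OF V has_partialI(2)[OF D[OF i]]]) auto
 qed
qed

lemma C_on_cmult: "openin (RR I) V ==> C_on k I V f ==> C_on k I V (%x. c * f x)"
 using C_on_mult C_on_const by blast

lemma C_on_minus: "openin (RR I) V ==> C_on k I V f ==> C_on k I V (%x. - f x)"
 using C_on_cmult[of I V k f "-1"] by simp

lemma C_on_diff:
 "openin (RR I) V ==> C_on k I V f ==> C_on k I V g ==> C_on k I V (%x. f x - g x)"
 using C_on_add[of I V k f "%x. - g x"] C_on_minus[of I V k g] by simp

lemma C_on_sum:
 assumes "openin (RR I) V" "!!a. a : S ==> C_on k I V (f a)"
 shows "C_on k I V (%x. \<Sum>a\<in>S. f a x)"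
 using assms(2) by (induction S rule: infinite_finite_induct) (auto intro!: C_on_add assms(1) C_on_const)

lemma C_on_prod:
 assumes "openin (RR I) V" "!!a. a : S ==> C_on k I V (f a)"
 shows "C_on k I V (%x. \<Prod>a\<in>S. f a x)"
 using assms(2) by (induction S rule: infinite_finite_induct) (auto intro!: C_on_mult assms(1) C_on_const)

text \<open>The chain rule changes the coordinates one at a time and uses the mean value theorem
 for each change.\<close>

lemma total_derivative:
 assumes fin: "finite J" and V: "openin (RR J) V" and g: "C_on 1 J V g"
  and y: "y : V"
  and c: "!!j. j : J ==> ((%t. c t j) has_real_derivative c' j) (at t0)" "!!j. j : J ==> c t0 j = y j"
  and S: "S \<subseteq> J"
 shows "((%t. g (%j. if j : S then c t j else y j)) has_real_derivative (\<Sum>j\<in>S. pd j g y * c' j)) (at t0)"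
proof -
 have "finite S" using fin S finite_subset by blast
 thus ?thesis using S
 proof (induction S rule: finite_induct)
  case empty thus ?case by simp
 next
  case (insert k S)
  \<comment> \<open>The point in which the coordinates in \<open>S\<close> have already moved;
    coordinate \<open>k\<close> moves next.\<close>
  define m where "m t = (%j. if j : S then c t j else y j)" for t
  have k: "k : J" using insert by auto
  have yext: "y : extensional J" using V y openin_subset_extensional by blast
  have mk: "m t k = y k" for t using insert by (simp add: m_def)
  have m0: "m t0 = y" using c(2) insert.prems by (auto simp: m_def fun_eq_iff subset_iff)
  obtain r where r: "r > 0" "cube J y r \<subseteq> V" using openin_contains_cube[OF fin V y] by blast
  have "\<exists>gm. (\<forall>z. c z k - c t0 k = gm z * (z - t0)) & isCont gm t0 & gm t0 = c' k"
   using c(1)[OF k] unfolding CARAT_DERIV .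
  then obtain gm where gm: "!!z. c z k - y k = gm z * (z - t0)" "isCont gm t0" "gm t0 = c' k"
   using c(2)[OF k] by auto
  \<comment> \<open>Difference quotient of \<open>g\<close> in direction \<open>k\<close>, completed
    by the expected limit where the displacement is zero. Caratheodory's criterion then only asks
    for continuity of \<open>q\<close> at \<open>t0\<close>.\<close>
  define q where "q t = (if c t k = y k then pd k g y
    else (g ((m t)(k := c t k)) - g (m t)) / (c t k - y k))" for t
  have gq: "g ((m t)(k := c t k)) - g (m t) = q t * gm t * (t - t0)" for t
  proof (cases "c t k = y k")
   case True
   hence "(m t)(k := c t k) = m t" using mk by auto
   moreover have "gm t * (t - t0) = 0" using gm(1)[of t] True by simp
   ultimately show ?thesis by auto
  next
   case False
   hence "g ((m t)(k := c t k)) - g (m t) = q t * (c t k - y k)" by (simp add: q_def)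
   thus ?thesis using gm(1)[of t] by (simp add: mult.assoc)
  qed
  have cj: "eventually (%t. \<bar>c t j - y j\<bar> < s) (nhds t0)" if "s > 0" "j : J" for s j
  proof -
   have "isCont (%t. c t j) t0" using c(1)[OF that(2)] DERIV_isCont by blast
   hence "((%t. c t j) \<longlongrightarrow> c t0 j) (nhds t0)" by (simp add: continuous_at tendsto_nhds_iff)
   from tendstoD[OF this \<open>s > 0\<close>] show ?thesis using c(2)[OF that(2)] by (simp add: dist_real_def)
  qed
  have "isCont q t0" unfolding continuous_at
  proof (rule tendstoI)
   fix e :: real assume "e > 0"
   have "C_on 0 J V (pd k g)" using g k by (auto simp: C_on_Suc_iff One_nat_def)
   hence co: "continuous_map (subtopology (RR J) V) euclideanreal (pd k g)"
    by (simp add: C_on_0_iff continuous_map_powertop_real_iff)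
   have "openin (subtopology (RR J) V) {z : topspace (subtopology (RR J) V). pd k g z : ball (pd k g y) e}"
    using co by (rule openin_continuous_map_preimage) auto
   hence "openin (RR J) {z : V. pd k g z : ball (pd k g y) e}"
    using V openin_subset_extensional[OF V]
    by (simp add: openin_open_subtopology subset_iff cong: conj_cong)
     (smt (verit, best) Collect_cong)
   moreover have "y : {z : V. pd k g z : ball (pd k g y) e}"
    using y \<open>e > 0\<close> by simp
   ultimately obtain s where s: "s > 0"
    "cube J y s \<subseteq> {z : V. pd k g z : ball (pd k g y) e}"
    using openin_contains_cube[OF fin] by meson
   have "eventually (%t. \<forall>j\<in>J. \<bar>c t j - y j\<bar> < s) (nhds t0)"
    using cj[OF s(1)] fin by (simp add: eventually_ball_finite_distrib)
   hence "eventually (%t. dist (q t) (q t0) < e) (nhds t0)"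
   proof eventually_elim
    case (elim t)
    have line: "(m t)(k := \<xi>) : cube J y s" if "\<bar>\<xi> - y k\<bar> < s" for \<xi>
     using elim that insert.prems yext s(1) unfolding mem_cube m_def
     by (auto simp: extensional_def)
    have q0: "q t0 = pd k g y" using c(2)[OF k] by (simp add: q_def)
    show ?case
    proof (cases "c t k = y k")
     case True thus ?thesis using q0 \<open>e > 0\<close> by (simp add: q_def)
    next
     case False
     define f where "f \<xi> = g ((m t)(k := \<xi>))" for \<xi>
     have der: "(f has_real_derivative pd k g ((m t)(k := \<xi>))) (at \<xi>)" if "\<bar>\<xi> - y k\<bar> < s" for \<xi>
     proof -
      have "(m t)(k := \<xi>) : V" using line[OF that] s by auto
      hence "has_partial k g ((m t)(k := \<xi>))" using g k by (auto simp: C_on_Suc_iff One_nat_def)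
      from has_partialD[OF this] show ?thesis by (simp add: f_def[abs_def])
     qed
     have ck: "\<bar>c t k - y k\<bar> < s" using elim k by auto
     \<comment> \<open>The mean value theorem for either order of the endpoints; the whole segment
       stays in the cube where \<open>pd k g\<close> is within \<open>e\<close> of its value at
       \<open>y\<close>.\<close>
     have "\<exists>\<xi>. \<bar>\<xi> - y k\<bar> < s & f (c t k) - f (y k) = (c t k - y k) * pd k g ((m t)(k := \<xi>))"
     proof (cases "y k < c t k")
      case True
      have "\<exists>z>y k. z < c t k & f (c t k) - f (y k) = (c t k - y k) * pd k g ((m t)(k := z))"
       by (rule MVT2[OF True]) (use der ck in auto)
      thus ?thesis using ck by force
     next
      case F: False
      hence lt: "c t k < y k" using False by simp
      have "\<exists>z>c t k. z < y k & f (y k) - f (c t k) = (y k - c t k) * pd k g ((m t)(k := z))"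
       by (rule MVT2[OF lt]) (use der ck in auto)
      then obtain z where z: "z > c t k" "z < y k" "f (y k) - f (c t k) = (y k - c t k) * pd k g ((m t)(k := z))" by blast
      hence "f (c t k) - f (y k) = (c t k - y k) * pd k g ((m t)(k := z))" by (simp add: algebra_simps)
      thus ?thesis using z ck by force
     qed
     then obtain \<xi> where \<xi>: "\<bar>\<xi> - y k\<bar> < s" "f (c t k) - f (y k) = (c t k - y k) * pd k g ((m t)(k := \<xi>))" by blast
     have "f (y k) = g (m t)" using mk by (metis f_def fun_upd_triv)
     hence "q t = pd k g ((m t)(k := \<xi>))" using \<xi>(2) False by (simp add: q_def f_def)
     moreover have "(m t)(k := \<xi>) : {z : V. pd k g z : ball (pd k g y) e}"
      using line[OF \<xi>(1)] s(2) by blast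
     ultimately show ?thesis using q0 by (simp add: dist_commute)
    qed
   qed
   thus "eventually (%t. dist (q t) (q t0) < e) (at t0)"
    by (simp add: eventually_nhds_conv_at)
  qed
  hence D2: "((%t. g ((m t)(k := c t k)) - g (m t)) has_real_derivative (pd k g y * c' k)) (at t0)"
   unfolding CARAT_DERIV
  proof (intro exI[of _ "%t. q t * gm t"] conjI allI)
   show "g ((m z)(k := c z k)) - g (m z) - (g ((m t0)(k := c t0 k)) - g (m t0)) = q z * gm z * (z - t0)" for z
    using gq[of z] gq[of t0] by simp
   show "isCont (%t. q t * gm t) t0" using \<open>isCont q t0\<close> gm(2) by (rule continuous_mult)
   show "q t0 * gm t0 = pd k g y * c' k" using gm(3) c(2)[OF k] by (simp add: q_def)
  qed
  have D1: "((%t. g (m t)) has_real_derivative (\<Sum>j\<in>S. pd j g y * c' j)) (at t0)"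
   using insert unfolding m_def by auto
  have "((%t. g (m t) + (g ((m t)(k := c t k)) - g (m t))) has_real_derivative
    ((\<Sum>j\<in>S. pd j g y * c' j) + pd k g y * c' k)) (at t0)"
   by (rule DERIV_add[OF D1 D2])
  moreover have "(m t)(k := c t k) = (%j. if j : insert k S then c t j else y j)" for t
   by (auto simp: m_def)
  ultimately show ?case using insert by (simp add: add.commute)
 qed
qed

lemma total_derivative_extensional:
 assumes fin: "finite J" and V: "openin (RR J) V" and g: "C_on 1 J V g"
  and y: "c t0 : V" and ext: "!!t. c t : extensional J"
  and c: "!!j. j : J ==> ((%t. c t j) has_real_derivative c' j) (at t0)"
 shows "((%t. g (c t)) has_real_derivative (\<Sum>j\<in>J. pd j g (c t0) * c' j)) (at t0)"
proof -
 have "(%j. if j : J then c t j else c t0 j) = c t" for t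
  using ext by (auto simp: extensional_def)
 thus ?thesis
  using total_derivative[OF fin V g y c refl subset_refl] by simp
qed

lemma chain_rule:
 assumes fin: "finite J" and V: "openin (RR I) V" and V': "openin (RR J) V'"
  and u: "u ` V \<subseteq> V'" "!!j. j : J ==> C_on 1 I V (%x. u x j)" and g: "C_on 1 J V' g"
  and x: "x : V" "i : I"
 shows "((%t. g (u (x(i := t)))) has_real_derivative
   (\<Sum>j\<in>J. pd j g (u x) * pd i (%x. u x j) x)) (at (x i))"
proof -
 \<comment> \<open>Off \<open>V\<close> nothing is known about \<open>u\<close>, so the curve is
   frozen there to be extensional for every \<open>t\<close>; near \<open>x i\<close> it is
   unchanged.\<close>
 define c where "c t = (if x(i := t) : V then u (x(i := t)) else u x)" for t
 have ev: "eventually (%t. c t = u (x(i := t))) (nhds (x i))"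
  using eventually_line_in[OF V x(2,1)] by eventually_elim (auto simp: c_def)
 have ext: "c t : extensional J" for t
  using u(1) x V' openin_subset_extensional[OF V'] by (auto simp: c_def)
 have c0: "c (x i) = u x" using x by (simp add: c_def)
 have "((%t. g (c t)) has_real_derivative (\<Sum>j\<in>J. pd j g (c (x i)) * pd i (%x. u x j) x)) (at (x i))"
 proof (rule total_derivative_extensional[OF fin V' g _ ext])
  show "c (x i) : V'" using c0 u x by auto
  fix j assume j: "j : J"
  have "has_partial i (%x. u x j) x" using u(2)[OF j] x by (auto simp: C_on_Suc_iff One_nat_def)
  from has_partialD[OF this]
  show "((%t. c t j) has_real_derivative pd i (%x. u x j) x) (at (x i))"
   by (subst DERIV_cong_ev[OF refl _ refl]) (use ev in \<open>auto elim: eventually_mono\<close>)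
 qed
 thus ?thesis unfolding c0
  by (subst (asm) DERIV_cong_ev[OF refl _ refl]) (use ev in \<open>auto elim: eventually_mono\<close>)
qed

lemma continuous_on_compose_coords:
 fixes u :: "'a::topological_space => 'j => real"
 assumes "u ` V \<subseteq> V'" "V' \<subseteq> extensional J" "!!j. j : J ==> continuous_on V (%x. u x j)" "continuous_on V' g"
 shows "continuous_on V (%x. g (u x))"
proof -
 have "continuous_on V (%x. u x j)" for j
 proof (cases "j : J")
  case False
  have "continuous_on V (%x. undefined :: real)" by simp
  thus ?thesis
   by (rule continuous_on_eq) (use False assms(1,2) in \<open>force simp: extensional_def image_subset_iff subset_iff\<close>)
 qed (use assms in auto)
 hence "continuous_on V u" by (rule continuous_on_coordinatewise_then_product)
 thus ?thesis using assms continuous_on_compose2 by blast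
qed

text \<open>The chain rule writes each first partial as a sum of products of \<open>pd j g\<close>
  at \<open>u\<close> and partials of \<open>u\<close>, all one order lower. The induction therefore
  runs over the order with \<open>g\<close> generalised.\<close>

lemma C_on_compose:
 assumes fin: "finite J" and V: "openin (RR I) V" and V': "openin (RR J) V'"
  and u: "u ` V \<subseteq> V'" "!!j. j : J ==> C_on k I V (%x. u x j)" and g: "C_on k J V' g"
 shows "C_on k I V (%x. g (u x))"
 using u(2) g
proof (induction k arbitrary: g)
 case 0
 thus ?case
  using continuous_on_compose_coords[OF u(1) openin_subset_extensional[OF V'], where g=g]
   openin_subset_extensional[OF V] openin_subset_extensional[OF V']
  by (auto simp: C_on_0_iff Int_absorb1)
next
 case (Suc k)
 have c1: "C_on 1 I V (%x. u x j)" if "j : J" for j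
  using C_on_mono[OF Suc.prems(1)[OF that], of 1] by simp
 have g1: "C_on 1 J V' g"
  using C_on_mono[OF Suc.prems(2), of 1] by simp
 note D = chain_rule[OF fin V V' u(1) c1 g1]
 show ?case unfolding C_on_Suc_iff
 proof (intro conjI ballI)
  show "continuous_on (extensional I \<inter> V) (%x. g (u x))"
   using continuous_on_compose_coords[OF u(1) openin_subset_extensional[OF V'], where g=g]
    openin_subset_extensional[OF V] openin_subset_extensional[OF V'] Suc.prems
   by (auto simp: C_on_Suc_iff Int_absorb1)
  fix i assume i: "i : I"
  show "has_partial i (%x. g (u x)) x" if "x : V" for x
   using has_partialI(1)[OF D[OF _ that i]] by blast
  have "C_on k I V (%x. \<Sum>j\<in>J. pd j g (u x) * pd i (%x. u x j) x)"
  proof (intro C_on_sum C_on_mult V)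
   fix j assume j: "j : J"
   show "C_on k I V (%x. pd j g (u x))"
    by (rule Suc.IH) (use C_on_SucD[OF Suc.prems(1)] Suc.prems(2) j in \<open>auto simp: C_on_Suc_iff\<close>)
   show "C_on k I V (pd i (%x. u x j))"
    using Suc.prems(1)[OF j] i by (auto simp: C_on_Suc_iff)
  qed
  moreover have "pd i (%x. g (u x)) x = (\<Sum>j\<in>J. pd j g (u x) * pd i (%x. u x j) x)"
   if "x : V" for x
   using has_partialI(2)[OF D[OF _ that i]] by blast
  ultimately show "C_on k I V (pd i (%x. g (u x)))"
   by (simp add: C_on_cong[OF V, of "pd i (%x. g (u x))"])
 qed
qed

definition Cinf_on :: "'i set => ('i => real) set => (('i => real) => real) => bool" where
 "Cinf_on I V f \<longleftrightarrow> (\<forall>k. C_on k I V f)"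

lemma coord_smooth_on_iff: "coord_smooth_on I J V f \<longleftrightarrow> (\<forall>j\<in>J. Cinf_on I V (%x. f x j))"
 by (simp add: coord_smooth_on_def Cinf_on_def)

lemma Cinf_on_cont: "Cinf_on I V f ==> continuous_on (extensional I \<inter> V) f"
 unfolding Cinf_on_def using C_on_cont by blast

lemma Cinf_on_partial:
 assumes "Cinf_on I V f" "i : I"
 shows "Cinf_on I V (pd i f)"
 unfolding Cinf_on_def
proof
 fix k
 have "C_on (Suc k) I V f" using assms by (simp add: Cinf_on_def)
 thus "C_on k I V (pd i f)" using assms by (simp add: C_on_Suc_iff)
qed

lemma Cinf_on_has_partial:
 assumes "Cinf_on I V f" "i : I" "x : V"
 shows "has_partial i f x"
proof -
 have "C_on (Suc 0) I V f" using assms by (simp add: Cinf_on_def)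
 thus ?thesis using assms by (simp add: C_on_Suc_iff)
qed

lemma Cinf_on_subset: "Cinf_on I V f ==> V' \<subseteq> V ==> Cinf_on I V' f"
 unfolding Cinf_on_def using C_on_subset by blast

lemma Cinf_on_cong:
 "openin (RR I) V ==> (!!y. y : V ==> f y = g y) ==> Cinf_on I V f \<longleftrightarrow> Cinf_on I V g"
 by (simp add: Cinf_on_def C_on_cong[of I V f g])

lemma Cinf_on_local:
 assumes "!!x. x : V ==> \<exists>V'. openin (RR I) V' & x : V' & Cinf_on I (V \<inter> V') f"
 shows "Cinf_on I V f"
 unfolding Cinf_on_def by (intro allI C_on_local) (use assms in \<open>auto simp: Cinf_on_def\<close>)

lemma Cinf_on_const: "Cinf_on I V (%x. c)" by (simp add: Cinf_on_def C_on_const)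

lemma Cinf_on_coord: "Cinf_on I V (%x. x i)" by (simp add: Cinf_on_def C_on_coord)

lemma Cinf_on_arith:
 assumes "openin (RR I) V"
 shows Cinf_on_add: "Cinf_on I V f ==> Cinf_on I V g ==> Cinf_on I V (%x. f x + g x)"
  and Cinf_on_diff: "Cinf_on I V f ==> Cinf_on I V g ==> Cinf_on I V (%x. f x - g x)"
  and Cinf_on_mult: "Cinf_on I V f ==> Cinf_on I V g ==> Cinf_on I V (%x. f x * g x)"
  and Cinf_on_minus: "Cinf_on I V f ==> Cinf_on I V (%x. - f x)"
  and Cinf_on_sum: "(!!a. a : S ==> Cinf_on I V (h a)) ==> Cinf_on I V (%x. \<Sum>a\<in>S. h a x)"
  and Cinf_on_prod: "(!!a. a : S ==> Cinf_on I V (h a)) ==> Cinf_on I V (%x. \<Prod>a\<in>S. h a x)"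
 using assms by (auto simp: Cinf_on_def intro: C_on_add C_on_diff C_on_mult C_on_minus C_on_sum C_on_prod)

lemma Cinf_on_compose:
 assumes "finite J" "openin (RR I) V" "openin (RR J) V'"
  "u ` V \<subseteq> V'" "!!j. j : J ==> Cinf_on I V (%x. u x j)" "Cinf_on J V' g"
 shows "Cinf_on I V (%x. g (u x))"
 using assms C_on_compose[OF assms(1-4)] by (auto simp: Cinf_on_def)

lemma Cinf_on_chain_rule:
 assumes fin: "finite J" and V: "openin (RR I) V" and V': "openin (RR J) V'"
  and u: "u ` V \<subseteq> V'" "!!j. j : J ==> Cinf_on I V (%x. u x j)" and g: "Cinf_on J V' g"
  and x: "x : V" "i : I"
 shows "((%t. g (u (x(i := t)))) has_real_derivative
   (\<Sum>j\<in>J. pd j g (u x) * pd i (%x. u x j) x)) (at (x i))"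
 using chain_rule[OF fin V V' u(1) _ _ x] u(2) g unfolding Cinf_on_def by blast

section \<open>Iterated integrals over coordinate cubes\<close>

text \<open>Iterated one-dimensional integrals rather than a product measure: differentiation under
  the integral and integration by parts are then one-variable facts used inductively. The result is
  still a function of the full point and is constant in the integrated coordinates.\<close>

primrec iint :: "real => ('q => real) => 'q list => (('q => real) => real) => ('q => real) => real" where
 "iint ro c [] g = g"
| "iint ro c (j # js) g = (%x. integral {c j - ro .. c j + ro} (%t. iint ro c js g (x(j := t))))"

lemma iint_append: "iint ro c (is @ js) g = iint ro c is (iint ro c js g)"
 by (induction "is") auto

lemma iint_upd: "j : set js ==> iint ro c js g (x(j := t)) = iint ro c js g x"
proof (induction js arbitrary: x)
 case (Cons k js)
 show ?case
 proof (cases "j = k")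
  case True
  thus ?thesis by (simp only: iint.simps fun_upd_upd)
 next
  case False
  hence "j : set js" using Cons by auto
  hence "iint ro c js g ((x(j := t))(k := u)) = iint ro c js g (x(k := u))" for u
   by (simp only: fun_upd_twist[OF False] Cons.IH)
  thus ?thesis by (simp only: iint.simps)
 qed
qed simp

lemma iint_pull:
 assumes "!!x j t. j : set js ==> f (x(j := t)) = f x"
 shows "iint ro c js (%x. f x * g x) x = f x * iint ro c js g x"
 using assms by (induction js arbitrary: x) auto

text \<open>The closed range of integration has radius \<open>ro\<close> strictly below the radius
  \<open>ep\<close> of the open cube, so integrands are defined on a neighbourhood of the range and
  overwriting a coordinate stays in the cube.\<close>

locale int_cube =
 fixes Q :: "'q set" and c :: "'q => real" and ep ro :: real
 assumes finQ: "finite Q" and rho: "0 < ro" "ro < ep"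
begin

abbreviation "B \<equiv> cube Q c ep"
abbreviation "ii \<equiv> iint ro c"

lemma openB: "openin (RR Q) B" by (rule openin_cube[OF finQ])

lemma B_ext: "B \<subseteq> extensional Q" by (auto simp: mem_cube)

lemma Cinf_contB: "Cinf_on Q B g ==> continuous_on B g"
 using Cinf_on_cont[of Q B g] B_ext by (simp add: Int_absorb1)

lemma upd_B: "x : B ==> j : Q ==> t : {c j - ro .. c j + ro} ==> x(j := t) : B"
 using rho by (auto simp: mem_cube extensional_def abs_less_iff)

lemma upd_B': "x : B ==> j : Q ==> \<bar>t - c j\<bar> < ep ==> x(j := t) : B"
 by (auto simp: mem_cube extensional_def)

lemma iint_cong:
 "(!!x. x : B ==> f x = g x) ==> set js \<subseteq> Q ==> x : B ==> ii js f x = ii js g x"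
proof (induction js arbitrary: x)
 case (Cons j js)
 show ?case unfolding iint.simps
  by (rule integral_cong, rule Cons.IH[OF Cons.prems(1) _ upd_B[OF Cons.prems(3)]])
   (use Cons.prems(2) in auto)
qed auto

lemma continuous_upd: "continuous_on (S \<times> T) (%(x::'q => real, t). x(j := t))"
proof (rule continuous_on_coordinatewise_then_product)
 fix i
 show "continuous_on (S \<times> T) (%z. (case z of (x, t) => x(j := t)) i)"
  by (cases "i = j") (auto simp: case_prod_beta intro: continuous_intros
    continuous_on_product_then_coordinatewise[OF continuous_on_fst[OF continuous_on_id]])
qed

lemma slice_cont:
 assumes "continuous_on B g" "x : B" "j : Q"
 shows "continuous_on {c j - ro .. c j + ro} (%t. g (x(j := t)))"
proof (rule continuous_on_compose2[OF assms(1)])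
 show "continuous_on {c j - ro .. c j + ro} (%t. x(j := t))"
 proof (rule continuous_on_coordinatewise_then_product)
  fix i show "continuous_on {c j - ro .. c j + ro} (%t. (x(j := t)) i)" by (cases "i = j") auto
 qed
qed (use assms upd_B in auto)

lemma iint_continuous:
 "continuous_on B g ==> set js \<subseteq> Q ==> continuous_on B (ii js g)"
proof (induction js)
 case (Cons j js)
 have h: "continuous_on B (ii js g)" using Cons by auto
 have "continuous_on (B \<times> {c j - ro .. c j + ro}) (%z. ii js g (case z of (x, t) => x(j := t)))"
  by (rule continuous_on_compose2[OF h continuous_upd]) (use Cons.prems upd_B in auto)
 hence "continuous_on (B \<times> cbox (c j - ro) (c j + ro)) (%(x, t). ii js g (x(j := t)))"
  by (simp add: case_prod_beta)
 from integral_continuous_on_param[OF this] show ?case by simp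
qed simp

lemma iint_integrable:
 assumes "continuous_on B g" "set js \<subseteq> Q" "x : B" "j : Q"
 shows "(%t. ii js g (x(j := t))) integrable_on {c j - ro .. c j + ro}"
 by (intro integrable_continuous_real slice_cont iint_continuous assms)

lemma iint_add:
 assumes "continuous_on B f" "continuous_on B g"
 shows "set js \<subseteq> Q ==> x : B ==> ii js (%x. f x + g x) x = ii js f x + ii js g x"
proof (induction js arbitrary: x)
 case (Cons j js)
 have "integral {c j - ro .. c j + ro} (%t. ii js (%x. f x + g x) (x(j := t)))
  = integral {c j - ro .. c j + ro} (%t. ii js f (x(j := t)) + ii js g (x(j := t)))"
  by (rule integral_cong, rule Cons.IH[OF _ upd_B[OF Cons.prems(2)]]) (use Cons.prems(1) in auto)
 also have "\<dots> = integral {c j - ro .. c j + ro} (%t. ii js f (x(j := t))) + integral {c j - ro .. c j + ro} (%t. ii js g (x(j := t)))"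
  by (intro Henstock_Kurzweil_Integration.integral_add iint_integrable) (use assms Cons.prems in auto)
 finally show ?case by simp
qed simp

lemma iint_cmult: "ii js (%x. a * g x) x = a * ii js g x"
 by (rule iint_pull) simp

lemma iint_zero: "ii js (%x. 0) x = 0"
 using iint_cmult[of js 0 "%x. 0" x] by simp

lemma iint_diff:
 assumes "continuous_on B f" "continuous_on B g" "set js \<subseteq> Q" "x : B"
 shows "ii js (%x. f x - g x) x = ii js f x - ii js g x"
proof -
 have "ii js (%x. f x + (-1) * g x) x = ii js f x + ii js (%x. (-1) * g x) x"
  using assms by (intro iint_add) (auto intro: continuous_intros)
 thus ?thesis unfolding iint_cmult by simp
qed

lemma iint_sum:
 assumes "!!a. a : S ==> continuous_on B (f a)" "set js \<subseteq> Q" "x : B"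
 shows "ii js (%x. \<Sum>a\<in>S. f a x) x = (\<Sum>a\<in>S. ii js (f a) x)"
 using assms(1)
proof (induction S rule: infinite_finite_induct)
 case (insert a S)
 have "ii js (%x. f a x + (\<Sum>a\<in>S. f a x)) x = ii js (f a) x + ii js (%x. \<Sum>a\<in>S. f a x) x"
  by (rule iint_add) (use insert assms in \<open>auto intro: continuous_on_sum\<close>)
 thus ?case using insert by simp
qed (auto simp: iint_zero)

text \<open>The bound is needed only on a set \<open>C\<close> that the integration does not leave.
  It is applied to a face of the cube in the integration by parts and to a compact cube in the
  approximation argument.\<close>

lemma iint_bound:
 assumes g: "continuous_on B g" and C: "C \<subseteq> B" and M: "!!y. y : C ==> \<bar>g y\<bar> <= M"
 shows "(!!y j t. y : C ==> j : set js ==> t : {c j - ro .. c j + ro} ==> y(j := t) : C) ==>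
  set js \<subseteq> Q ==> x : C ==> \<bar>ii js g x\<bar> <= (2 * ro) ^ length js * M"
proof (induction js arbitrary: x)
 case Nil thus ?case using M by simp
next
 case (Cons j js)
 have IH: "\<bar>ii js g y\<bar> <= (2 * ro) ^ length js * M" if "y : C" for y
  by (rule Cons.IH) (use Cons.prems that in auto)
 have "norm (integral (cbox (c j - ro) (c j + ro)) (%t. ii js g (x(j := t)))) \<le>
   ((2 * ro) ^ length js * M) * measure lborel (cbox (c j - ro) (c j + ro))"
 proof (rule integrable_bound)
  show "0 <= (2 * ro) ^ length js * M" using IH[OF Cons.prems(3)] by linarith
  show "(%t. ii js g (x(j := t))) integrable_on cbox (c j - ro) (c j + ro)"
   using iint_integrable[of g js x j] g C Cons.prems by auto
  fix t assume "t : cbox (c j - ro) (c j + ro)"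
  hence "x(j := t) : C" by (intro Cons.prems(1) Cons.prems(3)) auto
  thus "norm (ii js g (x(j := t))) <= (2 * ro) ^ length js * M" using IH by simp
 qed
 thus ?case using rho by (simp add: mult_ac)
qed

text \<open>One differentiation under a one-dimensional integral for each entry of
  \<open>js\<close>. The variable \<open>i\<close> is not integrated, so the two updates
  commute.\<close>

lemma iint_Leibniz:
 assumes i: "i : Q" and g: "continuous_on B g" and gp: "!!x. x : B ==> has_partial i g x"
  and g': "continuous_on B (pd i g)"
 shows "i \<notin> set js ==> set js \<subseteq> Q ==> x : B ==>
  ((%s. ii js g (x(i := s))) has_real_derivative ii js (pd i g) x) (at (x i))"
proof (induction js arbitrary: x)
 case Nil
 show ?case unfolding iint.simps by (rule has_partialD[OF gp[OF Nil(3)]])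
next
 case (Cons j js)
 define U where "U = {c i - ep <..< c i + ep}"
 have xU: "x i : U" using Cons.prems i by (auto simp: U_def mem_cube abs_less_iff)
 have ij: "i ~= j" "j : Q" using Cons.prems by auto
 have xB: "(x(i := s))(j := t) : B" if "s : U" "t : {c j - ro .. c j + ro}" for s t
  by (intro upd_B upd_B') (use that Cons.prems i in \<open>auto simp: U_def abs_less_iff\<close>)
 have "((%s. integral (cbox (c j - ro) (c j + ro)) (%t. ii js g ((x(i := s))(j := t)))) has_field_derivative
   integral (cbox (c j - ro) (c j + ro)) (%t. ii js (pd i g) ((x(i := x i))(j := t)))) (at (x i) within U)"
 proof (rule leibniz_rule_field_derivative)
  fix s t assume s: "s : U" and t: "t : cbox (c j - ro) (c j + ro)"
  have "((%u. ii js g (((x(i := s))(j := t))(i := u))) has_real_derivative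
    ii js (pd i g) ((x(i := s))(j := t))) (at (((x(i := s))(j := t)) i))"
   by (rule Cons.IH[OF _ _ xB[OF s]]) (use Cons.prems t in auto)
  moreover have "((x(i := s))(j := t))(i := u) = (x(i := u))(j := t)" for u using ij by auto
  ultimately have "((%u. ii js g ((x(i := u))(j := t))) has_real_derivative
    ii js (pd i g) ((x(i := s))(j := t))) (at s)"
   using ij by simp
  thus "((%u. ii js g ((x(i := u))(j := t))) has_real_derivative
    ii js (pd i g) ((x(i := s))(j := t))) (at s within U)"
   by (rule has_field_derivative_at_within)
 next
  fix s assume s: "s : U"
  hence "x(i := s) : B" by (intro upd_B') (use Cons.prems i in \<open>auto simp: U_def abs_less_iff\<close>)
  thus "(%t. ii js g ((x(i := s))(j := t))) integrable_on cbox (c j - ro) (c j + ro)"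
   using iint_integrable[of g js "x(i := s)" j] g Cons.prems by auto
 next
  have h: "continuous_on B (ii js (pd i g))" using iint_continuous g' Cons.prems by auto
  have "continuous_on (U \<times> cbox (c j - ro) (c j + ro)) (%z. ii js (pd i g) ((x(i := fst z))(j := snd z)))"
  proof (rule continuous_on_compose2[OF h])
   show "continuous_on (U \<times> cbox (c j - ro) (c j + ro)) (%z. (x(i := fst z))(j := snd z))"
   proof (rule continuous_on_coordinatewise_then_product)
    fix l show "continuous_on (U \<times> cbox (c j - ro) (c j + ro)) (%z. ((x(i := fst z))(j := snd z)) l)"
     by (cases "l = j"; cases "l = i") (auto intro: continuous_intros)
   qed
  qed (use xB in auto)
  thus "continuous_on (U \<times> cbox (c j - ro) (c j + ro)) (%(s, t). ii js (pd i g) ((x(i := s))(j := t)))"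
   by (simp add: case_prod_beta)
 qed (use xU in \<open>auto simp: U_def\<close>)
 moreover have "at (x i) within U = at (x i)"
  using xU by (intro at_within_open) (auto simp: U_def)
 ultimately show ?case by (simp del: fun_upd_apply)
qed

text \<open>Integrals outside direction \<open>j\<close> pass through untouched. At \<open>j\<close>
  itself the derivative is pulled out of the inner integrals, and the fundamental theorem leaves two
  boundary values, both zero by \<open>van\<close>.\<close>

lemma iint_by_parts:
 assumes j: "j : Q" and g: "continuous_on B g" and gp: "!!x. x : B ==> has_partial j g x"
  and g': "continuous_on B (pd j g)"
  and van: "!!x. x : B ==> \<bar>x j - c j\<bar> = ro ==> g x = 0"
 shows "j : set js ==> distinct js ==> set js \<subseteq> Q ==> x : B ==> ii js (pd j g) x = 0"
proof (induction js arbitrary: x)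
 case (Cons k js)
 show ?case
 proof (cases "k = j")
  case True
  hence nj: "j \<notin> set js" using Cons.prems by auto
  define F where "F t = ii js g (x(j := t))" for t
  \<comment> \<open>Overwriting the remaining integration variables stays on the face
    \<open>y j = t\<close>, where the integrand is bounded by 0.\<close>
  have F0: "F t = 0" if "\<bar>t - c j\<bar> = ro" for t
  proof -
   have "\<bar>ii js g (x(j := t))\<bar> <= (2 * ro) ^ length js * 0"
   proof (rule iint_bound[OF g, where C = "{y : B. y j = t}"])
    show "x(j := t) : {y : B. y j = t}" using upd_B'[OF Cons.prems(4) j] that rho by auto
   qed (use van that nj Cons.prems upd_B in auto)
   thus ?thesis by (simp add: F_def)
  qed
  have "((%t. ii js (pd j g) (x(j := t))) has_integral (F (c j + ro) - F (c j - ro))) {c j - ro .. c j + ro}"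
  proof (rule fundamental_theorem_of_calculus)
   fix t assume t: "t : {c j - ro .. c j + ro}"
   have "((%s. ii js g ((x(j := t))(j := s))) has_real_derivative ii js (pd j g) (x(j := t))) (at ((x(j := t)) j))"
    by (rule iint_Leibniz[OF j g gp g' nj]) (use Cons.prems upd_B t j in auto)
   thus "(F has_vector_derivative ii js (pd j g) (x(j := t))) (at t within {c j - ro .. c j + ro})"
    unfolding F_def by (simp add: has_real_derivative_iff_has_vector_derivative has_vector_derivative_at_within)
  qed (use rho in auto)
  thus ?thesis using F0 True rho by (auto dest: integral_unique)
 next
  case False
  have "integral {c k - ro .. c k + ro} (%t. ii js (pd j g) (x(k := t))) = integral {c k - ro .. c k + ro} (%t. 0)"
   by (rule integral_cong, rule Cons.IH[OF _ _ _ upd_B[OF Cons.prems(4)]])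
    (use Cons.prems(1-3) False in auto)
  thus ?thesis by simp
 qed
qed simp

lemma iint_Cinf:
 assumes g: "Cinf_on Q B g" and js: "set js \<subseteq> Q"
 shows "Cinf_on Q B (ii js g)"
proof -
 have "C_on k Q B (ii js g)" for k
  using g
 proof (induction k arbitrary: g)
  case 0
  thus ?case using iint_continuous[OF Cinf_contB js] B_ext by (simp add: C_on_0_iff Int_absorb1)
 next
  case (Suc k)
  show ?case unfolding C_on_Suc_iff
  proof (intro conjI ballI)
   show "continuous_on (extensional Q \<inter> B) (ii js g)"
    using iint_continuous[OF Cinf_contB js] B_ext Suc.prems by (simp add: Int_absorb1)
   fix i assume i: "i : Q"
   show "has_partial i (ii js g) x" if "x : B" for x
   proof (cases "i : set js")
    case True
    hence "(%t. ii js g (x(i := t))) = (%t. ii js g x)" by (simp add: iint_upd)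
    thus ?thesis by (simp add: has_partial_def)
   next
    case False
    show ?thesis
     by (rule has_partialI(1)[OF iint_Leibniz[OF i Cinf_contB[OF Suc.prems] _ Cinf_contB[OF Cinf_on_partial[OF Suc.prems i]] False js that]])
      (rule Cinf_on_has_partial[OF Suc.prems i])
   qed
   show "C_on k Q B (pd i (ii js g))"
   proof (cases "i : set js")
    case True
    hence "pd i (ii js g) = (%x. 0)" by (simp add: iint_upd partial_deriv_def fun_eq_iff)
    thus ?thesis by (simp add: C_on_const)
   next
    case False
    have "pd i (ii js g) x = ii js (pd i g) x" if "x : B" for x
     by (rule has_partialI(2)[OF iint_Leibniz[OF i Cinf_contB[OF Suc.prems] _ Cinf_contB[OF Cinf_on_partial[OF Suc.prems i]] False js that]])
      (rule Cinf_on_has_partial[OF Suc.prems i])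
    moreover have "C_on k Q B (ii js (pd i g))"
     by (rule Suc.IH[OF Cinf_on_partial[OF Suc.prems i]])
    ultimately show ?thesis by (simp add: C_on_cong[OF openB, of "pd i (ii js g)"])
   qed
  qed
 qed
 thus ?thesis by (simp add: Cinf_on_def)
qed

end

section \<open>Smoothing of continuous functions\<close>

text \<open>Stone-Weierstrass for a ring of smooth functions that contains the constants and the
  coordinates, hence separates points.\<close>

lemma uniform_smooth_approximation:
 fixes K :: "('z => real) set"
 assumes fin: "finite Z" and K: "compact K" "K \<subseteq> extensional Z" and h: "continuous_on K h" and e: "e > 0"
 shows "\<exists>p. Cinf_on Z (extensional Z) p & (\<forall>x\<in>K. \<bar>h x - p x\<bar> < e)"
proof -
 obtain f n where f: "bij_betw f Z {0..<n::nat}" using ex_bij_betw_finite_nat[OF fin] by blast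
 define g where "g = inv_into Z f"
 have g: "g m : Z" "f (g m) = m" if "m < n" for m
  using that f unfolding g_def bij_betw_def by (auto simp: inv_into_into f_inv_into_f)
 have gf: "g (f z) = z" "f z < n" if "z : Z" for z
  using that f unfolding g_def bij_betw_def by (auto simp: inv_into_f_f)
 \<comment> \<open>Renumbering of the coordinates by natural numbers, padded with 0; the
   approximation theorem is applied to sequences and the result transported back.\<close>
 define Ph where "Ph x m = (if m < n then x (g m) else 0)" for x :: "'z => real" and m
 define \<Psi> where "\<Psi> w = restrict (%z. w (f z)) Z" for w :: "nat => real"
 have \<Psi>Ph: "\<Psi> (Ph x) = x" if "x : extensional Z" for x
  using that gf by (auto simp: \<Psi>_def Ph_def fun_eq_iff extensional_def)
 have Phcont: "continuous_on K Ph"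
 proof (rule continuous_on_coordinatewise_then_product)
  fix m show "continuous_on K (%x. Ph x m)"
   by (cases "m < n") (auto simp: Ph_def intro: continuous_on_subset[OF continuous_on_product_coordinates])
 qed
 have \<Psi>cont: "continuous_on (Ph ` K) \<Psi>"
 proof (rule continuous_on_coordinatewise_then_product)
  fix z show "continuous_on (Ph ` K) (%x. \<Psi> x z)"
   by (cases "z : Z") (auto simp: \<Psi>_def intro: continuous_on_subset[OF continuous_on_product_coordinates])
 qed
 \<comment> \<open>Smoothness is imposed after transport to \<open>Z\<close>, so the ring laws
   reduce to those of \<open>Cinf_on\<close>.\<close>
 define R where "R = {p. continuous_on (Ph ` K) p & Cinf_on Z (extensional Z) (%x. p (Ph x))}"
 have op: "openin (RR Z) (extensional Z)"
  using openin_topspace[of "RR Z"] by simp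
 interpret function_ring_on R "Ph ` K"
 proof
  show "compact (Ph ` K)" using compact_continuous_image[OF Phcont K(1)] .
  show "\<exists>f\<in>R. f x ~= f y" if xy: "x : Ph ` K" "y : Ph ` K" "x ~= y" for x y
  proof -
   obtain m where m: "x m ~= y m" using xy by auto
   hence "m < n" using xy by (auto simp: Ph_def)
   hence "(%w. w m) : R"
    by (auto simp: R_def Ph_def Cinf_on_coord intro: continuous_on_subset[OF continuous_on_product_coordinates])
   with m show ?thesis by (intro bexI[of _ "%w. w m"])
  qed
 qed (auto simp: R_def intro: continuous_intros Cinf_on_add[OF op] Cinf_on_mult[OF op] Cinf_on_const)
 have "continuous_on (Ph ` K) (%w. h (\<Psi> w))"
  by (rule continuous_on_compose2[OF h \<Psi>cont]) (use \<Psi>Ph K in auto)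
 from Stone_Weierstrass_basic[OF this e] obtain p where
  p: "p : R" "!!w. w : Ph ` K ==> \<bar>h (\<Psi> w) - p w\<bar> < e" by blast
 show ?thesis
 proof (intro exI[of _ "%x. p (Ph x)"] conjI ballI)
  show "Cinf_on Z (extensional Z) (%x. p (Ph x))" using p(1) by (simp add: R_def)
  fix x assume x: "x : K"
  have "\<Psi> (Ph x) = x" using \<Psi>Ph K(2) x by blast
  thus "\<bar>h x - p (Ph x)\<bar> < e" using p(2)[of "Ph x"] x by simp
 qed
qed

lemma compact_closed_cube: "compact (\<Pi>\<^sub>E i\<in>Q. {a i .. b i :: real})"
proof -
 have "compactin (RR Q) (\<Pi>\<^sub>E i\<in>Q. {a i .. b i})"
  by (subst compactin_PiE) auto
 thus ?thesis
  by (simp add: powertop_real_eq_top_of_set compactin_subtopology)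
qed

lemma partial_mult:
 assumes "has_partial i f x" "has_partial i g x"
 shows "has_partial i (%x. f x * g x) x"
  "pd i (%x. f x * g x) x = pd i f x * g x + f x * pd i g x"
proof -
 have "((%t. f (x(i := t)) * g (x(i := t))) has_real_derivative
    (pd i f x * g (x(i := x i)) + pd i g x * f (x(i := x i)))) (at (x i))"
  by (intro DERIV_mult has_partialD assms)
 from has_partialI[OF this]
 show "has_partial i (%x. f x * g x) x"
  "pd i (%x. f x * g x) x = pd i f x * g x + f x * pd i g x"
  by (simp_all add: mult.commute)
qed

text \<open>Integration by parts moves the \<open>p\<close>-derivatives of \<open>h \<circ> Z\<close>, which are combinations of its
 derivatives in the integration variables, onto the weight \<open>kp\<close>; so no differentiability of \<open>h\<close>
 is used in the end.\<close>

locale smoothing = int_cube +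
 fixes js :: "'a list" and Zi :: "'z set" and Z :: "('a => real) => 'z => real" and V :: "('z => real) set"
  and a :: "'a => 'a => ('a => real) => real" and ro' :: real
 assumes js: "distinct js" "set js \<subseteq> Q"
  and Zi: "finite Zi" and V: "openin (RR Zi) V"
  and Z: "Z ` B \<subseteq> V" "!!z. z : Zi ==> Cinf_on Q B (%x. Z x z)"
  and a: "!!i k. i : Q - set js ==> k : set js ==> Cinf_on Q B (a i k)"
  and span: "!!i z x. i : Q - set js ==> z : Zi ==> x : B ==>
   pd i (%x. Z x z) x = (\<Sum>k\<in>set js. a i k x * pd k (%x. Z x z) x)"
  and rho': "ro' < ro"
begin

text \<open>Only the integration variables are confined. Because \<open>ro' < ro\<close>, such a
  weight vanishes near the faces of the integration range, which kills boundary terms and is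
  inherited by all partial derivatives.\<close>

definition supp :: "(('a => real) => real) => bool" where
 "supp kp \<longleftrightarrow> (\<forall>x\<in>B. (\<exists>j\<in>set js. \<bar>x j - c j\<bar> > ro') --> kp x = 0)"

text \<open>The formal transpose. Writing H for \<open>h\<close> composed with \<open>Z\<close>, so
  that \<open>pd i H\<close> is the sum of \<open>a i k * pd k H\<close>, the derivative
  \<open>pd i (kp * H)\<close> equals \<open>transp i kp * H\<close> plus the sum of
  \<open>pd k (kp * a i k * H)\<close>, and that sum integrates to zero.\<close>

definition transp :: "'a => (('a => real) => real) => ('a => real) => real" where
 "transp i kp x = pd i kp x - (\<Sum>k\<in>set js. pd k (%x. kp x * a i k x) x)"

lemma transp_Cinf:
 assumes "Cinf_on Q B kp" "i : Q - set js"
 shows "Cinf_on Q B (transp i kp)"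
 unfolding transp_def
 by (intro Cinf_on_diff[OF openB] Cinf_on_sum[OF openB] Cinf_on_partial Cinf_on_mult[OF openB] a)
  (use assms js in auto)

lemma supp_partial:
 assumes "supp kp" "l : Q"
 shows "supp (pd l kp)"
 unfolding supp_def
proof (intro ballI impI)
 fix x assume x: "x : B" and "\<exists>j\<in>set js. \<bar>x j - c j\<bar> > ro'"
 then obtain j where j: "j : set js" "\<bar>x j - c j\<bar> > ro'" by blast
 define W where "W = {y : B. \<bar>y j - c j\<bar> > ro'}"
 have jQ: "j : Q" using j js by auto
 have "continuous_map (RR Q) euclideanreal (%y. y j - c j)"
  by (intro continuous_intros continuous_map_product_coordinates[of j Q "%_. euclideanreal", simplified] jQ)
 hence "continuous_map (RR Q) euclideanreal (%y. \<bar>y j - c j\<bar>)"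
  by (rule continuous_map_real_abs)
 hence "openin (RR Q) {y : topspace (RR Q). \<bar>y j - c j\<bar> : {ro'<..}}"
  by (rule openin_continuous_map_preimage) simp
 hence "openin (RR Q) ({y : topspace (RR Q). \<bar>y j - c j\<bar> : {ro'<..}} \<inter> B)"
  using openB by (rule openin_Int)
 moreover have "{y : topspace (RR Q). \<bar>y j - c j\<bar> : {ro'<..}} \<inter> B = W"
  using B_ext by (auto simp: W_def)
 ultimately have W: "openin (RR Q) W" by simp
 have "pd l kp x = pd l (%x. 0) x"
  by (rule partial_cong(2)[OF W]) (use assms x j in \<open>auto simp: W_def supp_def\<close>)
 also have "\<dots> = 0" by (simp add: partial_deriv_def)
 finally show "pd l kp x = 0" .
qed

lemma supp_transp:
 assumes "supp kp" "i : Q - set js"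
 shows "supp (transp i kp)"
proof -
 have "supp (pd k (%x. kp x * a i k x))" if "k : set js" for k
  by (rule supp_partial) (use assms that js in \<open>auto simp: supp_def\<close>)
 thus ?thesis using supp_partial[OF assms(1), of i] assms(2)
  unfolding supp_def transp_def by (auto intro!: sum.neutral)
qed

lemma Z_continuous: "continuous_on B Z"
proof (rule continuous_on_coordinatewise_then_product)
 fix z show "continuous_on B (%x. Z x z)"
 proof (cases "z : Zi")
  case True thus ?thesis using Z(2) Cinf_contB by blast
 next
  case False
  have "continuous_on B (%x. undefined :: real)" by simp
  thus ?thesis
   by (rule continuous_on_eq)
    (use False Z(1) openin_subset_extensional[OF V] in \<open>force simp: extensional_def image_subset_iff subset_iff\<close>)
 qed
qed

text \<open>The identity behind \<open>transp\<close> for smooth \<open>h\<close>. The conclusion no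
  longer contains a derivative of \<open>h\<close>, which is what permits the passage to continuous
  \<open>h\<close>.\<close>

lemma deriv_smooth:
 assumes h: "Cinf_on Zi V h" and kp: "Cinf_on Q B kp" "supp kp" and i: "i : Q - set js" and x: "x : B"
 shows "((%s. ii js (%x. kp x * h (Z x)) (x(i := s))) has_real_derivative ii js (%x. transp i kp x * h (Z x)) x) (at (x i))"
proof -
 define H where "H x = h (Z x)" for x
 have H: "Cinf_on Q B H" unfolding H_def
  by (rule Cinf_on_compose[OF Zi openB V Z h])
 have HD: "pd l H x = (\<Sum>z\<in>Zi. pd z h (Z x) * pd l (%x. Z x z) x)" if "l : Q" "x : B" for l x
  using has_partialI(2)[OF Cinf_on_chain_rule[OF Zi openB V Z h that(2,1)]] unfolding H_def[abs_def] .
 have iQ: "i : Q" "i \<notin> set js" using i by auto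
 have G: "Cinf_on Q B (%x. kp x * H x)" by (rule Cinf_on_mult[OF openB kp(1) H])
 have ka: "Cinf_on Q B (%x. kp x * a i k x)" if "k : set js" for k
  by (rule Cinf_on_mult[OF openB kp(1) a[OF i that]])
 have kaH: "Cinf_on Q B (%x. (kp x * a i k x) * H x)" if "k : set js" for k
  by (rule Cinf_on_mult[OF openB ka[OF that] H])
 have kQ: "k : Q" if "k : set js" for k using that js by auto
 have eq: "pd i (%x. kp x * H x) y =
   transp i kp y * H y + (\<Sum>k\<in>set js. pd k (%x. (kp x * a i k x) * H x) y)" if y: "y : B" for y
 proof -
  have "pd i H y = (\<Sum>z\<in>Zi. pd z h (Z y) * (\<Sum>k\<in>set js. a i k y * pd k (%x. Z x z) y))"
   unfolding HD[OF iQ(1) y] by (intro sum.cong refl) (simp add: span[OF i _ y])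
  also have "\<dots> = (\<Sum>k\<in>set js. a i k y * (\<Sum>z\<in>Zi. pd z h (Z y) * pd k (%x. Z x z) y))"
   unfolding sum_distrib_left by (subst sum.swap) (simp add: mult_ac)
  also have "\<dots> = (\<Sum>k\<in>set js. a i k y * pd k H y)"
   by (intro sum.cong refl) (simp add: HD[OF kQ y])
  finally have iH: "pd i H y = (\<Sum>k\<in>set js. a i k y * pd k H y)" .
  have "(\<Sum>k\<in>set js. pd k (%x. (kp x * a i k x) * H x) y) =
   (\<Sum>k\<in>set js. pd k (%x. kp x * a i k x) y * H y + (kp y * a i k y) * pd k H y)"
   by (intro sum.cong refl partial_mult(2) Cinf_on_has_partial[OF ka kQ y] Cinf_on_has_partial[OF H kQ y])
  also have "\<dots> = (\<Sum>k\<in>set js. pd k (%x. kp x * a i k x) y) * H y + kp y * pd i H y"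
   unfolding iH by (simp add: sum.distrib sum_distrib_left sum_distrib_right mult_ac)
  finally show ?thesis
   using partial_mult(2)[OF Cinf_on_has_partial[OF kp(1) iQ(1) y] Cinf_on_has_partial[OF H iQ(1) y]]
   by (simp add: transp_def algebra_simps)
 qed
 have cont1: "continuous_on B (%x. transp i kp x * H x)"
  by (intro continuous_on_mult Cinf_contB transp_Cinf kp i H)
 have cont2: "continuous_on B (pd k (%x. (kp x * a i k x) * H x))" if "k : set js" for k
  by (intro Cinf_contB Cinf_on_partial kaH that kQ)
 have "ii js (pd i (%x. kp x * H x)) x = ii js (%y. transp i kp y * H y + (\<Sum>k\<in>set js. pd k (%x. (kp x * a i k x) * H x) y)) x"
  by (rule iint_cong[OF eq js(2) x])
 also have "\<dots> = ii js (%y. transp i kp y * H y) x + ii js (%y. \<Sum>k\<in>set js. pd k (%x. (kp x * a i k x) * H x) y) x"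
  by (rule iint_add[OF cont1 _ js(2) x]) (intro continuous_on_sum cont2)
 also have "ii js (%y. \<Sum>k\<in>set js. pd k (%x. (kp x * a i k x) * H x) y) x = (\<Sum>k\<in>set js. ii js (pd k (%x. (kp x * a i k x) * H x)) x)"
  by (rule iint_sum[OF cont2 js(2) x])
 also have "\<dots> = 0"
 proof (rule sum.neutral, rule ballI)
  fix k assume k: "k : set js"
  show "ii js (pd k (%x. (kp x * a i k x) * H x)) x = 0"
  proof (rule iint_by_parts[OF kQ[OF k] Cinf_contB[OF kaH[OF k]] Cinf_on_has_partial[OF kaH[OF k] kQ[OF k]] cont2[OF k] _ k js x])
   fix y assume "y : B" "\<bar>y k - c k\<bar> = ro"
   hence "kp y = 0" using kp(2) k rho' unfolding supp_def by blast
   thus "kp y * a i k y * H y = 0" by simp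
  qed
 qed
 finally have "ii js (pd i (%x. kp x * H x)) x = ii js (%x. transp i kp x * H x) x" by simp
 moreover have "((%s. ii js (%x. kp x * H x) (x(i := s))) has_real_derivative ii js (pd i (%x. kp x * H x)) x) (at (x i))"
  by (rule iint_Leibniz[OF iQ(1) Cinf_contB[OF G] Cinf_on_has_partial[OF G iQ(1)] Cinf_contB[OF Cinf_on_partial[OF G iQ(1)]] iQ(2) js(2) x])
 ultimately show ?thesis by (simp add: H_def)
qed

text \<open>Uniform approximation of \<open>h\<close> on a compact set by smooth \<open>p n\<close>:
  both the averages and their derivatives, given by the formula free of derivatives of
  \<open>h\<close>, converge uniformly, so the limit may be differentiated.\<close>

lemma deriv_continuous:
 assumes h: "continuous_on V h" and kp: "Cinf_on Q B kp" "supp kp" and i: "i : Q - set js" and x: "x : B"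
 shows "((%s. ii js (%x. kp x * h (Z x)) (x(i := s))) has_real_derivative ii js (%x. transp i kp x * h (Z x)) x) (at (x i))"
proof -
 have iQ: "i : Q" "i \<notin> set js" using i by auto
 \<comment> \<open>\<open>m\<close> bounds \<open>ro\<close> and the distances of \<open>x\<close>
   from the centre, and \<open>r\<close> lies strictly between \<open>m\<close> and
   \<open>ep\<close>. The closed cube \<open>C\<close> of radius \<open>r\<close> thus contains
   \<open>x\<close>, a segment around it in direction \<open>i\<close>, and everything reached by
   integration.\<close>
 define m where "m = Max (insert ro ((%l. \<bar>x l - c l\<bar>) ` Q))"
 have m: "ro <= m" "!!l. l : Q ==> \<bar>x l - c l\<bar> <= m" "m < ep"
  using finQ rho x unfolding m_def by (auto simp: mem_cube)
 define r where "r = (m + ep) / 2"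
 have r: "m < r" "r < ep" using m by (auto simp: r_def)
 define C where "C = (\<Pi>\<^sub>E l\<in>Q. {c l - r .. c l + r})"
 have C: "compact C" unfolding C_def by (rule compact_closed_cube)
 have CB: "C \<subseteq> B" using r by (force simp: C_def cube_def PiE_iff)
 have Cupd: "y(j := t) : C" if "y : C" "j : Q" "\<bar>t - c j\<bar> <= r" for y j t
  using that by (auto simp: C_def PiE_iff extensional_def abs_le_iff)
 have xC: "x : C" using x m r by (fastforce simp: C_def PiE_iff mem_cube abs_le_iff)
 have K: "compact (Z ` C)" by (rule compact_continuous_image[OF continuous_on_subset[OF Z_continuous CB] C])
 have KV: "Z ` C \<subseteq> V" using Z(1) CB by auto
 have Kext: "Z ` C \<subseteq> extensional Zi" using KV openin_subset_extensional[OF V] by auto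
 have "\<forall>n. \<exists>p. Cinf_on Zi (extensional Zi) p & (\<forall>y\<in>Z ` C. \<bar>h y - p y\<bar> < inverse (real (Suc n)))"
  by (intro allI uniform_smooth_approximation[OF Zi K Kext continuous_on_subset[OF h KV]]) simp
 then obtain p where p: "!!n. Cinf_on Zi (extensional Zi) (p n)"
  "!!n y. y : C ==> \<bar>h (Z y) - p n (Z y)\<bar> < inverse (real (Suc n))" by (metis imageI)
 have pV: "Cinf_on Zi V (p n)" for n
  by (rule Cinf_on_subset[OF p(1) openin_subset_extensional[OF V]])
 have hZ: "continuous_on B (%x. h (Z x))"
  by (rule continuous_on_compose2[OF h Z_continuous Z(1)])
 have pZ: "continuous_on B (%x. p n (Z x))" for n
  by (rule Cinf_contB[OF Cinf_on_compose[OF Zi openB V Z pV]])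
 have approx: "\<exists>M\<ge>0. \<forall>n. \<forall>y\<in>C. \<bar>ii js (%x. mu x * p n (Z x)) y - ii js (%x. mu x * h (Z x)) y\<bar> <= M * inverse (real (Suc n))"
  if mu: "continuous_on B mu" for mu
 proof -
  have "compact (mu ` C)" by (rule compact_continuous_image[OF continuous_on_subset[OF mu CB] C])
  then obtain M where M: "!!y. y : C ==> \<bar>mu y\<bar> <= M"
   using compact_imp_bounded[THEN bounded_iff[THEN iffD1]] by (metis imageI real_norm_def)
  have M0: "M >= 0" using M[OF xC] by linarith
  have "\<bar>ii js (%x. mu x * p n (Z x)) y - ii js (%x. mu x * h (Z x)) y\<bar> <= (2 * ro) ^ length js * M * inverse (real (Suc n))"
   if y: "y : C" for n y
  proof -
   have yB: "y : B" using y CB by auto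
   have "ii js (%x. mu x * p n (Z x)) y - ii js (%x. mu x * h (Z x)) y = ii js (%x. mu x * p n (Z x) - mu x * h (Z x)) y"
    by (rule iint_diff[symmetric, OF _ _ js(2) yB]) (intro continuous_on_mult mu pZ hZ)+
   moreover have "\<bar>ii js (%x. mu x * p n (Z x) - mu x * h (Z x)) y\<bar> <= (2 * ro) ^ length js * (M * inverse (real (Suc n)))"
   proof (rule iint_bound[OF _ CB _ _ js(2) y])
    show "continuous_on B (%x. mu x * p n (Z x) - mu x * h (Z x))"
     by (intro continuous_on_diff continuous_on_mult mu pZ hZ)
    fix w assume w: "w : C"
    have "\<bar>mu w * p n (Z w) - mu w * h (Z w)\<bar> = \<bar>mu w\<bar> * \<bar>h (Z w) - p n (Z w)\<bar>"
     by (simp add: right_diff_distrib[symmetric] abs_mult abs_minus_commute)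
    also have "\<dots> <= M * inverse (real (Suc n))"
     using M[OF w] p(2)[OF w, of n] M0 by (intro mult_mono) auto
    finally show "\<bar>mu w * p n (Z w) - mu w * h (Z w)\<bar> <= M * inverse (real (Suc n))" .
   next
    fix w j t assume "w : C" "j : set js" "t : {c j - ro .. c j + ro}"
    thus "w(j := t) : C" using m r js by (intro Cupd) (auto simp: abs_le_iff)
   qed
   ultimately show ?thesis by (simp add: mult.assoc)
  qed
  thus ?thesis using M0 rho by (intro exI[of _ "(2 * ro) ^ length js * M"]) auto
 qed
 define U where "U = {c i - r <..< c i + r}"
 have U: "x i : U" using m(2)[OF iQ(1)] r by (auto simp: U_def abs_le_iff)
 have xsC: "x(i := s) : C" if "s : U" for s
  by (rule Cupd[OF xC iQ(1)]) (use that in \<open>auto simp: U_def abs_le_iff\<close>)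
 define T where "T n s = ii js (%x. kp x * p n (Z x)) (x(i := s))" for n s
 define T' where "T' n s = ii js (%x. transp i kp x * p n (Z x)) (x(i := s))" for n s
 define S where "S s = ii js (%x. kp x * h (Z x)) (x(i := s))" for s
 define S' where "S' s = ii js (%x. transp i kp x * h (Z x)) (x(i := s))" for s
 have TD: "(T n has_real_derivative T' n s) (at s)" if "s : U" for n s
  using deriv_smooth[OF pV kp i, of "x(i := s)" n] xsC[OF that] CB
  by (auto simp: T_def[abs_def] T'_def)
 obtain M where M: "M >= 0" "!!n y. y : C ==> \<bar>ii js (%x. kp x * p n (Z x)) y - ii js (%x. kp x * h (Z x)) y\<bar> <= M * inverse (real (Suc n))"
  using approx[OF Cinf_contB[OF kp(1)]] by blast
 obtain M' where M': "M' >= 0" "!!n y. y : C ==> \<bar>ii js (%x. transp i kp x * p n (Z x)) y - ii js (%x. transp i kp x * h (Z x)) y\<bar> <= M' * inverse (real (Suc n))"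
  using approx[OF Cinf_contB[OF transp_Cinf[OF kp(1) i]]] by blast
 have lim0: "(%n. N * inverse (real (Suc n))) \<longlonglongrightarrow> 0" for N :: real
  using tendsto_mult_left[OF LIMSEQ_inverse_real_of_nat, of N] by simp
 have TS: "(%n. T n s) \<longlonglongrightarrow> S s" if "s : U" for s
 proof -
  have "(%n. T n s - S s) \<longlonglongrightarrow> 0"
   by (rule tendsto_rabs_zero_cancel, rule tendsto_sandwich[OF _ _ tendsto_const lim0[of M]])
    (use M(2)[OF xsC[OF that]] in \<open>auto simp: T_def S_def\<close>)
  thus ?thesis by (simp add: LIM_zero_iff)
 qed
 have "\<exists>g. \<forall>s\<in>U. (%n. T n s) \<longlonglongrightarrow> g s & (g has_derivative (%h. S' s * h)) (at s within U)"
 proof (rule has_derivative_sequence[of U T "%n s h. T' n s * h" "%s h. S' s * h" "x i" "S (x i)"])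
  show "x i : U" "(%n. T n (x i)) \<longlonglongrightarrow> S (x i)" by (rule U TS[OF U])+
  show "convex U" by (simp add: U_def)
  show "(T n has_derivative (%h. T' n s * h)) (at s within U)" if "s : U" for n s
   using TD[OF that, of n] has_field_derivative_imp_has_derivative has_derivative_at_withinI by blast
  fix e :: real assume "e > 0"
  have "eventually (%n. M' * inverse (real (Suc n)) < e) sequentially"
   using order_tendstoD(2)[OF lim0 \<open>e > 0\<close>] .
  thus "\<forall>\<^sub>F n in sequentially. \<forall>s\<in>U. \<forall>h. norm (T' n s * h - S' s * h) <= e * norm h"
  proof eventually_elim
   case (elim n)
   show ?case
   proof (intro ballI allI)
    fix s h assume "s : U"
    hence "\<bar>T' n s - S' s\<bar> <= e"
     using M'(2)[OF xsC, of s n] elim by (auto simp: T'_def S'_def)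
    thus "norm (T' n s * h - S' s * h) <= e * norm h"
     by (simp add: left_diff_distrib[symmetric] abs_mult mult_right_mono)
   qed
  qed
 qed
 then obtain g where g: "!!s. s : U ==> (%n. T n s) \<longlonglongrightarrow> g s"
  "!!s. s : U ==> (g has_derivative (%h. S' s * h)) (at s within U)" by blast
 have gS: "g s = S s" if "s : U" for s
  using LIMSEQ_unique[OF g(1)[OF that] TS[OF that]] .
 have "(S has_derivative (%h. S' (x i) * h)) (at (x i) within U)"
  using has_derivative_transform[OF U _ g(2)[OF U]] gS by auto
 hence "(S has_derivative (%h. S' (x i) * h)) (at (x i))"
  using U by (subst (asm) at_within_open) (auto simp: U_def)
 thus ?thesis by (simp add: S_def[abs_def] S'_def has_field_derivative_def)
qed

text \<open>Each derivative has the original shape with the weight replaced by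
  \<open>transp i kp\<close>, which is again smooth and supported inside. The induction over the
  order generalises the weight.\<close>

theorem smoothing:
 assumes h: "continuous_on V h" and kp: "Cinf_on Q B kp" "supp kp"
 shows "Cinf_on Q B (ii js (%x. kp x * h (Z x)))"
proof -
 have hZ: "continuous_on B (%x. h (Z x))"
  by (rule continuous_on_compose2[OF h Z_continuous Z(1)])
 have cont: "continuous_on (extensional Q \<inter> B) (ii js (%x. kp x * h (Z x)))" if "Cinf_on Q B kp" for kp
  using iint_continuous[OF continuous_on_mult[OF Cinf_contB[OF that] hZ] js(2)] B_ext by (simp add: Int_absorb1)
 have "C_on k Q B (ii js (%x. kp x * h (Z x)))" for k
  using kp
 proof (induction k arbitrary: kp)
  case 0
  thus ?case using cont by (simp add: C_on_0_iff)
 next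
  case (Suc k)
  show ?case unfolding C_on_Suc_iff
  proof (intro conjI ballI cont Suc.prems)
   fix i assume i: "i : Q"
   show "has_partial i (ii js (%x. kp x * h (Z x))) x" if "x : B" for x
   proof (cases "i : set js")
    case True
    hence "(%t. ii js (%x. kp x * h (Z x)) (x(i := t))) = (%t. ii js (%x. kp x * h (Z x)) x)" by (simp add: iint_upd)
    thus ?thesis by (simp add: has_partial_def)
   next
    case False
    show ?thesis by (rule has_partialI(1)[OF deriv_continuous[OF h Suc.prems _ that]]) (use False i in auto)
   qed
   show "C_on k Q B (pd i (ii js (%x. kp x * h (Z x))))"
   proof (cases "i : set js")
    case True
    hence "pd i (ii js (%x. kp x * h (Z x))) = (%x. 0)" by (simp add: iint_upd partial_deriv_def fun_eq_iff)
    thus ?thesis by (simp add: C_on_const)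
   next
    case False
    hence i': "i : Q - set js" using i by auto
    have "pd i (ii js (%x. kp x * h (Z x))) x = ii js (%x. transp i kp x * h (Z x)) x" if "x : B" for x
     by (rule has_partialI(2)[OF deriv_continuous[OF h Suc.prems i' that]])
    moreover have "C_on k Q B (ii js (%x. transp i kp x * h (Z x)))"
     by (rule Suc.IH[OF transp_Cinf[OF Suc.prems(1) i'] supp_transp[OF Suc.prems(2) i']])
    ultimately show ?thesis by (simp add: C_on_cong[OF openB, of "pd i (ii js (%x. kp x * h (Z x)))"])
   qed
  qed
 qed
 thus ?thesis by (simp add: Cinf_on_def)
qed

end

subsection \<open>Bump functions\<close>

text \<open>The classical flat function is the case \<open>n = 0\<close>. Allowing powers in the
  denominator makes the family closed under differentiation, so smoothness is a plain
  induction.\<close>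

definition flat :: "nat => real => real" where
 "flat n x = (if x > 0 then exp (- 1 / x) / x ^ n else 0)"

lemma flat_nonneg: "flat n x >= 0" by (simp add: flat_def)

lemma flat_pos: "x > 0 ==> flat n x > 0" by (simp add: flat_def)

lemma power_fact_le_exp:
 assumes "(y::real) >= 0"
 shows "y ^ m / fact m <= exp y"
proof -
 have "(\<Sum>k\<in>{m}. y ^ k /\<^sub>R fact k) <= suminf (%k. y ^ k /\<^sub>R fact k)"
  by (rule sum_le_suminf) (use assms summable_exp_generic[of y] in auto)
 thus ?thesis by (simp add: exp_def divide_inverse mult.commute)
qed

text \<open>The exponential series gives exp(y) \<ge> y^(n+2)/(n+2)! at y = 1/x. Quadratic vanishing
  at 0 is what makes the derivative there equal to 0.\<close>

lemma flat_bound: "flat n x <= fact (n + 2) * x\<^sup>2"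
proof (cases "x > 0")
 case True
 have "(1 / x) ^ (n + 2) / fact (n + 2) <= exp (1 / x)"
  using True by (intro power_fact_le_exp) auto
 hence "inverse (exp (1 / x)) <= inverse ((1 / x) ^ (n + 2) / fact (n + 2))"
  using True by (intro le_imp_inverse_le) auto
 also have "\<dots> = fact (n + 2) * x ^ (n + 2)"
  using True by (simp add: power_divide field_simps del: fact_Suc)
 finally have "exp (- 1 / x) / x ^ n <= fact (n + 2) * x ^ (n + 2) / x ^ n"
  using True by (intro divide_right_mono) (auto simp: exp_minus)
 also have "\<dots> = fact (n + 2) * x\<^sup>2" using True by (simp add: power_add power2_eq_square del: fact_Suc)
 finally show ?thesis using True by (simp add: flat_def del: fact_Suc)
next
 case False
 thus ?thesis by (simp add: flat_def del: fact_Suc)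
qed

lemma flat_deriv: "(flat n has_real_derivative (flat (n + 2) x - real n * flat (n + 1) x)) (at x)"
proof -
 consider "x > 0" | "x < 0" | "x = 0" by linarith
 thus ?thesis
 proof cases
  case 1
  have "((%x. exp (- 1 / x) / x ^ n) has_real_derivative (flat (n + 2) x - real n * flat (n + 1) x)) (at x)"
   using 1 by (auto intro!: derivative_eq_intros simp: flat_def field_simps power2_eq_square)
     (cases n; simp add: field_simps)
  moreover have "eventually (%y. y : {0<..}) (nhds x)" using 1 by (intro eventually_nhds_in_open) auto
  hence "eventually (%y. flat n y = exp (- 1 / y) / y ^ n) (nhds x)"
   by eventually_elim (simp add: flat_def)
  ultimately show ?thesis by (subst DERIV_cong_ev[OF refl _ refl]) auto
 next
  case 2
  have "eventually (%y. y : {..<0}) (nhds x)" using 2 by (intro eventually_nhds_in_open) auto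
  hence "eventually (%y. flat n y = 0) (nhds x)"
   by eventually_elim (simp add: flat_def)
  hence "(flat n has_real_derivative 0) (at x)" by (subst DERIV_cong_ev[OF refl _ refl]) auto
  thus ?thesis using 2 by (simp add: flat_def)
 next
  case 3
  have "(%h. (flat n (0 + h) - flat n 0) / h) \<midarrow>0\<rightarrow> 0"
  proof (rule tendsto_rabs_zero_cancel, rule tendsto_sandwich[where f="%_. 0" and h="%h. fact (n + 2) * \<bar>h\<bar>"])
   show "\<forall>\<^sub>F h in at 0. \<bar>(flat n (0 + h) - flat n 0) / h\<bar> <= fact (n + 2) * \<bar>h\<bar>"
   proof (rule always_eventually, rule allI)
    fix h :: real
    show "\<bar>(flat n (0 + h) - flat n 0) / h\<bar> <= fact (n + 2) * \<bar>h\<bar>"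
    proof (cases "h = 0")
     case False
     have "\<bar>flat n h\<bar> <= fact (n + 2) * \<bar>h\<bar> * \<bar>h\<bar>"
      using flat_bound[of n h] flat_nonneg[of n h] by (simp add: power2_eq_square mult.assoc del: fact_Suc)
     thus ?thesis using False by (simp add: flat_def[of n 0] abs_divide divide_le_eq del: fact_Suc)
    qed simp
   qed
   show "((%h::real. fact (n + 2) * \<bar>h\<bar>) \<longlongrightarrow> 0) (at 0)"
    by (auto intro!: tendsto_eq_intros)
  qed auto
  hence "(flat n has_real_derivative 0) (at 0)" by (simp add: DERIV_def)
  thus ?thesis using 3 by (simp add: flat_def)
 qed
qed

lemma Cinf_flat:
 assumes V: "openin (RR I) V"
 shows "Cinf_on I V (%x. flat n (a * x i + b))"
proof -
 have "C_on k I V (%x. flat n (a * x i + b))" for k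
 proof (induction k arbitrary: n)
  case 0
  have "continuous_on UNIV (flat n)"
   by (meson DERIV_isCont flat_deriv continuous_at_imp_continuous_on)
  hence "continuous_on (extensional I \<inter> V) (%x. flat n (a * x i + b))"
   by (rule continuous_on_compose2)
    (auto intro!: continuous_intros continuous_on_subset[OF continuous_on_product_coordinates])
  thus ?case by (simp add: C_on_0_iff)
 next
  case (Suc k)
  have c: "continuous_on (extensional I \<inter> V) (%x. flat n (a * x i + b))"
   using Suc.IH[of n] C_on_cont by blast
  have D: "((%t. flat n (a * (x(l := t)) i + b)) has_real_derivative
    (if l = i then a * (flat (n + 2) (a * x i + b) - real n * flat (n + 1) (a * x i + b)) else 0)) (at (x l))" for x l
  proof (cases "l = i")
   case True
   have "((%t. flat n (a * t + b)) has_real_derivative ((flat (n + 2) (a * x i + b) - real n * flat (n + 1) (a * x i + b)) * a)) (at (x i))"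
    by (rule DERIV_chain2[OF flat_deriv]) (auto intro!: derivative_eq_intros)
   thus ?thesis using True by (simp add: mult.commute)
  qed simp
  have p: "pd l (%x. flat n (a * x i + b)) =
   (%x. if l = i then a * (flat (n + 2) (a * x i + b) - real n * flat (n + 1) (a * x i + b)) else 0)" for l
   by (rule ext, rule has_partialI(2)[OF D])
  have "C_on k I V (pd l (%x. flat n (a * x i + b)))" for l
   unfolding p
   by (cases "l = i") (auto intro!: C_on_cmult[OF V] C_on_diff[OF V] Suc.IH C_on_const)
  moreover have "has_partial l (%x. flat n (a * x i + b)) x" for l x
   by (rule has_partialI(1)[OF D])
  ultimately show ?case unfolding C_on_Suc_iff using c by blast
 qed
 thus ?thesis by (simp add: Cinf_on_def)
qed

definition bump1 :: "real => real => real => real" where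
 "bump1 ro d t = flat 0 (ro / 2 - (t - d)) * flat 0 (ro / 2 + (t - d))"

text \<open>Each factor is divided by its own integral, so the total weight over the range is 1.
  \<open>bump1\<close> is supported in radius \<open>ro / 2\<close>, which leaves the gap to
  \<open>ro\<close> required by the locale \<open>smoothing\<close>.\<close>

definition bump :: "real => ('q => real) => 'q list => ('q => real) => real" where
 "bump ro c js x = (\<Prod>j\<in>set js. bump1 ro (c j) (x j) / integral {c j - ro .. c j + ro} (bump1 ro (c j)))"

lemma bump1_nonneg: "bump1 ro d t >= 0" by (simp add: bump1_def flat_nonneg)

lemma bump1_continuous: "continuous_on S (bump1 ro d)"
proof -
 have "continuous_on UNIV (flat 0)"
  by (meson DERIV_isCont flat_deriv continuous_at_imp_continuous_on)
 thus ?thesis unfolding bump1_def[abs_def]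
  by (intro continuous_on_mult continuous_on_compose2[where f = "%t. ro / 2 - (t - d)" and g = "flat 0"]
   continuous_on_compose2[where f = "%t. ro / 2 + (t - d)" and g = "flat 0"]) (auto intro!: continuous_intros)
qed

lemma bump1_integral_pos:
 assumes "ro > 0"
 shows "integral {d - ro .. d + ro} (bump1 ro d) > 0"
proof -
 have "integral {d - ro .. d + ro} (bump1 ro d) >= 0"
  by (intro integral_nonneg integrable_continuous_real bump1_continuous bump1_nonneg)
 moreover have "integral {d - ro .. d + ro} (bump1 ro d) ~= 0"
 proof
  assume "integral {d - ro .. d + ro} (bump1 ro d) = 0"
  hence "bump1 ro d d = 0"
   using integral_eq_0_iff[OF bump1_continuous, of "d - ro" "d + ro" ro d] assms bump1_nonneg by auto
  thus False using assms flat_pos[of "ro / 2" 0] by (simp add: bump1_def)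
 qed
 ultimately show ?thesis by simp
qed

lemma Cinf_bump:
 assumes "openin (RR I) V"
 shows "Cinf_on I V (bump ro c js)"
proof -
 have 1: "bump1 ro d t = flat 0 ((-1) * t + (ro / 2 + d)) * flat 0 (1 * t + (ro / 2 - d))" for d t
  by (simp add: bump1_def algebra_simps)
 show ?thesis unfolding bump_def[abs_def] 1 divide_inverse
  by (intro Cinf_on_prod Cinf_on_mult Cinf_flat Cinf_on_const assms)
qed

lemma bump_eq_0:
 assumes "j : set js" "\<bar>x j - c j\<bar> > ro / 2"
 shows "bump ro c js x = 0"
proof -
 have "bump1 ro (c j) (x j) = 0" using assms(2) by (auto simp: bump1_def flat_def abs_if split: if_splits)
 thus ?thesis unfolding bump_def using assms(1) by (intro prod_zero) auto
qed

lemma bump_upd: "l \<notin> set js ==> bump ro c js (x(l := t)) = bump ro c js x"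
 unfolding bump_def by (intro prod.cong) auto

lemma bump_nonneg: "ro > 0 ==> bump ro c js x >= 0"
 unfolding bump_def by (intro prod_nonneg divide_nonneg_pos bump1_nonneg bump1_integral_pos)

lemma iint_bump:
 assumes "ro > 0"
 shows "distinct js ==> iint ro c js (bump ro c js) x = 1"
proof (induction js arbitrary: x)
 case Nil thus ?case by (simp add: bump_def)
next
 case (Cons j js)
 define m where "m = integral {c j - ro .. c j + ro} (bump1 ro (c j))"
 have m: "m > 0" unfolding m_def by (rule bump1_integral_pos[OF assms])
 have "bump ro c (j # js) = (%x. (bump1 ro (c j) (x j) / m) * bump ro c js x)"
  using Cons.prems by (auto simp: bump_def m_def)
 moreover have "iint ro c js (%x. (bump1 ro (c j) (x j) / m) * bump ro c js x) y =
   (bump1 ro (c j) (y j) / m) * iint ro c js (bump ro c js) y" for y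
  by (rule iint_pull) (use Cons.prems in auto)
 ultimately have "iint ro c (j # js) (bump ro c (j # js)) x =
  integral {c j - ro .. c j + ro} (%t. bump1 ro (c j) t / m)"
  using Cons by simp
 also have "\<dots> = 1" using m by (simp add: m_def[symmetric])
 finally show ?case .
qed

section \<open>Smooth parametrisations\<close>

text \<open>A smooth parametrisation in the sense of diffeology. Group operations, actions and
  tuples act on plots directly, so that smoothness of composite expressions needs no explicit choice
  of charts.\<close>

definition plot :: "('a, 'i) manifold => 'q set => ('q => real) set => (('q => real) => 'a) => bool" where
 "plot M Q V a \<longleftrightarrow> openin (RR Q) V \<and>
   continuous_map (subtopology (RR Q) V) (mtop M) a \<and>
   (\<forall>(U, ph)\<in>matlas M. \<forall>i\<in>midx M. Cinf_on Q {x : V. a x : U} (%x. ph (a x) i))"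

text \<open>Just what composing plots with smooth maps requires. Having only openness and
  injectivity of charts, it passes to products and powers without a study of their transition
  maps.\<close>

definition charted :: "('a, 'i) manifold => bool" where
 "charted M \<longleftrightarrow> finite (midx M) & (\<Union>(U, ph)\<in>matlas M. U) = topspace (mtop M) \<and>
   (\<forall>(U, ph)\<in>matlas M. openin (mtop M) U & inj_on ph U \<and>
    (\<forall>W\<subseteq>U. openin (mtop M) W --> openin (RR (midx M)) (ph ` W)))"

lemma charted_cover:
 assumes "charted M" "y : topspace (mtop M)"
 obtains U ph where "(U, ph) : matlas M" "y : U"
proof -
 have "y : (\<Union>(U, ph)\<in>matlas M. U)" using assms by (simp add: charted_def)
 thus thesis using that by auto
qed

lemma charted_chart:
 assumes "charted M" "(U, ph) : matlas M"
 shows "openin (mtop M) U" "inj_on ph U"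
  "!!W. W \<subseteq> U ==> openin (mtop M) W ==> openin (RR (midx M)) (ph ` W)"
 using assms unfolding charted_def by auto

lemma plotD:
 assumes "plot M Q V a"
 shows plot_open: "openin (RR Q) V"
  and plot_cont: "continuous_map (subtopology (RR Q) V) (mtop M) a"
  and plot_coord: "!!U ph i. (U, ph) : matlas M ==> i : midx M ==> Cinf_on Q {x : V. a x : U} (%x. ph (a x) i)"
 using assms by (auto simp: plot_def)

lemma plotI:
 assumes "openin (RR Q) V"
  "continuous_map (subtopology (RR Q) V) (mtop M) a"
  "!!U ph i. (U, ph) : matlas M ==> i : midx M ==> Cinf_on Q {x : V. a x : U} (%x. ph (a x) i)"
 shows "plot M Q V a"
 using assms by (auto simp: plot_def)

lemma plot_in: "plot M Q V a ==> x : V ==> a x : topspace (mtop M)"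
 using plot_cont[of M Q V a] plot_open[of M Q V a] openin_subset
 by (fastforce simp: continuous_map_def Pi_iff)

lemma plot_preimage_open:
 assumes "plot M Q V a" "openin (mtop M) U"
 shows "openin (RR Q) {x : V. a x : U}"
proof -
 have "openin (subtopology (RR Q) V) {x : topspace (subtopology (RR Q) V). a x : U}"
  using plot_cont[OF assms(1)] assms(2) by (rule openin_continuous_map_preimage)
 moreover have "{x : topspace (subtopology (RR Q) V). a x : U} = {x : V. a x : U}"
  using openin_subset_extensional[OF plot_open[OF assms(1)]] by auto
 ultimately show ?thesis using plot_open[OF assms(1)] by (simp add: openin_open_subtopology)
qed

lemma plot_chart:
 assumes "plot M Q V a" "(U, ph) : matlas M" "a ` V \<subseteq> U" "i : midx M"
 shows "Cinf_on Q V (%x. ph (a x) i)"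
proof -
 have "{x : V. a x : U} = V" using assms(3) by auto
 thus ?thesis using plot_coord[OF assms(1,2,4)] by simp
qed

lemma plot_subset:
 assumes "plot M Q V a" "openin (RR Q) V'" "V' \<subseteq> V"
 shows "plot M Q V' a"
proof (rule plotI[OF assms(2)])
 show "continuous_map (subtopology (RR Q) V') (mtop M) a"
  using plot_cont[OF assms(1)] assms(3) by (rule continuous_map_from_subtopology_mono)
 fix U ph i assume "(U, ph) : matlas M" "i : midx M"
 thus "Cinf_on Q {x : V'. a x : U} (%x. ph (a x) i)"
  by (rule Cinf_on_subset[OF plot_coord[OF assms(1)]]) (use assms(3) in auto)
qed

lemma plot_cong:
 assumes "plot M Q V a" "charted M" "!!x. x : V ==> a x = b x"
 shows "plot M Q V b"
proof (rule plotI[OF plot_open[OF assms(1)]])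
 show "continuous_map (subtopology (RR Q) V) (mtop M) b"
  using plot_cont[OF assms(1)] by (rule continuous_map_eq) (use assms(3) in auto)
 fix U ph i assume U: "(U, ph) : matlas M" "i : midx M"
 have "openin (mtop M) U" using U assms(2) by (auto simp: charted_def)
 from plot_preimage_open[OF assms(1) this]
 have "Cinf_on Q {x : V. a x : U} (%x. ph (b x) i)"
  using plot_coord[OF assms(1) U] assms(3)
  by (subst Cinf_on_cong[where g = "%x. ph (a x) i"]) auto
 moreover have "{x : V. a x : U} = {x : V. b x : U}" using assms(3) by auto
 ultimately show "Cinf_on Q {x : V. b x : U} (%x. ph (b x) i)" by simp
qed

lemma smooth_map_on_charted:
 assumes "smooth_map_on M N W f"
 shows "openin (mtop M) W" "continuous_map (subtopology (mtop M) W) (mtop N) f"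
  "!!U ph V ps j. (U, ph) : matlas M ==> (V, ps) : matlas N ==> j : midx N ==>
   Cinf_on (midx M) (ph ` {x : U \<inter> W. f x : V}) (%p. ps (f (inv_into U ph p)) j)"
 using assms by (fastforce simp: smooth_map_on_def coord_smooth_on_iff)+

text \<open>Near a point with \<open>a x\<close> in a chart domain, \<open>f\<close> after
  \<open>a\<close> is the chart expression of \<open>f\<close> applied to the coordinates of
  \<open>a\<close>; \<open>Cinf_on_local\<close> glues these local statements.\<close>

lemma plot_compose:
 assumes M: "charted M" and N: "charted N" and f: "smooth_map_on M N W f"
  and a: "plot M Q V a" "a ` V \<subseteq> W"
 shows "plot N Q V (%x. f (a x))"
proof (rule plotI[OF plot_open[OF a(1)]])
 note f' = smooth_map_on_charted[OF f]
 have "continuous_map (subtopology (RR Q) V) (subtopology (mtop M) W) a"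
  using plot_cont[OF a(1)] a(2) by (auto simp: continuous_map_in_subtopology)
 from continuous_map_compose[OF this f'(2)]
 show "continuous_map (subtopology (RR Q) V) (mtop N) (%x. f (a x))" by (simp add: o_def)
 fix U' ps j assume U': "(U', ps) : matlas N" and j: "j : midx N"
 have oU': "openin (mtop N) U'" using U' N by (auto simp: charted_def)
 have "openin (subtopology (mtop M) W) {x : topspace (subtopology (mtop M) W). f x : U'}"
  using f'(2) oU' by (rule openin_continuous_map_preimage)
 moreover have "{x : topspace (subtopology (mtop M) W). f x : U'} = {x : W. f x : U'}"
  using openin_subset[OF f'(1)] by auto
 ultimately have oW: "openin (mtop M) {x : W. f x : U'}" using f'(1) by (simp add: openin_open_subtopology)
 show "Cinf_on Q {x : V. f (a x) : U'} (%x. ps (f (a x)) j)"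
 proof (rule Cinf_on_local)
  fix x assume x: "x : {x : V. f (a x) : U'}"
  then obtain U ph where U: "(U, ph) : matlas M" "a x : U"
   using charted_cover[OF M plot_in[OF a(1), of x]] by auto
  note cU = charted_chart[OF M U(1)]
  define V'' where "V'' = {y : V. a y : U \<inter> {x : W. f x : U'}}"
  have oV'': "openin (RR Q) V''"
   unfolding V''_def by (intro plot_preimage_open[OF a(1)] openin_Int cU(1) oW)
  have eq: "{x : U \<inter> W. f x : U'} = U \<inter> {x : W. f x : U'}" by auto
  have "Cinf_on Q V'' (%y. ps (f (inv_into U ph (ph (a y)))) j)"
  proof (rule Cinf_on_compose[OF _ oV'', where u = "%y. ph (a y)" and g = "%p. ps (f (inv_into U ph p)) j"])
   show "finite (midx M)" using M by (simp add: charted_def)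
   show "openin (RR (midx M)) (ph ` {x : U \<inter> W. f x : U'})"
    unfolding eq by (intro cU(3) openin_Int cU(1) oW) auto
   show "(%y. ph (a y)) ` V'' \<subseteq> ph ` {x : U \<inter> W. f x : U'}" by (auto simp: V''_def)
   show "Cinf_on Q V'' (%y. ph (a y) i)" if "i : midx M" for i
    by (rule Cinf_on_subset[OF plot_coord[OF a(1) U(1) that]]) (auto simp: V''_def)
   show "Cinf_on (midx M) (ph ` {x : U \<inter> W. f x : U'}) (%p. ps (f (inv_into U ph p)) j)"
    by (rule f'(3)[OF U(1) U' j])
  qed
  hence "Cinf_on Q V'' (%y. ps (f (a y)) j)"
   by (subst Cinf_on_cong[OF oV'', where g = "%y. ps (f (inv_into U ph (ph (a y)))) j"])
    (use cU(2) in \<open>auto simp: V''_def inv_into_f_f\<close>)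
  moreover have "{x : V. f (a x) : U'} \<inter> V'' = V''" by (auto simp: V''_def)
  moreover have "x : V''" using x U a(2) by (auto simp: V''_def)
  ultimately show "\<exists>V'. openin (RR Q) V' & x : V' & Cinf_on Q ({x : V. f (a x) : U'} \<inter> V') (%x. ps (f (a x)) j)"
   using oV'' by (intro exI[of _ V'']) simp
 qed
qed

lemma continuous_map_Cinf_coords:
 assumes "openin (RR P) V'" "V \<subseteq> extensional Q" "u ` V' \<subseteq> V" "!!q. q : Q ==> Cinf_on P V' (%x. u x q)"
 shows "continuous_map (subtopology (RR P) V') (subtopology (RR Q) V) u"
 unfolding continuous_map_in_subtopology
proof (intro conjI continuous_map_coordinatewise_then_product)
 fix q assume "q : Q"
 thus "continuous_map (subtopology (RR P) V') euclideanreal (%x. u x q)"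
  unfolding continuous_map_powertop_real_iff using assms(4) Cinf_on_cont by blast
next
 fix q x assume "q \<notin> Q" "x : topspace (subtopology (RR P) V')"
 thus "u x q = undefined" using assms(2,3) by (force simp: extensional_def)
qed (use assms(3) in auto)

lemma plot_reparam:
 assumes a: "plot M Q V a" and M: "charted M" and finQ: "finite Q"
  and u: "openin (RR P) V'" "u ` V' \<subseteq> V" "!!q. q : Q ==> Cinf_on P V' (%x. u x q)"
 shows "plot M P V' (%x. a (u x))"
proof (rule plotI[OF u(1)])
 have cu: "continuous_map (subtopology (RR P) V') (subtopology (RR Q) V) u"
  by (rule continuous_map_Cinf_coords[OF u(1) openin_subset_extensional[OF plot_open[OF a]] u(2,3)])
 from continuous_map_compose[OF this plot_cont[OF a]]
 show co: "continuous_map (subtopology (RR P) V') (mtop M) (%x. a (u x))" by (simp add: o_def)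
 fix U ph i assume U: "(U, ph) : matlas M" and i: "i : midx M"
 have oU: "openin (mtop M) U" using U M by (auto simp: charted_def)
 have "openin (subtopology (RR P) V') {x : topspace (subtopology (RR P) V'). a (u x) : U}"
  using co oU by (rule openin_continuous_map_preimage)
 moreover have "{x : topspace (subtopology (RR P) V'). a (u x) : U} = {x : V'. a (u x) : U}"
  using openin_subset_extensional[OF u(1)] by auto
 ultimately have o: "openin (RR P) {x : V'. a (u x) : U}" using u(1) by (simp add: openin_open_subtopology)
 show "Cinf_on P {x : V'. a (u x) : U} (%x. ph (a (u x)) i)"
 proof (rule Cinf_on_compose[OF finQ o plot_preimage_open[OF a oU], where u = u and g = "%y. ph (a y) i"])
  show "Cinf_on P {x : V'. a (u x) : U} (%x. u x q)" if "q : Q" for q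
   by (rule Cinf_on_subset[OF u(3)[OF that]]) auto
 qed (use u(2) plot_coord[OF a U i] in auto)
qed

lemma is_chart_props:
 assumes "is_chart T I U ph"
 shows "openin T U" "inj_on ph U" "W \<subseteq> U ==> openin T W ==> openin (RR I) (ph ` W)"
proof -
 show oU: "openin T U" using assms by (simp add: is_chart_def)
 have h: "homeomorphic_map (subtopology T U) (subtopology (RR I) (ph ` U)) ph"
  and o: "openin (RR I) (ph ` U)" using assms by (auto simp: is_chart_def)
 have ts: "topspace (subtopology T U) = U" using openin_subset[OF oU] by auto
 show "inj_on ph U" using homeomorphic_imp_injective_map[OF h] ts by simp
 assume W: "W \<subseteq> U" "openin T W"
 have "openin (subtopology T U) W" using W oU by (simp add: openin_open_subtopology)
 hence "openin (subtopology (RR I) (ph ` U)) (ph ` W)"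
  using homeomorphic_map_openness[OF h, unfolded ts, OF W(1)] by blast
 thus "openin (RR I) (ph ` W)" using o by (simp add: openin_open_subtopology)
qed

text \<open>The smooth transition maps of the atlas enter here: they are the coordinates of an
  inverse chart in any other chart.\<close>

lemma chart_plot:
 assumes M: "smooth_manifold M" and U: "(U, ph) : matlas M"
 shows "plot M (midx M) (ph ` U) (inv_into U ph)"
proof (rule plotI)
 have ch: "is_chart (mtop M) (midx M) U ph" using M U by (auto simp: smooth_manifold_def)
 thus "openin (RR (midx M)) (ph ` U)" by (simp add: is_chart_def)
 have inj: "inj_on ph U" by (rule is_chart_props(2)[OF ch])
 obtain g where g: "homeomorphic_maps (subtopology (mtop M) U) (subtopology (RR (midx M)) (ph ` U)) ph g"
  using ch by (auto simp: is_chart_def homeomorphic_map_maps)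
 have Us: "U \<subseteq> topspace (mtop M)" using ch openin_subset by (auto simp: is_chart_def)
 have "continuous_map (subtopology (RR (midx M)) (ph ` U)) (mtop M) g"
  using g by (auto simp: homeomorphic_maps_def continuous_map_in_subtopology)
 thus "continuous_map (subtopology (RR (midx M)) (ph ` U)) (mtop M) (inv_into U ph)"
 proof (rule continuous_map_eq)
  fix p assume "p : topspace (subtopology (RR (midx M)) (ph ` U))"
  then obtain x where "x : U" "p = ph x" by auto
  thus "g p = inv_into U ph p" using g inj Us by (auto simp: homeomorphic_maps_def inv_into_f_f)
 qed
 fix V ps i assume V: "(V, ps) : matlas M" and i: "i : midx M"
 have "Cinf_on (midx M) (ph ` (U \<inter> V)) (%p. ps (inv_into U ph p) i)"
  using M U V i by (fastforce simp: smooth_manifold_def coord_smooth_on_iff)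
 moreover have "{p : ph ` U. inv_into U ph p : V} = ph ` (U \<inter> V)"
  using inj by (auto simp: inv_into_f_f)
 ultimately show "Cinf_on (midx M) {p : ph ` U. inv_into U ph p : V} (%p. ps (inv_into U ph p) i)" by simp
qed

lemma smooth_manifold_charted: "smooth_manifold M ==> charted M"
 unfolding charted_def smooth_manifold_def using is_chart_props by (fastforce split: prod.splits)

lemma charted_extensional:
 "charted M ==> (U, ph) : matlas M ==> x : U ==> ph x : extensional (midx M)"
proof -
 assume M: "charted M" and U: "(U, ph) : matlas M" "x : U"
 hence "openin (RR (midx M)) (ph ` U)" by (auto simp: charted_def)
 from openin_subset_extensional[OF this] U show ?thesis by auto
qed

section \<open>Products and powers of charted spaces\<close>

lemma charted_prod:
 assumes M: "charted M" and N: "charted N"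
 shows "charted (prod_manifold M N)"
proof -
 define I where "I = midx M <+> midx N"
 define Ph where "Ph ph ps = (%(x, y). restrict (case_sum (ph x) (ps y)) I)"
  for ph :: "'a => 'b => real" and ps :: "'c => 'd => real"
 have at: "matlas (prod_manifold M N) = {(U \<times> V, Ph ph ps) | U ph V ps. (U, ph) : matlas M & (V, ps) : matlas N}"
  by (simp add: prod_manifold_def Ph_def I_def)
 have "finite (midx (prod_manifold M N))" using M N by (simp add: prod_manifold_def charted_def)
 moreover have "(\<Union>(U, ph)\<in>matlas (prod_manifold M N). U) = topspace (mtop (prod_manifold M N))"
 proof (rule Set.set_eqI)
  fix z
  have ts: "topspace (mtop (prod_manifold M N)) = topspace (mtop M) \<times> topspace (mtop N)"
   by (simp add: prod_manifold_def)
  show "z : (\<Union>(U, ph)\<in>matlas (prod_manifold M N). U) \<longleftrightarrow> z : topspace (mtop (prod_manifold M N))"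
  proof
   assume "z : (\<Union>(U, ph)\<in>matlas (prod_manifold M N). U)"
   then obtain U ph V ps where U: "(U, ph) : matlas M" "(V, ps) : matlas N" "z : U \<times> V"
    unfolding at by auto
   thus "z : topspace (mtop (prod_manifold M N))" unfolding ts
    using openin_subset[OF charted_chart(1)[OF M U(1)]] openin_subset[OF charted_chart(1)[OF N U(2)]] by auto
  next
   assume "z : topspace (mtop (prod_manifold M N))"
   hence z: "fst z : topspace (mtop M)" "snd z : topspace (mtop N)" unfolding ts by auto
   obtain U ph where U: "(U, ph) : matlas M" "fst z : U" using charted_cover[OF M z(1)] .
   obtain V ps where V: "(V, ps) : matlas N" "snd z : V" using charted_cover[OF N z(2)] .
   have "(U \<times> V, Ph ph ps) : matlas (prod_manifold M N)" unfolding at using U V by blast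
   moreover have "z : U \<times> V" using U V by (simp add: mem_Times_iff)
   ultimately show "z : (\<Union>(U, ph)\<in>matlas (prod_manifold M N). U)" by (intro UN_I) auto
  qed
 qed
 moreover have "openin (prod_topology (mtop M) (mtop N)) (U \<times> V) & inj_on (Ph ph ps) (U \<times> V) \<and>
   (\<forall>W\<subseteq>U \<times> V. openin (prod_topology (mtop M) (mtop N)) W --> openin (RR I) (Ph ph ps ` W))"
  if U: "(U, ph) : matlas M" and V: "(V, ps) : matlas N" for U ph V ps
 proof (intro conjI allI impI)
  note cU = charted_chart[OF M U] and cV = charted_chart[OF N V]
  have eU: "ph x : extensional (midx M)" if "x : U" for x using charted_extensional[OF M U that] .
  have eV: "ps x : extensional (midx N)" if "x : V" for x using charted_extensional[OF N V that] .
  show "openin (prod_topology (mtop M) (mtop N)) (U \<times> V)" using cU cV by (simp add: openin_prod_Times_iff)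
  have val: "Ph ph ps (x, y) (Inl i) = ph x i" if "i : midx M" for x y i using that by (auto simp: Ph_def I_def)
  have val': "Ph ph ps (x, y) (Inr i) = ps y i" if "i : midx N" for x y i using that by (auto simp: Ph_def I_def)
  show "inj_on (Ph ph ps) (U \<times> V)"
  proof (rule inj_onI, clarify)
   fix x y x' y' assume h: "x : U" "y : V" "x' : U" "y' : V" "Ph ph ps (x, y) = Ph ph ps (x', y')"
   have "ph x = ph x'" by (rule extensionalityI[OF eU eU]) (use h val in metis)+
   moreover have "ps y = ps y'" by (rule extensionalityI[OF eV eV]) (use h val' in metis)+
   ultimately show "x = x' & y = y'" using h cU(2) cV(2) by (auto dest: inj_onD)
  qed
  fix W assume W: "W \<subseteq> U \<times> V" "openin (prod_topology (mtop M) (mtop N)) W"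
  show "openin (RR I) (Ph ph ps ` W)"
  proof (subst openin_subopen, rule ballI)
   fix p assume "p : Ph ph ps ` W"
   then obtain x y where xy: "(x, y) : W" "p = Ph ph ps (x, y)" by auto
   obtain A C where AC: "openin (mtop M) A" "openin (mtop N) C" "x : A" "y : C" "A \<times> C \<subseteq> W"
    using W(2) xy(1) unfolding openin_prod_topology_alt by metis
   have AU: "A \<subseteq> U" "C \<subseteq> V" using AC W(1) by auto
   define T where "T = {q : extensional I. restrict (%i. q (Inl i)) (midx M) : ph ` A} \<inter>
     {q : extensional I. restrict (%i. q (Inr i)) (midx N) : ps ` C}"
   have "continuous_map (RR I) (RR (midx M)) (%q. restrict (%i. q (Inl i)) (midx M))"
    using continuous_map_product_coordinates[of _ I "%_. euclideanreal"]
    by (intro continuous_map_coordinatewise_then_product) (auto simp: I_def)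
   from openin_continuous_map_preimage[OF this cU(3)[OF AU(1) AC(1)]]
   have o1: "openin (RR I) {q : extensional I. restrict (%i. q (Inl i)) (midx M) : ph ` A}" by simp
   have "continuous_map (RR I) (RR (midx N)) (%q. restrict (%i. q (Inr i)) (midx N))"
    using continuous_map_product_coordinates[of _ I "%_. euclideanreal"]
    by (intro continuous_map_coordinatewise_then_product) (auto simp: I_def)
   from openin_continuous_map_preimage[OF this cV(3)[OF AU(2) AC(2)]]
   have o2: "openin (RR I) {q : extensional I. restrict (%i. q (Inr i)) (midx N) : ps ` C}" by simp
   have "openin (RR I) T" unfolding T_def using o1 o2 by (rule openin_Int)
   moreover have "p : T"
   proof -
    have "restrict (%i. p (Inl i)) (midx M) = ph x"
     by (rule extensionalityI[OF restrict_extensional eU]) (use AC AU xy val in auto)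
    moreover have "restrict (%i. p (Inr i)) (midx N) = ps y"
     by (rule extensionalityI[OF restrict_extensional eV]) (use AC AU xy val' in auto)
    ultimately show ?thesis using AC xy by (auto simp: T_def Ph_def)
   qed
   moreover have "T \<subseteq> Ph ph ps ` W"
   proof
    fix q assume q: "q : T"
    then obtain x' y' where x'y': "x' : A" "y' : C" "restrict (%i. q (Inl i)) (midx M) = ph x'"
     "restrict (%i. q (Inr i)) (midx N) = ps y'" by (auto simp: T_def)
    have "q = Ph ph ps (x', y')"
    proof (rule extensionalityI)
     show "q : extensional I" using q by (auto simp: T_def)
     show "Ph ph ps (x', y') : extensional I" by (auto simp: Ph_def)
     fix i assume "i : I"
     thus "q i = Ph ph ps (x', y') i"
      using val val' x'y'(3,4)[symmetric] by (auto simp: I_def)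
    qed
    thus "q : Ph ph ps ` W" using AC x'y' by auto
   qed
   ultimately show "\<exists>T. openin (RR I) T & p : T & T \<subseteq> Ph ph ps ` W" by blast
  qed
 qed
 ultimately show ?thesis unfolding charted_def at
  by (simp add: prod_manifold_def I_def[symmetric]) blast
qed

text \<open>A point in the image of an open set has a neighbourhood in the image of an open box, and
  the latter is cut out slot by slot by preimages of chart images.\<close>

lemma charted_pow:
 assumes M: "charted M"
 shows "charted (pow_manifold n M)"
proof -
 define I where "I = {..<n} \<times> midx M"
 define Ph where "Ph ph = (%x. \<lambda>(j, i)\<in>I. ph j (x j) i)" for ph :: "nat => 'a => 'b => real"
 define P where "P U = (\<Pi>\<^sub>E j\<in>{..<n}. U j)" for U :: "nat => 'a set"
 define T where "T = product_topology (%_. mtop M) {..<n}"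
 have at: "matlas (pow_manifold n M) = {(P U, Ph ph) | U ph. \<forall>j<n. (U j, ph j) : matlas M}"
  by (simp add: pow_manifold_def Ph_def I_def P_def)
 have fin: "finite (midx (pow_manifold n M))" using M by (simp add: pow_manifold_def charted_def)
 have ts: "topspace (mtop (pow_manifold n M)) = (\<Pi>\<^sub>E j\<in>{..<n}. topspace (mtop M))"
  by (simp add: pow_manifold_def)
 have cov: "(\<Union>(U, ph)\<in>matlas (pow_manifold n M). U) = topspace (mtop (pow_manifold n M))"
 proof (intro equalityI subsetI)
  fix x assume "x : (\<Union>(U, ph)\<in>matlas (pow_manifold n M). U)"
  then obtain U ph where U: "!!j. j < n ==> (U j, ph j) : matlas M" "x : P U" unfolding at by auto
  have "U j \<subseteq> topspace (mtop M)" if "j < n" for j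
   using openin_subset[OF charted_chart(1)[OF M U(1)[OF that]]] .
  thus "x : topspace (mtop (pow_manifold n M))"
   using U(2) PiE_mono[of "{..<n}" U "%_. topspace (mtop M)"] unfolding ts P_def by auto
 next
  fix x assume x: "x : topspace (mtop (pow_manifold n M))"
  have "\<forall>j\<in>{..<n}. \<exists>U ph. (U, ph) : matlas M & x j : U"
  proof
   fix j assume "j : {..<n}"
   hence "x j : topspace (mtop M)" using x unfolding ts by (rule PiE_mem[rotated])
   from charted_cover[OF M this] show "\<exists>U ph. (U, ph) : matlas M & x j : U" by metis
  qed
  then obtain U ph where U: "\<forall>j\<in>{..<n}. (U j, ph j) : matlas M & x j : U j" by metis
  hence "(P U, Ph ph) : matlas (pow_manifold n M)" unfolding at by auto
  moreover have "x : P U" using U x unfolding ts P_def by (auto simp: PiE_iff)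
  ultimately show "x : (\<Union>(U, ph)\<in>matlas (pow_manifold n M). U)" by (intro UN_I) auto
 qed
 have ch: "openin T (P U) & inj_on (Ph ph) (P U) \<and>
   (\<forall>W\<subseteq>P U. openin T W --> openin (RR I) (Ph ph ` W))"
  if U: "!!j. j < n ==> (U j, ph j) : matlas M" for U ph
 proof (intro conjI allI impI)
  have cU: "openin (mtop M) (U j)" "inj_on (ph j) (U j)"
   "!!W. W \<subseteq> U j ==> openin (mtop M) W ==> openin (RR (midx M)) (ph j ` W)" if "j < n" for j
   using charted_chart[OF M U[OF that]] by auto
  have eU: "ph j x : extensional (midx M)" if "j < n" "x : U j" for x j using charted_extensional[OF M U that(2)] that by auto
  show "openin T (P U)" unfolding T_def P_def using cU(1) by (subst openin_PiE) auto
  have val: "Ph ph x (j, i) = ph j (x j) i" if "j < n" "i : midx M" for x j i using that by (auto simp: Ph_def I_def)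
  show "inj_on (Ph ph) (P U)"
  proof (rule inj_onI)
   fix x y assume h: "x : P U" "y : P U" "Ph ph x = Ph ph y"
   show "x = y"
   proof (rule extensionalityI[where A = "{..<n}"])
    fix j assume "j : {..<n}"
    hence j: "j < n" by simp
    have "ph j (x j) = ph j (y j)"
    proof (rule extensionalityI[OF eU[OF j] eU[OF j]])
     show "x j : U j" "y j : U j" using h j by (auto simp: P_def PiE_iff)
     fix i assume "i : midx M"
     thus "ph j (x j) i = ph j (y j) i" using val[OF j, of i x] val[OF j, of i y] h(3) by simp
    qed
    thus "x j = y j" using cU(2)[OF j] h j by (auto simp: P_def PiE_iff dest: inj_onD)
   qed (use h in \<open>auto simp: P_def PiE_iff\<close>)
  qed
  fix W assume W: "W \<subseteq> P U" "openin T W"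
  show "openin (RR I) (Ph ph ` W)"
  proof (subst openin_subopen, rule ballI)
   fix p assume "p : Ph ph ` W"
   then obtain x where x: "x : W" "p = Ph ph x" by auto
   obtain A where A: "!!j. j < n ==> openin (mtop M) (A j)" "x : P A" "P A \<subseteq> W"
    using W(2) x(1) unfolding T_def openin_product_topology_alt P_def by (metis lessThan_iff)
   have PA: "P A \<subseteq> P U" using A W by auto
   \<comment> \<open>From an inclusion of products to one of factors: a single coordinate of the
     known point \<open>x\<close> is varied.\<close>
   have AU: "A j \<subseteq> U j" if "j < n" for j
   proof
    fix y assume "y : A j"
    hence "x(j := y) : P A" using A(2) that by (auto simp: P_def PiE_iff extensional_def)
    hence "x(j := y) : P U" using PA by auto
    hence "(x(j := y)) j : U j" unfolding P_def by (rule PiE_mem) (use that in simp)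
    thus "y : U j" by simp
   qed
   define S where "S j = {q : extensional I. restrict (%i. q (j, i)) (midx M) : ph j ` A j}" for j
   have oS: "openin (RR I) (S j)" if "j < n" for j
   proof -
    have "continuous_map (RR I) (RR (midx M)) (%q. restrict (%i. q (j, i)) (midx M))"
     using continuous_map_product_coordinates[of _ I "%_. euclideanreal"] that
     by (intro continuous_map_coordinatewise_then_product) (auto simp: I_def)
    from openin_continuous_map_preimage[OF this cU(3)[OF that AU A(1)]] that
    show ?thesis by (simp add: S_def)
   qed
   \<comment> \<open>For \<open>n = 0\<close> the empty intersection would be the whole type instead
     of the one-point coordinate space.\<close>
   define R where "R = (if n = 0 then extensional I else (\<Inter>j\<in>{..<n}. S j))"
   have "openin (RR I) R"
   proof (cases "n = 0")
    case True thus ?thesis using openin_topspace[of "RR I"] by (simp add: R_def)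
   next
    case False
    hence "openin (RR I) (\<Inter>j\<in>{..<n}. S j)" by (intro openin_INT2) (use oS in auto)
    thus ?thesis using False by (simp add: R_def)
   qed
   moreover have "p : R"
   proof -
    have xA: "x j : A j" if "j < n" for j
     using PiE_mem[OF A(2)[unfolded P_def]] that by simp
    have "restrict (%i. p (j, i)) (midx M) = ph j (x j)" if j: "j < n" for j
    proof (rule extensionalityI[OF restrict_extensional eU[OF j]])
     show "x j : U j" using AU[OF j] xA[OF j] by blast
     fix i assume "i : midx M"
     thus "restrict (%i. p (j, i)) (midx M) i = ph j (x j) i" using val[OF j] x by simp
    qed
    thus ?thesis using xA x by (auto simp: R_def S_def Ph_def)
   qed
   moreover have "R \<subseteq> Ph ph ` W"
   proof
    fix q assume q: "q : R"
    hence "\<forall>j\<in>{..<n}. \<exists>y. y : A j & restrict (%i. q (j, i)) (midx M) = ph j y"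
     by (auto simp: R_def S_def split: if_splits)
    then obtain y where y: "!!j. j < n ==> y j : A j & restrict (%i. q (j, i)) (midx M) = ph j (y j)"
     by (metis lessThan_iff)
    define z where "z = restrict y {..<n}"
    have zA: "z : P A" using y by (auto simp: z_def P_def)
    have "q = Ph ph z"
    proof (rule extensionalityI)
     show "q : extensional I" using q by (cases "n = 0") (auto simp: R_def S_def)
     show "Ph ph z : extensional I" by (auto simp: Ph_def)
     fix l assume "l : I"
     then obtain j i where l: "l = (j, i)" "j < n" "i : midx M" by (auto simp: I_def)
     have "q (j, i) = ph j (y j) i" using y[OF l(2)] l(3) by (metis restrict_apply')
     thus "q l = Ph ph z l" using val[OF l(2,3)] l by (simp add: z_def)
    qed
    thus "q : Ph ph ` W" using A zA by auto
   qed
   ultimately show "\<exists>T. openin (RR I) T & p : T & T \<subseteq> Ph ph ` W" by blast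
  qed
 qed
 have ch': "openin T Y & inj_on F Y & (\<forall>W\<subseteq>Y. openin T W --> openin (RR I) (F ` W))"
  if YF: "(Y, F) : matlas (pow_manifold n M)" for Y F
 proof -
  obtain U ph where "Y = P U" "F = Ph ph" "\<forall>j<n. (U j, ph j) : matlas M"
   using YF unfolding at by blast
  thus ?thesis using ch[of U ph] by simp
 qed
 have TI: "mtop (pow_manifold n M) = T" "midx (pow_manifold n M) = I" by (simp_all add: pow_manifold_def T_def I_def)
 show ?thesis unfolding charted_def TI(1) TI(2)
 proof (intro conjI)
  show "finite I" "(\<Union>(U, ph)\<in>matlas (pow_manifold n M). U) = topspace T" using fin cov TI by simp_all
  show "\<forall>(U, ph)\<in>matlas (pow_manifold n M). openin T U & inj_on ph U \<and>
    (\<forall>W\<subseteq>U. openin T W --> openin (RR I) (ph ` W))"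
   using ch' by blast
 qed
qed

lemma plot_pair:
 assumes a: "plot M Q V a" and b: "plot N Q V b"
 shows "plot (prod_manifold M N) Q V (%x. (a x, b x))"
proof (rule plotI[OF plot_open[OF a]])
 show "continuous_map (subtopology (RR Q) V) (mtop (prod_manifold M N)) (%x. (a x, b x))"
  using plot_cont[OF a] plot_cont[OF b] by (simp add: prod_manifold_def continuous_map_paired)
 fix W \<theta> i assume W: "(W, \<theta>) : matlas (prod_manifold M N)" and i: "i : midx (prod_manifold M N)"
 obtain U ph U' ps where U: "(U, ph) : matlas M" "(U', ps) : matlas N" "W = U \<times> U'"
  "\<theta> = (%(x, y). restrict (case_sum (ph x) (ps y)) (midx M <+> midx N))"
  using W by (auto simp: prod_manifold_def)
 from i consider k where "i = Inl k" "k : midx M" | k where "i = Inr k" "k : midx N"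
  by (auto simp: prod_manifold_def)
 thus "Cinf_on Q {x : V. (a x, b x) : W} (%x. \<theta> (a x, b x) i)"
 proof cases
  case 1
  have "Cinf_on Q {x : V. (a x, b x) : W} (%x. ph (a x) k)"
   by (rule Cinf_on_subset[OF plot_coord[OF a U(1) 1(2)]]) (auto simp: U(3))
  thus ?thesis using 1 by (simp add: U(4) InlI)
 next
  case 2
  have "Cinf_on Q {x : V. (a x, b x) : W} (%x. ps (b x) k)"
   by (rule Cinf_on_subset[OF plot_coord[OF b U(2) 2(2)]]) (auto simp: U(3))
  thus ?thesis using 2 by (simp add: U(4) InrI)
 qed
qed

lemma plot_tuple:
 assumes V: "openin (RR Q) V" and a: "!!j. j < n ==> plot M Q V (%x. a x j)"
  and ext: "!!x. x : V ==> a x : extensional {..<n}"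
 shows "plot (pow_manifold n M) Q V a"
proof (rule plotI[OF V])
 have "continuous_map (subtopology (RR Q) V) (product_topology (%_. mtop M) {..<n}) a"
 proof (rule continuous_map_coordinatewise_then_product)
  show "continuous_map (subtopology (RR Q) V) (mtop M) (%x. a x j)" if "j : {..<n}" for j
   using plot_cont[OF a] that by simp
  show "a x j = undefined" if "j \<notin> {..<n}" "x : topspace (subtopology (RR Q) V)" for j x
   using ext[of x] that by (auto simp: extensional_def)
 qed
 thus "continuous_map (subtopology (RR Q) V) (mtop (pow_manifold n M)) a"
  by (simp add: pow_manifold_def)
 fix W \<theta> l assume W: "(W, \<theta>) : matlas (pow_manifold n M)" and l: "l : midx (pow_manifold n M)"
 obtain U ph where U: "!!j. j < n ==> (U j, ph j) : matlas M" "W = (\<Pi>\<^sub>E j\<in>{..<n}. U j)"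
  "\<theta> = (%x. \<lambda>(j, i)\<in>{..<n} \<times> midx M. ph j (x j) i)"
  using W by (auto simp: pow_manifold_def)
 obtain j i where j: "l = (j, i)" "j < n" "i : midx M" using l by (auto simp: pow_manifold_def)
 have "Cinf_on Q {x : V. a x : W} (%x. ph j (a x j) i)"
  by (rule Cinf_on_subset[OF plot_coord[OF a[OF j(2)] U(1)[OF j(2)] j(3)]]) (use j(2) in \<open>auto simp: U(2) PiE_iff\<close>)
 thus "Cinf_on Q {x : V. a x : W} (%x. \<theta> (a x) l)" using j by (simp add: U(3))
qed

text \<open>The converse direction of the passage to plots: smoothness on \<open>M\<close> is tested
  along inverse charts, with no chart of \<open>N\<close> mentioned by the premise.\<close>

lemma smooth_map_onI:
 assumes "openin (mtop M) W" "continuous_map (subtopology (mtop M) W) (mtop N) f" "charted M"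
  and "!!U ph. (U, ph) : matlas M ==> plot N (midx M) (ph ` (U \<inter> W)) (%p. f (inv_into U ph p))"
 shows "smooth_map_on M N W f"
 unfolding smooth_map_on_def
proof (intro conjI assms(1,2) ballI, clarify)
 fix U ph V ps assume U: "(U, ph) : matlas M" and V: "(V, ps) : matlas N"
 have inj: "inj_on ph U" using assms(3) U by (auto simp: charted_def)
 have "ph ` {x : U \<inter> W. f x : V} = {p : ph ` (U \<inter> W). f (inv_into U ph p) : V}"
  using inj by (auto simp: inv_into_f_f)
 thus "coord_smooth_on (midx M) (midx N) (ph ` {x : U \<inter> W. f x : V}) (%p. ps (f (inv_into U ph p)))"
  unfolding coord_smooth_on_iff using plot_coord[OF assms(4)[OF U] V] by simp
qed

section \<open>Local logarithm of an abelian Lie group\<close>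

text \<open>The sum norm on the coordinates in \<open>J\<close>: coordinatewise estimates add up
  directly, and values off \<open>J\<close> do not enter.\<close>

definition nrm :: "'j set => ('j => real) => real" where
 "nrm J x = (\<Sum>j\<in>J. \<bar>x j\<bar>)"

definition nball :: "'j set => real => ('j => real) set" where
 "nball J s = {x : extensional J. nrm J x < s}"

lemma nrm_nonneg: "nrm J x >= 0" by (simp add: nrm_def sum_nonneg)

lemma nrm_cong: "(!!j. j : J ==> x j = y j) ==> nrm J x = nrm J y"
 by (simp add: nrm_def)

lemma nrm_triangle: "nrm J (%j. x j + y j) <= nrm J x + nrm J y"
 unfolding nrm_def sum.distrib[symmetric] by (intro sum_mono) auto

lemma nrm_triangle3: "nrm J z <= nrm J x + nrm J y" if "!!j. j : J ==> z j = x j + y j"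
 using nrm_triangle[of J x y] nrm_cong[of J z "%j. x j + y j"] that by simp

lemma nrm_scale: "nrm J (%j. a * x j) = \<bar>a\<bar> * nrm J x"
 by (simp add: nrm_def abs_mult sum_distrib_left)

lemma nrm_zero: "nrm J (%j. 0) = 0" by (simp add: nrm_def)

lemma coord_le_nrm: "finite J ==> j : J ==> \<bar>x j\<bar> <= nrm J x"
 unfolding nrm_def by (rule member_le_sum) auto

lemma nrm_0_iff: "finite J ==> nrm J x = 0 \<longleftrightarrow> (\<forall>j\<in>J. x j = 0)"
 by (simp add: nrm_def sum_nonneg_eq_0_iff)

lemma nball_subset_cube: "finite J ==> nball J s \<subseteq> cube J (%_. 0) s"
 by (auto simp: nball_def mem_cube intro: le_less_trans[OF coord_le_nrm])

lemma cube_subset_nball: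
 assumes "finite J" "s > 0"
 shows "cube J (%_. 0) (s / (real (card J) + 1)) \<subseteq> nball J s"
proof
 fix x assume x: "x : cube J (%_. 0) (s / (real (card J) + 1))"
 have "nrm J x <= real (card J) * (s / (real (card J) + 1))"
  unfolding nrm_def by (rule sum_bounded_above) (use x in \<open>auto simp: mem_cube less_imp_le\<close>)
 also have "\<dots> < s" using assms by (simp add: field_simps)
 finally show "x : nball J s" using x by (simp add: nball_def mem_cube)
qed

lemma openin_nball:
 assumes "finite J"
 shows "openin (RR J) (nball J s)"
proof -
 have "continuous_map (RR J) euclideanreal (nrm J)"
  unfolding nrm_def[abs_def]
  by (intro continuous_map_sum assms continuous_map_real_abs
   continuous_map_product_coordinates[of _ J "%_. euclideanreal", simplified])
 hence "openin (RR J) {x : topspace (RR J). nrm J x : {..<s}}"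
  by (rule openin_continuous_map_preimage) simp
 thus ?thesis by (simp add: nball_def)
qed

section \<open>Mean value estimates and perturbations of linear maps near zero\<close>

lemma mvt_cube:
 assumes fin: "finite J" and f: "C_on 1 J (cube J c r) f" and x: "x : cube J c r" and y: "y : cube J c r"
 shows "\<exists>t. 0 < t & t < 1 \<and>
   f x - f y = (\<Sum>i\<in>J. pd i f (\<lambda>j\<in>J. y j + t * (x j - y j)) * (x i - y i))"
proof -
 define gm where "gm t = (\<lambda>j\<in>J. y j + t * (x j - y j))" for t
 have in_cube: "gm t : cube J c r" if "0 <= t" "t <= 1" for t
  unfolding mem_cube
 proof (intro conjI ballI)
  show "gm t : extensional J" by (simp add: gm_def)
  fix j assume j: "j : J"
  have "gm t j - c j = (1 - t) * (y j - c j) + t * (x j - c j)"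
   using j by (simp add: gm_def algebra_simps)
  hence "\<bar>gm t j - c j\<bar> <= (1 - t) * \<bar>y j - c j\<bar> + t * \<bar>x j - c j\<bar>"
   using that by (metis abs_mult abs_of_nonneg abs_triangle_ineq diff_ge_0_iff_ge)
  also have "\<dots> < r"
   using x y j that by (intro convex_bound_lt) (auto simp: mem_cube)
  finally show "\<bar>gm t j - c j\<bar> < r" .
 qed
 have D: "((%t. f (gm t)) has_real_derivative (\<Sum>i\<in>J. pd i f (gm t) * (x i - y i))) (at t)"
  if "0 <= t" "t <= 1" for t
 proof (rule total_derivative_extensional[OF fin openin_cube[OF fin] f, of gm t])
  show "gm t : cube J c r" by (rule in_cube[OF that])
  show "gm t : extensional J" for t by (simp add: gm_def)
  fix j assume j: "j : J"
  have "((%t. y j + t * (x j - y j)) has_real_derivative (x j - y j)) (at t)"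
   by (auto intro!: derivative_eq_intros)
  thus "((%t. gm t j) has_real_derivative (x j - y j)) (at t)" using j by (simp add: gm_def)
 qed
 have "\<exists>t>0. t < 1 & f (gm 1) - f (gm 0) = (1 - 0) * (\<Sum>i\<in>J. pd i f (gm t) * (x i - y i))"
  by (rule MVT2) (use D in auto)
 moreover have "gm 1 = x" "gm 0 = y" using x y by (auto simp: gm_def mem_cube extensional_def fun_eq_iff)
 ultimately show ?thesis by (auto simp: gm_def)
qed

lemma mvt_cube_bound:
 assumes fin: "finite J" and f: "C_on 1 J (cube J c r) f" and x: "x : cube J c r" and y: "y : cube J c r"
  and bd: "!!i t. i : J ==> 0 < t ==> t < 1 ==> \<bar>partial_deriv i f (\<lambda>j\<in>J. y j + t * (x j - y j))\<bar> <= \<theta>"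
 shows "\<bar>f x - f y\<bar> <= \<theta> * nrm J (%j. x j - y j)"
proof -
 obtain t where t: "0 < t" "t < 1" "f x - f y = (\<Sum>i\<in>J. pd i f (\<lambda>j\<in>J. y j + t * (x j - y j)) * (x i - y i))"
  using mvt_cube[OF fin f x y] by blast
 have "\<bar>f x - f y\<bar> <= (\<Sum>i\<in>J. \<bar>partial_deriv i f (\<lambda>j\<in>J. y j + t * (x j - y j))\<bar> * \<bar>x i - y i\<bar>)"
  unfolding t(3) by (rule order_trans[OF sum_abs]) (simp add: abs_mult)
 also have "\<dots> <= (\<Sum>i\<in>J. \<theta> * \<bar>x i - y i\<bar>)"
  by (intro sum_mono mult_right_mono bd t) auto
 finally show ?thesis by (simp add: nrm_def sum_distrib_left)
qed

lemma continuous_cube_near: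
 fixes g :: "('j => real) => real"
 assumes fin: "finite J" and V: "openin (RR J) V" and g: "continuous_on (extensional J \<inter> V) g" and x: "x : V" and e: "e > 0"
 shows "\<exists>s>0. cube J x s \<subseteq> V & (\<forall>y\<in>cube J x s. \<bar>g y - g x\<bar> < e)"
proof -
 have "continuous_map (subtopology (RR J) V) euclideanreal g"
  using g by (simp add: continuous_map_powertop_real_iff)
 hence "openin (subtopology (RR J) V) {y : topspace (subtopology (RR J) V). g y : ball (g x) e}"
  by (rule openin_continuous_map_preimage) simp
 moreover have "{y : topspace (subtopology (RR J) V). g y : ball (g x) e} = {y : V. \<bar>g y - g x\<bar> < e}"
  using openin_subset_extensional[OF V] by (auto simp: dist_real_def abs_minus_commute)
 ultimately have "openin (RR J) {y : V. \<bar>g y - g x\<bar> < e}"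
  using V by (simp add: openin_open_subtopology)
 moreover have "x : {y : V. \<bar>g y - g x\<bar> < e}" using x e by simp
 ultimately show ?thesis using openin_contains_cube[OF fin] by (smt (verit) mem_Collect_eq subset_iff)
qed

lemma continuous_cube_bounded:
 fixes g :: "('j => real) => real"
 assumes fin: "finite J" and g: "continuous_on (cube J c r) g" and r: "r > 0" and c: "c : extensional J"
 shows "\<exists>s C. 0 < s & s <= r & C >= 0 & (\<forall>y\<in>cube J c s. \<bar>g y\<bar> <= C)"
proof -
 have ext: "extensional J \<inter> cube J c r = cube J c r" by (auto simp: mem_cube)
 obtain s where s: "s > 0" "\<forall>y\<in>cube J c s. \<bar>g y - g c\<bar> < 1"
  using continuous_cube_near[OF fin openin_cube[OF fin] _ center_in_cube[OF c r], of g 1] g unfolding ext by auto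
 show ?thesis
 proof (rule exI[of _ "min s r"], rule exI[of _ "\<bar>g c\<bar> + 1"], intro conjI ballI)
  fix y assume "y : cube J c (min s r)"
  hence "y : cube J c s" using cube_mono[of "min s r" s J c] by auto
  thus "\<bar>g y\<bar> <= \<bar>g c\<bar> + 1" using s(2) by fastforce
 qed (use s r in auto)
qed

lemma finite_uniform_radius:
 assumes "finite S" "!!a s s'. a : S ==> P a s ==> 0 < s' ==> s' <= s ==> P a s'"
  "!!a. a : S ==> \<exists>s>0. P a (s::real)" "r > 0"
 shows "\<exists>s. 0 < s & s <= r & (\<forall>a\<in>S. P a s)"
proof -
 obtain s where s: "!!a. a : S ==> s a > 0 & P a (s a)" using assms(3) by metis
 define m where "m = Min (insert r (s ` S))"
 have m: "m > 0" "m <= r" "!!a. a : S ==> m <= s a" using assms(1,4) s by (auto simp: m_def)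
 thus ?thesis using assms(2) s by (intro exI[of _ m]) blast
qed

lemma zero_ext: "(\<lambda>j\<in>J. 0) : extensional J" by simp

lemma cube_zero_eq: "cube J (\<lambda>j\<in>J. 0) r = cube J (%_. 0) r"
 by (auto simp: mem_cube)

text \<open>The mean value estimate used twice: bounded second partials bound the first ones by a
  multiple of the norm, and these in turn bound \<open>f\<close> by the squared norm.\<close>

lemma second_order_bound:
 assumes fin: "finite J" and r: "r > 0" and f: "Cinf_on J (cube J (%_. 0) r) f" and f0: "f (\<lambda>j\<in>J. 0) = 0"
  and f'0: "!!i. i : J ==> pd i f (\<lambda>j\<in>J. 0) = 0"
 shows "\<exists>C\<ge>0. \<exists>s>0. s <= r & (\<forall>x\<in>cube J (%_. 0) s. \<bar>f x\<bar> <= C * (nrm J x)\<^sup>2)"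
proof -
 let ?K = "cube J (%_. 0)"
 have C1: "C_on 1 J (?K s) g" if "Cinf_on J (?K r) g" "s <= r" for g s
  using C_on_subset[of 1 J "?K r" g "?K s"] cube_mono[OF that(2)] that(1) by (auto simp: Cinf_on_def)
 have "\<exists>s C. 0 < s & s <= r & C >= 0 & (\<forall>y\<in>?K s. \<bar>partial_deriv i (pd k f) y\<bar> <= C)"
  if "i : J" "k : J" for i k
 proof -
  have "Cinf_on J (?K r) (pd i (pd k f))" by (intro Cinf_on_partial f that)
  hence "continuous_on (cube J (\<lambda>j\<in>J. 0) r) (pd i (pd k f))"
   using Cinf_on_cont[of J "?K r"] unfolding cube_zero_eq by (auto simp: mem_cube Int_absorb1 subset_iff)
  from continuous_cube_bounded[OF fin this r zero_ext] show ?thesis unfolding cube_zero_eq .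
 qed
 hence "\<exists>s>0. s <= r & (\<exists>C\<ge>0. \<forall>y\<in>?K s. \<bar>partial_deriv (fst z) (pd (snd z) f) y\<bar> <= C)" if "z : J \<times> J" for z
  using that by (cases z) fastforce
 hence "\<exists>s. 0 < s & s <= r & (\<forall>z\<in>J\<times>J. s <= r & (\<exists>C\<ge>0. \<forall>y\<in>?K s. \<bar>partial_deriv (fst z) (pd (snd z) f) y\<bar> <= C))"
  by (intro finite_uniform_radius[where P="%z s. s <= r & (\<exists>C\<ge>0. \<forall>y\<in>?K s. \<bar>partial_deriv (fst z) (pd (snd z) f) y\<bar> <= C)"])
   (use fin r cube_mono in \<open>auto; blast\<close>)+
 then obtain s where s: "0 < s" "s <= r" "!!z. z : J \<times> J ==> \<exists>C\<ge>0. \<forall>y\<in>?K s. \<bar>partial_deriv (fst z) (pd (snd z) f) y\<bar> <= C"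
  by blast
 obtain c where c: "!!z. z : J \<times> J ==> c z >= 0 & (\<forall>y\<in>?K s. \<bar>partial_deriv (fst z) (pd (snd z) f) y\<bar> <= c z)"
  using s(3) by metis
 define C where "C = (\<Sum>z\<in>J\<times>J. c z)"
 have C0: "C >= 0" unfolding C_def by (intro sum_nonneg) (use c in auto)
 have C: "\<bar>partial_deriv i (pd k f) y\<bar> <= C" if "i : J" "k : J" "y : ?K s" for i k y
 proof -
  have "c (i, k) <= C" unfolding C_def by (rule member_le_sum) (use that c fin in auto)
  thus ?thesis using c[of "(i, k)"] that by force
 qed
 have seg: "(\<lambda>j\<in>J. (\<lambda>j\<in>J. 0) j + t * (x j - (\<lambda>j\<in>J. 0) j)) : ?K s & nrm J (\<lambda>j\<in>J. (\<lambda>j\<in>J. 0) j + t * (x j - (\<lambda>j\<in>J. 0) j)) <= nrm J x"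
  if "x : ?K s" "0 < t" "t < 1" for x t
 proof
  have le: "\<bar>t * x j\<bar> <= \<bar>x j\<bar>" for j using that(2,3) by (simp add: abs_mult mult_left_le_one_le)
  show "(\<lambda>j\<in>J. (\<lambda>j\<in>J. 0) j + t * (x j - (\<lambda>j\<in>J. 0) j)) : ?K s"
   using that(1) le by (auto simp: mem_cube intro: le_less_trans)
  show "nrm J (\<lambda>j\<in>J. (\<lambda>j\<in>J. 0) j + t * (x j - (\<lambda>j\<in>J. 0) j)) <= nrm J x"
   unfolding nrm_def by (rule sum_mono) (use le in auto)
 qed
 have z: "(\<lambda>j\<in>J. 0) : ?K s" using s by (simp add: mem_cube)
 have nz: "nrm J (%j. x j - (\<lambda>j\<in>J. 0) j) = nrm J x" for x by (rule nrm_cong) simp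
 have d1: "\<bar>partial_deriv k f x\<bar> <= C * nrm J x" if "k : J" "x : ?K s" for k x
  using mvt_cube_bound[OF fin C1[OF Cinf_on_partial[OF f that(1)] s(2)] that(2) z, of C] C that seg
  by (simp only: f'0[OF that(1)] nz) auto
 have "\<bar>f x\<bar> <= C * (nrm J x)\<^sup>2" if x: "x : ?K s" for x
 proof -
  have "\<bar>f x - f (\<lambda>j\<in>J. 0)\<bar> <= (C * nrm J x) * nrm J (%j. x j - (\<lambda>j\<in>J. 0) j)"
  proof (rule mvt_cube_bound[OF fin C1[OF f s(2)] x z])
   fix i t :: real
   fix i assume i: "i : J" and t: "0 < t" "t < 1"
   show "\<bar>partial_deriv i f (\<lambda>j\<in>J. (\<lambda>j\<in>J. 0) j + t * (x j - (\<lambda>j\<in>J. 0) j))\<bar> <= C * nrm J x"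
    by (rule order_trans[OF d1[OF i] mult_left_mono]) (use seg[OF x t] C0 in auto)
  qed
  thus ?thesis unfolding f0 nz by (simp add: power2_eq_square mult.assoc)
 qed
 hence *: "\<forall>x\<in>?K s. \<bar>f x\<bar> <= C * (nrm J x)\<^sup>2" by blast
 show ?thesis
  by (rule exI[of _ C], rule conjI[OF C0], rule exI[of _ s]) (intro conjI s(1,2) *)
qed

text \<open>The first partials vanish at 0 and are continuous, so they are as small as desired on a
  small cube; convexity of the cube turns this into a Lipschitz bound.\<close>

lemma small_lipschitz:
 assumes fin: "finite J" and r: "r > 0" and f: "!!j. j : J ==> Cinf_on J (cube J (%_. 0) r) (%x. f x j)"
  and f'0: "!!i j. i : J ==> j : J ==> pd i (%x. f x j) (\<lambda>j\<in>J. 0) = 0" and \<theta>: "\<theta> > 0"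
 shows "\<exists>s. 0 < s & s <= r & (\<forall>x\<in>cube J (%_. 0) s. \<forall>y\<in>cube J (%_. 0) s.
   nrm J (%j. f x j - f y j) <= \<theta> * nrm J (%j. x j - y j))"
proof -
 let ?K = "cube J (%_. 0)"
 \<comment> \<open>The share of one coordinate in \<open>\<theta>\<close>; adding 1 to the
   cardinality covers empty \<open>J\<close>.\<close>
 define mu where "mu = \<theta> / (real (card J) + 1)"
 have mu: "mu > 0" using \<theta> by (simp add: mu_def)
 have near: "\<exists>s>0. s <= r & (\<forall>y\<in>?K s. \<bar>partial_deriv i (%x. f x j) y\<bar> <= mu)" if ij: "i : J" "j : J" for i j
 proof -
  have "Cinf_on J (?K r) (pd i (%x. f x j))" by (rule Cinf_on_partial[OF f[OF ij(2)] ij(1)])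
  hence co: "continuous_on (extensional J \<inter> ?K r) (pd i (%x. f x j))" by (rule Cinf_on_cont)
  have z: "(\<lambda>j\<in>J. 0) : ?K r" using r by (simp add: mem_cube)
  obtain s where s: "s > 0" "cube J (\<lambda>j\<in>J. 0) s \<subseteq> ?K r"
   "\<forall>y\<in>cube J (\<lambda>j\<in>J. 0) s. \<bar>partial_deriv i (%x. f x j) y - pd i (%x. f x j) (\<lambda>j\<in>J. 0)\<bar> < mu"
   using continuous_cube_near[OF fin openin_cube[OF fin] co z mu] by blast
  show ?thesis
  proof (intro exI[of _ "min s r"] conjI ballI)
   fix y assume "y : ?K (min s r)"
   hence "y : cube J (\<lambda>j\<in>J. 0) s" using cube_mono[of "min s r" s J] unfolding cube_zero_eq by auto
   thus "\<bar>partial_deriv i (%x. f x j) y\<bar> <= mu" using s(3) f'0[OF ij] by fastforce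
  qed (use s r in auto)
 qed
 have "\<exists>s. 0 < s & s <= r & (\<forall>z\<in>J\<times>J. \<forall>y\<in>?K s. \<bar>partial_deriv (fst z) (%x. f x (snd z)) y\<bar> <= mu)"
 proof (rule finite_uniform_radius[where P="%z s. \<forall>y\<in>?K s. \<bar>partial_deriv (fst z) (%x. f x (snd z)) y\<bar> <= mu"])
  show "\<forall>y\<in>?K s'. \<bar>partial_deriv (fst a) (%x. f x (snd a)) y\<bar> <= mu"
   if "\<forall>y\<in>?K s. \<bar>partial_deriv (fst a) (%x. f x (snd a)) y\<bar> <= mu" "s' <= s" for a s s'
   using that cube_mono[OF that(2)] by blast
  show "\<exists>s>0. \<forall>y\<in>?K s. \<bar>partial_deriv (fst a) (%x. f x (snd a)) y\<bar> <= mu" if "a : J \<times> J" for a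
   using near[of "fst a" "snd a"] that by (auto simp: mem_Times_iff)
 qed (use fin r in auto)
 then obtain s where s: "0 < s" "s <= r"
  and s3: "\<forall>z\<in>J\<times>J. \<forall>y\<in>?K s. \<bar>partial_deriv (fst z) (%x. f x (snd z)) y\<bar> <= mu"
  by auto
 have s_bound: "\<bar>partial_deriv i (%x. f x j) y\<bar> <= mu" if "i : J" "j : J" "y : ?K s" for i j y
  using s3[THEN bspec, of "(i, j)"] that by simp
 have "nrm J (%j. f x j - f y j) <= \<theta> * nrm J (%j. x j - y j)" if x: "x : ?K s" and y: "y : ?K s" for x y
 proof -
  have *: "\<bar>f x j - f y j\<bar> <= mu * nrm J (%j. x j - y j)" if j: "j : J" for j
  proof (rule mvt_cube_bound[OF fin _ x y])
   show "C_on 1 J (?K s) (%x. f x j)"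
    using C_on_subset[of 1 J "?K r" "%x. f x j" "?K s"] cube_mono[OF s(2)] f[OF j] by (auto simp: Cinf_on_def)
   fix i and t :: real assume i: "i : J" and t: "0 < t" "t < 1"
   have "(\<lambda>j\<in>J. y j + t * (x j - y j)) : ?K s" unfolding mem_cube
   proof (intro conjI ballI)
    fix l assume l: "l : J"
    have "y l + t * (x l - y l) = (1 - t) * y l + t * x l" by (simp add: algebra_simps)
    hence "\<bar>y l + t * (x l - y l)\<bar> <= (1 - t) * \<bar>y l\<bar> + t * \<bar>x l\<bar>"
     using t by (metis abs_mult abs_of_nonneg abs_triangle_ineq diff_ge_0_iff_ge less_imp_le)
    also have "\<dots> < s" using x y l t by (intro convex_bound_lt) (auto simp: mem_cube)
    finally show "\<bar>(\<lambda>j\<in>J. y j + t * (x j - y j)) l - 0\<bar> < s" using l by simp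
   qed simp
   thus "\<bar>partial_deriv i (%x. f x j) (\<lambda>j\<in>J. y j + t * (x j - y j))\<bar> <= mu" by (rule s_bound[OF i j])
  qed
  have "nrm J (%j. f x j - f y j) <= real (card J) * (mu * nrm J (%j. x j - y j))"
   unfolding nrm_def[of J "%j. f x j - f y j"] by (rule sum_bounded_above) (use * in auto)
  also have "\<dots> <= \<theta> * nrm J (%j. x j - y j)"
  proof -
   have "real (card J) * mu <= \<theta>" using \<theta> by (simp add: mu_def field_simps)
   from mult_right_mono[OF this nrm_nonneg] show ?thesis by (simp add: mult.assoc)
  qed
  finally show ?thesis .
 qed
 thus ?thesis using s by blast
qed

lemma geometric_convergent:
 fixes Y :: "nat => real"
 assumes "!!n. \<bar>Y (Suc n) - Y n\<bar> <= a * q ^ n" "0 <= q" "q < 1"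
 shows "\<exists>l. Y \<longlonglongrightarrow> l & \<bar>l - Y 0\<bar> <= a / (1 - q)"
proof -
 have sm: "summable (%n. a * q ^ n)" using assms by (intro summable_mult summable_geometric) auto
 have s: "summable (%n. Y (Suc n) - Y n)"
  by (rule summable_comparison_test[OF _ sm]) (use assms in auto)
 have "(%n. \<Sum>i<n. Y (Suc i) - Y i) \<longlonglongrightarrow> suminf (%n. Y (Suc n) - Y n)"
  using s by (rule summable_LIMSEQ)
 hence "(%n. Y n - Y 0) \<longlonglongrightarrow> suminf (%n. Y (Suc n) - Y n)" by (simp add: sum_lessThan_telescope)
 from tendsto_add[OF this tendsto_const[of "Y 0"]] have l: "Y \<longlonglongrightarrow> suminf (%n. Y (Suc n) - Y n) + Y 0" by simp
 have sa: "summable (%n. \<bar>Y (Suc n) - Y n\<bar>)"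
  by (rule summable_comparison_test[OF _ sm]) (use assms in auto)
 have "\<bar>suminf (%n. Y (Suc n) - Y n)\<bar> <= suminf (%n. \<bar>Y (Suc n) - Y n\<bar>)" by (rule summable_rabs[OF sa])
 also have "\<dots> <= suminf (%n. a * q ^ n)" by (rule suminf_le[OF assms(1) sa sm])
 also have "\<dots> = a / (1 - q)" using assms suminf_geometric[of q] by (subst suminf_mult) (auto intro: summable_geometric)
 finally show ?thesis using l by auto
qed

text \<open>Newton's iteration with the fixed derivative \<open>c\<close>: since \<open>g\<close>
  deviates from \<open>c\<close> times the identity by a Lipschitz constant at most
  \<open>c / 2\<close>, each correction is at most half the preceding one.\<close>

lemma perturbed_inverse:
 fixes g :: "('j => real) => 'j => real"
 assumes fin: "finite J" and c: "c > 0" and \<theta>: "0 <= \<theta>" "\<theta> <= c / 2"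
  and lip: "!!x y. x : nball J s ==> y : nball J s ==>
    nrm J (%j. (g x j - g y j) - c * (x j - y j)) <= \<theta> * nrm J (%j. x j - y j)"
  and g0: "!!j. j : J ==> g (\<lambda>j\<in>J. 0) j = 0" and y: "nrm J y < c * s / 2"
 shows "\<exists>x\<in>nball J s. \<forall>j\<in>J. g x j = y j"
proof -
 define a where "a = nrm J y / c"
 have a: "0 <= a" "2 * a < s" using c y nrm_nonneg[of J y] by (auto simp: a_def field_simps)
 define Y where "Y = rec_nat (\<lambda>j\<in>J. 0) (%_ x. \<lambda>j\<in>J. x j + (y j - g x j) / c)"
 have Y0: "Y 0 = (\<lambda>j\<in>J. 0)" and YS: "Y (Suc n) = (\<lambda>j\<in>J. Y n j + (y j - g (Y n) j) / c)" for n
  by (auto simp: Y_def)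
 have Ye: "Y n : extensional J" for n by (cases n) (auto simp: Y0 YS)
 \<comment> \<open>Corrections a, a/2, a/4, ... keep the iterates below 2a < s, hence inside the
   ball where \<open>lip\<close> may be used.\<close>
 have P: "nrm J (Y n) <= a * (2 - 2 * (1 / 2) ^ n) & nrm J (%j. Y (Suc n) j - Y n j) <= a * (1 / 2) ^ n" for n
 proof (induction n)
  case 0
  have "nrm J (%j. Y (Suc 0) j - Y 0 j) = nrm J (%j. (1 / c) * y j)"
   by (rule nrm_cong) (simp add: YS Y0 g0)
  also have "\<dots> = a" using c by (simp only: nrm_scale) (simp add: a_def)
  finally show ?case by (simp add: Y0 nrm_def)
 next
  case (Suc n)
  have pos: "0 <= a * (1 / 2) ^ n" using a by simp
  have b1: "a * (2 - 2 * (1 / 2) ^ n) < s"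
  proof -
   have "a * (2 - 2 * (1 / 2) ^ n) = 2 * a - 2 * (a * (1 / 2) ^ n)" by (simp add: algebra_simps)
   thus ?thesis using a pos by linarith
  qed
  have n1: "nrm J (Y (Suc n)) <= nrm J (Y n) + nrm J (%j. Y (Suc n) j - Y n j)"
   by (rule nrm_triangle3) simp
  hence n2: "nrm J (Y (Suc n)) <= a * (2 - 2 * (1 / 2) ^ Suc n)"
   using Suc by (simp add: algebra_simps)
  have b2: "a * (2 - 2 * (1 / 2) ^ Suc n) < s"
  proof -
   have "a * (2 - 2 * (1 / 2) ^ Suc n) = 2 * a - a * (1 / 2) ^ n" by (simp add: algebra_simps)
   thus ?thesis using a pos by linarith
  qed
  have B: "Y n : nball J s" "Y (Suc n) : nball J s" using Suc b1 n2 b2 Ye by (auto simp: nball_def)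
  have "nrm J (%j. Y (Suc (Suc n)) j - Y (Suc n) j) =
    nrm J (%j. (- 1 / c) * ((g (Y (Suc n)) j - g (Y n) j) - c * (Y (Suc n) j - Y n j)))"
  proof (rule nrm_cong)
   fix j assume j: "j : J"
   have e: "y j - g (Y n) j = c * (Y (Suc n) j - Y n j)" using j c by (simp add: YS)
   have "Y (Suc (Suc n)) j - Y (Suc n) j = (y j - g (Y (Suc n)) j) / c" using j by (simp add: YS)
   also have "\<dots> = (c * (Y (Suc n) j - Y n j) + g (Y n) j - g (Y (Suc n)) j) / c" using e by simp
   also have "\<dots> = (- 1 / c) * ((g (Y (Suc n)) j - g (Y n) j) - c * (Y (Suc n) j - Y n j))"
   proof -
    have "(c * d + u - v) / c = (- 1 / c) * ((v - u) - c * d)" for d u v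
     using c by (simp add: field_simps)
    thus ?thesis .
   qed
   finally show "Y (Suc (Suc n)) j - Y (Suc n) j = (- 1 / c) * ((g (Y (Suc n)) j - g (Y n) j) - c * (Y (Suc n) j - Y n j))" .
  qed
  also have "\<dots> = (1 / c) * nrm J (%j. (g (Y (Suc n)) j - g (Y n) j) - c * (Y (Suc n) j - Y n j))"
   using c by (simp only: nrm_scale) simp
  also have "\<dots> <= (1 / c) * (\<theta> * nrm J (%j. Y (Suc n) j - Y n j))"
   using lip[OF B(2,1)] c by (intro mult_left_mono) auto
  also have "\<dots> <= (1 / c) * ((c / 2) * nrm J (%j. Y (Suc n) j - Y n j))"
   using \<theta> c nrm_nonneg by (intro mult_left_mono mult_right_mono) auto
  also have "\<dots> <= a * (1 / 2) ^ Suc n" using Suc c by simp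
  finally show ?case using n2 by simp
 qed
 have "\<exists>l. (%n. Y n j) \<longlonglongrightarrow> l" if "j : J" for j
 proof -
  have "\<bar>Y (Suc n) j - Y n j\<bar> <= a * (1 / 2) ^ n" for n
   using coord_le_nrm[OF fin that, of "%j. Y (Suc n) j - Y n j"] P[of n] by simp
  from geometric_convergent[OF this] show ?thesis by auto
 qed
 then obtain l where l: "!!j. j : J ==> (%n. Y n j) \<longlonglongrightarrow> l j" by metis
 define x where "x = restrict l J"
 have lx: "(%n. Y n j) \<longlonglongrightarrow> x j" if "j : J" for j using l[OF that] that by (simp add: x_def)
 have Yn: "nrm J (Y n) <= 2 * a" for n
 proof -
  have "a * (2 - 2 * (1 / 2) ^ n) = 2 * a - 2 * (a * (1 / 2) ^ n)" by (simp add: algebra_simps)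
  moreover have "0 <= a * (1 / 2) ^ n" using a by simp
  ultimately show ?thesis using P[of n] by linarith
 qed
 have "(%n. nrm J (Y n)) \<longlonglongrightarrow> nrm J x"
  unfolding nrm_def by (intro tendsto_sum tendsto_rabs lx)
 hence "nrm J x <= 2 * a" by (rule LIMSEQ_le_const2) (use Yn in auto)
 hence xB: "x : nball J s" using a by (auto simp: nball_def x_def)
 have YB: "Y n : nball J s" for n using Yn[of n] a Ye by (auto simp: nball_def)
 have d0: "(%n. nrm J (%j. x j - Y n j)) \<longlonglongrightarrow> 0"
 proof -
  have "(%n. \<Sum>j\<in>J. \<bar>x j - Y n j\<bar>) \<longlonglongrightarrow> (\<Sum>j\<in>J. \<bar>x j - x j\<bar>)"
   by (intro tendsto_sum tendsto_rabs tendsto_diff tendsto_const lx)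
  thus ?thesis by (simp add: nrm_def)
 qed
 have "g x j = y j" if j: "j : J" for j
 proof -
  have b: "norm ((g x j - g (Y n) j) - c * (x j - Y n j)) <= \<theta> * nrm J (%j. x j - Y n j)" for n
   using order_trans[OF coord_le_nrm[OF fin j, of "%j. (g x j - g (Y n) j) - c * (x j - Y n j)"] lip[OF xB YB]] by simp
  have "(%n. \<theta> * nrm J (%j. x j - Y n j)) \<longlonglongrightarrow> 0" using tendsto_mult_left[OF d0, of \<theta>] by simp
  hence "(%n. (g x j - g (Y n) j) - c * (x j - Y n j)) \<longlonglongrightarrow> 0"
   by (rule Lim_null_comparison[rotated]) (rule always_eventually, rule allI, rule b)
  moreover have "(%n. c * (x j - Y n j)) \<longlonglongrightarrow> c * (x j - x j)"
   by (intro tendsto_intros lx[OF j])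
  ultimately have "(%n. (g x j - g (Y n) j) - c * (x j - Y n j) + c * (x j - Y n j)) \<longlonglongrightarrow> 0 + c * (x j - x j)"
   by (rule tendsto_add)
  hence 1: "(%n. g x j - g (Y n) j) \<longlonglongrightarrow> 0" by simp
  have "(%n. c * (Y (Suc n) j - Y n j)) \<longlonglongrightarrow> c * (x j - x j)"
   by (intro tendsto_intros lx[OF j] LIMSEQ_Suc)
  moreover have "c * (Y (Suc n) j - Y n j) = y j - g (Y n) j" for n using j c by (simp add: YS)
  ultimately have 2: "(%n. y j - g (Y n) j) \<longlonglongrightarrow> 0" by simp
  from tendsto_diff[OF 1 2] have "(%n. g x j - y j) \<longlonglongrightarrow> 0" by simp
  from LIMSEQ_unique[OF this tendsto_const] show ?thesis by simp
 qed
 thus ?thesis using xB by blast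
qed

lemma perturbed_lower_bound:
 assumes fin: "finite J" and c: "c > 0"
  and lip: "nrm J (%j. (u j - v j) - c * (x j - y j)) <= \<theta> * nrm J (%j. x j - y j)"
 shows "(c - \<theta>) * nrm J (%j. x j - y j) <= nrm J (%j. u j - v j)"
proof -
 have "nrm J (%j. c * (x j - y j)) <= nrm J (%j. u j - v j) + nrm J (%j. (- 1) * ((u j - v j) - c * (x j - y j)))"
  by (rule nrm_triangle3) (simp add: algebra_simps)
 hence "c * nrm J (%j. x j - y j) <= nrm J (%j. u j - v j) + nrm J (%j. (u j - v j) - c * (x j - y j))"
  using c by (simp only: nrm_scale)
 thus ?thesis using lip by (simp add: algebra_simps)
qed

lemma deriv_quadratic:
 fixes f :: "real => real"
 assumes s: "s > 0" and b: "!!t. \<bar>t - t0\<bar> < s ==> \<bar>f t - f t0 - d * (t - t0)\<bar> <= C * (t - t0)\<^sup>2"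
 shows "(f has_real_derivative d) (at t0)"
proof -
 have "((%t. (f t - f t0) / (t - t0) - d) \<longlongrightarrow> 0) (at t0)"
 proof (rule Lim_null_comparison)
  have "((%t. C * \<bar>t - t0\<bar>) \<longlongrightarrow> C * \<bar>t0 - t0\<bar>) (at t0)" by (intro tendsto_intros)
  thus "((%t. C * \<bar>t - t0\<bar>) \<longlongrightarrow> 0) (at t0)" by simp
  show "\<forall>\<^sub>F t in at t0. norm ((f t - f t0) / (t - t0) - d) <= C * \<bar>t - t0\<bar>"
   unfolding eventually_at
  proof (intro exI[of _ s] conjI s ballI impI)
   fix t assume t: "t ~= t0 & dist t t0 < s"
   hence "\<bar>t - t0\<bar> < s" by (simp add: dist_real_def)
   note b[OF this]
   moreover have "(f t - f t0) / (t - t0) - d = (f t - f t0 - d * (t - t0)) / (t - t0)"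
    using t by (simp add: field_simps)
   moreover have "(t - t0)\<^sup>2 = \<bar>t - t0\<bar> * \<bar>t - t0\<bar>" by (simp add: power2_eq_square)
   ultimately show "norm ((f t - f t0) / (t - t0) - d) <= C * \<bar>t - t0\<bar>"
    using t by (simp add: abs_divide divide_le_eq mult.assoc)
  qed
 qed
 thus ?thesis by (simp add: has_field_derivative_iff LIM_zero_iff)
qed

text \<open>Two vectors packed into one over the index set \<open>{..<2} \<times> J\<close>, so that
  functions of two vectors fall under the calculus in coordinate spaces. \<open>sl\<close> recovers
  the components.\<close>

definition pr :: "'j set => ('j => real) => ('j => real) => nat \<times> 'j => real" where
 "pr J x y = (\<lambda>(k, j)\<in>{..<2} \<times> J. if k = 0 then x j else y j)"

definition sl :: "'j set => nat => (nat \<times> 'j => real) => 'j => real" where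
 "sl J k p = (\<lambda>j\<in>J. p (k, j))"

lemma pr_ext: "pr J x y : extensional ({..<2} \<times> J)" by (simp add: pr_def)

lemma sl_pr: "x : extensional J ==> sl J 0 (pr J x y) = x" "y : extensional J ==> sl J 1 (pr J x y) = y"
 by (auto simp: sl_def pr_def fun_eq_iff extensional_def)

lemma pr_app: "j : J ==> pr J x y (0, j) = x j" "j : J ==> pr J x y (Suc 0, j) = y j"
 by (auto simp: pr_def)

lemma pr_upd: "i : J ==> (pr J x y)((0, i) := t) = pr J (x(i := t)) y"
 "i : J ==> (pr J x y)((1, i) := t) = pr J x (y(i := t))"
 by (auto simp: pr_def fun_eq_iff)

lemma sum_W: "(\<Sum>kp\<in>{..<2::nat} \<times> J. f kp) = (\<Sum>j\<in>J. f (0, j)) + (\<Sum>j\<in>J. f (1, j))"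
proof -
 have e: "(\<Sum>kp\<in>{..<2::nat} \<times> J. f kp) = (\<Sum>k\<in>{..<2::nat}. \<Sum>j\<in>J. f (k, j))"
  by (subst sum.cartesian_product) (simp add: case_prod_unfold)
 show ?thesis unfolding e by (simp add: numeral_2_eq_2 lessThan_Suc add.commute)
qed

lemma nrm_pr: "nrm ({..<2} \<times> J) (pr J x y) = nrm J x + nrm J y"
 unfolding nrm_def sum_W by (simp add: pr_app)

lemma pr_cube: "x : cube J (%_. 0) s ==> y : cube J (%_. 0) s ==> pr J x y : cube ({..<2} \<times> J) (%_. 0) s"
 by (auto simp: mem_cube pr_def)

lemma sl_cube: "k < 2 ==> p : cube ({..<2} \<times> J) (%_. 0) s ==> sl J k p : cube J (%_. 0) s"
 by (auto simp: mem_cube sl_def)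

text \<open>\<open>m\<close> is a multiplication in coordinates with unit 0, and
  \<open>q x u\<close> plays the part of x^(-1) u. Both are total, with laws only while intermediate
  values stay in the cube. Commutativity enters through \<open>m_sq\<close>: squaring, and therefore
  halving, respects products.\<close>

locale local_group =
 fixes J :: "'j set" and r :: real and m q :: "('j => real) => ('j => real) => 'j => real"
 assumes fin: "finite J" and r: "r > 0"
  and m_ext: "!!x y. m x y : extensional J" and q_ext: "!!x y. q x y : extensional J"
  and m_smooth: "!!j. j : J ==> Cinf_on ({..<2} \<times> J) (cube ({..<2} \<times> J) (%_. 0) r) (%p. m (sl J 0 p) (sl J 1 p) j)"
  and q_smooth: "!!j. j : J ==> Cinf_on ({..<2} \<times> J) (cube ({..<2} \<times> J) (%_. 0) r) (%p. q (sl J 0 p) (sl J 1 p) j)"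
  and m_zero: "!!x. x : cube J (%_. 0) r ==> m x (\<lambda>j\<in>J. 0) = x" "!!x. x : cube J (%_. 0) r ==> m (\<lambda>j\<in>J. 0) x = x"
  and q_self: "!!x. x : cube J (%_. 0) r ==> q x x = (\<lambda>j\<in>J. 0)"
  and m_q: "!!x u. x : cube J (%_. 0) r ==> u : cube J (%_. 0) r ==> q x u : cube J (%_. 0) r ==> m x (q x u) = u"
  and m_sq: "!!x y. x : cube J (%_. 0) r ==> y : cube J (%_. 0) r ==> m x x : cube J (%_. 0) r ==>
    m y y : cube J (%_. 0) r ==> m x y : cube J (%_. 0) r ==> m (m x y) (m x y) = m (m x x) (m y y)"
begin

abbreviation "K \<equiv> cube J (%_. 0)"
abbreviation "W \<equiv> {..<2::nat} \<times> J"
abbreviation "KW \<equiv> cube W (%_. 0)"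
abbreviation "zr \<equiv> (\<lambda>j\<in>J. 0 :: real)"

lemma finW: "finite W" using fin by simp

lemma zero_K: "s > 0 ==> zr : K s" by (simp add: mem_cube)

lemma openK: "openin (RR J) (K s)" by (rule openin_cube[OF fin])

lemma openKW: "openin (RR W) (KW s)" by (rule openin_cube[OF finW])

lemma coords_compose:
 assumes F: "Cinf_on W (KW r) F" and V: "openin (RR P) V"
  and u: "u ` V \<subseteq> K r" "!!j. j : J ==> Cinf_on P V (%x. u x j)"
  and v: "v ` V \<subseteq> K r" "!!j. j : J ==> Cinf_on P V (%x. v x j)"
 shows "Cinf_on P V (%x. F (pr J (u x) (v x)))"
proof (rule Cinf_on_compose[OF finW V openKW _ _ F])
 show "(%x. pr J (u x) (v x)) ` V \<subseteq> KW r" using u(1) v(1) pr_cube by blast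
 fix kp assume "kp : W"
 then obtain k j where k: "kp = (k, j)" "k < 2" "j : J" by auto
 thus "Cinf_on P V (%x. pr J (u x) (v x) kp)"
  using u(2) v(2) by (cases "k = 0") (auto simp: pr_def)
qed

lemma m_compose:
 assumes V: "openin (RR P) V"
  and u: "u ` V \<subseteq> K r" "!!j. j : J ==> Cinf_on P V (%x. u x j)"
  and v: "v ` V \<subseteq> K r" "!!j. j : J ==> Cinf_on P V (%x. v x j)" and j: "j : J"
 shows "Cinf_on P V (%x. m (u x) (v x) j)" "Cinf_on P V (%x. q (u x) (v x) j)"
proof -
 have e: "u x : extensional J" "v x : extensional J" if "x : V" for x
  using u(1) v(1) that by (auto simp: mem_cube)
 have "Cinf_on P V (%x. m (sl J 0 (pr J (u x) (v x))) (sl J 1 (pr J (u x) (v x))) j)"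
  by (rule coords_compose[OF m_smooth[OF j] V u v])
 thus "Cinf_on P V (%x. m (u x) (v x) j)"
  by (subst Cinf_on_cong[OF V, where g = "%x. m (sl J 0 (pr J (u x) (v x))) (sl J 1 (pr J (u x) (v x))) j"])
   (simp add: sl_pr e del: One_nat_def)
 have "Cinf_on P V (%x. q (sl J 0 (pr J (u x) (v x))) (sl J 1 (pr J (u x) (v x))) j)"
  by (rule coords_compose[OF q_smooth[OF j] V u v])
 thus "Cinf_on P V (%x. q (u x) (v x) j)"
  by (subst Cinf_on_cong[OF V, where g = "%x. q (sl J 0 (pr J (u x) (v x))) (sl J 1 (pr J (u x) (v x))) j"])
   (simp add: sl_pr e del: One_nat_def)
qed

text \<open>The difference \<open>m x y - (x + y)\<close> vanishes whenever one argument is 0, that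
  is on both coordinate subspaces. All its first partials at the origin vanish, and
  \<open>second_order_bound\<close> applies.\<close>

lemma m_quadratic: "\<exists>s C. 0 < s & s <= r & C >= 0 \<and>
  (\<forall>x\<in>K s. \<forall>y\<in>K s. nrm J (%j. m x y j - (x j + y j)) <= C * (nrm J x + nrm J y)\<^sup>2)"
proof -
 define f where "f j p = m (sl J 0 p) (sl J 1 p) j - (p (0, j) + p (1, j))" for j p
 have f: "Cinf_on W (KW r) (f j)" if "j : J" for j
  unfolding f_def by (intro Cinf_on_diff[OF openKW] Cinf_on_add[OF openKW] Cinf_on_coord m_smooth that)
 have zW: "(\<lambda>kp\<in>W. 0 :: real) = pr J zr zr" by (auto simp: pr_def fun_eq_iff)
 have f0: "f j (pr J x zr) = 0" "f j (pr J zr x) = 0" if "j : J" "x : K r" for j x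
 proof -
  have "x : extensional J" using that by (simp add: mem_cube)
  thus "f j (pr J x zr) = 0" "f j (pr J zr x) = 0"
   using that m_zero[OF that(2)] by (simp_all add: f_def sl_pr pr_app del: One_nat_def) (simp_all add: pr_app)
 qed
 have ez: "zr(i := t) : K r" if "i : J" "\<bar>t\<bar> < r" for i t using that r by (auto simp: mem_cube extensional_def)
 have f'0: "pd kp (f j) (\<lambda>kp\<in>W. 0) = 0" if j: "j : J" and kp: "kp : W" for j kp
 proof (rule has_partialI(2))
  obtain k i where k: "kp = (k, i)" "k < 2" "i : J" using kp by auto
  have "f j ((\<lambda>kp\<in>W. 0)(kp := t)) = 0" if "\<bar>t\<bar> < r" for t
  proof (cases "k = 0")
   case True
   thus ?thesis using f0(1)[OF j ez[OF k(3) that]] unfolding zW k(1) by (simp only: pr_upd[OF k(3)])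
  next
   case False
   hence "k = 1" using k(2) by simp
   thus ?thesis using f0(2)[OF j ez[OF k(3) that]] unfolding zW k(1) by (simp only: pr_upd[OF k(3)])
  qed
  note z = this
  have "((%t. f j ((\<lambda>kp\<in>W. 0)(kp := t))) has_real_derivative 0) (at 0)"
  proof (rule deriv_quadratic[OF r, where C = 0])
   fix t :: real assume "\<bar>t - 0\<bar> < r"
   hence tr: "\<bar>t\<bar> < r" "\<bar>0::real\<bar> < r" using r by simp_all
   show "\<bar>f j ((\<lambda>kp\<in>W. 0)(kp := t)) - f j ((\<lambda>kp\<in>W. 0)(kp := 0)) - 0 * (t - 0)\<bar> <= 0 * (t - 0)\<^sup>2"
    unfolding z[OF tr(1)] z[OF tr(2)] by simp
  qed
  thus "((%t. f j ((\<lambda>kp\<in>W. 0)(kp := t))) has_real_derivative 0) (at ((\<lambda>kp\<in>W. 0) kp))"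
   using kp by simp
 qed
 have "\<exists>s. 0 < s & s <= r & (\<forall>j\<in>J. \<exists>C\<ge>0. \<forall>p\<in>KW s. \<bar>f j p\<bar> <= C * (nrm W p)\<^sup>2)"
 proof (rule finite_uniform_radius[where P = "%j s. \<exists>C\<ge>0. \<forall>p\<in>KW s. \<bar>f j p\<bar> <= C * (nrm W p)\<^sup>2", OF fin _ _ r])
  fix j s s' assume "\<exists>C\<ge>0. \<forall>p\<in>KW s. \<bar>f j p\<bar> <= C * (nrm W p)\<^sup>2" "s' <= s"
  thus "\<exists>C\<ge>0. \<forall>p\<in>KW s'. \<bar>f j p\<bar> <= C * (nrm W p)\<^sup>2" using cube_mono by (meson subsetD)
 next
  fix j assume j: "j : J"
  have "f j (\<lambda>kp\<in>W. 0) = 0" unfolding zW using f0(1)[OF j zero_K[OF r]] .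
  from second_order_bound[OF finW r f[OF j] this f'0[OF j]]
  show "\<exists>s>0. \<exists>C\<ge>0. \<forall>p\<in>KW s. \<bar>f j p\<bar> <= C * (nrm W p)\<^sup>2" by auto
 qed
 then obtain s where s: "0 < s" "s <= r" and "\<forall>j\<in>J. \<exists>C\<ge>0. \<forall>p\<in>KW s. \<bar>f j p\<bar> <= C * (nrm W p)\<^sup>2" by blast
 hence "\<forall>j\<in>J. \<exists>C. C >= 0 & (\<forall>p\<in>KW s. \<bar>f j p\<bar> <= C * (nrm W p)\<^sup>2)" by auto
 from bchoice[OF this] obtain c where c: "!!j. j : J ==> c j >= 0 & (\<forall>p\<in>KW s. \<bar>f j p\<bar> <= c j * (nrm W p)\<^sup>2)" by auto
 have "nrm J (%j. m x y j - (x j + y j)) <= (\<Sum>j\<in>J. c j) * (nrm J x + nrm J y)\<^sup>2" if x: "x : K s" and y: "y : K s" for x y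
 proof -
  have e: "x : extensional J" "y : extensional J" using x y by (auto simp: mem_cube)
  have "\<bar>m x y j - (x j + y j)\<bar> <= c j * (nrm J x + nrm J y)\<^sup>2" if j: "j : J" for j
  proof -
   have "\<bar>f j (pr J x y)\<bar> <= c j * (nrm W (pr J x y))\<^sup>2" using c[OF j] pr_cube[OF x y] by blast
   thus ?thesis using e j by (simp add: f_def sl_pr nrm_pr pr_app del: One_nat_def) (simp add: pr_app)
  qed
  thus ?thesis unfolding nrm_def[of J "%j. m x y j - (x j + y j)"] sum_distrib_right by (rule sum_mono)
 qed
 moreover have "(\<Sum>j\<in>J. c j) >= 0" by (intro sum_nonneg) (use c in auto)
 ultimately show ?thesis using s by blast
qed

text \<open>By \<open>m_quadratic\<close> the map \<open>m x x - 2 x\<close> is of second order at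
  0, so it has an arbitrarily small Lipschitz constant nearby; 1/2 suffices to invert
  squaring.\<close>

lemma double_lipschitz: "\<exists>s. 0 < s & s <= r & (\<forall>x\<in>K s. \<forall>y\<in>K s.
  nrm J (%j. (m x x j - m y y j) - 2 * (x j - y j)) <= 1 / 2 * nrm J (%j. x j - y j))"
proof -
 obtain s C where C: "0 < s" "s <= r" "C >= 0"
  "\<forall>x\<in>K s. \<forall>y\<in>K s. nrm J (%j. m x y j - (x j + y j)) <= C * (nrm J x + nrm J y)\<^sup>2"
  using m_quadratic by blast
 define g where "g x j = m x x j - 2 * x j" for x j
 have g: "Cinf_on J (K r) (%x. g x j)" if "j : J" for j
  unfolding g_def by (intro Cinf_on_diff[OF openK] m_compose(1)[OF openK] Cinf_on_mult[OF openK] Cinf_on_const Cinf_on_coord that) auto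
 have g'0: "pd i (%x. g x j) zr = 0" if i: "i : J" and j: "j : J" for i j
 proof (rule has_partialI(2))
  have z: "\<bar>g (zr(i := t)) j\<bar> <= 4 * C * t\<^sup>2" if t: "\<bar>t\<bar> < s" for t
  proof -
   have zK: "zr(i := t) : K s" using t i C(1) by (auto simp: mem_cube extensional_def)
   have n: "nrm J (zr(i := t)) = \<bar>t\<bar>"
   proof -
    have "nrm J (zr(i := t)) = (\<Sum>l\<in>J. if l = i then \<bar>t\<bar> else 0)" unfolding nrm_def by (intro sum.cong) auto
    thus ?thesis using i fin by simp
   qed
   have "\<bar>m (zr(i := t)) (zr(i := t)) j - ((zr(i := t)) j + (zr(i := t)) j)\<bar> <= C * (\<bar>t\<bar> + \<bar>t\<bar>)\<^sup>2"
    using order_trans[OF coord_le_nrm[OF fin j, of "%j. m (zr(i := t)) (zr(i := t)) j - ((zr(i := t)) j + (zr(i := t)) j)"] bspec[OF bspec[OF C(4) zK] zK]]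
    unfolding n .
   moreover have "(\<bar>t\<bar> + \<bar>t\<bar>)\<^sup>2 = 4 * t\<^sup>2" by (simp add: power2_eq_square)
   ultimately show ?thesis unfolding g_def by (simp only: mult_2)
  qed
  have "((%t. g (zr(i := t)) j) has_real_derivative 0) (at 0)"
  proof (rule deriv_quadratic[OF C(1), where C = "4 * C"])
   fix t assume "\<bar>t - 0\<bar> < s"
   thus "\<bar>g (zr(i := t)) j - g (zr(i := 0)) j - 0 * (t - 0)\<bar> <= 4 * C * (t - 0)\<^sup>2"
    using z[of t] z[of 0] C(1) by simp
  qed
  thus "((%t. g (zr(i := t)) j) has_real_derivative 0) (at (zr i))" using i by simp
 qed
 obtain s' where s': "0 < s'" "s' <= r" "\<forall>x\<in>K s'. \<forall>y\<in>K s'. nrm J (%j. g x j - g y j) <= 1 / 2 * nrm J (%j. x j - y j)"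
  using small_lipschitz[where \<theta> = "1 / 2" and f = g, OF fin r g g'0] by auto
 have "nrm J (%j. (m x x j - m y y j) - 2 * (x j - y j)) = nrm J (%j. g x j - g y j)" for x y
  by (rule nrm_cong) (simp add: g_def)
 thus ?thesis using s' by (intro exI[of _ s']) simp
qed

lemma geo_rearrange: "(2 * (2 / 3)\<^sup>2) ^ n = (2 :: real) ^ n * ((2 / 3) ^ n)\<^sup>2"
 by (simp only: power_mult_distrib power2_eq_square)

text \<open>\<open>L y\<close> is the limit of \<open>2^n\<close> times the \<open>n\<close>-fold
  half of \<open>y\<close>. Convergence rests on the contraction factor 2/3 of halving, and
  additivity on uniqueness of small square roots together with the quadratic error of
  \<open>m\<close>, which is negligible in the limit.\<close>

lemma log_exists: "\<exists>L s C. 0 < s & s <= r & C >= 0 \<and>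
  (\<forall>x\<in>nball J s. \<forall>y\<in>nball J s. nrm J (%j. m x y j - (x j + y j)) <= C * (nrm J x + nrm J y)\<^sup>2) \<and>
  (\<forall>y\<in>nball J s. \<forall>j\<in>J. \<bar>L y j - y j\<bar> <= C * (nrm J y)\<^sup>2) \<and>
  (\<forall>y\<in>nball J s. \<forall>w\<in>nball J s. \<forall>j\<in>J. L (m y w) j = L y j + L w j)"
proof -
 obtain sA C where A: "0 < sA" "sA <= r" "C >= 0"
  "\<forall>x\<in>K sA. \<forall>y\<in>K sA. nrm J (%j. m x y j - (x j + y j)) <= C * (nrm J x + nrm J y)\<^sup>2"
  using m_quadratic by blast
 obtain sB where B: "0 < sB" "sB <= r" "\<forall>x\<in>K sB. \<forall>y\<in>K sB.
   nrm J (%j. (m x x j - m y y j) - 2 * (x j - y j)) <= 1 / 2 * nrm J (%j. x j - y j)"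
  using double_lipschitz by blast
 define s where "s = min sA sB"
 have s: "0 < s" "s <= r" using A B by (auto simp: s_def)
 have sK: "nball J s \<subseteq> K sA" "nball J s \<subseteq> K sB" "nball J s \<subseteq> K r"
  using nball_subset_cube[OF fin, of s] cube_mono[of s sA J "%_. 0"] cube_mono[of s sB J "%_. 0"] cube_mono[OF s(2), of J "%_. 0"]
  by (auto simp: s_def)
 have quad: "nrm J (%j. m x y j - (x j + y j)) <= C * (nrm J x + nrm J y)\<^sup>2" if "x : nball J s" "y : nball J s" for x y
  using A(4) sK(1) that by blast
 have lip: "nrm J (%j. (m x x j - m y y j) - 2 * (x j - y j)) <= 1 / 2 * nrm J (%j. x j - y j)" if "x : nball J s" "y : nball J s" for x y
  using B(3) sK(2) that by blast
 have zB: "zr : nball J s" using s by (simp add: nball_def nrm_def)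
 have m00: "m zr zr = zr" using m_zero(1)[OF zero_K[OF r]] .
 \<comment> \<open>Here 3/2 is 2 - 1/2. It yields uniqueness of square roots and the factor 2/3 by
   which halving contracts.\<close>
 have low: "3 / 2 * nrm J (%j. x j - y j) <= nrm J (%j. m x x j - m y y j)" if "x : nball J s" "y : nball J s" for x y
  using perturbed_lower_bound[OF fin _ lip[OF that]] by simp
 have "\<exists>x. x : nball J s & m x x = y" if y: "y : nball J s" for y
 proof -
  have "\<exists>x\<in>nball J s. \<forall>j\<in>J. m x x j = y j"
  proof (rule perturbed_inverse[OF fin, of 2 "1/2" s "%x. m x x" y])
   show "nrm J y < 2 * s / 2" using y by (simp add: nball_def)
   show "m zr zr j = 0" if "j : J" for j using m00 that by simp
  qed (use lip in auto)
  then obtain x where x: "x : nball J s" "\<forall>j\<in>J. m x x j = y j" by blast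
  have "m x x = y" by (rule extensionalityI[OF m_ext, of y]) (use x y in \<open>auto simp: nball_def\<close>)
  thus ?thesis using x by blast
 qed
 hence "\<forall>y\<in>nball J s. \<exists>x. x : nball J s & m x x = y" by blast
 from bchoice[OF this] obtain h where h: "!!y. y : nball J s ==> h y : nball J s" "!!y. y : nball J s ==> m (h y) (h y) = y"
  by blast
 have uniq: "x = x'" if "x : nball J s" "x' : nball J s" "m x x = m x' x'" for x x'
 proof -
  have "nrm J (%j. x j - x' j) <= 0" using low[OF that(1,2)] that(3) by (simp add: nrm_zero)
  hence "nrm J (%j. x j - x' j) = 0" using nrm_nonneg[of J "%j. x j - x' j"] by linarith
  hence "\<forall>j\<in>J. x j - x' j = 0" by (simp only: nrm_0_iff[OF fin])
  thus ?thesis using that by (intro extensionalityI[of x J x']) (auto simp: nball_def)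
 qed
 have hn: "nrm J (h y) <= 2 / 3 * nrm J y" if y: "y : nball J s" for y
 proof -
  have "3 / 2 * nrm J (%j. h y j - zr j) <= nrm J (%j. m (h y) (h y) j - m zr zr j)"
   by (rule low[OF h(1)[OF y] zB])
  moreover have "nrm J (%j. h y j - zr j) = nrm J (h y)" by (rule nrm_cong) simp
  moreover have "nrm J (%j. m (h y) (h y) j - m zr zr j) = nrm J y" unfolding h(2)[OF y] m00 by (rule nrm_cong) simp
  ultimately show ?thesis by simp
 qed
 \<comment> \<open>The quadratic error of squaring at \<open>h y\<close>; twice the norm of
   \<open>h y\<close> is at most 4/3 of that of \<open>y\<close>, and 16/9 is the square of
   4/3.\<close>
 have h2: "\<bar>2 * h y j - y j\<bar> <= 16 / 9 * C * (nrm J y)\<^sup>2" if y: "y : nball J s" and j: "j : J" for y j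
 proof -
  have "\<bar>y j - (h y j + h y j)\<bar> <= nrm J (%j. m (h y) (h y) j - (h y j + h y j))"
   unfolding h(2)[OF y] by (rule coord_le_nrm[OF fin j])
  also have "\<dots> <= C * (nrm J (h y) + nrm J (h y))\<^sup>2" by (rule quad[OF h(1)[OF y] h(1)[OF y]])
  also have "\<dots> <= C * (4 / 3 * nrm J y)\<^sup>2"
   by (intro mult_left_mono power_mono) (use hn[OF y] nrm_nonneg[of J "h y"] A(3) in auto)
  also have "\<dots> = 16 / 9 * C * (nrm J y)\<^sup>2" by (simp add: power2_eq_square)
  finally show ?thesis by (simp add: abs_minus_commute)
 qed
 define H where "H n y = (h ^^ n) y" for n y
 have H0: "H 0 y = y" and HS: "H (Suc n) y = h (H n y)" for n y by (simp_all add: H_def)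
 have HB: "H n y : nball J s & nrm J (H n y) <= (2 / 3) ^ n * nrm J y" if y: "y : nball J s" for n y
 proof (induction n)
  case 0 thus ?case using y by (simp add: H0)
 next
  case (Suc n)
  thus ?case using h(1)[of "H n y"] hn[of "H n y"] by (auto simp: HS intro: order_trans)
 qed
 \<comment> \<open>After \<open>n\<close> halvings the quadratic error has shrunk by (2/3)^(2n) and
   is magnified by 2^n, a ratio of 8/9 per step. The geometric series contributes (16/9) / (1 - 8/9)
   = 16.\<close>
 have HL: "\<exists>l. (%n. 2 ^ n * H n y j) \<longlonglongrightarrow> l & \<bar>l - y j\<bar> <= 16 * C * (nrm J y)\<^sup>2" if y: "y : nball J s" and j: "j : J" for y j
 proof -
  have "\<bar>2 ^ Suc n * H (Suc n) y j - 2 ^ n * H n y j\<bar> <= (16 / 9 * C * (nrm J y)\<^sup>2) * (8 / 9) ^ n" for n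
  proof -
   have "\<bar>2 ^ Suc n * H (Suc n) y j - 2 ^ n * H n y j\<bar> = 2 ^ n * \<bar>2 * h (H n y) j - H n y j\<bar>"
   proof -
    have "2 ^ Suc n * H (Suc n) y j - 2 ^ n * H n y j = 2 ^ n * (2 * h (H n y) j - H n y j)"
     by (simp add: HS algebra_simps)
    thus ?thesis by (simp add: abs_mult)
   qed
   also have "\<dots> <= 2 ^ n * (16 / 9 * C * (nrm J (H n y))\<^sup>2)" using h2[OF _ j] HB[OF y] by (intro mult_left_mono) auto
   also have "\<dots> <= 2 ^ n * (16 / 9 * C * ((2 / 3) ^ n * nrm J y)\<^sup>2)"
    using HB[OF y, of n] nrm_nonneg[of J "H n y"] A(3) by (intro mult_left_mono power_mono) auto
   also have "\<dots> = (16 / 9 * C * (nrm J y)\<^sup>2) * (2 * (2 / 3)\<^sup>2) ^ n"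
    unfolding geo_rearrange by (simp only: power_mult_distrib mult_ac)
   also have "2 * (2 / 3)\<^sup>2 = (8 / 9 :: real)" by (simp add: power2_eq_square)
   finally show ?thesis .
  qed
  from geometric_convergent[OF this] show ?thesis by (simp add: H0 mult.assoc)
 qed
 define L where "L y j = lim (%n. 2 ^ n * H n y j)" for y j
 have Llb: "(%n. 2 ^ n * H n y j) \<longlonglongrightarrow> L y j & \<bar>L y j - y j\<bar> <= 16 * C * (nrm J y)\<^sup>2"
  if y: "y : nball J s" and j: "j : J" for y j
 proof -
  obtain l where l: "(%n. 2 ^ n * H n y j) \<longlonglongrightarrow> l" "\<bar>l - y j\<bar> <= 16 * C * (nrm J y)\<^sup>2"
   using HL[OF y j] by blast
  have "L y j = l" unfolding L_def by (rule limI[OF l(1)])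
  thus ?thesis using l by simp
 qed
 note Llim = Llb[THEN conjunct1] and Lb = Llb[THEN conjunct2]
 \<comment> \<open>For factors in the ball of radius \<open>t\<close>, the sum a of their norms is
   below 2t, so \<open>C a \<le> 1\<close> and the product has norm at most 2a < 4t \<le> s.\<close>
 define t where "t = min (s / 4) (1 / (2 * C + 1))"
 have t: "0 < t" "4 * t <= s" "2 * t * C <= 1" "t <= s"
 proof -
  show "0 < t" "4 * t <= s" "t <= s" using s A(3) by (auto simp: t_def)
  have "t * (2 * C + 1) <= 1" using A(3) by (simp add: t_def min_def field_simps)
  thus "2 * t * C <= 1" using \<open>0 < t\<close> by (simp add: algebra_simps)
 qed
 have tB: "nball J t \<subseteq> nball J s" using t by (auto simp: nball_def)
 have mB: "m y w : nball J s" if y: "y : nball J t" and w: "w : nball J t" for y w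
 proof -
  define a where "a = nrm J y + nrm J w"
  have a: "0 <= a" "a < 2 * t" using y w nrm_nonneg[of J y] nrm_nonneg[of J w] by (auto simp: a_def nball_def)
  have "nrm J (m y w) <= nrm J (%j. m y w j - (y j + w j)) + nrm J (%j. y j + w j)" by (rule nrm_triangle3) simp
  also have "\<dots> <= C * a\<^sup>2 + a" using add_mono[OF quad[of y w] nrm_triangle[of J y w]] tB y w unfolding a_def by blast
  also have "C * a\<^sup>2 <= a"
  proof -
   have "C * a <= C * (2 * t)" using a A(3) by (intro mult_left_mono) auto
   hence "C * a <= 1" using t(3) by (simp add: mult_ac)
   from mult_right_mono[OF this a(1)] show ?thesis by (simp add: power2_eq_square mult_ac)
  qed
  finally have "nrm J (m y w) < s" using a t by simp
  thus ?thesis using m_ext by (simp add: nball_def)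
 qed
 \<comment> \<open>Both sides are small and have the square \<open>m y w\<close>, by
   \<open>m_sq\<close>; small square roots are unique.\<close>
 have hm: "h (m y w) = m (h y) (h w)" if y: "y : nball J t" and w: "w : nball J t" for y w
 proof -
  have ys: "y : nball J s" "w : nball J s" using y w tB by auto
  have ht: "h y : nball J t" "h w : nball J t"
   using hn[OF ys(1)] hn[OF ys(2)] h(1)[OF ys(1)] h(1)[OF ys(2)] y w nrm_nonneg[of J y] nrm_nonneg[of J w]
   by (auto simp: nball_def)
  have "m (m (h y) (h w)) (m (h y) (h w)) = m (m (h y) (h y)) (m (h w) (h w))"
   using m_sq[of "h y" "h w"] sK(3) ht tB ys mB[OF ht] h(2) by (auto simp: subset_iff)
  also have "\<dots> = m y w" using h(2) ys by simp
  finally have "m (m (h y) (h w)) (m (h y) (h w)) = m (h (m y w)) (h (m y w))" using h(2)[OF mB[OF y w]] by simp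
  thus ?thesis using uniq[OF mB[OF ht] h(1)[OF mB[OF y w]]] by simp
 qed
 have Ht: "H n y : nball J t" if y: "y : nball J t" for y n
 proof -
  have "y : nball J s" using y tB by auto
  note HB[OF this, of n]
  moreover have "(2 / 3) ^ n * nrm J y <= 1 * nrm J y" by (intro mult_right_mono power_le_one nrm_nonneg) auto
  ultimately show ?thesis using y by (auto simp: nball_def)
 qed
 have Hm: "H n (m y w) = m (H n y) (H n w)" if "y : nball J t" "w : nball J t" for y w n
  by (induction n) (simp_all add: H0 HS hm Ht that)
 have "L (m y w) j = L y j + L w j" if y: "y : nball J t" and w: "w : nball J t" and j: "j : J" for y w j
 proof -
  have ys: "y : nball J s" "w : nball J s" using y w tB by auto
  have b: "norm (2 ^ n * H n (m y w) j - (2 ^ n * H n y j + 2 ^ n * H n w j)) <= (C * (nrm J y + nrm J w)\<^sup>2) * (8 / 9) ^ n" for n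
  proof -
   have "norm (2 ^ n * H n (m y w) j - (2 ^ n * H n y j + 2 ^ n * H n w j)) = 2 ^ n * \<bar>m (H n y) (H n w) j - (H n y j + H n w j)\<bar>"
   proof -
    have "2 ^ n * H n (m y w) j - (2 ^ n * H n y j + 2 ^ n * H n w j) = 2 ^ n * (m (H n y) (H n w) j - (H n y j + H n w j))"
     by (simp add: Hm[OF y w] algebra_simps)
    thus ?thesis by (simp add: abs_mult)
   qed
   also have "\<dots> <= 2 ^ n * (C * (nrm J (H n y) + nrm J (H n w))\<^sup>2)"
    using order_trans[OF coord_le_nrm[OF fin j, of "%j. m (H n y) (H n w) j - (H n y j + H n w j)"] quad] HB[OF ys(1)] HB[OF ys(2)]
    by (intro mult_left_mono) auto
   also have "\<dots> <= 2 ^ n * (C * ((2 / 3) ^ n * (nrm J y + nrm J w))\<^sup>2)"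
    using HB[OF ys(1), of n] HB[OF ys(2), of n] nrm_nonneg[of J "H n y"] nrm_nonneg[of J "H n w"] A(3)
    by (intro mult_left_mono power_mono) (auto simp: distrib_left)
   also have "\<dots> = (C * (nrm J y + nrm J w)\<^sup>2) * (2 * (2 / 3)\<^sup>2) ^ n"
    unfolding geo_rearrange by (simp only: power_mult_distrib mult_ac)
   also have "2 * (2 / 3)\<^sup>2 = (8 / 9 :: real)" by (simp add: power2_eq_square)
   finally show ?thesis .
  qed
  have "(%n. (C * (nrm J y + nrm J w)\<^sup>2) * (8 / 9) ^ n) \<longlonglongrightarrow> (C * (nrm J y + nrm J w)\<^sup>2) * 0"
   by (intro tendsto_mult_left LIMSEQ_realpow_zero) auto
  hence "(%n. (C * (nrm J y + nrm J w)\<^sup>2) * (8 / 9) ^ n) \<longlonglongrightarrow> 0" by simp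
  hence l1: "(%n. 2 ^ n * H n (m y w) j - (2 ^ n * H n y j + 2 ^ n * H n w j)) \<longlonglongrightarrow> 0"
   by (rule Lim_null_comparison[rotated]) (rule always_eventually, rule allI, rule b)
  have l2: "(%n. 2 ^ n * H n (m y w) j - (2 ^ n * H n y j + 2 ^ n * H n w j)) \<longlonglongrightarrow> L (m y w) j - (L y j + L w j)"
   by (intro tendsto_diff tendsto_add Llim mB[OF y w] ys j)
  show ?thesis using LIMSEQ_unique[OF l1 l2] by simp
 qed
 hence c3: "\<forall>y\<in>nball J t. \<forall>w\<in>nball J t. \<forall>j\<in>J. L (m y w) j = L y j + L w j" by blast
 have c1: "\<forall>x\<in>nball J t. \<forall>y\<in>nball J t. nrm J (%j. m x y j - (x j + y j)) <= 16 * C * (nrm J x + nrm J y)\<^sup>2"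
 proof (intro ballI)
  fix x y assume "x : nball J t" "y : nball J t"
  hence "nrm J (%j. m x y j - (x j + y j)) <= C * (nrm J x + nrm J y)\<^sup>2" using quad tB by blast
  also have "\<dots> <= 16 * C * (nrm J x + nrm J y)\<^sup>2" using A(3) by (intro mult_right_mono) auto
  finally show "nrm J (%j. m x y j - (x j + y j)) <= 16 * C * (nrm J x + nrm J y)\<^sup>2" .
 qed
 have c2: "\<forall>y\<in>nball J t. \<forall>j\<in>J. \<bar>L y j - y j\<bar> <= 16 * C * (nrm J y)\<^sup>2" using Lb tB by blast
 show ?thesis
  by (rule exI[of _ L], rule exI[of _ t], rule exI[of _ "16 * C"])
   (intro conjI c1 c2 c3 t(1), use t s A in auto)
qed

text \<open>No regularity of \<open>L\<close> is assumed. From \<open>L u = L x + L (q x u)\<close>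
  and L z = z + O(|z|^2), the partials of \<open>L\<close> at \<open>x\<close> are those of
  \<open>q x\<close> at \<open>x\<close>, and these depend smoothly on \<open>x\<close>.\<close>

lemma log_Cinf:
 assumes s: "0 < s" "s <= r" and Lb: "!!y j. y : nball J s ==> j : J ==> \<bar>L y j - y j\<bar> <= C * (nrm J y)\<^sup>2"
  and Lm: "!!y w j. y : nball J s ==> w : nball J s ==> j : J ==> L (m y w) j = L y j + L w j" and j: "j : J"
 shows "Cinf_on J (nball J s) (%x. L x j)"
proof -
 let ?B = "nball J s"
 have BK: "?B \<subseteq> K r" using nball_subset_cube[OF fin, of s] cube_mono[OF s(2), of J "%_. 0"] by blast
 have oB: "openin (RR J) ?B" by (rule openin_nball[OF fin])
 have Bext: "extensional J \<inter> ?B = ?B" by (auto simp: nball_def)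
 have zB: "zr : ?B" using s by (simp add: nball_def nrm_def)
 have qx: "Cinf_on J ?B (%u. q x u l)" if "x : ?B" "l : J" for x l
  by (rule m_compose(2)[OF oB]) (use that BK in \<open>auto intro: Cinf_on_const Cinf_on_coord\<close>)
 define V where "V x = {u : ?B. q x u : ?B}" for x
 have oV: "openin (RR J) (V x)" if x: "x : ?B" for x
 proof -
  have "continuous_map (subtopology (RR J) ?B) (subtopology (RR J) (extensional J)) (q x)"
   by (rule continuous_map_Cinf_coords[OF oB _ _ qx[OF x]]) (use q_ext in auto)
  hence "continuous_map (subtopology (RR J) ?B) (RR J) (q x)"
   by (simp add: continuous_map_in_subtopology)
  from openin_continuous_map_preimage[OF this oB] have "openin (RR J) {u : topspace (subtopology (RR J) ?B). q x u : ?B}"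
   using oB by (simp add: openin_open_subtopology)
  moreover have "{u : topspace (subtopology (RR J) ?B). q x u : ?B} = V x" by (auto simp: V_def nball_def)
  ultimately show ?thesis by simp
 qed
 have xV: "x : V x" if x: "x : ?B" for x using x BK q_self zB by (auto simp: V_def subset_iff)
 have LV: "L u j = L x j + L (q x u) j" if "x : ?B" "u : V x" for x u
 proof -
  have "m x (q x u) = u" using m_q[of x u] that BK by (auto simp: V_def subset_iff)
  thus ?thesis using Lm[of x "q x u" j] that j by (auto simp: V_def)
 qed
 have Lq: "\<bar>L u j - L x j - q x u j\<bar> <= C * (nrm J (q x u))\<^sup>2" if "x : ?B" "u : V x" for x u
  using LV[OF that] Lb[of "q x u" j] that j by (auto simp: V_def)
 have cont: "continuous_on ?B (%x. L x j)" unfolding continuous_on_def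
 proof
  fix x assume x: "x : ?B"
  have qc: "((%u. q x u l) \<longlongrightarrow> 0) (at x within ?B)" if "l : J" for l
  proof -
   have "continuous_on ?B (%u. q x u l)" using Cinf_on_cont[OF qx[OF x that]] unfolding Bext .
   hence "((%u. q x u l) \<longlongrightarrow> q x x l) (at x within ?B)" using x by (simp add: continuous_on_def)
   thus ?thesis using q_self[of x] x BK that by auto
  qed
  have n0: "((%u. nrm J (q x u)) \<longlongrightarrow> 0) (at x within ?B)"
  proof -
   have "((%u. \<Sum>l\<in>J. \<bar>q x u l\<bar>) \<longlongrightarrow> (\<Sum>l\<in>J. \<bar>0\<bar>)) (at x within ?B)"
    by (intro tendsto_sum tendsto_rabs qc)
   thus ?thesis by (simp add: nrm_def)
  qed
  have "((%u. C * (nrm J (q x u))\<^sup>2 + \<bar>q x u j\<bar>) \<longlongrightarrow> C * 0\<^sup>2 + \<bar>0\<bar>) (at x within ?B)"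
   by (intro tendsto_add tendsto_mult_left tendsto_power n0 tendsto_rabs qc j)
  hence lim: "((%u. C * (nrm J (q x u))\<^sup>2 + \<bar>q x u j\<bar>) \<longlongrightarrow> 0) (at x within ?B)" by simp
  have "((%u. L u j - L x j) \<longlongrightarrow> 0) (at x within ?B)"
  proof (rule Lim_null_comparison[OF _ lim])
   obtain T where T: "open T" "V x = extensional J \<inter> T"
    using oV[OF x] unfolding powertop_real_eq_top_of_set openin_open by auto
   show "\<forall>\<^sub>F u in at x within ?B. norm (L u j - L x j) <= C * (nrm J (q x u))\<^sup>2 + \<bar>q x u j\<bar>"
    unfolding eventually_at_topological
   proof (intro exI[of _ T] conjI ballI impI T(1))
    show "x : T" using xV[OF x] T by auto
    fix u assume "u : T" "u : ?B"
    hence "u : V x" using T by (auto simp: nball_def)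
    from Lq[OF x this] show "norm (L u j - L x j) <= C * (nrm J (q x u))\<^sup>2 + \<bar>q x u j\<bar>" by simp
   qed
  qed
  thus "((%x. L x j) \<longlongrightarrow> L x j) (at x within ?B)" by (simp add: LIM_zero_iff)
 qed
 \<comment> \<open>The derivative of \<open>q\<close> in its second vector, on the diagonal: the
   candidate for \<open>pd i L\<close>, already known to be smooth.\<close>
 define d where "d i x = pd (1, i) (%p. q (sl J 0 p) (sl J 1 p) j) (pr J x x)" for i x
 have D: "((%t. L (x(i := t)) j) has_real_derivative d i x) (at (x i))" if x: "x : ?B" and i: "i : J" for x i
 proof -
  have xe: "x : extensional J" using x by (simp add: nball_def)
  have xK: "x : K r" using x BK by auto
  define ph where "ph l t = q x (x(i := t)) l" for l t
  have phD: "(ph l has_real_derivative pd (1, i) (%p. q (sl J 0 p) (sl J 1 p) l) (pr J x x)) (at (x i))" if l: "l : J" for l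
  proof -
   have "has_partial (1, i) (%p. q (sl J 0 p) (sl J 1 p) l) (pr J x x)"
    by (rule Cinf_on_has_partial[OF q_smooth[OF l] _ pr_cube[OF xK xK]]) (use i in auto)
   from has_partialD[OF this]
   have "((%t. q (sl J 0 (pr J x (x(i := t)))) (sl J 1 (pr J x (x(i := t)))) l) has_real_derivative
     pd (1, i) (%p. q (sl J 0 p) (sl J 1 p) l) (pr J x x)) (at (pr J x x (1, i)))"
    unfolding pr_upd(2)[OF i] .
   moreover have "pr J x x (1, i) = x i" using i by (simp add: pr_app)
   ultimately show ?thesis using xe fun_upd_extensional[OF xe i] unfolding ph_def by (simp only: sl_pr)
  qed
  have ph0: "ph l (x i) = 0" if "l : J" for l using q_self[OF xK] that by (simp add: ph_def)
  have ratio: "((%t. ph l t / (t - x i)) \<longlongrightarrow> pd (1, i) (%p. q (sl J 0 p) (sl J 1 p) l) (pr J x x)) (at (x i))" if "l : J" for l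
   using phD[OF that] ph0[OF that] by (simp add: has_field_derivative_iff)
  have "((%t. C * ((\<Sum>l\<in>J. \<bar>ph l t / (t - x i)\<bar>)\<^sup>2 * \<bar>t - x i\<bar>)) \<longlongrightarrow>
    C * ((\<Sum>l\<in>J. \<bar>partial_deriv (1, i) (%p. q (sl J 0 p) (sl J 1 p) l) (pr J x x)\<bar>)\<^sup>2 * \<bar>x i - x i\<bar>)) (at (x i))"
   by (intro tendsto_mult_left tendsto_mult tendsto_power tendsto_sum tendsto_rabs ratio tendsto_diff tendsto_ident_at tendsto_const)
  hence lim: "((%t. C * ((\<Sum>l\<in>J. \<bar>ph l t / (t - x i)\<bar>)\<^sup>2 * \<bar>t - x i\<bar>)) \<longlongrightarrow> 0) (at (x i))" by simp
  have "((%t. (L (x(i := t)) j - L x j) / (t - x i) - ph j t / (t - x i)) \<longlongrightarrow> 0) (at (x i))"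
  proof (rule Lim_null_comparison[OF _ lim])
   have ev: "\<forall>\<^sub>F t in at (x i). x(i := t) : V x"
    using eventually_line_in[OF oV[OF x] i xV[OF x]] by (simp add: eventually_nhds_conv_at)
   have ne: "\<forall>\<^sub>F t in at (x i). t ~= x i" by (simp add: eventually_at_filter)
   show "\<forall>\<^sub>F t in at (x i). norm ((L (x(i := t)) j - L x j) / (t - x i) - ph j t / (t - x i)) <= C * ((\<Sum>l\<in>J. \<bar>ph l t / (t - x i)\<bar>)\<^sup>2 * \<bar>t - x i\<bar>)"
    using ev ne
   proof eventually_elim
    case (elim t)
    have "\<bar>L (x(i := t)) j - L x j - ph j t\<bar> <= C * (nrm J (q x (x(i := t))))\<^sup>2"
     using Lq[OF x elim(1)] by (simp add: ph_def)
    moreover have "nrm J (q x (x(i := t))) = (\<Sum>l\<in>J. \<bar>ph l t / (t - x i)\<bar>) * \<bar>t - x i\<bar>"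
     unfolding nrm_def sum_distrib_right ph_def[symmetric] by (intro sum.cong) (use elim(2) in \<open>auto simp: abs_divide\<close>)
    ultimately have "\<bar>L (x(i := t)) j - L x j - ph j t\<bar> <= (C * ((\<Sum>l\<in>J. \<bar>ph l t / (t - x i)\<bar>)\<^sup>2 * \<bar>t - x i\<bar>)) * \<bar>t - x i\<bar>"
     by (simp add: power2_eq_square mult_ac)
    thus ?case using elim(2) by (simp add: diff_divide_distrib[symmetric] abs_divide divide_le_eq)
   qed
  qed
  from tendsto_add[OF this ratio[OF j]]
  show ?thesis by (simp add: has_field_derivative_iff d_def)
 qed
 have dC: "Cinf_on J ?B (d i)" if i: "i : J" for i
  unfolding d_def by (rule coords_compose[OF Cinf_on_partial[OF q_smooth[OF j]] oB])
   (use i BK Cinf_on_coord in auto)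
 have "C_on k J ?B (%x. L x j)" for k
 proof (cases k)
  case 0
  thus ?thesis using cont by (simp add: C_on_0_iff Bext)
 next
  case (Suc n)
  have hp: "has_partial i (%x. L x j) x" "pd i (%x. L x j) x = d i x" if "i : J" "x : ?B" for i x
   by (rule has_partialI[OF D[OF that(2,1)]])+
  have "C_on n J ?B (pd i (%x. L x j))" if i: "i : J" for i
   using C_on_cong[OF oB, of "pd i (%x. L x j)" "d i" n] hp(2)[OF i] dC[OF i]
   by (simp add: Cinf_on_def)
  thus ?thesis unfolding Suc C_on_Suc_iff using cont hp(1) by (simp add: Bext)
 qed
 thus ?thesis by (simp add: Cinf_on_def)
qed

text \<open>\<open>L\<close> is a small Lipschitz perturbation of the identity, so it has a local
  inverse \<open>e\<close> that turns sums into products. Smoothness of \<open>e\<close> follows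
  from this homomorphism property, without an inverse function theorem for higher
  derivatives.\<close>

theorem local_log: "\<exists>L e s ro. 0 < s & s <= r & 0 < ro \<and>
  (\<forall>j\<in>J. Cinf_on J (nball J s) (%x. L x j)) & (\<forall>j\<in>J. Cinf_on J (nball J ro) (%v. e v j)) \<and>
  (\<forall>v\<in>nball J ro. e v : nball J s & (\<forall>j\<in>J. L (e v) j = v j)) \<and>
  (\<forall>x\<in>nball J s. \<forall>v\<in>nball J ro. (\<forall>j\<in>J. L x j = v j) --> x = e v) \<and>
  (\<forall>v\<in>nball J ro. \<forall>w\<in>nball J ro. (\<lambda>j\<in>J. v j + w j) : nball J ro --> m (e v) (e w) = e (\<lambda>j\<in>J. v j + w j)) \<and>
  e zr = zr"
proof -
 obtain L s0 C where s0: "0 < s0" "s0 <= r" "C >= 0"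
  and mq: "\<forall>x\<in>nball J s0. \<forall>y\<in>nball J s0. nrm J (%j. m x y j - (x j + y j)) <= C * (nrm J x + nrm J y)\<^sup>2"
  and Lb: "\<forall>y\<in>nball J s0. \<forall>j\<in>J. \<bar>L y j - y j\<bar> <= C * (nrm J y)\<^sup>2"
  and Lm: "\<forall>y\<in>nball J s0. \<forall>w\<in>nball J s0. \<forall>j\<in>J. L (m y w) j = L y j + L w j"
  using log_exists by blast
 have LC: "Cinf_on J (nball J s0) (%x. L x j)" if "j : J" for j
  by (rule log_Cinf[OF s0(1,2) _ _ that]) (use Lb Lm in blast)+
 define r1 where "r1 = s0 / (real (card J) + 1)"
 have r1: "r1 > 0" "K r1 \<subseteq> nball J s0" using s0(1) cube_subset_nball[OF fin s0(1)] by (auto simp: r1_def)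
 define g where "g x j = L x j - x j" for x j
 have gC: "Cinf_on J (K r1) (%x. g x j)" if "j : J" for j
  unfolding g_def by (intro Cinf_on_diff[OF openK] Cinf_on_subset[OF LC[OF that] r1(2)] Cinf_on_coord)
 have nz: "nrm J (zr(i := t)) = \<bar>t\<bar>" if "i : J" for i t
 proof -
  have "nrm J (zr(i := t)) = (\<Sum>l\<in>J. if l = i then \<bar>t\<bar> else 0)" unfolding nrm_def by (intro sum.cong) auto
  thus ?thesis using that fin by simp
 qed
 have g'0: "pd i (%x. g x j) zr = 0" if i: "i : J" and j: "j : J" for i j
 proof (rule has_partialI(2))
  have z: "\<bar>g (zr(i := t)) j\<bar> <= C * t\<^sup>2" if t: "\<bar>t\<bar> < s0" for t
  proof -
   have "zr(i := t) : nball J s0" using t i nz[OF i] by (auto simp: nball_def intro: fun_upd_extensional)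
   hence "\<bar>L (zr(i := t)) j - (zr(i := t)) j\<bar> <= C * (nrm J (zr(i := t)))\<^sup>2" using Lb j by blast
   thus ?thesis unfolding nz[OF i] g_def by simp
  qed
  have "((%t. g (zr(i := t)) j) has_real_derivative 0) (at 0)"
  proof (rule deriv_quadratic[OF s0(1), where C = C])
   fix t :: real assume "\<bar>t - 0\<bar> < s0"
   hence tr: "\<bar>t\<bar> < s0" "\<bar>0::real\<bar> < s0" using s0 by simp_all
   show "\<bar>g (zr(i := t)) j - g (zr(i := 0)) j - 0 * (t - 0)\<bar> <= C * (t - 0)\<^sup>2"
    using z[OF tr(1)] z[OF tr(2)] by (simp del: fun_upd_apply)
  qed
  thus "((%t. g (zr(i := t)) j) has_real_derivative 0) (at (zr i))" using i by simp
 qed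
 obtain s1 where s1: "0 < s1" "s1 <= r1" "\<forall>x\<in>K s1. \<forall>y\<in>K s1. nrm J (%j. g x j - g y j) <= 1 / 2 * nrm J (%j. x j - y j)"
  using small_lipschitz[where \<theta> = "1 / 2" and f = g, OF fin r1(1) gC g'0] by auto
 define s where "s = min s1 s0"
 have s: "0 < s" "s <= r" "s <= s0" using s0 s1 by (auto simp: s_def)
 have sK: "nball J s \<subseteq> K s1" "nball J s \<subseteq> nball J s0" "nball J s \<subseteq> K r"
  using nball_subset_cube[OF fin, of s] cube_mono[of s s1 J "%_. 0"] cube_mono[OF s(2), of J "%_. 0"]
  by (auto simp: s_def nball_def)
 have lip: "nrm J (%j. (L x j - L y j) - 1 * (x j - y j)) <= 1 / 2 * nrm J (%j. x j - y j)" if "x : nball J s" "y : nball J s" for x y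
 proof -
  have "nrm J (%j. (L x j - L y j) - 1 * (x j - y j)) = nrm J (%j. g x j - g y j)" by (rule nrm_cong) (simp add: g_def)
  moreover have "nrm J (%j. g x j - g y j) <= 1 / 2 * nrm J (%j. x j - y j)" using s1(3) sK(1) that by blast
  ultimately show ?thesis by simp
 qed
 have low: "nrm J (%j. x j - y j) <= 2 * nrm J (%j. L x j - L y j)" if "x : nball J s" "y : nball J s" for x y
  using perturbed_lower_bound[OF fin _ lip[OF that]] by simp
 have zB: "zr : nball J s" using s by (simp add: nball_def nrm_def)
 have L0: "L zr j = 0" if "j : J" for j
 proof -
  have "nrm J zr = 0" by (simp add: nrm_def)
  hence "\<bar>L zr j - zr j\<bar> <= C * 0\<^sup>2" using Lb zB sK(2) that by (metis subsetD)
  thus ?thesis using that by simp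
 qed
 have inj: "x = y" if "x : nball J s" "y : nball J s" "!!j. j : J ==> L x j = L y j" for x y
 proof -
  have "nrm J (%j. L x j - L y j) = nrm J (%j. 0)" by (rule nrm_cong) (use that(3) in simp)
  hence "nrm J (%j. x j - y j) <= 0" using low[OF that(1,2)] by (simp add: nrm_zero)
  hence "nrm J (%j. x j - y j) = 0" using nrm_nonneg[of J "%j. x j - y j"] by linarith
  hence "\<forall>j\<in>J. x j - y j = 0" by (simp only: nrm_0_iff[OF fin])
  thus ?thesis using that by (intro extensionalityI[of x J y]) (auto simp: nball_def)
 qed
 have "\<exists>x. x : nball J s & (\<forall>j\<in>J. L x j = v j)" if v: "v : nball J (s / 2)" for v
 proof -
  have "\<exists>x\<in>nball J s. \<forall>j\<in>J. L x j = v j"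
   by (rule perturbed_inverse[OF fin, of 1 "1/2" s L v]) (use lip L0 v in \<open>auto simp: nball_def\<close>)
  thus ?thesis by blast
 qed
 hence "\<forall>v\<in>nball J (s / 2). \<exists>x. x : nball J s & (\<forall>j\<in>J. L x j = v j)" by blast
 from bchoice[OF this] obtain e where e: "!!v. v : nball J (s / 2) ==> e v : nball J s"
  "!!v j. v : nball J (s / 2) ==> j : J ==> L (e v) j = v j" by blast
 have zB2: "zr : nball J (s / 2)" using s by (simp add: nball_def nrm_def)
 have e0: "e zr = zr" by (rule inj[OF e(1)[OF zB2] zB]) (use e(2)[OF zB2] L0 in simp)
 have elip: "nrm J (%j. e v j - e w j) <= 2 * nrm J (%j. v j - w j)" if "v : nball J (s / 2)" "w : nball J (s / 2)" for v w
 proof -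
  have "nrm J (%j. L (e v) j - L (e w) j) = nrm J (%j. v j - w j)" by (rule nrm_cong) (use e(2) that in simp)
  thus ?thesis using low[OF e(1)[OF that(1)] e(1)[OF that(2)]] by simp
 qed
 have en: "nrm J (e v) <= 2 * nrm J v" if v: "v : nball J (s / 2)" for v
 proof -
  have "nrm J (%j. e v j - e zr j) = nrm J (e v)" "nrm J (%j. v j - zr j) = nrm J v"
   unfolding e0 by (rule nrm_cong, simp)+
  thus ?thesis using elip[OF v zB2] by simp
 qed
 have e2: "\<bar>e v j - v j\<bar> <= 4 * C * (nrm J v)\<^sup>2" if v: "v : nball J (s / 2)" and j: "j : J" for v j
 proof -
  have "e v : nball J s0" using e(1)[OF v] sK(2) by blast
  hence "\<bar>L (e v) j - e v j\<bar> <= C * (nrm J (e v))\<^sup>2" using Lb j by blast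
  also have "\<dots> <= C * (2 * nrm J v)\<^sup>2" using en[OF v] s0(3) nrm_nonneg[of J "e v"] by (intro mult_left_mono power_mono) auto
  finally show ?thesis using e(2)[OF v j] by (simp add: power2_eq_square abs_minus_commute mult_ac)
 qed
 \<comment> \<open>If v and w have norm below \<open>ro\<close>, then e v and e w have total norm a
   < 4 ro by \<open>en\<close>, so \<open>C a \<le> 1\<close> and their product has norm at most 2a
   < 8 ro \<le> s.\<close>
 define ro where "ro = min (s / 8) (1 / (4 * C + 1))"
 have ro: "0 < ro" "8 * ro <= s" "4 * ro * C <= 1"
 proof -
  show "0 < ro" "8 * ro <= s" using s s0(3) by (auto simp: ro_def)
  have "ro * (4 * C + 1) <= 1" using s0(3) by (simp add: ro_def min_def field_simps)
  thus "4 * ro * C <= 1" using \<open>0 < ro\<close> by (simp add: algebra_simps)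
 qed
 have roB: "nball J ro \<subseteq> nball J (s / 2)" using ro by (auto simp: nball_def)
 have add: "m (e v) (e w) = e (\<lambda>j\<in>J. v j + w j)"
  if v: "v : nball J ro" and w: "w : nball J ro" for v w
 proof -
  have vs: "v : nball J (s / 2)" "w : nball J (s / 2)" using v w roB by auto
  have vw: "(\<lambda>j\<in>J. v j + w j) : nball J (s / 2)"
  proof -
   have "nrm J (\<lambda>j\<in>J. v j + w j) <= nrm J v + nrm J w" by (rule nrm_triangle3) simp
   thus ?thesis using v w ro by (simp add: nball_def)
  qed
  define a where "a = nrm J (e v) + nrm J (e w)"
  have a: "0 <= a" "a < 4 * ro" using en[OF vs(1)] en[OF vs(2)] v w nrm_nonneg[of J "e v"] nrm_nonneg[of J "e w"] by (auto simp: a_def nball_def)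
  have "nrm J (m (e v) (e w)) <= nrm J (%j. m (e v) (e w) j - (e v j + e w j)) + nrm J (%j. e v j + e w j)" by (rule nrm_triangle3) simp
  also have "\<dots> <= C * a\<^sup>2 + a" using mq e(1)[OF vs(1)] e(1)[OF vs(2)] sK(2) nrm_triangle[of J "e v" "e w"]
   by (intro add_mono) (auto simp: a_def)
  also have "C * a\<^sup>2 <= a"
  proof -
   have "C * a <= C * (4 * ro)" using a s0(3) by (intro mult_left_mono) auto
   hence "C * a <= 1" using ro(3) by (simp add: mult_ac)
   from mult_right_mono[OF this a(1)] show ?thesis by (simp add: power2_eq_square mult_ac)
  qed
  finally have "nrm J (m (e v) (e w)) < s" using a ro by simp
  hence mB: "m (e v) (e w) : nball J s" using m_ext by (simp add: nball_def)
  show ?thesis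
  proof (rule inj[OF mB e(1)[OF vw]])
   fix j assume j: "j : J"
   have "e v : nball J s0" "e w : nball J s0" using e(1) vs sK(2) by auto
   thus "L (m (e v) (e w)) j = L (e (\<lambda>j\<in>J. v j + w j)) j" using Lm j e(2)[OF vw j] e(2)[OF vs(1) j] e(2)[OF vs(2) j] by simp
  qed
 qed
 have oro: "openin (RR J) (nball J ro)" by (rule openin_nball[OF fin])
 have roext: "extensional J \<inter> nball J ro = nball J ro" by (auto simp: nball_def)
 have econt: "continuous_on (nball J ro) (%v. e v j)" if j: "j : J" for j
  unfolding continuous_on_def
 proof
  fix v assume v: "v : nball J ro"
  have c: "((%w. w l) \<longlongrightarrow> v l) (at v within nball J ro)" for l
   using continuous_on_subset[OF continuous_on_product_coordinates[of l], of "nball J ro"] v by (auto simp: continuous_on_def)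
  have "((%w. 2 * (\<Sum>l\<in>J. \<bar>w l - v l\<bar>)) \<longlongrightarrow> 2 * (\<Sum>l\<in>J. \<bar>v l - v l\<bar>)) (at v within nball J ro)"
   by (intro tendsto_mult_left tendsto_sum tendsto_rabs tendsto_diff c tendsto_const)
  hence lim: "((%w. 2 * nrm J (%l. w l - v l)) \<longlongrightarrow> 0) (at v within nball J ro)" by (simp add: nrm_def)
  have "((%w. e w j - e v j) \<longlongrightarrow> 0) (at v within nball J ro)"
  proof (rule Lim_null_comparison[OF _ lim])
   show "\<forall>\<^sub>F w in at v within nball J ro. norm (e w j - e v j) <= 2 * nrm J (%l. w l - v l)"
    unfolding eventually_at_topological
   proof (intro exI[of _ UNIV] conjI ballI impI)
    fix w assume w: "w : nball J ro"
    show "norm (e w j - e v j) <= 2 * nrm J (%l. w l - v l)"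
     using order_trans[OF coord_le_nrm[OF fin j, of "%j. e w j - e v j"] elip[of w v]] v w roB by auto
   qed auto
  qed
  thus "((%v. e v j) \<longlongrightarrow> e v j) (at v within nball J ro)" by (simp add: LIM_zero_iff)
 qed
 define M where "M j = (%p. m (sl J 0 p) (sl J 1 p) j)" for j
 have MC: "Cinf_on W (KW r) (M j)" if "j : J" for j unfolding M_def by (rule m_smooth[OF that])
 have eK: "e v : K r" if "v : nball J ro" for v using e(1) roB sK(3) that by blast
 have eext: "e v : extensional J" if "v : nball J (s / 2)" for v using e(1)[OF that] by (simp add: nball_def)
 \<comment> \<open>Since e(v + w) = m (e v) (e w) and e w = w + O(|w|^2), a step along axis
   \<open>i\<close> from \<open>v\<close> is seen by \<open>m\<close> as a step of its second
   argument from 0.\<close>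
 have D: "((%t. e (v(i := t)) j) has_real_derivative pd (1, i) (M j) (pr J (e v) zr)) (at (v i))"
  if v: "v : nball J ro" and i: "i : J" and j: "j : J" for v i j
 proof -
  have vext: "v : extensional J" using v by (simp add: nball_def)
  define w where "w t = zr(i := t - v i)" for t
  have wn: "nrm J (w t) = \<bar>t - v i\<bar>" for t unfolding w_def by (rule nz[OF i])
  have wext: "w t : extensional J" for t unfolding w_def by (rule fun_upd_extensional[OF zero_ext i])
  have wB: "w t : nball J ro" if "\<bar>t - v i\<bar> < ro" for t using that wn wext by (simp add: nball_def)
  have w0: "w (v i) = zr" using i by (auto simp: w_def)
  define c where "c t = pr J (e v) (e (w t))" for t
  have c0: "c (v i) = pr J (e v) zr" by (simp add: c_def w0 e0)
  have "((%t. M j (c t)) has_real_derivative (\<Sum>kp\<in>W. pd kp (M j) (c (v i)) * (if kp = (1, i) then 1 else 0))) (at (v i))"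
  proof (rule total_derivative_extensional[OF finW openKW])
   show "C_on 1 W (KW r) (M j)" using MC[OF j] by (simp add: Cinf_on_def)
   show "c (v i) : KW r" unfolding c0 by (rule pr_cube[OF eK[OF v] zero_K[OF r]])
   show "c t : extensional W" for t unfolding c_def by (rule pr_ext)
   fix kp assume "kp : W"
   then obtain k l where k: "kp = (k, l)" "k < 2" "l : J" by auto
   show "((%t. c t kp) has_real_derivative (if kp = (1, i) then 1 else 0)) (at (v i))"
   proof (cases "k = 0")
    case True
    thus ?thesis using k by (simp add: c_def pr_app)
   next
    case False
    hence k1: "k = 1" using k by simp
    have ct: "c t kp = e (w t) l" for t using k k1 by (simp add: c_def pr_app)
    have "((%t. e (w t) l) has_real_derivative (if l = i then 1 else 0)) (at (v i))"
    proof (rule deriv_quadratic[OF ro(1), where C = "4 * C"])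
     fix t assume t: "\<bar>t - v i\<bar> < ro"
     have "\<bar>e (w t) l - w t l\<bar> <= 4 * C * (nrm J (w t))\<^sup>2" by (rule e2[OF _ k(3)]) (use wB[OF t] roB in blast)
     moreover have "w t l = (if l = i then 1 else 0) * (t - v i)" using k(3) by (auto simp: w_def)
     moreover have "e (w (v i)) l = 0" using k(3) by (simp add: w0 e0)
     ultimately show "\<bar>e (w t) l - e (w (v i)) l - (if l = i then 1 else 0) * (t - v i)\<bar> <= 4 * C * (t - v i)\<^sup>2"
      unfolding wn by simp
    qed
    thus ?thesis unfolding ct using k k1 by simp
   qed
  qed
  moreover have "(\<Sum>kp\<in>W. pd kp (M j) (c (v i)) * (if kp = (1, i) then 1 else 0)) = pd (1, i) (M j) (pr J (e v) zr)"
   unfolding c0 using i finW by (subst sum.remove[of _ "(1, i)"]) (auto intro!: sum.neutral)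
  ultimately have MD: "((%t. M j (c t)) has_real_derivative pd (1, i) (M j) (pr J (e v) zr)) (at (v i))" by simp
  have "\<forall>\<^sub>F t in nhds (v i). t : ball (v i) ro" by (rule eventually_nhds_in_open) (use ro in auto)
  hence "\<forall>\<^sub>F t in nhds (v i). M j (c t) = e (v(i := t)) j"
  proof eventually_elim
   case (elim t)
   hence t: "\<bar>t - v i\<bar> < ro" by (simp add: dist_real_def abs_minus_commute)
   have "(\<lambda>j\<in>J. v j + w t j) = v(i := t)" using vext i by (auto simp: w_def fun_eq_iff extensional_def)
   hence "m (e v) (e (w t)) = e (v(i := t))" using add[OF v wB[OF t]] by simp
   thus ?case using eext[of v] eext[of "w t"] v wB[OF t] roB
    by (simp add: M_def c_def sl_pr subset_iff del: One_nat_def fun_upd_apply)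
  qed
  thus ?thesis using MD by (subst (asm) DERIV_cong_ev[OF refl _ refl]) auto
 qed
 \<comment> \<open>Bootstrapping: the partials of \<open>e\<close> are a smooth function of
   \<open>e\<close> itself, so class C^k gives class C^(k+1).\<close>
 have eC: "C_on k J (nball J ro) (%v. e v j)" if "j : J" for k j
  using that
 proof (induction k arbitrary: j)
  case 0
  thus ?case using econt by (simp add: C_on_0_iff roext)
 next
  case (Suc k)
  have hp: "has_partial i (%v. e v j) v" "pd i (%v. e v j) v = pd (1, i) (M j) (pr J (e v) zr)"
   if "i : J" "v : nball J ro" for i v
   by (rule has_partialI[OF D[OF that(2,1) Suc.prems]])+
  have "C_on k J (nball J ro) (pd i (%v. e v j))" if i: "i : J" for i
  proof -
   have "C_on k J (nball J ro) (%v. pd (1, i) (M j) (pr J (e v) zr))"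
   proof (rule C_on_compose[OF finW oro openKW, where u = "%v. pr J (e v) zr" and g = "pd (1, i) (M j)"])
    show "(%v. pr J (e v) zr) ` nball J ro \<subseteq> KW r" using pr_cube[OF eK zero_K[OF r]] by blast
    show "C_on k W (KW r) (pd (1, i) (M j))"
     using Cinf_on_partial[OF MC[OF Suc.prems], of "(1, i)"] i by (simp add: Cinf_on_def)
    fix kp assume "kp : W"
    then obtain a l where a: "kp = (a, l)" "a < 2" "l : J" by auto
    show "C_on k J (nball J ro) (%v. pr J (e v) zr kp)"
     using Suc.IH[OF a(3)] a by (cases "a = 0") (auto simp: pr_def C_on_const)
   qed
   thus ?thesis using C_on_cong[OF oro, of "pd i (%v. e v j)"] hp(2)[OF i] by simp
  qed
  thus ?case unfolding C_on_Suc_iff using econt[OF Suc.prems] hp(1) by (simp add: roext)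
 qed
 have c1: "\<forall>j\<in>J. Cinf_on J (nball J s) (%x. L x j)" using Cinf_on_subset[OF LC sK(2)] by blast
 have c2: "\<forall>j\<in>J. Cinf_on J (nball J ro) (%v. e v j)" using eC by (simp add: Cinf_on_def)
 have c3: "\<forall>v\<in>nball J ro. e v : nball J s & (\<forall>j\<in>J. L (e v) j = v j)" using e roB by blast
 have c4: "\<forall>x\<in>nball J s. \<forall>v\<in>nball J ro. (\<forall>j\<in>J. L x j = v j) --> x = e v"
 proof (intro ballI impI)
  fix x v assume x: "x : nball J s" and v: "v : nball J ro" and l: "\<forall>j\<in>J. L x j = v j"
  have "v : nball J (s / 2)" using v roB by blast
  thus "x = e v" using inj[OF x e(1)] e(2) l by simp
 qed
 have c5: "\<forall>v\<in>nball J ro. \<forall>w\<in>nball J ro. (\<lambda>j\<in>J. v j + w j) : nball J ro --> m (e v) (e w) = e (\<lambda>j\<in>J. v j + w j)"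
  using add by blast
 show ?thesis
  by (rule exI[of _ L], rule exI[of _ e], rule exI[of _ s], rule exI[of _ ro])
   (intro conjI c1 c2 c3 c4 c5 e0 s(1) s(2) ro(1))
qed

end

section \<open>Lie groups and smooth parametrisations\<close>

lemma lie_groupD:
 assumes "lie_group G M"
 shows "group G" "smooth_manifold M" "charted M" "topspace (mtop M) = carrier G"
  "smooth_map (prod_manifold M M) M (%(x, y). x \<otimes>\<^bsub>G\<^esub> y)" "smooth_map M M (%x. inv\<^bsub>G\<^esub> x)"
 using assms by (auto simp: lie_group_def smooth_manifold_charted)

lemma plot_const:
 assumes "openin (RR Q) V" "g : topspace (mtop M)"
 shows "plot M Q V (%x. g)"
 by (rule plotI) (use assms in \<open>auto intro: Cinf_on_const\<close>)

lemma plot_smooth_map: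
 assumes "charted M" "charted N" "smooth_map M N f" "plot M Q V a"
 shows "plot N Q V (%x. f (a x))"
 by (rule plot_compose[OF assms(1,2) assms(3)[unfolded smooth_map_def] assms(4)])
  (use plot_in[OF assms(4)] in auto)

lemma plot_mult:
 assumes G: "lie_group G M" and a: "plot M Q V a" and b: "plot M Q V b"
 shows "plot M Q V (%x. a x \<otimes>\<^bsub>G\<^esub> b x)"
 using plot_smooth_map[OF charted_prod[OF lie_groupD(3)[OF G] lie_groupD(3)[OF G]] lie_groupD(3)[OF G] lie_groupD(5)[OF G] plot_pair[OF a b]]
 by simp

lemma plot_inv:
 assumes G: "lie_group G M" and a: "plot M Q V a"
 shows "plot M Q V (%x. inv\<^bsub>G\<^esub> a x)"
 by (rule plot_smooth_map[OF lie_groupD(3)[OF G] lie_groupD(3)[OF G] lie_groupD(6)[OF G] a])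

lemma plot_act:
 assumes G: "lie_group G M" and A: "smooth_module G M A N act" and a: "plot M Q V a" and b: "plot N Q V b"
 shows "plot N Q V (%x. act (a x) (b x))"
proof -
 have N: "charted N" using A by (auto simp: smooth_module_def dest: lie_groupD(3))
 have "smooth_map (prod_manifold M N) N (%(g, a). act g a)" using A by (simp add: smooth_module_def)
 from plot_smooth_map[OF charted_prod[OF lie_groupD(3)[OF G] N] N this plot_pair[OF a b]] show ?thesis by simp
qed

lemma chart_preimage_open:
 assumes "smooth_manifold M" "(U, ph) : matlas M" "openin (RR (midx M)) T"
 shows "openin (mtop M) {x : U. ph x : T}"
proof -
 have ch: "is_chart (mtop M) (midx M) U ph" using assms by (auto simp: smooth_manifold_def)
 hence oU: "openin (mtop M) U" and h: "homeomorphic_map (subtopology (mtop M) U) (subtopology (RR (midx M)) (ph ` U)) ph"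
  by (auto simp: is_chart_def)
 have "continuous_map (subtopology (mtop M) U) (RR (midx M)) ph"
  using homeomorphic_imp_continuous_map[OF h] by (simp add: continuous_map_in_subtopology)
 from openin_continuous_map_preimage[OF this assms(3)]
 have "openin (mtop M) {x : topspace (subtopology (mtop M) U). ph x : T}" using oU by (simp add: openin_open_subtopology)
 moreover have "topspace (subtopology (mtop M) U) = U" using openin_subset[OF oU] by auto
 ultimately show ?thesis by (simp only:)
qed

lemma chart_coord_continuous:
 assumes "smooth_manifold M" "(U, ph) : matlas M"
 shows "continuous_map (subtopology (mtop M) U) (RR (midx M)) ph"
proof -
 have "homeomorphic_map (subtopology (mtop M) U) (subtopology (RR (midx M)) (ph ` U)) ph"
  using assms by (auto simp: smooth_manifold_def is_chart_def)
 from homeomorphic_imp_continuous_map[OF this] show ?thesis by (simp add: continuous_map_in_subtopology)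
qed

locale ab_chart =
 fixes A :: "('a, 'd) monoid_scheme" and N :: "('a, 'j) manifold" and U :: "'a set" and ps :: "'a => 'j => real"
 assumes A: "comm_group A" and lie: "lie_group A N" and U: "(U, ps) : matlas N" and oneU: "\<one>\<^bsub>A\<^esub> : U"
begin

abbreviation "J \<equiv> midx N"

text \<open>The chart recentred so that the unit has coordinates 0; \<open>eta\<close> inverts it on
  vectors whose translate \<open>sh v\<close> lies in the image of the chart.\<close>

definition lam :: "'a => 'j => real" where "lam a = (\<lambda>j\<in>J. ps a j - ps \<one>\<^bsub>A\<^esub> j)"

definition sh :: "('j => real) => 'j => real" where "sh v = (\<lambda>j\<in>J. ps \<one>\<^bsub>A\<^esub> j + v j)"

definition eta :: "('j => real) => 'a" where "eta v = inv_into U ps (sh v)"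

lemmas lieN = lie_groupD[OF lie]

lemma finJ: "finite J" using lieN(3) by (simp add: charted_def)

lemma lam_ext: "lam a : extensional J" by (simp add: lam_def)

lemma chartU: "openin (mtop N) U" "inj_on ps U" "openin (RR J) (ps ` U)"
 using charted_chart[OF lieN(3) U] by auto

lemma U_carrier: "U \<subseteq> carrier A" using openin_subset[OF chartU(1)] lieN(4) by simp

lemma psi_ext: "a : U ==> ps a : extensional J" by (rule charted_extensional[OF lieN(3) U])

lemma eta_lam: "a : U ==> eta (lam a) = a"
proof -
 assume a: "a : U"
 have "sh (lam a) = ps a" using psi_ext[OF a] by (auto simp: sh_def lam_def fun_eq_iff extensional_def)
 thus ?thesis using chartU(2) a by (simp add: eta_def inv_into_f_f)
qed

lemma eta_in: "sh v : ps ` U ==> eta v : U" by (simp add: eta_def inv_into_into)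

lemma lam_eta: "v : extensional J ==> sh v : ps ` U ==> lam (eta v) = v"
 by (auto simp: eta_def lam_def f_inv_into_f sh_def fun_eq_iff extensional_def)

lemma lam_one: "lam \<one>\<^bsub>A\<^esub> = (\<lambda>j\<in>J. 0)" by (auto simp: lam_def)

lemma eta_zero: "eta (\<lambda>j\<in>J. 0) = \<one>\<^bsub>A\<^esub>" using eta_lam[OF oneU] by (simp add: lam_one)

lemma plot_lam:
 assumes "plot N Q V a" "a ` V \<subseteq> U" "j : J"
 shows "Cinf_on Q V (%x. lam (a x) j)"
 unfolding lam_def using assms(3)
 by (simp, intro Cinf_on_diff[OF plot_open[OF assms(1)]] plot_chart[OF assms(1) U assms(2)] Cinf_on_const) simp_all

lemma plot_eta:
 assumes V: "openin (RR Q) V" and v: "!!x. x : V ==> sh (v x) : ps ` U"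
  "!!j. j : J ==> Cinf_on Q V (%x. v x j)"
 shows "plot N Q V (%x. eta (v x))"
 unfolding eta_def
proof (rule plot_reparam[OF chart_plot[OF lieN(2) U] lieN(3) finJ V])
 show "Cinf_on Q V (%x. sh (v x) j)" if "j : J" for j
  unfolding sh_def using that by (simp, intro Cinf_on_add[OF V] Cinf_on_const v(2)) simp_all
qed (use v in auto)

text \<open>By continuity \<open>r\<close> can be taken so small that products and quotients of
  elements with coordinates in the cube stay in the chart; the local laws are then those of the
  group read through \<open>lam\<close> and \<open>eta\<close>.\<close>

lemma chart_local_group: "\<exists>r>0. (\<forall>v\<in>cube J (%_. 0) r. sh v : ps ` U) \<and>
  local_group J r (%x y. lam (eta x \<otimes>\<^bsub>A\<^esub> eta y)) (%x y. lam (inv\<^bsub>A\<^esub> eta x \<otimes>\<^bsub>A\<^esub> eta y))"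
proof -
 interpret A: comm_group A by (rule A)
 let ?W = "{..<2::nat} \<times> J"
 have finW: "finite ?W" using finJ by simp
 have oJ: "openin (RR J) (extensional J)" using openin_topspace[of "RR J"] by simp
 have "continuous_map (subtopology (RR J) (extensional J)) (subtopology (RR J) (extensional J)) sh"
  by (rule continuous_map_Cinf_coords[OF oJ subset_refl])
   (auto simp: sh_def intro!: Cinf_on_add[OF oJ] Cinf_on_const Cinf_on_coord)
 hence "continuous_map (RR J) (RR J) sh"
  using subtopology_topspace[of "RR J"] by simp
 from openin_continuous_map_preimage[OF this chartU(3)]
 have "openin (RR J) {v : extensional J. sh v : ps ` U}" by simp
 moreover have "sh (\<lambda>j\<in>J. 0) = ps \<one>\<^bsub>A\<^esub>" using psi_ext[OF oneU] by (auto simp: sh_def fun_eq_iff extensional_def)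
 hence "(\<lambda>j\<in>J. 0) : {v : extensional J. sh v : ps ` U}" using oneU by simp
 ultimately obtain r0 where r0: "r0 > 0" "cube J (\<lambda>j\<in>J. 0) r0 \<subseteq> {v : extensional J. sh v : ps ` U}"
  using openin_contains_cube[OF finJ] by meson
 have r0': "sh v : ps ` U" if "v : cube J (%_. 0) r0" for v using r0(2) that unfolding cube_zero_eq by auto
 have oW: "openin (RR ?W) (cube ?W (%_. 0) s)" for s by (rule openin_cube[OF finW])
 have pe: "plot N ?W (cube ?W (%_. 0) r0) (%p. eta (sl J k p))" if k: "k < 2" for k
 proof (rule plot_eta[OF oW])
  show "sh (sl J k p) : ps ` U" if "p : cube ?W (%_. 0) r0" for p by (rule r0'[OF sl_cube[OF k that]])
  show "Cinf_on ?W (cube ?W (%_. 0) r0) (%p. sl J k p j)" if "j : J" for j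
   using that by (simp add: sl_def Cinf_on_coord)
 qed
 have pm: "plot N ?W (cube ?W (%_. 0) r0) (%p. eta (sl J 0 p) \<otimes>\<^bsub>A\<^esub> eta (sl J 1 p))"
  by (intro plot_mult[OF lie] pe) auto
 have pq: "plot N ?W (cube ?W (%_. 0) r0) (%p. inv\<^bsub>A\<^esub> eta (sl J 0 p) \<otimes>\<^bsub>A\<^esub> eta (sl J 1 p))"
  by (intro plot_mult[OF lie] plot_inv[OF lie] pe) auto
 define O' where "O' = {p : cube ?W (%_. 0) r0. eta (sl J 0 p) \<otimes>\<^bsub>A\<^esub> eta (sl J 1 p) : U} \<inter>
  {p : cube ?W (%_. 0) r0. inv\<^bsub>A\<^esub> eta (sl J 0 p) \<otimes>\<^bsub>A\<^esub> eta (sl J 1 p) : U}"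
 have "openin (RR ?W) O'" unfolding O'_def
  by (intro openin_Int plot_preimage_open[OF pm chartU(1)] plot_preimage_open[OF pq chartU(1)])
 moreover have "sl J k (\<lambda>kp\<in>?W. 0) = (\<lambda>j\<in>J. 0)" if "k < 2" for k using that by (auto simp: sl_def fun_eq_iff)
 hence "(\<lambda>kp\<in>?W. 0) : O'" using r0(1) oneU by (simp add: O'_def mem_cube eta_zero)
 ultimately obtain r1 where r1: "r1 > 0" "cube ?W (\<lambda>kp\<in>?W. 0) r1 \<subseteq> O'"
  using openin_contains_cube[OF finW] by meson
 define r where "r = min r0 r1"
 have r: "r > 0" using r0 r1 by (simp add: r_def)
 have shr: "sh v : ps ` U" if "v : cube J (%_. 0) r" for v
  using that cube_mono[of r r0 J "%_. 0"] by (intro r0') (auto simp: r_def)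
 have prU: "eta x \<otimes>\<^bsub>A\<^esub> eta y : U" "inv\<^bsub>A\<^esub> eta x \<otimes>\<^bsub>A\<^esub> eta y : U"
  if x: "x : cube J (%_. 0) r" and y: "y : cube J (%_. 0) r" for x y
 proof -
  have e: "x : extensional J" "y : extensional J" using x y by (auto simp: mem_cube)
  have "pr J x y : cube ?W (%_. 0) r" by (rule pr_cube[OF x y])
  hence "pr J x y : O'" using r1(2) cube_mono[of r r1 ?W "%_. 0"] unfolding cube_zero_eq by (auto simp: r_def)
  thus "eta x \<otimes>\<^bsub>A\<^esub> eta y : U" "inv\<^bsub>A\<^esub> eta x \<otimes>\<^bsub>A\<^esub> eta y : U"
   by (auto simp: O'_def sl_pr[OF e(1)] sl_pr[OF e(2)] simp del: One_nat_def)
 qed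
 have etaA: "eta x : carrier A" if "x : cube J (%_. 0) r" for x using eta_in[OF shr[OF that]] U_carrier by auto
 have le: "lam (eta x) = x" if "x : cube J (%_. 0) r" for x
  using lam_eta[OF _ shr[OF that]] that by (simp add: mem_cube)
 have sub: "cube ?W (%_. 0) r \<subseteq> cube ?W (%_. 0) r0" by (rule cube_mono) (simp add: r_def)
 have "local_group J r (%x y. lam (eta x \<otimes>\<^bsub>A\<^esub> eta y)) (%x y. lam (inv\<^bsub>A\<^esub> eta x \<otimes>\<^bsub>A\<^esub> eta y))"
 proof
  show "finite J" "r > 0" by (rule finJ, rule r)
  fix j assume j: "j : J"
  show "Cinf_on ?W (cube ?W (%_. 0) r) (%p. lam (eta (sl J 0 p) \<otimes>\<^bsub>A\<^esub> eta (sl J 1 p)) j)"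
   by (rule plot_lam[OF plot_subset[OF pm oW sub] _ j]) (use prU(1) sl_cube in fastforce)
  show "Cinf_on ?W (cube ?W (%_. 0) r) (%p. lam (inv\<^bsub>A\<^esub> eta (sl J 0 p) \<otimes>\<^bsub>A\<^esub> eta (sl J 1 p)) j)"
   by (rule plot_lam[OF plot_subset[OF pq oW sub] _ j]) (use prU(2) sl_cube in fastforce)
 next
  fix x assume x: "x : cube J (%_. 0) r"
  show "lam (eta x \<otimes>\<^bsub>A\<^esub> eta (\<lambda>j\<in>J. 0)) = x" "lam (eta (\<lambda>j\<in>J. 0) \<otimes>\<^bsub>A\<^esub> eta x) = x"
   using etaA[OF x] le[OF x] by (simp_all add: eta_zero)
  show "lam (inv\<^bsub>A\<^esub> eta x \<otimes>\<^bsub>A\<^esub> eta x) = (\<lambda>j\<in>J. 0)" using etaA[OF x] by (simp add: lam_one)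
 next
  fix x u assume x: "x : cube J (%_. 0) r" and u: "u : cube J (%_. 0) r"
  have "eta (lam (inv\<^bsub>A\<^esub> eta x \<otimes>\<^bsub>A\<^esub> eta u)) = inv\<^bsub>A\<^esub> eta x \<otimes>\<^bsub>A\<^esub> eta u" by (rule eta_lam[OF prU(2)[OF x u]])
  hence "eta x \<otimes>\<^bsub>A\<^esub> eta (lam (inv\<^bsub>A\<^esub> eta x \<otimes>\<^bsub>A\<^esub> eta u)) = eta u"
   using etaA[OF x] etaA[OF u] by (simp add: A.m_assoc[symmetric])
  thus "lam (eta x \<otimes>\<^bsub>A\<^esub> eta (lam (inv\<^bsub>A\<^esub> eta x \<otimes>\<^bsub>A\<^esub> eta u))) = u" using le[OF u] by simp
 next
  fix x y assume x: "x : cube J (%_. 0) r" and y: "y : cube J (%_. 0) r"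
  note e = eta_lam[OF prU(1)[OF x y]] eta_lam[OF prU(1)[OF x x]] eta_lam[OF prU(1)[OF y y]]
  show "lam (eta (lam (eta x \<otimes>\<^bsub>A\<^esub> eta y)) \<otimes>\<^bsub>A\<^esub> eta (lam (eta x \<otimes>\<^bsub>A\<^esub> eta y))) =
    lam (eta (lam (eta x \<otimes>\<^bsub>A\<^esub> eta x)) \<otimes>\<^bsub>A\<^esub> eta (lam (eta y \<otimes>\<^bsub>A\<^esub> eta y)))"
   unfolding e using etaA[OF x] etaA[OF y] by (simp add: A.m_ac)
 qed (auto simp: lam_ext)
 thus ?thesis using r shr by blast
qed

end

text \<open>\<open>e_add\<close> is an equation of coordinates, and \<open>lam\<close> also has
  values off the chart. Only with \<open>e_prod\<close> does it become the equation
  \<open>Eg_add\<close> in the group.\<close>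

locale log_group = ab_chart A N U ps
 for A :: "('a, 'd) monoid_scheme" and N :: "('a, 'j) manifold" and U :: "'a set" and ps :: "'a => 'j => real" +
 fixes r s ro :: real and L e :: "('j => real) => 'j => real"
 assumes sr: "0 < s" "s <= r" and shr: "!!v. v : cube J (%_. 0) r ==> sh v : ps ` U" and rho0: "0 < ro"
  and L_smooth: "!!j. j : J ==> Cinf_on J (nball J s) (%x. L x j)"
  and e_smooth: "!!j. j : J ==> Cinf_on J (nball J ro) (%v. e v j)"
  and e_in: "!!v. v : nball J ro ==> e v : nball J s"
  and L_e: "!!v j. v : nball J ro ==> j : J ==> L (e v) j = v j"
  and L_inj: "!!x v. x : nball J s ==> v : nball J ro ==> (!!j. j : J ==> L x j = v j) ==> x = e v"
  and e_add: "!!v w. v : nball J ro ==> w : nball J ro ==> (\<lambda>j\<in>J. v j + w j) : nball J ro ==>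
   lam (eta (e v) \<otimes>\<^bsub>A\<^esub> eta (e w)) = e (\<lambda>j\<in>J. v j + w j)"
  and e_prod: "!!v w. v : nball J ro ==> w : nball J ro ==> eta (e v) \<otimes>\<^bsub>A\<^esub> eta (e w) : U"
  and e_zero: "e (\<lambda>j\<in>J. 0) = (\<lambda>j\<in>J. 0)"
begin

definition Eg :: "('j => real) => 'a" where "Eg v = eta (e v)"

definition Lg :: "'a => 'j => real" where "Lg a = (\<lambda>j\<in>J. L (lam a) j)"

abbreviation "NB \<equiv> nball J"

lemma NBsK: "NB s \<subseteq> cube J (%_. 0) r"
 using nball_subset_cube[OF finJ, of s] cube_mono[OF sr(2), of J "%_. 0"] by blast

lemma e_sh: "v : NB ro ==> sh (e v) : ps ` U" using e_in NBsK shr by blast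

lemma Eg_U: "v : NB ro ==> Eg v : U" unfolding Eg_def by (rule eta_in[OF e_sh])

lemma Eg_carrier: "v : NB ro ==> Eg v : carrier A" using Eg_U U_carrier by blast

lemma lam_Eg: "v : NB ro ==> lam (Eg v) = e v"
 unfolding Eg_def using lam_eta[OF _ e_sh] e_in[of v] by (simp add: nball_def)

lemma Lg_Eg: "v : NB ro ==> Lg (Eg v) = v"
 using L_e[of v] by (auto simp: Lg_def lam_Eg fun_eq_iff nball_def extensional_def)

lemma Lg_ext: "Lg a : extensional J" by (simp add: Lg_def)

lemma Eg_Lg: "a : Eg ` NB ro ==> Eg (Lg a) = a" using Lg_Eg by auto

lemma Lg_in: "a : Eg ` NB t ==> t <= ro ==> Lg a : NB t"
proof -
 assume a: "a : Eg ` NB t" and t: "t <= ro"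
 then obtain v where v: "v : NB t" "a = Eg v" by blast
 hence "v : NB ro" using t by (auto simp: nball_def)
 thus ?thesis using v Lg_Eg by simp
qed

lemma Eg_zero: "Eg (\<lambda>j\<in>J. 0) = \<one>\<^bsub>A\<^esub>" by (simp add: Eg_def e_zero eta_zero)

lemma Eg_add:
 assumes "v : NB ro" "w : NB ro" "(\<lambda>j\<in>J. v j + w j) : NB ro"
 shows "Eg (\<lambda>j\<in>J. v j + w j) = Eg v \<otimes>\<^bsub>A\<^esub> Eg w"
 unfolding Eg_def e_add[OF assms, symmetric] by (rule eta_lam[OF e_prod[OF assms(1,2)]])

lemma plot_Eg:
 assumes V: "openin (RR Q) V" and v: "!!x. x : V ==> v x : NB ro" "!!j. j : J ==> Cinf_on Q V (%x. v x j)"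
 shows "plot N Q V (%x. Eg (v x))"
 unfolding Eg_def
proof (rule plot_eta[OF V])
 show "sh (e (v x)) : ps ` U" if "x : V" for x using e_sh v(1) that by blast
 show "Cinf_on Q V (%x. e (v x) j)" if "j : J" for j
  by (rule Cinf_on_compose[OF finJ V openin_nball[OF finJ] _ v(2) e_smooth[OF that]]) (use v(1) in auto)
qed

lemma lam_in_s: "a : Eg ` NB ro ==> lam a : NB s" using lam_Eg e_in by auto

lemma plot_Lg:
 assumes a: "plot N Q V a" "a ` V \<subseteq> Eg ` NB ro" and j: "j : J"
 shows "Cinf_on Q V (%x. Lg (a x) j)"
proof -
 have "Eg ` NB ro \<subseteq> U" by (rule image_subsetI) (rule Eg_U)
 with a(2) have aU: "a ` V \<subseteq> U" by (rule subset_trans)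
 have "(%x. lam (a x)) ` V \<subseteq> NB s"
 proof (rule image_subsetI)
  fix x assume x: "x : V"
  have "a x : Eg ` NB ro" by (rule subsetD[OF a(2) imageI[OF x]])
  thus "lam (a x) : NB s" by (rule lam_in_s)
 qed
 note im = this
 have "Cinf_on Q V (%x. L (lam (a x)) j)"
 proof (rule Cinf_on_compose[where u = "%x. lam (a x)" and g = "%y. L y j" and J = J])
  show "(%x. lam (a x)) ` V \<subseteq> NB s" by (rule im)
  show "Cinf_on J (NB s) (%y. L y j)" by (rule L_smooth[OF j])
  show "Cinf_on Q V (%x. lam (a x) i)" if "i : J" for i by (rule plot_lam[OF a(1) aU that])
 qed (rule finJ plot_open[OF a(1)] openin_nball[OF finJ])+
 thus ?thesis using j by (simp add: Lg_def)
qed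

lemma Lg_continuous: "continuous_map (subtopology (mtop N) {a : U. lam a : NB s}) (RR J) Lg"
proof (rule continuous_map_coordinatewise_then_product)
 fix j assume j: "j : J"
 let ?S = "{a : U. lam a : NB s}"
 have "continuous_map (subtopology (mtop N) ?S) (RR J) ps"
  by (rule continuous_map_from_subtopology_mono[OF chart_coord_continuous[OF lieN(2) U]]) auto
 hence "continuous_map (subtopology (mtop N) ?S) euclideanreal (%a. ps a i)" if "i : J" for i
  using that by (rule continuous_map_product_then_coordinatewise(1))
 hence "continuous_map (subtopology (mtop N) ?S) euclideanreal (%a. lam a i)" if "i : J" for i
  using that by (simp add: lam_def continuous_map_diff)
 hence "continuous_map (subtopology (mtop N) ?S) (RR J) lam"
  by (intro continuous_map_coordinatewise_then_product) (auto simp: lam_def)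
 hence 1: "continuous_map (subtopology (mtop N) ?S) (subtopology (RR J) (NB s)) lam"
  by (auto simp: continuous_map_in_subtopology)
 have "continuous_map (subtopology (RR J) (NB s)) euclideanreal (%x. L x j)"
  unfolding continuous_map_powertop_real_iff by (rule Cinf_on_cont[OF L_smooth[OF j]])
 from continuous_map_compose[OF 1 this] show "continuous_map (subtopology (mtop N) ?S) euclideanreal (%a. Lg a j)"
  using j by (simp add: o_def Lg_def)
qed (simp add: Lg_def)

text \<open>The image is the preimage of a ball under the continuous map \<open>Lg\<close> on the
  set where \<open>lam\<close> lies in the ball of radius \<open>s\<close>; injectivity of
  \<open>L\<close> there excludes further points.\<close>

lemma openin_Eg:
 assumes "t <= ro"
 shows "openin (mtop N) (Eg ` NB t)"
proof -
 let ?S = "{a : U. lam a : NB s}"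
 have "openin (RR J) {x : ps ` U. (\<lambda>j\<in>J. x j - ps \<one>\<^bsub>A\<^esub> j) : NB s}"
 proof -
  have "continuous_map (subtopology (RR J) (ps ` U)) (subtopology (RR J) (extensional J)) (%x. \<lambda>j\<in>J. x j - ps \<one>\<^bsub>A\<^esub> j)"
   by (rule continuous_map_Cinf_coords[OF chartU(3) subset_refl])
    (auto intro!: Cinf_on_diff[OF chartU(3)] Cinf_on_const Cinf_on_coord)
  hence "continuous_map (subtopology (RR J) (ps ` U)) (RR J) (%x. \<lambda>j\<in>J. x j - ps \<one>\<^bsub>A\<^esub> j)"
   by (simp add: continuous_map_in_subtopology)
  from openin_continuous_map_preimage[OF this openin_nball[OF finJ]]
  have "openin (RR J) {x : topspace (subtopology (RR J) (ps ` U)). (\<lambda>j\<in>J. x j - ps \<one>\<^bsub>A\<^esub> j) : NB s}"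
   using chartU(3) by (simp add: openin_open_subtopology)
  moreover have "topspace (subtopology (RR J) (ps ` U)) = ps ` U" using openin_subset[OF chartU(3)] by auto
  ultimately show ?thesis by (simp only:)
 qed
 from chart_preimage_open[OF lieN(2) U this]
 have "openin (mtop N) {a : U. ps a : {x : ps ` U. (\<lambda>j\<in>J. x j - ps \<one>\<^bsub>A\<^esub> j) : NB s}}" .
 moreover have "{a : U. ps a : {x : ps ` U. (\<lambda>j\<in>J. x j - ps \<one>\<^bsub>A\<^esub> j) : NB s}} = ?S" by (auto simp: lam_def)
 ultimately have oS: "openin (mtop N) ?S" by (simp only:)
 from openin_continuous_map_preimage[OF Lg_continuous openin_nball[OF finJ]]
 have "openin (mtop N) {a : topspace (subtopology (mtop N) ?S). Lg a : NB t}" using oS by (simp add: openin_open_subtopology)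
 moreover have "topspace (subtopology (mtop N) ?S) = ?S" using openin_subset[OF oS] by auto
 moreover have "{a : ?S. Lg a : NB t} = Eg ` NB t"
 proof (intro equalityI subsetI)
  fix a assume a: "a : {a : ?S. Lg a : NB t}"
  hence v: "Lg a : NB ro" using assms by (auto simp: nball_def)
  have "lam a = e (Lg a)" by (rule L_inj[OF _ v]) (use a in \<open>auto simp: Lg_def\<close>)
  hence "a = Eg (Lg a)" using eta_lam[of a] a by (simp add: Eg_def)
  thus "a : Eg ` NB t" using a by blast
 next
  fix a assume a: "a : Eg ` NB t"
  hence a': "a : Eg ` NB ro" using assms by (auto simp: nball_def)
  obtain v where "v : NB ro" "a = Eg v" using a' by blast
  thus "a : {a : ?S. Lg a : NB t}" using lam_in_s[OF a'] Lg_in[OF a assms] Eg_U[of v] by simp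
 qed
 ultimately show ?thesis by (simp only:)
qed

lemma Lg_continuous': "continuous_map (subtopology (mtop N) (Eg ` NB ro)) (RR J) Lg"
proof (rule continuous_map_from_subtopology_mono[OF Lg_continuous])
 show "Eg ` NB ro \<subseteq> {a : U. lam a : NB s}"
  by (rule image_subsetI) (simp add: Eg_U lam_in_s)
qed

end

context ab_chart
begin

theorem log_group_exists: "\<exists>r s ro L e. log_group A N U ps r s ro L e"
proof -
 obtain r where r: "r > 0" "\<forall>v\<in>cube J (%_. 0) r. sh v : ps ` U"
  and lg: "local_group J r (%x y. lam (eta x \<otimes>\<^bsub>A\<^esub> eta y)) (%x y. lam (inv\<^bsub>A\<^esub> eta x \<otimes>\<^bsub>A\<^esub> eta y))"
  using chart_local_group by blast
 from local_group.local_log[OF lg] obtain L e s ro where *: "0 < s" "s <= r" "0 < ro"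
  "\<forall>j\<in>J. Cinf_on J (nball J s) (%x. L x j)" "\<forall>j\<in>J. Cinf_on J (nball J ro) (%v. e v j)"
  "\<forall>v\<in>nball J ro. e v : nball J s & (\<forall>j\<in>J. L (e v) j = v j)"
  "\<forall>x\<in>nball J s. \<forall>v\<in>nball J ro. (\<forall>j\<in>J. L x j = v j) --> x = e v"
  "\<forall>v\<in>nball J ro. \<forall>w\<in>nball J ro. (\<lambda>j\<in>J. v j + w j) : nball J ro --> lam (eta (e v) \<otimes>\<^bsub>A\<^esub> eta (e w)) = e (\<lambda>j\<in>J. v j + w j)"
  "e (\<lambda>j\<in>J. 0) = (\<lambda>j\<in>J. 0)"
  by blast
 have NBK: "nball J s \<subseteq> cube J (%_. 0) r" using nball_subset_cube[OF finJ, of s] cube_mono[OF *(2), of J "%_. 0"] by blast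
 let ?W = "{..<2::nat} \<times> J"
 have finW: "finite ?W" using finJ by simp
 have zs: "sl J k (\<lambda>kp\<in>?W. 0) = (\<lambda>j\<in>J. 0)" if "k < 2" for k using that by (auto simp: sl_def fun_eq_iff)
 define t where "t = ro / (real (card J) + 1)"
 have t: "0 < t" "cube J (%_. 0) t \<subseteq> nball J ro" using cube_subset_nball[OF finJ *(3)] *(3) by (auto simp: t_def)
 have oW: "openin (RR ?W) (cube ?W (%_. 0) t)" by (rule openin_cube[OF finW])
 have pe: "plot N ?W (cube ?W (%_. 0) t) (%p. eta (e (sl J k p)))" if k: "k < 2" for k
 proof (rule plot_eta[OF oW])
  have sk: "sl J k p : nball J ro" if "p : cube ?W (%_. 0) t" for p using sl_cube[OF k that] t by blast
  show "sh (e (sl J k p)) : ps ` U" if "p : cube ?W (%_. 0) t" for p using sk[OF that] *(6) r(2) NBK by blast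
  show "Cinf_on ?W (cube ?W (%_. 0) t) (%p. e (sl J k p) j)" if "j : J" for j
  proof (rule Cinf_on_compose[OF finJ oW openin_nball[OF finJ], where u = "sl J k" and g = "%v. e v j"])
   show "sl J k ` cube ?W (%_. 0) t \<subseteq> nball J ro" using sk by blast
   show "Cinf_on J (nball J ro) (%v. e v j)" using *(5) that by blast
   show "Cinf_on ?W (cube ?W (%_. 0) t) (%x. sl J k x l)" if "l : J" for l
    using that by (simp add: sl_def Cinf_on_coord)
  qed
 qed
 have pm: "plot N ?W (cube ?W (%_. 0) t) (%p. eta (e (sl J 0 p)) \<otimes>\<^bsub>A\<^esub> eta (e (sl J 1 p)))"
  by (intro plot_mult[OF lie] pe) auto
 have "(\<lambda>kp\<in>?W. 0) : {p : cube ?W (%_. 0) t. eta (e (sl J 0 p)) \<otimes>\<^bsub>A\<^esub> eta (e (sl J 1 p)) : U}"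
 proof -
  interpret A: comm_group A by (rule A)
  show ?thesis using t(1) oneU by (simp add: mem_cube zs *(9) eta_zero)
 qed
 then obtain t1 where t1: "t1 > 0" "cube ?W (\<lambda>kp\<in>?W. 0) t1 \<subseteq> {p : cube ?W (%_. 0) t. eta (e (sl J 0 p)) \<otimes>\<^bsub>A\<^esub> eta (e (sl J 1 p)) : U}"
  using openin_contains_cube[OF finW plot_preimage_open[OF pm chartU(1)]] by meson
 \<comment> \<open>The radius is shrunk so that products of two exponentials remain in the chart, as
   \<open>e_prod\<close> demands.\<close>
 define ro1 where "ro1 = min ro t1"
 have ro1: "0 < ro1" "ro1 <= ro" using *(3) t1 by (auto simp: ro1_def)
 have sub: "nball J ro1 \<subseteq> nball J ro" using ro1 by (auto simp: nball_def)
 have prodU: "eta (e v) \<otimes>\<^bsub>A\<^esub> eta (e w) : U" if v: "v : nball J ro1" and w: "w : nball J ro1" for v w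
 proof -
  have vw: "v : cube J (%_. 0) t1" "w : cube J (%_. 0) t1"
   using v w nball_subset_cube[OF finJ, of ro1] cube_mono[of ro1 t1 J "%_. 0"] by (auto simp: ro1_def)
  have e: "v : extensional J" "w : extensional J" using v w by (auto simp: nball_def)
  have "pr J v w : cube ?W (%_. 0) t1" by (rule pr_cube[OF vw])
  hence "eta (e (sl J 0 (pr J v w))) \<otimes>\<^bsub>A\<^esub> eta (e (sl J 1 (pr J v w))) : U" using t1(2) unfolding cube_zero_eq by blast
  thus ?thesis unfolding sl_pr(1)[OF e(1)] sl_pr(2)[OF e(2)] .
 qed
 have "log_group A N U ps r s ro1 L e"
 proof (unfold_locales)
  show "0 < s" "s <= r" "0 < ro1" using * ro1 by auto
  show "!!v. v : cube J (%_. 0) r ==> sh v : ps ` U" using r(2) by blast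
  show "!!j. j : J ==> Cinf_on J (nball J s) (%x. L x j)" using *(4) by blast
  show "!!j. j : J ==> Cinf_on J (nball J ro1) (%v. e v j)" using *(5) Cinf_on_subset[OF _ sub] by blast
  show "!!v. v : nball J ro1 ==> e v : nball J s" using *(6) sub by blast
  show "!!v j. v : nball J ro1 ==> j : J ==> L (e v) j = v j" using *(6) sub by blast
  show "!!x v. x : nball J s ==> v : nball J ro1 ==> (!!j. j : J ==> L x j = v j) ==> x = e v" using *(7) sub by blast
  show "!!v w. v : nball J ro1 ==> w : nball J ro1 ==> (\<lambda>j\<in>J. v j + w j) : nball J ro1 ==>
    lam (eta (e v) \<otimes>\<^bsub>A\<^esub> eta (e w)) = e (\<lambda>j\<in>J. v j + w j)" using *(8) sub by blast
  show "!!v w. v : nball J ro1 ==> w : nball J ro1 ==> eta (e v) \<otimes>\<^bsub>A\<^esub> eta (e w) : U" by (rule prodU)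
  show "e (\<lambda>j\<in>J. 0) = (\<lambda>j\<in>J. 0)" by (rule *(9))
 qed
 thus ?thesis by blast
qed

end

section \<open>Averaging in local coordinates\<close>

text \<open>An iterated integral sees its integrand only at points whose
  \<open>js\<close>-coordinates have been overwritten within the range, so both the integrand and
  the base point may be exchanged.\<close>

lemma iint_transfer:
 assumes "!!z. (!!j. j : set js ==> \<bar>z j - c j\<bar> <= ro) ==>
   g (%i. if i : set js then z i else x i) = g' (%i. if i : set js then z i else x' i)"
 shows "iint ro c js g x = iint ro c js g' x'"
 using assms
proof (induction js arbitrary: x x')
 case Nil
 thus ?case by simp
next
 case (Cons j js)
 have "iint ro c js g (x(j := t)) = iint ro c js g' (x'(j := t))" if t: "t : {c j - ro .. c j + ro}" for t
 proof (rule Cons.IH)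
  fix z assume z: "!!i. i : set js ==> \<bar>z i - c i\<bar> <= ro"
  define z' where "z' = (if j : set js then z else z(j := t))"
  have e: "(%i. if i : set js then z i else (y(j := t)) i) = (%i. if i : set (j # js) then z' i else y i)" for y
   by (auto simp: z'_def fun_eq_iff)
  have "g (%i. if i : set (j # js) then z' i else x i) = g' (%i. if i : set (j # js) then z' i else x' i)"
   by (rule Cons.prems) (use z t in \<open>auto simp: z'_def abs_le_iff split: if_splits\<close>)
  thus "g (%i. if i : set js then z i else (x(j := t)) i) = g' (%i. if i : set js then z i else (x'(j := t)) i)"
   unfolding e .
 qed
 thus ?case unfolding iint.simps by (intro integral_cong) simp
qed

lemma (in int_cube) iint_nonneg:
 assumes "continuous_on B g" "!!x. x : B ==> g x >= 0"
 shows "set js \<subseteq> Q ==> x : B ==> ii js g x >= 0"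
proof (induction js arbitrary: x)
 case (Cons j js)
 have jQ: "j : Q" "set js \<subseteq> Q" using Cons.prems by auto
 show ?case unfolding iint.simps
  by (intro integral_nonneg iint_integrable[OF assms(1) jQ(2) Cons.prems(2) jQ(1)] Cons.IH[OF jQ(2)] upd_B[OF Cons.prems(2) jQ(1)]) auto
qed (use assms in auto)

text \<open>Averages with a nonnegative weight of total mass 1 do not exceed the bound: the
  integrals of \<open>C * mu - mu * g\<close> and \<open>C * mu + mu * g\<close> are
  nonnegative.\<close>

lemma (in int_cube) iint_weighted_bound:
 assumes mu: "continuous_on B mu" "!!x. x : B ==> mu x >= 0" "ii js mu x = 1"
  and g: "continuous_on B g" "!!x. x : B ==> \<bar>g x\<bar> <= C" and js: "set js \<subseteq> Q" and x: "x : B"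
 shows "\<bar>ii js (%x. mu x * g x) x\<bar> <= C"
proof -
 have c1: "continuous_on B (%x. C * mu x)" and c2: "continuous_on B (%x. mu x * g x)"
  by (intro continuous_intros mu g)+
 have C: "ii js (%x. C * mu x) x = C" using mu(3) by (simp add: iint_cmult)
 have "ii js (%x. C * mu x - mu x * g x) x >= 0"
 proof (rule iint_nonneg[OF _ _ js x])
  show "0 <= C * mu y - mu y * g y" if "y : B" for y
   using mult_left_mono[of "g y" C "mu y"] g(2)[OF that] mu(2)[OF that] by (simp add: mult.commute abs_le_iff)
 qed (intro continuous_intros c1 c2)
 moreover have "ii js (%x. C * mu x + mu x * g x) x >= 0"
 proof (rule iint_nonneg[OF _ _ js x])
  show "0 <= C * mu y + mu y * g y" if "y : B" for y
   using mult_left_mono[of "- g y" C "mu y"] g(2)[OF that] mu(2)[OF that] by (simp add: mult.commute abs_le_iff)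
 qed (intro continuous_intros c1 c2)
 ultimately show ?thesis
  unfolding iint_diff[OF c1 c2 js x] iint_add[OF c1 c2 js x] C by (simp add: abs_le_iff)
qed

text \<open>Cauchy's functional equation on an interval. After subtracting the linear map with the
  same value at 1, the remainder vanishes at the fractions k/n and is bounded, which forces it below
  2C/n everywhere.\<close>

lemma bounded_additive_linear:
 fixes ph :: "real => real"
 assumes add: "!!s t. \<bar>s\<bar> <= 1 ==> \<bar>t\<bar> <= 1 ==> \<bar>s + t\<bar> <= 1 ==> ph (s + t) = ph s + ph t"
  and bd: "!!t. \<bar>t\<bar> <= 1 ==> \<bar>ph t\<bar> <= C" and t: "\<bar>t\<bar> <= 1"
 shows "ph t = t * ph 1"
proof -
 define ps where "ps t = ph t - t * ph 1" for t
 have padd: "ps (s + t) = ps s + ps t" if "\<bar>s\<bar> <= 1" "\<bar>t\<bar> <= 1" "\<bar>s + t\<bar> <= 1" for s t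
  using add[OF that] by (simp add: ps_def algebra_simps)
 have p1: "ps 1 = 0" by (simp add: ps_def)
 have p0: "ps 0 = 0" using padd[of 0 0] by simp
 have pneg: "ps (- t) = - ps t" if "\<bar>t\<bar> <= 1" for t using padd[of t "- t"] that p0 by simp
 have pb: "\<bar>ps t\<bar> <= 2 * C" if "\<bar>t\<bar> <= 1" for t
 proof -
  have C: "C >= 0" using bd[of 0] by simp
  have "\<bar>ps t\<bar> <= \<bar>ph t\<bar> + \<bar>t\<bar> * \<bar>ph 1\<bar>" unfolding ps_def abs_mult[symmetric] by (rule abs_triangle_ineq4)
  also have "\<dots> <= C + 1 * C" by (intro add_mono mult_mono bd that) auto
  finally show ?thesis by simp
 qed
 have pn: "ps (real n * u) = real n * ps u" if "\<bar>real n * u\<bar> <= 1" for n u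
  using that
 proof (induction n)
  case 0 thus ?case by (simp add: p0)
 next
  case (Suc n)
  have b: "real n * \<bar>u\<bar> <= real (Suc n) * \<bar>u\<bar>" "1 * \<bar>u\<bar> <= real (Suc n) * \<bar>u\<bar>" by (intro mult_right_mono; simp)+
  have "real (Suc n) * \<bar>u\<bar> <= 1" using Suc.prems by (simp add: abs_mult)
  hence l: "\<bar>real n * u\<bar> <= 1" "\<bar>u\<bar> <= 1" using b by (simp_all add: abs_mult)
  have "ps (real n * u + u) = ps (real n * u) + ps u"
   by (rule padd[OF l]) (use Suc.prems in \<open>simp add: algebra_simps\<close>)
  thus ?case using Suc.IH[OF l(1)] by (simp add: algebra_simps)
 qed
 \<comment> \<open>\<open>u\<close> is the distance from \<open>t\<close> down to a multiple of 1/n,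
   where \<open>ps\<close> vanishes; since n u \<le> 1, the value n ps(u) = ps(n u) is at most
   2C.\<close>
 have small: "\<bar>ps t\<bar> <= 2 * C / real n" if n: "n > 0" and t: "0 <= t" "t <= 1" for n t
 proof -
  define k where "k = nat \<lfloor>real n * t\<rfloor>"
  have k: "real k <= real n * t" "real n * t < real k + 1" using t by (simp_all add: k_def)
  define u where "u = t - real k / real n"
  have nt: "real n * t <= real n" using t n by simp
  have "real k / real n <= t" using k n by (simp add: divide_le_eq mult.commute)
  moreover have "real n * u = real n * t - real k" using n by (simp add: u_def right_diff_distrib)
  ultimately have u: "0 <= u" "real n * u <= 1" using k by (simp_all add: u_def)
  have kn: "real k / real n <= 1" proof -
   have "real k <= real n" using k nt by linarith
   thus ?thesis using n by simp
  qed
  have "ps (real n * (1 / real n)) = real n * ps (1 / real n)" by (rule pn) (use n in simp)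
  hence "ps (1 / real n) = 0" using n p1 by simp
  moreover have "ps (real k * (1 / real n)) = real k * ps (1 / real n)" by (rule pn) (use kn in simp)
  ultimately have pk: "ps (real k / real n) = 0" by simp
  have "0 <= real k / real n" by simp
  hence u1: "u <= 1" using t unfolding u_def by linarith
  have "ps (real k / real n + u) = ps (real k / real n) + ps u"
   by (rule padd) (use kn u u1 t in \<open>auto simp: u_def\<close>)
  hence "ps t = ps u" by (simp add: pk u_def)
  moreover have "ps (real n * u) = real n * ps u" by (rule pn) (use u n in simp)
  moreover have "\<bar>ps (real n * u)\<bar> <= 2 * C" by (rule pb) (use u n in simp)
  ultimately show ?thesis using n by (simp add: abs_mult field_simps)
 qed
 have z: "ps t = 0" if t: "0 <= t" "t <= 1" for t
 proof -
  have "(%n. 2 * C / real (Suc n)) \<longlonglongrightarrow> 0" by (intro LIMSEQ_Suc[OF lim_const_over_n])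
  moreover have "\<bar>ps t\<bar> <= 2 * C / real (Suc n)" for n by (rule small[OF _ t]) simp
  ultimately have "\<bar>ps t\<bar> <= 0" by (intro LIMSEQ_le_const) auto
  thus ?thesis by simp
 qed
 have "ps t = 0"
 proof (cases "t >= 0")
  case True thus ?thesis using z t by simp
 next
  case False
  hence "ps (- t) = 0" using z[of "- t"] t by simp
  thus ?thesis using pneg[OF t] by simp
 qed
 thus ?thesis by (simp add: ps_def)
qed

lemma nrm_single: "finite J ==> k : J ==> nrm J (\<lambda>j\<in>J. if j = k then a else 0) = \<bar>a\<bar>"
proof -
 assume "finite J" "k : J"
 moreover have "nrm J (\<lambda>j\<in>J. if j = k then a else 0) = (\<Sum>l\<in>J. if l = k then \<bar>a\<bar> else 0)"
  unfolding nrm_def by (intro sum.cong) auto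
 ultimately show ?thesis by simp
qed

text \<open>The vector is assembled axis by axis inside the larger ball of radius
  \<open>\<eta>\<close>, and on each axis the one-variable result applies after scaling by
  \<open>ta\<close>. This linearises the action of a group element.\<close>

lemma bounded_additive_coords:
 fixes T :: "('j => real) => real"
 assumes fin: "finite J" and ta: "0 < ta" "ta < \<eta>"
  and add: "!!v w. v : nball J \<eta> ==> w : nball J \<eta> ==> (\<lambda>j\<in>J. v j + w j) : nball J \<eta> ==>
   T (\<lambda>j\<in>J. v j + w j) = T v + T w"
  and bd: "!!v. v : nball J \<eta> ==> \<bar>T v\<bar> <= C" and v: "v : nball J ta"
 shows "T v = (\<Sum>k\<in>J. T (\<lambda>j\<in>J. if j = k then ta else 0) / ta * v k)"
proof -
 define E where "E k a = (\<lambda>j\<in>J. if j = k then a else 0 :: real)" for k a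
 have E: "E k a : nball J \<eta>" if "k : J" "\<bar>a\<bar> <= ta" for k a
  using nrm_single[OF fin that(1)] that ta by (simp add: E_def nball_def)
 have single: "T (E k (v k)) = T (E k ta) / ta * v k" if k: "k : J" for k
 proof -
  have vk: "\<bar>v k\<bar> <= ta" using coord_le_nrm[OF fin k, of v] v by (simp add: nball_def)
  have "T (E k (v k / ta * ta)) = v k / ta * T (E k (1 * ta))"
  proof (rule bounded_additive_linear[where C = C])
   fix s t :: real assume st: "\<bar>s\<bar> <= 1" "\<bar>t\<bar> <= 1" "\<bar>s + t\<bar> <= 1"
   have b: "\<bar>s * ta\<bar> <= ta" "\<bar>t * ta\<bar> <= ta" "\<bar>(s + t) * ta\<bar> <= ta" using st ta by (simp_all add: abs_mult)
   have e: "(\<lambda>j\<in>J. E k (s * ta) j + E k (t * ta) j) = E k ((s + t) * ta)" by (auto simp: E_def fun_eq_iff algebra_simps)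
   show "T (E k ((s + t) * ta)) = T (E k (s * ta)) + T (E k (t * ta))"
    using add[OF E[OF k b(1)] E[OF k b(2)]] E[OF k b(3)] unfolding e by simp
  next
   fix t :: real assume "\<bar>t\<bar> <= 1"
   thus "\<bar>T (E k (t * ta))\<bar> <= C" using ta by (intro bd E[OF k]) (simp add: abs_mult)
  next
   show "\<bar>v k / ta\<bar> <= 1" using vk ta by (simp add: abs_divide)
  qed
  thus ?thesis using ta by simp
 qed
 have part: "nrm J (\<lambda>j\<in>J. if j : S then v j else 0) <= nrm J v" for S
  unfolding nrm_def by (rule sum_mono) auto
 have partB: "(\<lambda>j\<in>J. if j : S then v j else 0) : nball J \<eta>" for S
  using part[of S] v ta by (simp add: nball_def)
 have T0: "T (\<lambda>j\<in>J. 0) = 0"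
 proof -
  have z: "(\<lambda>j\<in>J. 0 :: real) : nball J \<eta>" using ta by (simp add: nball_def nrm_def)
  have "(\<lambda>j\<in>J. (\<lambda>j\<in>J. 0 :: real) j + (\<lambda>j\<in>J. 0) j) = (\<lambda>j\<in>J. 0)" by (auto simp: fun_eq_iff)
  thus ?thesis using add[OF z z] z by simp
 qed
 have "T (\<lambda>j\<in>J. if j : S then v j else 0) = (\<Sum>k\<in>S. T (E k ta) / ta * v k)" if "finite S" "S \<subseteq> J" for S
  using that
 proof (induction S rule: finite_induct)
  case empty
  show ?case by (simp only: empty_iff if_False sum.empty T0)
 next
  case (insert k S)
  hence k: "k : J" by simp
  have vk: "\<bar>v k\<bar> <= ta" using coord_le_nrm[OF fin k, of v] v by (simp add: nball_def)
  have e: "(\<lambda>j\<in>J. (\<lambda>j\<in>J. if j : S then v j else 0) j + E k (v k) j) = (\<lambda>j\<in>J. if j : insert k S then v j else 0)"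
   using insert by (auto simp: E_def fun_eq_iff)
  have "T (\<lambda>j\<in>J. if j : insert k S then v j else 0) = T (\<lambda>j\<in>J. if j : S then v j else 0) + T (E k (v k))"
   using add[OF partB[of S] E[OF k vk]] partB[of "insert k S"] unfolding e .
  also have "T (\<lambda>j\<in>J. if j : S then v j else 0) = (\<Sum>k\<in>S. T (E k ta) / ta * v k)"
   by (rule insert.IH) (use insert.prems in simp)
  also have "T (E k (v k)) = T (E k ta) / ta * v k" by (rule single[OF k])
  finally show ?case using insert.hyps by (simp only: sum.insert add.commute not_False_eq_True)
 qed
 from this[OF fin subset_refl] have "T (\<lambda>j\<in>J. if j : J then v j else 0) = (\<Sum>k\<in>J. T (E k ta) / ta * v k)" .
 moreover have "(\<lambda>j\<in>J. if j : J then v j else 0) = v" using v by (auto simp: nball_def fun_eq_iff extensional_def)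
 ultimately show ?thesis by (simp add: E_def)
qed

section \<open>Products and inverses in logarithmic coordinates\<close>

context log_group
begin

lemma Eg_NB_mono: "p <= q ==> Eg ` NB p \<subseteq> Eg ` NB q" by (intro image_mono) (auto simp: nball_def)

lemma Lg_mult:
 assumes "a : Eg ` NB p" "b : Eg ` NB q" "0 < p" "0 < q" "p + q <= ro"
 shows "a \<otimes>\<^bsub>A\<^esub> b : Eg ` NB (p + q)" "j : J ==> Lg (a \<otimes>\<^bsub>A\<^esub> b) j = Lg a j + Lg b j"
proof -
 obtain v w where vw: "v : NB p" "a = Eg v" "w : NB q" "b = Eg w" using assms(1,2) by blast
 have vr: "v : NB ro" "w : NB ro" using vw assms by (auto simp: nball_def)
 have "nrm J (\<lambda>j\<in>J. v j + w j) <= nrm J v + nrm J w" by (rule nrm_triangle3) simp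
 hence s: "(\<lambda>j\<in>J. v j + w j) : NB (p + q)" using vw by (simp add: nball_def)
 hence sr: "(\<lambda>j\<in>J. v j + w j) : NB ro" using assms(5) by (simp add: nball_def)
 have e: "a \<otimes>\<^bsub>A\<^esub> b = Eg (\<lambda>j\<in>J. v j + w j)" unfolding vw using Eg_add[OF vr sr] by simp
 show "a \<otimes>\<^bsub>A\<^esub> b : Eg ` NB (p + q)" unfolding e using s by (rule imageI)
 show "Lg (a \<otimes>\<^bsub>A\<^esub> b) j = Lg a j + Lg b j" if "j : J" unfolding e Lg_Eg[OF sr] using that by (simp add: vw Lg_Eg vr)
qed

lemma Lg_inv:
 assumes "a : Eg ` NB p" "2 * p <= ro" "0 < p"
 shows "inv\<^bsub>A\<^esub> a : Eg ` NB p" "j : J ==> Lg (inv\<^bsub>A\<^esub> a) j = - Lg a j"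
proof -
 interpret A: comm_group A by (rule A)
 obtain v where v: "v : NB p" "a = Eg v" using assms(1) by blast
 have "nrm J (\<lambda>j\<in>J. - v j) = nrm J v" unfolding nrm_def by (intro sum.cong) auto
 hence w: "(\<lambda>j\<in>J. - v j) : NB p" using v by (simp add: nball_def)
 have vr: "v : NB ro" "(\<lambda>j\<in>J. - v j) : NB ro" using v w assms by (auto simp: nball_def)
 have z: "(\<lambda>j\<in>J. v j + (\<lambda>j\<in>J. - v j) j) = (\<lambda>j\<in>J. 0)" by (auto simp: fun_eq_iff)
 have zr: "(\<lambda>j\<in>J. 0) : NB ro" using rho0 by (simp add: nball_def nrm_def)
 have "Eg v \<otimes>\<^bsub>A\<^esub> Eg (\<lambda>j\<in>J. - v j) = \<one>\<^bsub>A\<^esub>" using Eg_add[OF vr] zr unfolding z Eg_zero by simp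
 hence e: "inv\<^bsub>A\<^esub> a = Eg (\<lambda>j\<in>J. - v j)"
  using A.inv_equality[of "Eg (\<lambda>j\<in>J. - v j)" "Eg v"] Eg_carrier[OF vr(1)] Eg_carrier[OF vr(2)] by (simp add: v(2) A.m_comm)
 show "inv\<^bsub>A\<^esub> a : Eg ` NB p" unfolding e using w by (rule imageI)
 have "Lg (inv\<^bsub>A\<^esub> a) = (\<lambda>j\<in>J. - v j)" "Lg a = v" using e Lg_Eg[OF vr(2)] Lg_Eg[OF vr(1)] v(2) by simp_all
 thus "Lg (inv\<^bsub>A\<^esub> a) j = - Lg a j" if "j : J" using that by simp
qed

end

text \<open>\<open>\<delta>\<close> takes the place of the radius of the logarithm, because
  \<open>ro\<close> will denote the radius of integration.\<close>

locale coh = log_group A N U ps r s \<delta> L e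
 for A :: "('a, 'd) monoid_scheme" and N :: "('a, 'j) manifold" and U and ps and r s \<delta> :: real and L e +
 fixes G :: "('g, 'c) monoid_scheme" and M :: "('g, 'i) manifold" and act :: "'g => 'a => 'a"
  and U0 :: "'g set" and ph0 :: "'g => 'i => real"
 assumes lieG: "lie_group G M" and mod: "smooth_module G M A N act"
  and U0: "(U0, ph0) : matlas M" and one0: "\<one>\<^bsub>G\<^esub> : U0"
begin

abbreviation "I \<equiv> midx M"
abbreviation "Q \<equiv> {..<4::nat} \<times> I"
abbreviation "cI \<equiv> ph0 \<one>\<^bsub>G\<^esub>"

definition Qc :: "nat \<times> 'i => real" where "Qc = (%kp. cI (snd kp))"

abbreviation "qbox \<equiv> cube Q Qc"

text \<open>A point of the box carries four group elements: the slots 0 and 1 hold the arguments of a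
 cochain, the slots 2 and 3 the averaging variables \<open>r\<close> and \<open>u\<close>.\<close>

definition gm :: "nat => (nat \<times> 'i => real) => 'g" where
 "gm k x = inv_into U0 ph0 (\<lambda>i\<in>I. x (k, i))"

lemmas lieM = lie_groupD[OF lieG]

lemma finI: "finite I" using lieM(3) by (simp add: charted_def)

lemma finQ: "finite Q" using finI by simp

lemma chart0: "openin (mtop M) U0" "inj_on ph0 U0" "openin (RR I) (ph0 ` U0)"
 using charted_chart[OF lieM(3) U0] by auto

lemma phi0_ext: "a : U0 ==> ph0 a : extensional I" by (rule charted_extensional[OF lieM(3) U0])

lemma slice_box: "x : qbox t ==> k < 4 ==> (\<lambda>i\<in>I. x (k, i)) : cube I cI t"
 by (auto simp: mem_cube Qc_def)

lemma inv_phi0: "a : U0 ==> inv_into U0 ph0 (ph0 a) = a" using chart0(2) by (simp add: inv_into_f_f)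

lemma gm_cong: "(!!i. i : I ==> x (k, i) = y (k, i)) ==> gm k x = gm k y"
 unfolding gm_def by (rule arg_cong[where f = "inv_into U0 ph0"]) (auto simp: fun_eq_iff)

end

text \<open>\<open>D1\<close> is where cochains are controlled. \<open>D2\<close> is smaller,
  symmetric, and such that words of up to three of its elements lie in \<open>D1\<close>; the
  displaced integration variable \<open>r \<sigma>' \<sigma>^(-1)\<close> is such a word.\<close>

locale coh_box = coh A N U ps r s \<delta> L e G M act U0 ph0
 for A :: "('a, 'd) monoid_scheme" and N :: "('a, 'j) manifold" and U and ps and r s \<delta> :: real and L e
  and G :: "('g, 'c) monoid_scheme" and M :: "('g, 'i) manifold" and act and U0 and ph0 +
 fixes D1 D2 :: "'g set" and ep ro :: real
 assumes box_chart: "cube I cI ep \<subseteq> ph0 ` U0" and ro: "0 < ro" "ro < ep"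
  and D1: "openin (mtop M) D1" "D1 \<subseteq> U0"
  and D2: "D2 \<subseteq> D1" "\<one>\<^bsub>G\<^esub> : D2" "!!a. a : D2 ==> inv\<^bsub>G\<^esub> a : D2"
   "!!a b. a : D2 ==> b : D2 ==> a \<otimes>\<^bsub>G\<^esub> b : D1"
   "!!a b c. a : D2 ==> b : D2 ==> c : D2 ==> a \<otimes>\<^bsub>G\<^esub> b \<otimes>\<^bsub>G\<^esub> c : D1"
  and gmD2: "!!x k. x : qbox ep ==> k < 4 ==> gm k x : D2"
begin

sublocale int_cube Q Qc ep ro by unfold_locales (use finQ ro in auto)

lemma D_carrier: "D1 \<subseteq> carrier G" "D2 \<subseteq> carrier G"
 using openin_subset[OF D1(1)] lieM(4) D2(1) by auto

lemma phi0_gm: "x : B ==> k < 4 ==> i : I ==> ph0 (gm k x) i = x (k, i)"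
proof -
 assume x: "x : B" "k < 4" "i : I"
 have "(\<lambda>i\<in>I. x (k, i)) : ph0 ` U0" using slice_box[OF x(1,2)] box_chart by blast
 from f_inv_into_f[OF this] show ?thesis using x(3) by (metis gm_def restrict_apply')
qed

lemma plot_gm:
 assumes k: "k < 4"
 shows "plot M Q B (gm k)"
 unfolding gm_def[abs_def]
proof (rule plot_reparam[OF chart_plot[OF lieM(2) U0] lieM(3) finI openB])
 show "(%x. \<lambda>i\<in>I. x (k, i)) ` B \<subseteq> ph0 ` U0" using slice_box[OF _ k] box_chart by blast
 show "Cinf_on Q B (%x. (\<lambda>i\<in>I. x (k, i)) i)" if "i : I" for i using that by (simp add: Cinf_on_coord)
qed

text \<open>A displacement of the parameter \<open>i\<close> of \<open>ze\<close> is absorbed by moving the slot \<open>k0\<close>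
 to \<open>om\<close>; the coordinate \<open>ex\<close> records the displaced value.\<close>

lemma slot_span:
 fixes i :: "nat \<times> 'i"
 defines "ex \<equiv> (4, snd i)"
 defines "Qp \<equiv> insert ex Q"
 defines "cp \<equiv> Qc(ex := Qc i)"
 assumes i: "i : Q" and k0: "k0 < 4"
  and ze: "plot M Q B ze" "ze ` B \<subseteq> D1"
  and om: "plot M Qp (cube Qp cp ep) om" "om ` cube Qp cp ep \<subseteq> D1"
  and om0: "!!x. x : B ==> om (x(ex := x i)) = gm k0 x"
  and move: "!!x t. x : B ==> x(i := t) : B ==>
    ze (x(i := t)) = ze (%kp. if kp : {k0} \<times> I then ph0 (om (x(ex := t))) (snd kp) else x kp)"
 shows "!!l. l : I ==> Cinf_on Q B (%x. pd ex (%y. ph0 (om y) l) (x(ex := x i)))"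
  "!!x l. x : B ==> l : I ==> pd i (%x. ph0 (ze x) l) x =
    (\<Sum>l'\<in>I. pd ex (%y. ph0 (om y) l') (x(ex := x i)) * pd (k0, l') (%x. ph0 (ze x) l) x)"
proof -
 \<comment> \<open>The slots of the box are numbered below 4, so an index with first component 4 is
   new.\<close>
 have exQ: "ex \<notin> Q" by (simp add: ex_def)
 have finQp: "finite Qp" using finQ by (simp add: Qp_def)
 have oQp: "openin (RR Qp) (cube Qp cp ep)" by (rule openin_cube[OF finQp])
 have up: "x(ex := t) : cube Qp cp ep" if "x : B" "\<bar>t - Qc i\<bar> < ep" for x t
  using that exQ by (auto simp: mem_cube Qp_def cp_def extensional_def)
 have xi: "\<bar>x i - Qc i\<bar> < ep" if "x : B" for x using that i by (auto simp: mem_cube)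
 have omC: "Cinf_on Qp (cube Qp cp ep) (%y. ph0 (om y) l)" if "l : I" for l
  by (rule plot_chart[OF om(1) U0 _ that]) (use om(2) D1(2) in blast)
 have zeC: "Cinf_on Q B (%y. ph0 (ze y) l)" if "l : I" for l
  by (rule plot_chart[OF ze(1) U0 _ that]) (use ze(2) D1(2) in blast)
 have exQp: "ex : Qp" by (simp add: Qp_def)
 show "Cinf_on Q B (%x. pd ex (%y. ph0 (om y) l) (x(ex := x i)))" if l: "l : I" for l
 proof (rule Cinf_on_compose[OF finQp openB oQp, where u = "%x. x(ex := x i)" and g = "pd ex (%y. ph0 (om y) l)"])
  show "(%x. x(ex := x i)) ` B \<subseteq> cube Qp cp ep" using up xi by blast
  show "Cinf_on Qp (cube Qp cp ep) (pd ex (%y. ph0 (om y) l))" by (rule Cinf_on_partial[OF omC[OF l] exQp])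
  fix kp show "Cinf_on Q B (%x. (x(ex := x i)) kp)" by (cases "kp = ex") (simp_all add: Cinf_on_coord)
 qed
 fix x l assume x: "x : B" and l: "l : I"
 \<comment> \<open>The curve that leaves the parameter in place and moves slot \<open>k0\<close>
   instead. Along it \<open>ze\<close> takes the same values as along the coordinate line of
   \<open>i\<close>.\<close>
 define y where "y t = (%kp. if kp : {k0} \<times> I then ph0 (om (x(ex := t))) (snd kp) else x kp)" for t
 have xe: "x : extensional Q" using x by (simp add: mem_cube)
 have y0: "y (x i) = x"
  using phi0_gm[OF x k0] by (auto simp: y_def om0[OF x] fun_eq_iff)
 define d where "d kp = (if kp : {k0} \<times> I then pd ex (%y. ph0 (om y) (snd kp)) (x(ex := x i)) else 0)" for kp
 have "((%t. ph0 (ze (y t)) l) has_real_derivative (\<Sum>kp\<in>Q. pd kp (%y. ph0 (ze y) l) (y (x i)) * d kp)) (at (x i))"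
 proof (rule total_derivative_extensional[OF finQ openB, where g = "%y. ph0 (ze y) l" and c = y])
  show "C_on 1 Q B (%y. ph0 (ze y) l)" using zeC[OF l] by (simp add: Cinf_on_def)
  show "y (x i) : B" using y0 x by simp
  show "y t : extensional Q" for t using xe k0 by (auto simp: y_def extensional_def)
  fix kp assume "kp : Q"
  show "((%t. y t kp) has_real_derivative d kp) (at (x i))"
  proof (cases "kp : {k0} \<times> I")
   case True
   hence "snd kp : I" by auto
   have "has_partial ex (%y. ph0 (om y) (snd kp)) (x(ex := x i))"
    by (rule Cinf_on_has_partial[OF omC[OF \<open>snd kp : I\<close>] exQp up[OF x xi[OF x]]])
   from has_partialD[OF this] show ?thesis using True by (simp add: y_def d_def del: fun_upd_apply) (simp add: fun_upd_apply)
  qed (simp add: y_def d_def)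
 qed
 moreover have "(\<Sum>kp\<in>Q. pd kp (%y. ph0 (ze y) l) (y (x i)) * d kp) =
   (\<Sum>l'\<in>I. pd ex (%y. ph0 (om y) l') (x(ex := x i)) * pd (k0, l') (%x. ph0 (ze x) l) x)"
 proof -
  have "(\<Sum>kp\<in>Q. pd kp (%y. ph0 (ze y) l) x * d kp) = (\<Sum>kp\<in>Pair k0 ` I. pd kp (%y. ph0 (ze y) l) x * d kp)"
   by (rule sum.mono_neutral_right[OF finQ]) (use k0 in \<open>auto simp: d_def\<close>)
  also have "\<dots> = (\<Sum>l'\<in>I. pd (k0, l') (%y. ph0 (ze y) l) x * d (k0, l'))"
   by (subst sum.reindex) (auto simp: inj_on_def)
  finally show ?thesis unfolding y0 by (simp add: d_def mult.commute del: fun_upd_apply)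
 qed
 ultimately have D: "((%t. ph0 (ze (y t)) l) has_real_derivative
   (\<Sum>l'\<in>I. pd ex (%y. ph0 (om y) l') (x(ex := x i)) * pd (k0, l') (%x. ph0 (ze x) l) x)) (at (x i))" by simp
 have ev: "\<forall>\<^sub>F t in nhds (x i). ph0 (ze (x(i := t))) l = ph0 (ze (y t)) l"
  using eventually_line_in[OF openB i x] by eventually_elim (simp add: move[OF x] y_def del: fun_upd_apply)
 show "pd i (%x. ph0 (ze x) l) x =
    (\<Sum>l'\<in>I. pd ex (%y. ph0 (om y) l') (x(ex := x i)) * pd (k0, l') (%x. ph0 (ze x) l) x)"
  by (rule has_partialI(2)) (subst DERIV_cong_ev[OF refl ev refl], rule D)
qed

end

section \<open>Smoothing of local cocycles\<close>

context coh_box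
begin

abbreviation "TT \<equiv> subtopology (prod_topology (mtop M) (mtop M)) (D1 \<times> D1)"

text \<open>\<open>iint\<close> wants a list of variables while \<open>I\<close> is only a finite
  set, so some enumeration of the coordinates of slot \<open>k\<close> is chosen.\<close>

definition slot :: "nat => (nat \<times> 'i) list" where
 "slot k = (SOME l. distinct l & set l = {k} \<times> I)"

lemma slot: "distinct (slot k)" "set (slot k) = {k} \<times> I"
proof -
 have "finite ({k} \<times> I)" using finI by simp
 hence "\<exists>l. distinct l & set l = {k} \<times> I" using finite_distinct_list by metis
 from someI_ex[OF this] show "distinct (slot k)" "set (slot k) = {k} \<times> I" by (auto simp: slot_def)
qed

text \<open>Dependence on the two parameter slots only; the averaging slots 2 and 3 may be moved
  without effect.\<close>

definition low :: "((nat \<times> 'i => real) => 'g) => bool" where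
 "low sg \<longleftrightarrow> (\<forall>x y. (\<forall>k<2. \<forall>i\<in>I. x (k, i) = y (k, i)) --> sg x = sg y)"

lemma low_eq: "low sg ==> (!!k i. k < 2 ==> i : I ==> x (k, i) = y (k, i)) ==> sg x = sg y"
 unfolding low_def by simp

lemma low_const: "low (%x. g)" by (simp add: low_def)

lemma low_gm: "k < 2 ==> low (gm k)" unfolding low_def by (intro allI impI gm_cong) simp

lemma low_mult: "low sg ==> low ta ==> low (%x. sg x \<otimes>\<^bsub>G\<^esub> ta x)"
 unfolding low_def by metis

lemma plot_into_D1: "(%x. sg x) ` B \<subseteq> D1 ==> sg ` B \<subseteq> U0" using D1(2) by auto

text \<open>The regularisation step. A parameter of \<open>sg\<close> is absorbed by slot 2 on the
  right of \<open>r\<close>, one of \<open>ta\<close> by slot 3 on the left of \<open>u\<close>. As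
  each argument of \<open>h\<close> involves only one of these slots, both motions can be performed
  at once and the locale \<open>smoothing\<close> applies.\<close>

lemma smooth_double:
 assumes sg: "plot M Q B sg" "sg ` B \<subseteq> D2" "low sg" and ta: "plot M Q B ta" "ta ` B \<subseteq> D2" "low ta"
  and h: "continuous_map TT euclideanreal (%(a, b). h a b)"
  and kp: "Cinf_on Q B kp" "!!x j. x : B ==> j : {2, 3} \<times> I ==> \<bar>x j - Qc j\<bar> > ro / 2 ==> kp x = 0"
 shows "Cinf_on Q B (ii (slot 2 @ slot 3) (%x. kp x * h (gm 2 x \<otimes>\<^bsub>G\<^esub> sg x) (ta x \<otimes>\<^bsub>G\<^esub> gm 3 x)))"
proof -
 interpret G: group G by (rule lieM(1))
 define js where "js = slot 2 @ slot 3"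
 have js: "distinct js" "set js = {2, 3} \<times> I" using slot[of 2] slot[of 3] by (auto simp: js_def)
 define ze0 where "ze0 x = gm 2 x \<otimes>\<^bsub>G\<^esub> sg x" for x
 define ze1 where "ze1 x = ta x \<otimes>\<^bsub>G\<^esub> gm 3 x" for x
 have p0: "plot M Q B ze0" and p1: "plot M Q B ze1" unfolding ze0_def ze1_def
  by (intro plot_mult[OF lieG] plot_gm sg ta; simp)+
 have sgD: "sg x : D2" "ta x : D2" if "x : B" for x using sg(2) ta(2) that by auto
 have r0: "ze0 x : D1" "ze1 x : D1" if "x : B" for x unfolding ze0_def ze1_def
  by (intro D2(4) gmD2 sgD that; simp)+
 have r0': "ze0 ` B \<subseteq> D1" "ze1 ` B \<subseteq> D1" using r0 by auto
 have cG: "a : carrier G" if "a : D2" for a using D_carrier(2) that by auto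
 have cD1: "a : U0" if "a : D1" for a using D1(2) that by auto
 define ex where "ex i = (4::nat, snd i)" for i :: "nat \<times> 'i"
 define Qp where "Qp i = insert (ex i) Q" for i
 define cp where "cp i = Qc(ex i := Qc i)" for i
 \<comment> \<open>Solution r' of r' sg(x) = r sg(x'), where x' is x with coordinate
   \<open>i\<close> replaced by the value stored at \<open>ex i\<close>. Likewise \<open>om1\<close>
   is the solution u' of ta(x) u' = ta(x') u.\<close>
 define om0 where "om0 i y = gm 2 (restrict y Q) \<otimes>\<^bsub>G\<^esub> sg ((restrict y Q)(i := y (ex i))) \<otimes>\<^bsub>G\<^esub> inv\<^bsub>G\<^esub> sg (restrict y Q)" for i y
 define om1 where "om1 i y = inv\<^bsub>G\<^esub> ta (restrict y Q) \<otimes>\<^bsub>G\<^esub> ta ((restrict y Q)(i := y (ex i))) \<otimes>\<^bsub>G\<^esub> gm 3 (restrict y Q)" for i y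
 have exQ: "ex i \<notin> Q" for i by (simp add: ex_def)
 have oQp: "openin (RR (Qp i)) (cube (Qp i) (cp i) ep)" for i
  by (rule openin_cube) (use finQ in \<open>simp add: Qp_def\<close>)
 have rB: "restrict y Q : B" "(restrict y Q)(i := y (ex i)) : B" if "y : cube (Qp i) (cp i) ep" "i : Q" for y i
 proof -
  have *: "\<bar>y kp - Qc kp\<bar> < ep" if "kp : Q" for kp
  proof -
   have "\<forall>kp\<in>Qp i. \<bar>y kp - cp i kp\<bar> < ep" using \<open>y : cube (Qp i) (cp i) ep\<close> unfolding mem_cube by blast
   moreover have "kp : Qp i" "kp ~= ex i" using that exQ[of i] unfolding Qp_def by blast+
   ultimately have "\<bar>y kp - cp i kp\<bar> < ep" by blast
   thus ?thesis using \<open>kp ~= ex i\<close> by (simp add: cp_def)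
  qed
  show rb: "restrict y Q : B" using * by (simp add: mem_cube)
  have "\<bar>y (ex i) - Qc i\<bar> < ep" using that(1) by (simp add: mem_cube Qp_def cp_def)
  thus "(restrict y Q)(i := y (ex i)) : B" by (intro upd_B'[OF rb that(2)])
 qed
 have pr1: "plot M (Qp i) (cube (Qp i) (cp i) ep) (%y. al (restrict y Q))"
  and pr2: "plot M (Qp i) (cube (Qp i) (cp i) ep) (%y. al ((restrict y Q)(i := y (ex i))))"
  if "plot M Q B al" "i : Q" for al i
 proof -
  show "plot M (Qp i) (cube (Qp i) (cp i) ep) (%y. al (restrict y Q))"
   by (rule plot_reparam[OF that(1) lieM(3) finQ oQp]) (use rB that in \<open>auto simp: Cinf_on_coord\<close>)
  show "plot M (Qp i) (cube (Qp i) (cp i) ep) (%y. al ((restrict y Q)(i := y (ex i))))"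
  proof (rule plot_reparam[OF that(1) lieM(3) finQ oQp])
   show "(%y. (restrict y Q)(i := y (ex i))) ` cube (Qp i) (cp i) ep \<subseteq> B" using rB(2) that by blast
   fix kp assume "kp : Q"
   thus "Cinf_on (Qp i) (cube (Qp i) (cp i) ep) (%y. ((restrict y Q)(i := y (ex i))) kp)"
    by (cases "kp = i") (simp_all add: Cinf_on_coord)
  qed
 qed
 have w0: "plot M (Qp i) (cube (Qp i) (cp i) ep) (om0 i)" "om0 i ` cube (Qp i) (cp i) ep \<subseteq> D1"
  and w1: "plot M (Qp i) (cube (Qp i) (cp i) ep) (om1 i)" "om1 i ` cube (Qp i) (cp i) ep \<subseteq> D1" if i: "i : Q" for i
 proof -
  show "plot M (Qp i) (cube (Qp i) (cp i) ep) (om0 i)" "plot M (Qp i) (cube (Qp i) (cp i) ep) (om1 i)"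
   unfolding om0_def om1_def by (intro plot_mult[OF lieG] plot_inv[OF lieG] pr1 pr2 plot_gm sg ta i; simp)+
  have "om0 i y : D1 & om1 i y : D1" if y: "y : cube (Qp i) (cp i) ep" for y
  proof -
   note b = rB[OF y i]
   show ?thesis unfolding om0_def om1_def
    by (intro conjI D2(5) D2(3) gmD2[OF b(1)] sgD[OF b(1)] sgD[OF b(2)]) simp_all
  qed
  thus "om0 i ` cube (Qp i) (cp i) ep \<subseteq> D1" "om1 i ` cube (Qp i) (cp i) ep \<subseteq> D1" by auto
 qed
 have rx: "restrict (x(ex i := t)) Q = x" if "x : B" for x i t
  using that exQ[of i] by (auto simp: mem_cube fun_eq_iff extensional_def)
 have w00: "om0 i (x(ex i := x i)) = gm 2 x" and w10: "om1 i (x(ex i := x i)) = gm 3 x" if x: "x : B" for x i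
  unfolding om0_def om1_def rx[OF x] using cG[OF sgD(1)[OF x]] cG[OF sgD(2)[OF x]] cG[OF gmD2[OF x]]
  by (simp_all add: G.m_assoc)
 have wt: "om0 i (x(ex i := t)) = gm 2 x \<otimes>\<^bsub>G\<^esub> sg (x(i := t)) \<otimes>\<^bsub>G\<^esub> inv\<^bsub>G\<^esub> sg x"
   "om1 i (x(ex i := t)) = inv\<^bsub>G\<^esub> ta x \<otimes>\<^bsub>G\<^esub> ta (x(i := t)) \<otimes>\<^bsub>G\<^esub> gm 3 x" if x: "x : B" for x i t
  unfolding om0_def om1_def rx[OF x] by simp_all
 define yk where "yk k g x = (%kp. if kp : {k} \<times> I then ph0 g (snd kp) else x kp)" for k g and x :: "nat \<times> 'i => real"
 have gmy: "gm k (yk k g x) = g" if "g : D1" for k g x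
 proof -
  have "(\<lambda>i\<in>I. yk k g x (k, i)) = ph0 g" using phi0_ext[OF cD1[OF that]] by (auto simp: yk_def fun_eq_iff extensional_def)
  thus ?thesis using inv_phi0[OF cD1[OF that]] by (simp add: gm_def)
 qed
 have ly: "al (yk k g x) = al x" if "low al" "k : {2, 3}" for al k g x
  by (rule low_eq[OF that(1)]) (use that(2) in \<open>auto simp: yk_def\<close>)
 have iQ: "i : Q" "fst i < 2" if "i : Q - set js" for i
  using that unfolding js(2) by (auto simp: less_Suc_eq numeral_eq_Suc)
 have move0: "ze0 (x(i := t)) = ze0 (yk 2 (om0 i (x(ex i := t))) x)" if x: "x : B" and xt: "x(i := t) : B" and i: "i : Q" "fst i < 2" for x i t
 proof -
  have "om0 i (x(ex i := t)) : D1"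
   unfolding wt(1)[OF x] by (intro D2(5) D2(3) gmD2 sgD x xt) simp
  hence "ze0 (yk 2 (om0 i (x(ex i := t))) x) = om0 i (x(ex i := t)) \<otimes>\<^bsub>G\<^esub> sg x"
   by (simp add: ze0_def gmy ly[OF sg(3)])
  also have "\<dots> = gm 2 x \<otimes>\<^bsub>G\<^esub> sg (x(i := t))"
   unfolding wt(1)[OF x] using cG[OF sgD(1)[OF x]] cG[OF sgD(1)[OF xt]] cG[OF gmD2[OF x, of 2]] by (simp add: G.m_assoc)
  also have "gm 2 x = gm 2 (x(i := t))" by (rule gm_cong) (use i in auto)
  finally show ?thesis by (simp only: ze0_def[of "x(i := t)"])
 qed
 have move1: "ze1 (x(i := t)) = ze1 (yk 3 (om1 i (x(ex i := t))) x)" if x: "x : B" and xt: "x(i := t) : B" and i: "i : Q" "fst i < 2" for x i t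
 proof -
  have "om1 i (x(ex i := t)) : D1"
   unfolding wt(2)[OF x] by (intro D2(5) D2(3) gmD2 sgD x xt) simp
  hence "ze1 (yk 3 (om1 i (x(ex i := t))) x) = ta x \<otimes>\<^bsub>G\<^esub> om1 i (x(ex i := t))"
   by (simp add: ze1_def gmy ly[OF ta(3)])
  also have "\<dots> = ta (x(i := t)) \<otimes>\<^bsub>G\<^esub> gm 3 x"
   unfolding wt(2)[OF x] using cG[OF sgD(2)[OF x]] cG[OF sgD(2)[OF xt]] cG[OF gmD2[OF x, of 3]] by (simp add: G.m_assoc[symmetric])
  also have "gm 3 x = gm 3 (x(i := t))" by (rule gm_cong) (use i in auto)
  finally show ?thesis by (simp only: ze1_def[of "x(i := t)"])
 qed
 have s0: "!!l. l : I ==> Cinf_on Q B (%x. pd (ex i) (%y. ph0 (om0 i y) l) (x(ex i := x i)))"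
  "!!x l. x : B ==> l : I ==> pd i (%x. ph0 (ze0 x) l) x =
    (\<Sum>l'\<in>I. pd (ex i) (%y. ph0 (om0 i y) l') (x(ex i := x i)) * pd (2, l') (%x. ph0 (ze0 x) l) x)"
  if i: "i : Q" "fst i < 2" for i
  by (rule slot_span[of i 2 ze0 "om0 i", folded ex_def, folded Qp_def cp_def, OF i(1) _ p0 r0'(1) w0[OF i(1)] w00 move0[OF _ _ i, unfolded yk_def]]; (assumption | simp))+
 have s1: "!!l. l : I ==> Cinf_on Q B (%x. pd (ex i) (%y. ph0 (om1 i y) l) (x(ex i := x i)))"
  "!!x l. x : B ==> l : I ==> pd i (%x. ph0 (ze1 x) l) x =
    (\<Sum>l'\<in>I. pd (ex i) (%y. ph0 (om1 i y) l') (x(ex i := x i)) * pd (3, l') (%x. ph0 (ze1 x) l) x)"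
  if i: "i : Q" "fst i < 2" for i
  by (rule slot_span[of i 3 ze1 "om1 i", folded ex_def, folded Qp_def cp_def, OF i(1) _ p1 r0'(2) w1[OF i(1)] w10 move1[OF _ _ i, unfolded yk_def]]; (assumption | simp))+
 define W2 where "W2 = {..<2::nat} \<times> I"
 \<comment> \<open>Both arguments of \<open>h\<close> in chart coordinates, packed into one vector
   as the locale \<open>smoothing\<close> expects.\<close>
 define Zm where "Zm x = pr I (ph0 (ze0 x)) (ph0 (ze1 x))" for x
 \<comment> \<open>The vector field replacing \<open>pd i\<close>: its slot-2 part is the velocity
   of \<open>om0\<close>, its slot-3 part that of \<open>om1\<close>.\<close>
 define a where "a i kp x = (if fst kp = 2 then pd (ex i) (%y. ph0 (om0 i y) (snd kp)) (x(ex i := x i))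
   else pd (ex i) (%y. ph0 (om1 i y) (snd kp)) (x(ex i := x i)))" for i and kp :: "nat \<times> 'i" and x
 define VV where "VV = {z : extensional W2. sl I 0 z : ph0 ` D1} \<inter> {z : extensional W2. sl I 1 z : ph0 ` D1}"
 have oD1: "openin (RR I) (ph0 ` D1)" using charted_chart(3)[OF lieM(3) U0 D1(2,1)] .
 have slc: "continuous_map (RR W2) (RR I) (sl I k)" if "k < 2" for k
  using continuous_map_product_coordinates[of _ W2 "%_. euclideanreal"] that
  by (intro continuous_map_coordinatewise_then_product) (auto simp: sl_def W2_def)
 have oV: "openin (RR W2) VV"
  unfolding VV_def using openin_continuous_map_preimage[OF slc[of 0] oD1] openin_continuous_map_preimage[OF slc[of 1] oD1]
  by (intro openin_Int) simp_all
 have phe: "ph0 (ze0 x) : extensional I" "ph0 (ze1 x) : extensional I" if "x : B" for x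
  using phi0_ext[OF cD1[OF r0(1)[OF that]]] phi0_ext[OF cD1[OF r0(2)[OF that]]] .
 have slZ: "sl I 0 (Zm x) = ph0 (ze0 x)" "sl I 1 (Zm x) = ph0 (ze1 x)" if "x : B" for x
  unfolding Zm_def using sl_pr(1)[OF phe(1)[OF that]] sl_pr(2)[OF phe(2)[OF that]] .
 have Zapp: "Zm x (0, l) = ph0 (ze0 x) l" "Zm x (Suc 0, l) = ph0 (ze1 x) l" if "l : I" for x l
  using pr_app[OF that] by (simp_all add: Zm_def)
 have sumY: "(\<Sum>kp\<in>set js. F kp) = (\<Sum>l\<in>I. F (2, l)) + (\<Sum>l\<in>I. F (3, l))" for F :: "nat \<times> 'i => real"
 proof -
  have "(\<Sum>kp\<in>set js. F kp) = (\<Sum>k\<in>{2::nat, 3}. \<Sum>l\<in>I. F (k, l))"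
   unfolding js(2) by (subst sum.cartesian_product) (simp add: case_prod_unfold)
  thus ?thesis by simp
 qed
 have triv: "set js \<subseteq> Q" "finite W2" "ro / 2 < ro"
  using js finI ro by (auto simp: W2_def)
 have ZB: "Zm ` B \<subseteq> VV"
 proof (rule image_subsetI)
  fix x assume x: "x : B"
  show "Zm x : VV" unfolding VV_def using slZ[OF x] r0[OF x] pr_ext by (auto simp: Zm_def W2_def)
 qed
 have Zc: "Cinf_on Q B (%x. Zm x z)" if zW: "z : W2" for z
 proof -
  obtain k l where k: "z = (k, l)" "k < 2" "l : I" using zW by (auto simp: W2_def)
  have z0: "Cinf_on Q B (%x. Zm x (0, l))" unfolding Zapp[OF k(3)] by (rule plot_chart[OF p0 U0 plot_into_D1[OF r0'(1)] k(3)])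
  have z1: "Cinf_on Q B (%x. Zm x (Suc 0, l))" unfolding Zapp[OF k(3)] by (rule plot_chart[OF p1 U0 plot_into_D1[OF r0'(2)] k(3)])
  show ?thesis
  proof (cases "k = 0")
   case True
   show ?thesis unfolding k(1) True by (rule z0)
  next
   case False
   hence k1: "k = Suc 0" using k(2) by linarith
   show ?thesis unfolding k(1) k1 by (rule z1)
  qed
 qed
 have ac: "Cinf_on Q B (a i k)" if ij: "i : Q - set js" and kj: "k : set js" for i k
 proof -
  have k: "snd k : I" using kj unfolding js(2) by (simp add: mem_Times_iff)
  show ?thesis
  proof (cases "fst k = 2")
   case True
   have e: "a i k = (%x. pd (ex i) (%y. ph0 (om0 i y) (snd k)) (x(ex i := x i)))"
    by (rule ext, unfold a_def, rule if_P[OF True])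
   show ?thesis unfolding e by (rule s0(1)[OF iQ[OF ij] k])
  next
   case False
   have e: "a i k = (%x. pd (ex i) (%y. ph0 (om1 i y) (snd k)) (x(ex i := x i)))"
    by (rule ext, unfold a_def, rule if_not_P[OF False])
   show ?thesis unfolding e by (rule s1(1)[OF iQ[OF ij] k])
  qed
 qed
 have spanc: "pd i (%x. Zm x z) x = (\<Sum>k\<in>set js. a i k x * pd k (%x. Zm x z) x)"
  if i: "i : Q - set js" and z: "z : W2" and x: "x : B" for i z x
 proof -
  obtain k l where k: "z = (k, l)" "k < 2" "l : I" using z by (auto simp: W2_def)
  have num32: "(3::nat) = 2 \<longleftrightarrow> False" by simp
  \<comment> \<open>The first argument ignores slot 3 and the second ignores slot 2. Hence one
    vector field serves both, the part belonging to the other slot multiplying zero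
    derivatives.\<close>
  have c0: "ze0 (x((3, l') := t)) = ze0 x" for l' t
   unfolding ze0_def using low_eq[OF sg(3), of "x((3, l') := t)" x] gm_cong[of "x((3, l') := t)" 2 x] by simp
  have c1: "ze1 (x((2, l') := t)) = ze1 x" for l' t
   unfolding ze1_def using low_eq[OF ta(3), of "x((2, l') := t)" x] gm_cong[of "x((2, l') := t)" 3 x] by simp
  show ?thesis
  proof (cases "k = 0")
   case True
   have "pd (3, l') (%x. ph0 (ze0 x) l) x = 0" for l' unfolding partial_deriv_def c0 by simp
   thus ?thesis using s0(2)[OF iQ[OF i] x k(3)] unfolding k(1) True Zapp[OF k(3)] sumY a_def fst_conv snd_conv
    by (simp only: if_True simp_thms zero_neq_one mult_zero_right sum.neutral_const add_0_right)
  next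
   case False
   hence k1: "k = Suc 0" using k by simp
   have "pd (2, l') (%x. ph0 (ze1 x) l) x = 0" for l' unfolding partial_deriv_def c1 by simp
   thus ?thesis using s1(2)[OF iQ[OF i] x k(3)] unfolding k(1) k1 Zapp[OF k(3)] sumY a_def fst_conv snd_conv
    by (simp only: if_False num32 mult_zero_right sum.neutral_const add_0_left)
  qed
 qed
 interpret sm: smoothing Q Qc ep ro js W2 Zm VV a "ro / 2"
 by (rule smoothing.intro[OF int_cube_axioms smoothing_axioms.intro[OF js(1) triv(1,2) oV ZB Zc ac spanc triv(3)]])
 define hh where "hh z = h (inv_into U0 ph0 (sl I 0 z)) (inv_into U0 ph0 (sl I 1 z))" for z
 have invc: "continuous_map (subtopology (RR W2) VV) (mtop M) (%z. inv_into U0 ph0 (sl I k z))" if k: "k < 2" for k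
 proof -
  have "k = 0 \<or> k = 1" using k by linarith
  hence "sl I k ` VV \<subseteq> ph0 ` D1" unfolding VV_def by (elim disjE) auto
  hence "sl I k ` VV \<subseteq> ph0 ` U0" using image_mono[OF D1(2), of ph0] by (rule subset_trans)
  hence "continuous_map (subtopology (RR W2) VV) (subtopology (RR I) (ph0 ` U0)) (sl I k)"
   using continuous_map_from_subtopology[OF slc[OF k]] by (auto simp: continuous_map_in_subtopology)
  from continuous_map_compose[OF this plot_cont[OF chart_plot[OF lieM(2) U0]]] show ?thesis by (simp add: o_def)
 qed
 have invD: "inv_into U0 ph0 p : D1" if "p : ph0 ` D1" for p using that inv_phi0 cD1 by auto
 have "continuous_map (subtopology (RR W2) VV) TT (%z. (inv_into U0 ph0 (sl I 0 z), inv_into U0 ph0 (sl I 1 z)))"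
  unfolding continuous_map_in_subtopology
 proof
  show "continuous_map (subtopology (RR W2) VV) (prod_topology (mtop M) (mtop M)) (%z. (inv_into U0 ph0 (sl I 0 z), inv_into U0 ph0 (sl I 1 z)))"
   using invc[of 0] invc[of 1] by (simp add: continuous_map_paired)
 qed (auto simp: VV_def intro!: invD)
 from continuous_map_compose[OF this h] have "continuous_map (subtopology (RR W2) VV) euclideanreal hh"
  by (simp add: o_def hh_def[abs_def])
 hence "continuous_on VV hh"
  unfolding continuous_map_powertop_real_iff using openin_subset_extensional[OF oV] by (simp add: Int_absorb1)
 moreover have "sm.supp kp" unfolding sm.supp_def using kp(2) js(2) by auto
 ultimately have "Cinf_on Q B (ii js (%x. kp x * hh (Zm x)))" using sm.smoothing kp(1) by blast
 moreover have "ii js (%x. kp x * h (gm 2 x \<otimes>\<^bsub>G\<^esub> sg x) (ta x \<otimes>\<^bsub>G\<^esub> gm 3 x)) x = ii js (%x. kp x * hh (Zm x)) x" if x: "x : B" for x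
 proof (rule iint_cong[OF _ _ x])
  fix y assume y: "y : B"
  show "kp y * h (gm 2 y \<otimes>\<^bsub>G\<^esub> sg y) (ta y \<otimes>\<^bsub>G\<^esub> gm 3 y) = kp y * hh (Zm y)"
   unfolding hh_def slZ[OF y] using inv_phi0[OF cD1[OF r0(1)[OF y]]] inv_phi0[OF cD1[OF r0(2)[OF y]]]
   by (simp add: ze0_def ze1_def)
 qed (use js in auto)
 ultimately show ?thesis unfolding js_def[symmetric]
  by (simp add: Cinf_on_cong[OF openB, of "ii js (%x. kp x * h (gm 2 x \<otimes>\<^bsub>G\<^esub> sg x) (ta x \<otimes>\<^bsub>G\<^esub> gm 3 x))" "ii js (%x. kp x * hh (Zm x))"])
qed

end

lemma smooth_moduleD:
 assumes "smooth_module G M A N act" "lie_group G M"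
 shows "!!g a. g : carrier G ==> a : carrier A ==> act g a : carrier A"
  "!!g a b. g : carrier G ==> a : carrier A ==> b : carrier A ==> act g (a \<otimes>\<^bsub>A\<^esub> b) = act g a \<otimes>\<^bsub>A\<^esub> act g b"
  "!!g h a. g : carrier G ==> h : carrier G ==> a : carrier A ==> act (g \<otimes>\<^bsub>G\<^esub> h) a = act g (act h a)"
  "!!a. a : carrier A ==> act \<one>\<^bsub>G\<^esub> a = a"
proof -
 have A: "comm_group A" and h: "act : hom G (AutoGroup A)" using assms(1) by (auto simp: smooth_module_def)
 interpret A: comm_group A by (rule A)
 interpret G: group G using assms(2) by (simp add: lie_group_def)
 have au: "act g : auto A" if "g : carrier G" for g
  using h that by (auto simp: hom_def AutoGroup_def)
 show cl: "act g a : carrier A" if "g : carrier G" "a : carrier A" for g a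
  using au[OF that(1)] that(2) by (auto simp: auto_def hom_def)
 show "act g (a \<otimes>\<^bsub>A\<^esub> b) = act g a \<otimes>\<^bsub>A\<^esub> act g b" if "g : carrier G" "a : carrier A" "b : carrier A" for g a b
  using au[OF that(1)] that by (auto simp: auto_def hom_def)
 show cm: "act (g \<otimes>\<^bsub>G\<^esub> h') a = act g (act h' a)" if "g : carrier G" "h' : carrier G" "a : carrier A" for g h' a
 proof -
  have "act (g \<otimes>\<^bsub>G\<^esub> h') = act g \<otimes>\<^bsub>AutoGroup A\<^esub> act h'" using h that by (auto simp: hom_def)
  also have "\<dots> = compose (carrier A) (act g) (act h')"
   using au[OF that(1)] au[OF that(2)] by (simp add: AutoGroup_def BijGroup_def auto_def)
  finally show ?thesis using that by (simp add: compose_def)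
 qed
 show "act \<one>\<^bsub>G\<^esub> a = a" if a: "a : carrier A" for a
 proof -
  \<comment> \<open>The action of the unit is idempotent and injective, hence the identity.\<close>
  have e: "act \<one>\<^bsub>G\<^esub> (act \<one>\<^bsub>G\<^esub> a) = act \<one>\<^bsub>G\<^esub> a" using cm[of "\<one>\<^bsub>G\<^esub>" "\<one>\<^bsub>G\<^esub>" a] a by simp
  have "inj_on (act \<one>\<^bsub>G\<^esub>) (carrier A)" using au[of "\<one>\<^bsub>G\<^esub>"] by (auto simp: auto_def Bij_def bij_betw_def)
  from inj_onD[OF this e] show ?thesis using cl a by simp
 qed
qed

text \<open>\<open>\<eta>0\<close> is so small that the action of \<open>D1\<close> keeps
  exponentials of its ball in the domain of the logarithm with a factor 8 to spare, the room
  consumed by the few sums formed below.\<close>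

locale coh_data = coh_box A N U ps r s \<delta> L e G M act U0 ph0 D1 D2 ep ro
 for A :: "('a, 'd) monoid_scheme" and N :: "('a, 'j) manifold" and U and ps and r s \<delta> :: real and L e
  and G :: "('g, 'c) monoid_scheme" and M :: "('g, 'i) manifold" and act and U0 and ph0 and D1 D2 and ep ro +
 fixes \<eta>0 :: real
 assumes \<eta>0: "0 < \<eta>0" "8 * \<eta>0 <= \<delta>"
  and act_small: "!!g v. g : D1 ==> v : NB \<eta>0 ==> act g (Eg v) : Eg ` NB (\<delta> / 8)"
  and products_D2: "!!x k l. x : qbox ep ==> k < 4 ==> l < 4 ==> gm k x \<otimes>\<^bsub>G\<^esub> gm l x : D2"
begin

text \<open>Radius on which the action is linear in logarithmic coordinates. It lies strictly below
  \<open>\<eta>0\<close> because \<open>bounded_additive_coords\<close> needs the margin.\<close>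

definition ta :: real where "ta = \<eta>0 / 2"
text \<open>Size allowed for cochains: a vector with all coordinates at most \<open>\<eta>\<close>
  has sum norm below \<open>ta / 8\<close>, also when \<open>J\<close> is empty.\<close>

definition \<eta> :: real where "\<eta> = ta / (8 * (real (card J) + 1))"

lemma sizes: "0 < ta" "ta < \<eta>0" "0 < \<eta>" "real (card J) * \<eta> < ta / 8" "\<eta> <= ta / 8" "16 * ta <= \<delta>" "0 < \<delta>"
proof -
 show t: "0 < ta" "ta < \<eta>0" using \<eta>0 by (auto simp: ta_def)
 show e: "0 < \<eta>" using t by (simp add: \<eta>_def)
 have h: "(real (card J) + 1) * \<eta> = ta / 8" by (simp add: \<eta>_def field_simps)
 thus "real (card J) * \<eta> < ta / 8" using e by (simp add: distrib_right)
 have "0 <= real (card J) * \<eta>" using e by simp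
 thus "\<eta> <= ta / 8" using h by (simp add: distrib_right)
 show "16 * ta <= \<delta>" "0 < \<delta>" using \<eta>0 by (auto simp: ta_def)
qed

lemma gmD1: "x : B ==> k < 4 ==> gm k x : D1" using gmD2 D2(1) by blast

lemma NB_\<delta>: "p <= \<delta> ==> v : NB p ==> v : NB \<delta>" by (simp add: nball_def)

lemma G_carrier: "a : D2 ==> a : carrier G" "a : D1 ==> a : carrier G" using D_carrier by auto

text \<open>The matrix of the action of \<open>g\<close> in logarithmic coordinates, with column
  \<open>k\<close> read off at the vector of length \<open>ta\<close> on the axis
  \<open>k\<close>.\<close>

definition Lm :: "'g => 'j => 'j => real" where
 "Lm g j k = Lg (act g (Eg (\<lambda>i\<in>J. if i = k then ta else 0))) j / ta"

text \<open>An automorphism is additive in logarithmic coordinates, and by the choice of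
  \<open>\<eta>0\<close> it is bounded there; bounded additive maps are linear.\<close>

lemma act_linear:
 assumes g: "g : D1" and v: "v : NB ta" and j: "j : J"
 shows "Lg (act g (Eg v)) j = (\<Sum>k\<in>J. Lm g j k * v k)"
 unfolding Lm_def
proof (rule bounded_additive_coords[where T = "%v. Lg (act g (Eg v)) j" and \<eta> = \<eta>0 and C = "\<delta> / 8", OF finJ sizes(1,2) _ _ v])
 have gc: "g : carrier G" using g D_carrier by auto
 fix v w assume v: "v : NB \<eta>0" and w: "w : NB \<eta>0" and vw: "(\<lambda>j\<in>J. v j + w j) : NB \<eta>0"
 have l: "\<eta>0 <= \<delta>" using \<eta>0 by simp
 have "act g (Eg (\<lambda>j\<in>J. v j + w j)) = act g (Eg v) \<otimes>\<^bsub>A\<^esub> act g (Eg w)"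
  unfolding Eg_add[OF NB_\<delta>[OF l v] NB_\<delta>[OF l w] NB_\<delta>[OF l vw]]
  by (rule smooth_moduleD(2)[OF mod lieG gc Eg_carrier[OF NB_\<delta>[OF l v]] Eg_carrier[OF NB_\<delta>[OF l w]]])
 thus "Lg (act g (Eg (\<lambda>j\<in>J. v j + w j))) j = Lg (act g (Eg v)) j + Lg (act g (Eg w)) j"
  using Lg_mult(2)[OF act_small[OF g v] act_small[OF g w] _ _ _ j] sizes(7) by simp
next
 fix v assume v: "v : NB \<eta>0"
 have "Lg (act g (Eg v)) : NB (\<delta> / 8)" by (rule Lg_in[OF act_small[OF g v]]) (use sizes in simp)
 thus "\<bar>Lg (act g (Eg v)) j\<bar> <= \<delta> / 8"
  using coord_le_nrm[OF finJ j, of "Lg (act g (Eg v))"] by (simp add: nball_def)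
qed

lemma Lm_smooth:
 assumes g: "plot M P V g" "g ` V \<subseteq> D1" and j: "j : J" and k: "k : J"
 shows "Cinf_on P V (%x. Lm (g x) j k)"
proof -
 define v where "v = (\<lambda>i\<in>J. if i = k then ta else 0)"
 have v: "v : NB \<eta>0" using nrm_single[OF finJ k, of ta] sizes by (simp add: v_def nball_def)
 have vc: "Eg v : topspace (mtop N)" using Eg_carrier[OF NB_\<delta>[OF _ v]] \<eta>0 lieN(4) by simp
 have p: "plot N P V (%x. act (g x) (Eg v))"
  by (rule plot_act[OF lieG mod g(1) plot_const[OF plot_open[OF g(1)] vc]])
 have "Cinf_on P V (%x. Lg (act (g x) (Eg v)) j)"
 proof (rule plot_Lg[OF p _ j])
  have "Eg ` NB (\<delta> / 8) \<subseteq> Eg ` NB \<delta>" by (rule Eg_NB_mono) (use sizes in simp)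
  thus "(%x. act (g x) (Eg v)) ` V \<subseteq> Eg ` NB \<delta>" using act_small[OF _ v] g(2) by blast
 qed
 hence "Cinf_on P V (%x. Lg (act (g x) (Eg v)) j * (1 / ta))"
  by (rule Cinf_on_mult[OF plot_open[OF g(1)] _ Cinf_on_const])
 thus ?thesis by (simp add: Lm_def v_def)
qed

abbreviation "us \<equiv> slot 3"
abbreviation "rs \<equiv> slot 2"
abbreviation "muu \<equiv> bump ro Qc us"
abbreviation "mur \<equiv> bump ro Qc rs"

lemma slot_sub: "k < 4 ==> set (slot k) \<subseteq> Q" using slot(2) by auto

lemma mu_props: "Cinf_on Q B (bump ro Qc (slot k))" "x : B ==> bump ro Qc (slot k) x >= 0" "ii (slot k) (bump ro Qc (slot k)) x = 1"
 by (rule Cinf_bump[OF openB], rule bump_nonneg[OF ro(1)], rule iint_bump[OF ro(1) slot(1)])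

lemma mu_cont: "continuous_on B (bump ro Qc (slot k))" by (rule Cinf_contB[OF mu_props(1)])

lemma average_const: "ii (slot k) (%x. bump ro Qc (slot k) x * C) x = C"
 using iint_cmult[of "slot k" C "bump ro Qc (slot k)" x] mu_props(3) by (simp add: mult.commute)

text \<open>Like \<open>low\<close>, with an adjustable number of slots and arbitrary values;
  \<open>below 3\<close> says that averaging over \<open>u\<close> has no effect.\<close>

definition below :: "nat => ((nat \<times> 'i => real) => 'x) => bool" where
 "below k al \<longleftrightarrow> (\<forall>x y. (\<forall>l<k. \<forall>i\<in>I. x (l, i) = y (l, i)) --> al x = al y)"

lemma belowD: "below k al ==> (!!l i. l < k ==> i : I ==> x (l, i) = y (l, i)) ==> al x = al y"
 unfolding below_def by simp

lemma below_const: "below k (%x. c)" by (simp add: below_def)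

lemma below_gm: "l < k ==> below k (gm l)" unfolding below_def by (intro allI impI gm_cong) simp

lemma below_mult: "below k al ==> below k be ==> below k (%x. al x \<otimes>\<^bsub>G\<^esub> be x)"
 unfolding below_def by metis

lemma average_transfer:
 assumes "!!z. (!!i. i : I ==> z (k, i) = z (k, i)) ==>
   g (%kp. if kp : {k} \<times> I then z kp else x kp) = g' (%kp. if kp : {k} \<times> I then z kp else x' kp)"
 shows "ii (slot k) (%y. bump ro Qc (slot k) y * g y) x = ii (slot k) (%y. bump ro Qc (slot k) y * g' y) x'"
proof (rule iint_transfer, unfold slot(2))
 fix z
 have "bump ro Qc (slot k) (%kp. if kp : {k} \<times> I then z kp else x kp) = bump ro Qc (slot k) (%kp. if kp : {k} \<times> I then z kp else x' kp)"
  unfolding bump_def slot(2) by (rule prod.cong) auto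
 thus "bump ro Qc (slot k) (%kp. if kp : {k} \<times> I then z kp else x kp) * g (%kp. if kp : {k} \<times> I then z kp else x kp) =
   bump ro Qc (slot k) (%kp. if kp : {k} \<times> I then z kp else x' kp) * g' (%kp. if kp : {k} \<times> I then z kp else x' kp)"
  using assms[of z] by simp
qed

lemma average_bound:
 assumes "continuous_on B g" "!!x. x : B ==> \<bar>g x\<bar> <= C" "x : B" "k < 4"
 shows "\<bar>ii (slot k) (%x. bump ro Qc (slot k) x * g x) x\<bar> <= C"
 by (rule iint_weighted_bound[OF mu_cont mu_props(2) mu_props(3) assms(1,2) slot_sub[OF assms(4)] assms(3)])

lemma continuous_plots:
 assumes h: "continuous_map TT euclideanreal (%(a, b). h a b)"
  and al: "plot M Q B al" "!!x. x : B ==> al x : D1" and be: "plot M Q B be" "!!x. x : B ==> be x : D1"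
 shows "continuous_on B (%x. h (al x) (be x))"
proof -
 have "continuous_map (subtopology (RR Q) B) TT (%x. (al x, be x))"
  unfolding continuous_map_in_subtopology using plot_cont[OF al(1)] plot_cont[OF be(1)] al(2) be(2)
  by (auto simp: continuous_map_paired)
 from continuous_map_compose[OF this h]
 have "continuous_map (subtopology (RR Q) B) euclideanreal (%x. h (al x) (be x))" by (simp add: o_def)
 thus ?thesis unfolding continuous_map_powertop_real_iff using B_ext by (simp add: Int_absorb1)
qed

lemma base_B: "restrict Qc Q : B" using ro by (simp add: mem_cube)

lemma small_vector:
 assumes "!!j. j : J ==> \<bar>v j\<bar> <= c * \<eta>" "0 < c"
 shows "(\<lambda>j\<in>J. v j) : NB (c * (ta / 8))"
proof -
 have "nrm J (\<lambda>j\<in>J. v j) <= real (card J) * (c * \<eta>)"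
  unfolding nrm_def by (rule sum_bounded_above) (use assms in auto)
 also have "\<dots> = c * (real (card J) * \<eta>)" by simp
 also have "\<dots> < c * (ta / 8)" by (rule mult_strict_left_mono[OF sizes(4) assms(2)])
 finally show ?thesis by (simp add: nball_def)
qed

text \<open>The factor \<open>w\<close> does not see slot 3, so the nested averages form one
  integral over slots 2 and 3 with the smooth weight \<open>mur * w * muu\<close>, to which
  \<open>smooth_double\<close> applies.\<close>

lemma double_average_smooth:
 assumes w: "Cinf_on Q B w" "below 3 w"
  and sg: "plot M Q B sg" "sg ` B \<subseteq> D2" "low sg" and be: "plot M Q B be" "be ` B \<subseteq> D2" "low be"
  and h: "continuous_map TT euclideanreal (%(a, b). h a b)"
 shows "Cinf_on Q B (ii rs (%y. mur y * (w y * ii us (%y. muu y * h (gm 2 y \<otimes>\<^bsub>G\<^esub> sg y) (be y \<otimes>\<^bsub>G\<^esub> gm 3 y)) y)))"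
proof -
 define kp where "kp y = mur y * w y * muu y" for y
 have k: "Cinf_on Q B kp" unfolding kp_def by (intro Cinf_on_mult[OF openB] mu_props(1) w)
 have k0: "kp x = 0" if "x : B" "j : {2, 3} \<times> I" "\<bar>x j - Qc j\<bar> > ro / 2" for x j
 proof -
  have "j : set rs \<or> j : set us" using that(2) slot(2)[of 2] slot(2)[of 3] by auto
  thus ?thesis using bump_eq_0[of j rs ro x Qc] bump_eq_0[of j us ro x Qc] that(3) by (auto simp: kp_def)
 qed
 have u: "mur (y(j := t)) * w (y(j := t)) = mur y * w y" if ju: "j : set us" for y j t
 proof -
  obtain i where j: "j = (3, i)" using ju slot(2)[of 3] by auto
  have "w (y(j := t)) = w y" by (rule belowD[OF w(2)]) (auto simp: j)
  moreover have "mur (y(j := t)) = mur y" by (rule bump_upd) (use slot(2)[of 2] in \<open>auto simp: j\<close>)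
  ultimately show ?thesis by simp
 qed
 have "ii us (%y. kp y * h (gm 2 y \<otimes>\<^bsub>G\<^esub> sg y) (be y \<otimes>\<^bsub>G\<^esub> gm 3 y)) y = mur y * (w y * ii us (%y. muu y * h (gm 2 y \<otimes>\<^bsub>G\<^esub> sg y) (be y \<otimes>\<^bsub>G\<^esub> gm 3 y)) y)" for y
  using iint_pull[of us "%y. mur y * w y", OF u, of ro Qc "%y. muu y * h (gm 2 y \<otimes>\<^bsub>G\<^esub> sg y) (be y \<otimes>\<^bsub>G\<^esub> gm 3 y)" y]
  by (simp add: kp_def mult.assoc)
 hence "ii (rs @ us) (%y. kp y * h (gm 2 y \<otimes>\<^bsub>G\<^esub> sg y) (be y \<otimes>\<^bsub>G\<^esub> gm 3 y)) =
   ii rs (%y. mur y * (w y * ii us (%y. muu y * h (gm 2 y \<otimes>\<^bsub>G\<^esub> sg y) (be y \<otimes>\<^bsub>G\<^esub> gm 3 y)) y))"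
  unfolding iint_append by (intro arg_cong[where f = "ii rs"] ext)
 thus ?thesis using smooth_double[OF sg be h k k0] by simp
qed

text \<open>In logarithmic coordinates the averaged action term is the matrix \<open>Lm\<close> of
  the parameter times a constant vector, and the averaged coboundary is an integral of smooth
  functions. Only the average of b(su) calls for the smoothing theorem.\<close>

theorem smooth_primitive:
 assumes bc: "!!j. j : J ==> continuous_map (subtopology (mtop M) D1) euclideanreal (%a. Lg (b a) j)"
  and bs: "!!a. a : D1 ==> b a : Eg ` NB \<eta>"
  and db: "plot N Q B (%x. act (gm 0 x) (b (gm 3 x)) \<otimes>\<^bsub>A\<^esub> inv\<^bsub>A\<^esub> b (gm 0 x \<otimes>\<^bsub>G\<^esub> gm 3 x) \<otimes>\<^bsub>A\<^esub> b (gm 0 x))"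
 shows "plot N Q B (%x. b (gm 0 x))"
proof -
 interpret A: comm_group A by (rule A)
 interpret G: group G by (rule lieM(1))
 define F where "F x = act (gm 0 x) (b (gm 3 x)) \<otimes>\<^bsub>A\<^esub> inv\<^bsub>A\<^esub> b (gm 0 x \<otimes>\<^bsub>G\<^esub> gm 3 x) \<otimes>\<^bsub>A\<^esub> b (gm 0 x)" for x
 note c = sizes
 have gg: "gm 0 x \<otimes>\<^bsub>G\<^esub> gm 3 x : D1" if "x : B" for x by (intro D2(4) gmD2 that; simp)
 have bE: "b a : Eg ` NB \<delta>" if "a : D1" for a using bs[OF that] Eg_NB_mono[of \<eta> \<delta>] c by auto
 have bv: "Lg (b a) : NB ta" "b a = Eg (Lg (b a))" if "a : D1" for a
 proof -
  have "Lg (b a) : NB \<eta>" by (rule Lg_in[OF bs[OF that]]) (use c in simp)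
  thus "Lg (b a) : NB ta" using c by (simp add: nball_def)
  show "b a = Eg (Lg (b a))" using Eg_Lg[OF bE[OF that]] by simp
 qed
 have F: "F x : Eg ` NB \<delta>" "!!j. j : J ==> Lg (F x) j = (\<Sum>k\<in>J. Lm (gm 0 x) j k * Lg (b (gm 3 x)) k) - Lg (b (gm 0 x \<otimes>\<^bsub>G\<^esub> gm 3 x)) j + Lg (b (gm 0 x)) j"
  if x: "x : B" for x
 proof -
  have g0: "gm 0 x : D1" and g3: "gm 3 x : D1" by (intro gmD1 x; simp)+
  have "act (gm 0 x) (Eg (Lg (b (gm 3 x)))) : Eg ` NB (\<delta> / 8)"
   by (rule act_small[OF g0]) (use bv(1)[OF g3] c in \<open>simp add: nball_def\<close>)
  hence a1: "act (gm 0 x) (b (gm 3 x)) : Eg ` NB (\<delta> / 8)" using bv(2)[OF g3] by simp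
  have i1: "inv\<^bsub>A\<^esub> b (gm 0 x \<otimes>\<^bsub>G\<^esub> gm 3 x) : Eg ` NB \<eta>"
   "!!j. j : J ==> Lg (inv\<^bsub>A\<^esub> b (gm 0 x \<otimes>\<^bsub>G\<^esub> gm 3 x)) j = - Lg (b (gm 0 x \<otimes>\<^bsub>G\<^esub> gm 3 x)) j"
   using Lg_inv[OF bs[OF gg[OF x]]] c by auto
  have m1: "act (gm 0 x) (b (gm 3 x)) \<otimes>\<^bsub>A\<^esub> inv\<^bsub>A\<^esub> b (gm 0 x \<otimes>\<^bsub>G\<^esub> gm 3 x) : Eg ` NB (\<delta> / 8 + \<eta>)"
   "!!j. j : J ==> Lg (act (gm 0 x) (b (gm 3 x)) \<otimes>\<^bsub>A\<^esub> inv\<^bsub>A\<^esub> b (gm 0 x \<otimes>\<^bsub>G\<^esub> gm 3 x)) j =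
     Lg (act (gm 0 x) (b (gm 3 x))) j + Lg (inv\<^bsub>A\<^esub> b (gm 0 x \<otimes>\<^bsub>G\<^esub> gm 3 x)) j"
   using Lg_mult[OF a1 i1(1)] c by auto
  have m2: "F x : Eg ` NB (\<delta> / 8 + \<eta> + \<eta>)"
   "!!j. j : J ==> Lg (F x) j = Lg (act (gm 0 x) (b (gm 3 x)) \<otimes>\<^bsub>A\<^esub> inv\<^bsub>A\<^esub> b (gm 0 x \<otimes>\<^bsub>G\<^esub> gm 3 x)) j + Lg (b (gm 0 x)) j"
   unfolding F_def using Lg_mult[OF m1(1) bs[OF g0]] c by auto
  show "F x : Eg ` NB \<delta>" using m2(1) Eg_NB_mono[of "\<delta> / 8 + \<eta> + \<eta>" \<delta>] c by auto
  have "Lg (act (gm 0 x) (b (gm 3 x))) j = (\<Sum>k\<in>J. Lm (gm 0 x) j k * Lg (b (gm 3 x)) k)" if "j : J" for j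
   using act_linear[OF g0 bv(1)[OF g3] that] bv(2)[OF g3] by simp
  thus "Lg (F x) j = (\<Sum>k\<in>J. Lm (gm 0 x) j k * Lg (b (gm 3 x)) k) - Lg (b (gm 0 x \<otimes>\<^bsub>G\<^esub> gm 3 x)) j + Lg (b (gm 0 x)) j"
   if "j : J" for j using m2(2)[OF that] m1(2)[OF that] i1(2)[OF that] that by simp
 qed
 have FC: "Cinf_on Q B (%x. Lg (F x) j)" if "j : J" for j
  by (rule plot_Lg[OF _ _ that]) (use db F(1) in \<open>auto simp: F_def\<close>)
 have hc: "continuous_map TT euclideanreal (%(a, a'). Lg (b a') j)" if j: "j : J" for j
 proof -
  have "continuous_map TT (subtopology (mtop M) D1) snd"
   by (auto simp: continuous_map_in_subtopology intro: continuous_map_from_subtopology continuous_map_snd)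
  from continuous_map_compose[OF this bc[OF j]] show ?thesis by (simp add: o_def case_prod_unfold)
 qed
 have pg: "plot M Q B (gm 0)" "plot M Q B (gm 3)" by (rule plot_gm, simp)+
 have pgg: "plot M Q B (%x. gm 0 x \<otimes>\<^bsub>G\<^esub> gm 3 x)" by (rule plot_mult[OF lieG pg])
 have one: "plot M Q B (%x. \<one>\<^bsub>G\<^esub>)" by (rule plot_const[OF openB]) (use lieM(4) in simp)
 have contb: "continuous_on B (%x. Lg (b (al x)) j)" if "j : J" "plot M Q B al" "!!x. x : B ==> al x : D1" for al j
  using continuous_plots[OF hc[OF that(1)] that(2,3) that(2,3)] .
 have LmC: "Cinf_on Q B (%x. Lm (gm 0 x) j k)" if "j : J" "k : J" for j k
  by (rule Lm_smooth[OF pg(1) _ that]) (use gmD1 in auto)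
 have main: "Cinf_on Q B (%x. Lg (b (gm 0 x)) j)" if j: "j : J" for j
 proof -
  \<comment> \<open>\<open>T\<close>, \<open>S\<close> and \<open>R\<close> are the averages over
    \<open>u\<close> of b(su), b(u) and of the coboundary.\<close>
  define T where "T = ii us (%y. muu y * Lg (b (gm 0 y \<otimes>\<^bsub>G\<^esub> gm 3 y)) j)"
  define S where "S k = ii us (%y. muu y * Lg (b (gm 3 y)) k)" for k
  define R where "R = ii us (%y. muu y * Lg (F y) j)"
  have T: "Cinf_on Q B T"
  proof -
   \<comment> \<open>The two-variable theorem is used with a function of its second argument only.
     The surplus average over slot 2 has total weight 1 and changes nothing.\<close>
   have "Cinf_on Q B (ii rs (%y. mur y * (1 * ii us (%y. muu y * Lg (b (gm 0 y \<otimes>\<^bsub>G\<^esub> gm 3 y)) j) y)))"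
    by (rule double_average_smooth[where h = "%a a'. Lg (b a') j" and sg = "%x. \<one>\<^bsub>G\<^esub>" and be = "gm 0", OF Cinf_on_const below_const one _ low_const pg(1) _ low_gm hc[OF j]])
     (use D2(2) gmD2 in auto)
   hence "Cinf_on Q B (ii rs (%y. mur y * (1 * T y)))" unfolding T_def .
   moreover have "ii rs (%y. mur y * (1 * T y)) = T"
   proof (rule ext)
    fix x
    have "T (y(l := t)) = T y" if lr: "l : set rs" for y l t
    proof -
     obtain i where l: "l = (2, i)" using lr slot(2)[of 2] by auto
     show ?thesis unfolding T_def
     proof (rule average_transfer)
      fix z
      have "gm m (%kp. if kp : {3} \<times> I then z kp else (y(l := t)) kp) = gm m (%kp. if kp : {3} \<times> I then z kp else y kp)" if "m ~= 2" for m
       by (rule gm_cong) (use that in \<open>auto simp: l\<close>)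
      from this[of 0] this[of 3]
      show "Lg (b (gm 0 (%kp. if kp : {3} \<times> I then z kp else (y(l := t)) kp) \<otimes>\<^bsub>G\<^esub> gm 3 (%kp. if kp : {3} \<times> I then z kp else (y(l := t)) kp))) j =
       Lg (b (gm 0 (%kp. if kp : {3} \<times> I then z kp else y kp) \<otimes>\<^bsub>G\<^esub> gm 3 (%kp. if kp : {3} \<times> I then z kp else y kp))) j"
       by (simp del: fun_upd_apply)
     qed
    qed
    from iint_pull[of rs T, OF this, of ro Qc mur x] show "ii rs (%y. mur y * (1 * T y)) x = T x" using mu_props(3)[of 2 x] by (simp add: mult.commute)
   qed
   ultimately show ?thesis by simp
  qed
  \<comment> \<open>The integrand sees slot 3 alone, so the average is a constant, evaluated at the
    centre of the box.\<close>
  have Sc: "S k x = S k (restrict Qc Q)" for k x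
   unfolding S_def
  proof (rule average_transfer)
   fix z
   have "gm 3 (%kp. if kp : {3} \<times> I then z kp else x kp) = gm 3 (%kp. if kp : {3} \<times> I then z kp else restrict Qc Q kp)"
    by (rule gm_cong) auto
   thus "Lg (b (gm 3 (%kp. if kp : {3} \<times> I then z kp else x kp))) k =
     Lg (b (gm 3 (%kp. if kp : {3} \<times> I then z kp else restrict Qc Q kp))) k" by simp
  qed
  have R: "Cinf_on Q B R" unfolding R_def
   by (rule iint_Cinf[OF Cinf_on_mult[OF openB mu_props(1) FC[OF j]] slot_sub]) simp
  have eq: "Lg (b (gm 0 x)) j = T x - (\<Sum>k\<in>J. Lm (gm 0 x) j k * S k (restrict Qc Q)) + R x" if x: "x : B" for x
  proof -
   define f1 where "f1 y = muu y * Lg (b (gm 0 y \<otimes>\<^bsub>G\<^esub> gm 3 y)) j" for y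
   define f2 where "f2 k y = Lm (gm 0 y) j k * (muu y * Lg (b (gm 3 y)) k)" for k y
   define f3 where "f3 y = muu y * Lg (F y) j" for y
   have c1: "continuous_on B f1" unfolding f1_def by (intro continuous_on_mult mu_cont contb[OF j pgg gg])
   have c2: "continuous_on B (f2 k)" if "k : J" for k
    unfolding f2_def by (intro continuous_on_mult mu_cont Cinf_contB[OF LmC[OF j that]] contb[OF that pg(2)] gmD1) simp_all
   have c3: "continuous_on B f3" unfolding f3_def by (intro continuous_on_mult mu_cont Cinf_contB[OF FC[OF j]])
   have sub: "set us \<subseteq> Q" by (rule slot_sub) simp
   have "Lg (b (gm 0 x)) j = ii us (%y. muu y * Lg (b (gm 0 y)) j) x"
   proof -
    have "ii us (%y. muu y * Lg (b (gm 0 y)) j) x = ii us (%y. muu y * Lg (b (gm 0 x)) j) x"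
    proof (rule average_transfer)
     fix z have "gm 0 (%kp. if kp : {3} \<times> I then z kp else x kp) = gm 0 x" by (rule gm_cong) auto
     thus "Lg (b (gm 0 (%kp. if kp : {3} \<times> I then z kp else x kp))) j = Lg (b (gm 0 x)) j" by simp
    qed
    thus ?thesis using average_const[of 3] by simp
   qed
   also have "\<dots> = ii us (%y. f1 y - (\<Sum>k\<in>J. f2 k y) + f3 y) x"
    by (rule iint_cong[OF _ sub x]) (simp add: f1_def f2_def f3_def F(2) j algebra_simps sum_distrib_left)
   also have "\<dots> = ii us f1 x - (\<Sum>k\<in>J. ii us (f2 k) x) + ii us f3 x"
    by (simp add: iint_add[OF continuous_on_diff[OF c1 continuous_on_sum[OF c2]] c3 sub x]
     iint_diff[OF c1 continuous_on_sum[OF c2] sub x] iint_sum[OF c2 sub x])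
   also have "(\<Sum>k\<in>J. ii us (f2 k) x) = (\<Sum>k\<in>J. Lm (gm 0 x) j k * S k (restrict Qc Q))"
   proof (rule sum.cong[OF refl])
    fix k
    have "ii us (f2 k) x = Lm (gm 0 x) j k * S k x" unfolding f2_def S_def
    proof (rule iint_pull)
     fix y l t assume "l : set us"
     then obtain i where "l = (3, i)" using slot(2)[of 3] by auto
     hence "gm 0 (y(l := t)) = gm 0 y" by (intro gm_cong) auto
     thus "Lm (gm 0 (y(l := t))) j k = Lm (gm 0 y) j k" by simp
    qed
    thus "ii us (f2 k) x = Lm (gm 0 x) j k * S k (restrict Qc Q)" using Sc[of k x] by simp
   qed
   finally show ?thesis by (simp add: T_def R_def f1_def[abs_def] f3_def[abs_def])
  qed
  have "Cinf_on Q B (%x. T x - (\<Sum>k\<in>J. Lm (gm 0 x) j k * S k (restrict Qc Q)) + R x)"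
   by (intro Cinf_on_add[OF openB] Cinf_on_diff[OF openB] Cinf_on_sum[OF openB] Cinf_on_mult[OF openB] T R LmC[OF j] Cinf_on_const)
  thus ?thesis using Cinf_on_cong[OF openB, of "%x. Lg (b (gm 0 x)) j", OF eq] by simp
 qed
 have "plot N Q B (%x. Eg (Lg (b (gm 0 x))))"
 proof (rule plot_Eg[OF openB _ main])
  show "Lg (b (gm 0 x)) : NB \<delta>" if "x : B" for x
   by (rule NB_\<delta>[OF _ bv(1)[OF gmD1[OF that]]]) (use c in auto)
 qed
 thus ?thesis
  by (rule plot_cong[OF _ lieN(3)]) (use bv(2)[OF gmD1] in auto)
qed

end

text \<open>The cocycle identity is assumed in the group; smallness of \<open>f\<close> on
  \<open>D1\<close> makes it an identity between logarithms, see
  \<open>f_cocycle_Lg\<close>.\<close>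

locale coh_cocycle = coh_data A N U ps r s \<delta> L e G M act U0 ph0 D1 D2 ep ro \<eta>0
 for A :: "('a, 'd) monoid_scheme" and N :: "('a, 'j) manifold" and U and ps and r s \<delta> :: real and L e
  and G :: "('g, 'c) monoid_scheme" and M :: "('g, 'i) manifold" and act and U0 and ph0 and D1 D2 and ep ro \<eta>0 +
 fixes f :: "'g => 'g => 'a"
 assumes f_cont: "!!j. j : J ==> continuous_map TT euclideanreal (%(a, b). Lg (f a b) j)"
  and f_small: "!!a b. a : D1 ==> b : D1 ==> f a b : Eg ` NB \<eta>"
  and f_cocycle: "!!a b c. a : D1 ==> b : D1 ==> c : D1 ==>
   act a (f b c) \<otimes>\<^bsub>A\<^esub> f a (b \<otimes>\<^bsub>G\<^esub> c) = f (a \<otimes>\<^bsub>G\<^esub> b) c \<otimes>\<^bsub>A\<^esub> f a b"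
begin

text \<open>The integrand depends on slot 3 only, so the centre of the box is an arbitrary choice of
  base point; \<open>P_eq\<close> moves it to any other one.\<close>

definition P :: "'g => 'g => 'j => real" where
 "P a b j = ii us (%y. muu y * Lg (f a (b \<otimes>\<^bsub>G\<^esub> gm 3 y)) j) (restrict Qc Q)"

definition bb :: "'g => 'a" where
 "bb a = Eg (\<lambda>j\<in>J. P a \<one>\<^bsub>G\<^esub> j)"

definition good :: "((nat \<times> 'i => real) => 'g) => ((nat \<times> 'i => real) => 'g) => bool" where
 "good al be \<longleftrightarrow> plot M Q B al & plot M Q B be & below 3 al & below 3 be \<and>
   (\<forall>x\<in>B. al x : D1 & (\<forall>y\<in>B. be x \<otimes>\<^bsub>G\<^esub> gm 3 y : D1))"

lemma us_sub: "set us \<subseteq> Q" and rs_sub: "set rs \<subseteq> Q" by (rule slot_sub, simp)+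

lemma P_eq:
 assumes "below 3 al" "below 3 be"
 shows "P (al x) (be x) j = ii us (%y. muu y * Lg (f (al y) (be y \<otimes>\<^bsub>G\<^esub> gm 3 y)) j) x"
 unfolding P_def
proof (rule average_transfer)
 fix z :: "nat \<times> 'i => real"
 have a: "al (%kp. if kp : {3} \<times> I then z kp else x kp) = al x" by (rule belowD[OF assms(1)]) auto
 have b: "be (%kp. if kp : {3} \<times> I then z kp else x kp) = be x" by (rule belowD[OF assms(2)]) auto
 have c: "gm 3 (%kp. if kp : {3} \<times> I then z kp else restrict Qc Q kp) = gm 3 (%kp. if kp : {3} \<times> I then z kp else x kp)"
  by (rule gm_cong) auto
 show "Lg (f (al x) (be x \<otimes>\<^bsub>G\<^esub> gm 3 (%kp. if kp : {3} \<times> I then z kp else restrict Qc Q kp))) j =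
   Lg (f (al (%kp. if kp : {3} \<times> I then z kp else x kp)) (be (%kp. if kp : {3} \<times> I then z kp else x kp) \<otimes>\<^bsub>G\<^esub> gm 3 (%kp. if kp : {3} \<times> I then z kp else x kp))) j"
  unfolding a b c ..
qed

lemma P_continuous:
 assumes "good al be" and j: "j : J"
 shows "continuous_on B (%x. P (al x) (be x) j)"
proof -
 have g: "plot M Q B al" "plot M Q B be" "below 3 al" "below 3 be" "!!x. x : B ==> al x : D1"
  "!!x. x : B ==> be x \<otimes>\<^bsub>G\<^esub> gm 3 x : D1" using assms(1) by (simp_all add: good_def)
 have p: "plot M Q B (%y. be y \<otimes>\<^bsub>G\<^esub> gm 3 y)" by (rule plot_mult[OF lieG g(2) plot_gm]) simp
 have "continuous_on B (%y. muu y * Lg (f (al y) (be y \<otimes>\<^bsub>G\<^esub> gm 3 y)) j)"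
  by (intro continuous_on_mult mu_cont) (rule continuous_plots[OF f_cont[OF j] g(1) _ p], (rule g; assumption)+)
 from iint_continuous[OF this us_sub] show ?thesis
  unfolding P_eq[OF g(3,4)] .
qed

lemma integrand_continuous:
 assumes a: "a : D1" and c: "c : carrier G" "!!y. y : B ==> c \<otimes>\<^bsub>G\<^esub> gm 3 y : D1" and j: "j : J"
 shows "continuous_on B (%y. Lg (f a (c \<otimes>\<^bsub>G\<^esub> gm 3 y)) j)"
proof -
 have pa: "plot M Q B (%x. a)" by (rule plot_const[OF openB]) (use a G_carrier lieM(4) in simp)
 have pc: "plot M Q B (%x. c)" by (rule plot_const[OF openB]) (use c lieM(4) in simp)
 have "plot M Q B (%y. c \<otimes>\<^bsub>G\<^esub> gm 3 y)" by (rule plot_mult[OF lieG pc plot_gm]) simp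
 from continuous_plots[OF f_cont[OF j] pa a this c(2)] show ?thesis by simp
qed

lemma P_bound:
 assumes a: "a : D1" and c: "c : carrier G" "!!y. y : B ==> c \<otimes>\<^bsub>G\<^esub> gm 3 y : D1" and j: "j : J"
 shows "\<bar>P a c j\<bar> <= \<eta>"
 unfolding P_def
proof (rule average_bound[OF integrand_continuous[OF a c j] _ base_B])
 fix y assume y: "y : B"
 have "Lg (f a (c \<otimes>\<^bsub>G\<^esub> gm 3 y)) : NB \<eta>"
  by (rule Lg_in[OF f_small[OF a c(2)[OF y]]]) (use sizes in simp)
 thus "\<bar>Lg (f a (c \<otimes>\<^bsub>G\<^esub> gm 3 y)) j\<bar> <= \<eta>"
  using coord_le_nrm[OF finJ j, of "Lg (f a (c \<otimes>\<^bsub>G\<^esub> gm 3 y))"] by (simp add: nball_def)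
qed simp_all

lemma one_word: "y : B ==> \<one>\<^bsub>G\<^esub> \<otimes>\<^bsub>G\<^esub> gm 3 y : D1"
 by (intro D2(4) D2(2) gmD2) simp_all

lemma bb_vec: "a : D1 ==> (\<lambda>j\<in>J. P a \<one>\<^bsub>G\<^esub> j) : NB (ta / 8)"
 using small_vector[of "P a \<one>\<^bsub>G\<^esub>" 1] P_bound[OF _ _ one_word, of a] G_carrier(1)[OF D2(2)] by simp

lemma f_cocycle_Lg:
 assumes a: "a : D1" and b: "b : D1" and c: "c : D1" and ab: "a \<otimes>\<^bsub>G\<^esub> b : D1" and bc: "b \<otimes>\<^bsub>G\<^esub> c : D1" and j: "j : J"
 shows "(\<Sum>k\<in>J. Lm a j k * Lg (f b c) k) + Lg (f a (b \<otimes>\<^bsub>G\<^esub> c)) j = Lg (f (a \<otimes>\<^bsub>G\<^esub> b) c) j + Lg (f a b) j"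
proof -
 note c' = sizes
 have l: "Lg (f b c) : NB \<eta>" by (rule Lg_in[OF f_small[OF b c]]) (use c' in simp)
 hence lt: "Lg (f b c) : NB ta" "Lg (f b c) : NB \<eta>0" using c' by (simp_all add: nball_def)
 have "f b c : Eg ` NB \<delta>" using f_small[OF b c] Eg_NB_mono[of \<eta> \<delta>] c' by auto
 hence e: "Eg (Lg (f b c)) = f b c" by (rule Eg_Lg)
 have s: "act a (f b c) : Eg ` NB (\<delta> / 8)" using act_small[OF a lt(2)] unfolding e .
 have 1: "Lg (act a (f b c)) j = (\<Sum>k\<in>J. Lm a j k * Lg (f b c) k)" using act_linear[OF a lt(1) j] unfolding e .
 have 2: "Lg (act a (f b c) \<otimes>\<^bsub>A\<^esub> f a (b \<otimes>\<^bsub>G\<^esub> c)) j = Lg (act a (f b c)) j + Lg (f a (b \<otimes>\<^bsub>G\<^esub> c)) j"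
  by (rule Lg_mult(2)[OF s f_small[OF a bc] _ _ _ j]) (use c' in simp_all)
 have 3: "Lg (f (a \<otimes>\<^bsub>G\<^esub> b) c \<otimes>\<^bsub>A\<^esub> f a b) j = Lg (f (a \<otimes>\<^bsub>G\<^esub> b) c) j + Lg (f a b) j"
  by (rule Lg_mult(2)[OF f_small[OF ab c] f_small[OF a b] _ _ _ j]) (use c' in simp_all)
 show ?thesis using 1 2 3 unfolding f_cocycle[OF a b c] by simp
qed

text \<open>The cocycle identity at (a, b, c u) averaged over u. The term f(a,b) does not contain u
  and survives unchanged because the weight has mass 1.\<close>

lemma P_cocycle:
 assumes a: "a : D1" and b: "b : D1" and ab: "a \<otimes>\<^bsub>G\<^esub> b : D1" and c: "c : carrier G"
  and cy: "!!y. y : B ==> c \<otimes>\<^bsub>G\<^esub> gm 3 y : D1" and bcy: "!!y. y : B ==> b \<otimes>\<^bsub>G\<^esub> c \<otimes>\<^bsub>G\<^esub> gm 3 y : D1" and j: "j : J"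
 shows "(\<Sum>k\<in>J. Lm a j k * P b c k) = P (a \<otimes>\<^bsub>G\<^esub> b) c j - P a (b \<otimes>\<^bsub>G\<^esub> c) j + Lg (f a b) j"
proof -
 interpret G: group G by (rule lieM(1))
 have bc: "b \<otimes>\<^bsub>G\<^esub> c : carrier G" using G_carrier(2)[OF b] c by simp
 define f1 where "f1 k y = muu y * Lg (f b (c \<otimes>\<^bsub>G\<^esub> gm 3 y)) k" for k y
 define f2 where "f2 y = muu y * Lg (f (a \<otimes>\<^bsub>G\<^esub> b) (c \<otimes>\<^bsub>G\<^esub> gm 3 y)) j" for y
 define f3 where "f3 y = muu y * Lg (f a (b \<otimes>\<^bsub>G\<^esub> c \<otimes>\<^bsub>G\<^esub> gm 3 y)) j" for y
 define f4 where "f4 y = muu y * Lg (f a b) j" for y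
 have c1: "continuous_on B (f1 k)" if "k : J" for k unfolding f1_def
  by (intro continuous_on_mult mu_cont integrand_continuous[OF b c cy that])
 have c2: "continuous_on B f2" unfolding f2_def by (intro continuous_on_mult mu_cont integrand_continuous[OF ab c cy j])
 have c3: "continuous_on B f3" unfolding f3_def by (intro continuous_on_mult mu_cont integrand_continuous[OF a bc bcy j])
 have c4: "continuous_on B f4" unfolding f4_def by (intro continuous_on_mult mu_cont continuous_on_const)
 have c1': "continuous_on B (%y. Lm a j k * f1 k y)" if "k : J" for k
  by (intro continuous_on_mult continuous_on_const c1 that)
 have "(\<Sum>k\<in>J. Lm a j k * P b c k) = (\<Sum>k\<in>J. ii us (%y. Lm a j k * f1 k y) (restrict Qc Q))"
  by (simp add: iint_cmult P_def f1_def)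
 also have "\<dots> = ii us (%y. \<Sum>k\<in>J. Lm a j k * f1 k y) (restrict Qc Q)"
  by (rule iint_sum[OF c1' us_sub base_B, symmetric])
 also have "\<dots> = ii us (%y. f2 y - f3 y + f4 y) (restrict Qc Q)"
 proof (rule iint_cong[OF _ us_sub base_B])
  fix y assume y: "y : B"
  have gy: "gm 3 y : carrier G" by (intro G_carrier(1) gmD2 y) simp
  have as: "b \<otimes>\<^bsub>G\<^esub> (c \<otimes>\<^bsub>G\<^esub> gm 3 y) = b \<otimes>\<^bsub>G\<^esub> c \<otimes>\<^bsub>G\<^esub> gm 3 y" using G_carrier(2)[OF b] c gy by (simp add: G.m_assoc)
  have "(\<Sum>k\<in>J. Lm a j k * Lg (f b (c \<otimes>\<^bsub>G\<^esub> gm 3 y)) k) + Lg (f a (b \<otimes>\<^bsub>G\<^esub> c \<otimes>\<^bsub>G\<^esub> gm 3 y)) j =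
    Lg (f (a \<otimes>\<^bsub>G\<^esub> b) (c \<otimes>\<^bsub>G\<^esub> gm 3 y)) j + Lg (f a b) j"
   using f_cocycle_Lg[OF a b cy[OF y] ab _ j] bcy[OF y] unfolding as by simp
  hence e: "(\<Sum>k\<in>J. Lm a j k * Lg (f b (c \<otimes>\<^bsub>G\<^esub> gm 3 y)) k) = Lg (f (a \<otimes>\<^bsub>G\<^esub> b) (c \<otimes>\<^bsub>G\<^esub> gm 3 y)) j
    - Lg (f a (b \<otimes>\<^bsub>G\<^esub> c \<otimes>\<^bsub>G\<^esub> gm 3 y)) j + Lg (f a b) j" by linarith
  have "muu y * (\<Sum>k\<in>J. Lm a j k * Lg (f b (c \<otimes>\<^bsub>G\<^esub> gm 3 y)) k) = muu y * (Lg (f (a \<otimes>\<^bsub>G\<^esub> b) (c \<otimes>\<^bsub>G\<^esub> gm 3 y)) j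
    - Lg (f a (b \<otimes>\<^bsub>G\<^esub> c \<otimes>\<^bsub>G\<^esub> gm 3 y)) j + Lg (f a b) j)" unfolding e ..
  thus "(\<Sum>k\<in>J. Lm a j k * f1 k y) = f2 y - f3 y + f4 y"
   by (simp add: f1_def f2_def f3_def f4_def sum_distrib_left algebra_simps)
 qed
 also have "\<dots> = ii us f2 (restrict Qc Q) - ii us f3 (restrict Qc Q) + ii us f4 (restrict Qc Q)"
  by (simp add: iint_add[OF continuous_on_diff[OF c2 c3] c4 us_sub base_B] iint_diff[OF c2 c3 us_sub base_B])
 also have "ii us f4 (restrict Qc Q) = Lg (f a b) j" unfolding f4_def by (rule average_const)
 finally show ?thesis unfolding P_def f2_def[abs_def] f3_def[abs_def] .
qed

text \<open>The matrix of the inverse element undoes the action, provided both vectors stay where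
  the action is linear. It serves to strip the factor \<open>r\<close> off an averaged cocycle
  identity.\<close>

lemma Lm_inverse:
 assumes g: "g : D2" and v: "v : NB (ta / 2)" and w: "w : NB ta" and e: "!!j. j : J ==> (\<Sum>k\<in>J. Lm g j k * v k) = w j" and l: "l : J"
 shows "v l = (\<Sum>j\<in>J. Lm (inv\<^bsub>G\<^esub> g) l j * w j)"
proof -
 interpret G: group G by (rule lieM(1))
 note c = sizes
 have g1: "g : D1" "inv\<^bsub>G\<^esub> g : D1" "g : carrier G" using g D2(1,3) G_carrier by auto
 have vt: "v : NB ta" "v : NB \<eta>0" "v : NB \<delta>" "w : NB \<delta>" using v w c by (auto simp: nball_def)
 have sm: "act g (Eg v) : Eg ` NB (\<delta> / 8)" by (rule act_small[OF g1(1) vt(2)])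
 hence sm': "act g (Eg v) : Eg ` NB \<delta>" using Eg_NB_mono[of "\<delta> / 8" \<delta>] c by auto
 have "Lg (act g (Eg v)) = w"
 proof (rule extensionalityI[OF Lg_ext])
  show "w : extensional J" using w by (simp add: nball_def)
  show "Lg (act g (Eg v)) j = w j" if "j : J" for j using act_linear[OF g1(1) vt(1) that] e[OF that] by simp
 qed
 hence "act g (Eg v) = Eg w" using Eg_Lg[OF sm'] by simp
 hence "act (inv\<^bsub>G\<^esub> g) (Eg w) = act (inv\<^bsub>G\<^esub> g \<otimes>\<^bsub>G\<^esub> g) (Eg v)"
  using smooth_moduleD(3)[OF mod lieG _ _ Eg_carrier[OF vt(3)], of "inv\<^bsub>G\<^esub> g" g] g1 by simp
 also have "\<dots> = Eg v" using smooth_moduleD(4)[OF mod lieG Eg_carrier[OF vt(3)]] g1 by simp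
 finally show ?thesis using act_linear[OF g1(2) w l] by (simp add: Lg_Eg vt)
qed

text \<open>P(r \<sigma>, \<tau>) already averages over u; a further average over r, with a smooth
  weight, has the form treated in \<open>double_average_smooth\<close>.\<close>

lemma P_double_smooth:
 assumes w: "Cinf_on Q B w" "below 3 w" and sg: "plot M Q B sg" "sg ` B \<subseteq> D2" "low sg"
  and be: "plot M Q B be" "be ` B \<subseteq> D2" "low be" and j: "j : J"
 shows "Cinf_on Q B (ii rs (%y. mur y * (w y * P (gm 2 y \<otimes>\<^bsub>G\<^esub> sg y) (be y) j)))"
  "continuous_on B (%y. P (gm 2 y \<otimes>\<^bsub>G\<^esub> sg y) (be y) j)"
proof -
 have lb: "below 3 al" if "low al" for al
  unfolding below_def by (intro allI impI low_eq[OF that]) auto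
 have b: "below 3 (%y. gm 2 y \<otimes>\<^bsub>G\<^esub> sg y)" by (intro below_mult below_gm lb sg) simp
 show "Cinf_on Q B (ii rs (%y. mur y * (w y * P (gm 2 y \<otimes>\<^bsub>G\<^esub> sg y) (be y) j)))"
  unfolding P_eq[OF b lb[OF be(3)]]
  by (rule double_average_smooth[where h = "%a b. Lg (f a b) j", OF w sg be f_cont[OF j]])
 have "good (%y. gm 2 y \<otimes>\<^bsub>G\<^esub> sg y) be"
  unfolding good_def
 proof (intro conjI ballI)
  show "plot M Q B (%y. gm 2 y \<otimes>\<^bsub>G\<^esub> sg y)" by (rule plot_mult[OF lieG plot_gm sg(1)]) simp
  show "gm 2 x \<otimes>\<^bsub>G\<^esub> sg x : D1" if "x : B" for x
   by (rule D2(4)[OF gmD2[OF that]]) (use sg(2) that in auto)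
  show "be x \<otimes>\<^bsub>G\<^esub> gm 3 y : D1" if "x : B" "y : B" for x y
   by (rule D2(4)[OF _ gmD2[OF that(2)]]) (use be(2) that in auto)
 qed (use be b lb in auto)
 from P_continuous[OF this j] show "continuous_on B (%y. P (gm 2 y \<otimes>\<^bsub>G\<^esub> sg y) (be y) j)" .
qed

text \<open>Two instances of \<open>P_cocycle\<close> with left factor r give r (P(s,t) - P(s,1)) =
  P(rs,t) - P(r,st) - P(rs,1) + P(r,s). Applying the inverse of r and averaging over r leaves on the
  right only terms covered by \<open>P_double_smooth\<close>, and on the left the difference
  itself.\<close>

lemma difference_smooth:
 assumes l: "l : J"
 shows "Cinf_on Q B (%x. P (gm 0 x) (gm 1 x) l - P (gm 0 x) \<one>\<^bsub>G\<^esub> l)"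
proof -
 interpret G: group G by (rule lieM(1))
 define w where "w j y = Lm (inv\<^bsub>G\<^esub> gm 2 y) l j" for j y
 define H where "H sg be j y = P (gm 2 y \<otimes>\<^bsub>G\<^esub> sg y) (be y) j" for sg be :: "(nat \<times> 'i => real) => 'g" and j y
 define o1 where "o1 = (%x :: nat \<times> 'i => real. \<one>\<^bsub>G\<^esub>)"
 define g01 where "g01 = (%x. gm 0 x \<otimes>\<^bsub>G\<^esub> gm 1 x)"
 have wC: "Cinf_on Q B (w j)" if "j : J" for j
  unfolding w_def
 proof (rule Lm_smooth[OF plot_inv[OF lieG plot_gm] _ l that])
  show "(%y. inv\<^bsub>G\<^esub> gm 2 y) ` B \<subseteq> D1"
  proof (rule image_subsetI)
   fix y assume "y : B"
   hence "gm 2 y : D2" by (rule gmD2) simp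
   thus "inv\<^bsub>G\<^esub> gm 2 y : D1" using D2(1,3) by blast
  qed
 qed simp
 have wb: "below 3 (w j)" for j
 proof -
  have "gm 2 x = gm 2 y" if "\<forall>l<3. \<forall>i\<in>I. x (l, i) = y (l, i)" for x y by (rule gm_cong) (use that in simp)
  thus ?thesis unfolding below_def w_def by metis
 qed
 have pl: "plot M Q B o1" "plot M Q B (gm 0)" "plot M Q B (gm 1)" "plot M Q B g01"
  unfolding o1_def g01_def using G_carrier(1)[OF D2(2)] lieM(4)
  by (auto intro!: plot_const[OF openB] plot_mult[OF lieG] plot_gm)
 have inD: "o1 ` B \<subseteq> D2" "gm 0 ` B \<subseteq> D2" "gm 1 ` B \<subseteq> D2" "g01 ` B \<subseteq> D2"
  unfolding o1_def g01_def using D2(2) gmD2 products_D2 by auto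
 have lw: "low o1" "low (gm 0)" "low (gm 1)" "low g01"
  unfolding o1_def g01_def by (auto intro!: low_const low_mult low_gm)
 define ok where "ok sg \<longleftrightarrow> plot M Q B sg & sg ` B \<subseteq> D2 & low sg" for sg
 have oks: "ok o1" "ok (gm 0)" "ok (gm 1)" "ok g01" using pl inD lw by (simp_all add: ok_def)
 have HC: "Cinf_on Q B (ii rs (%y. mur y * (w j y * H sg be j y)))" and Hc: "continuous_on B (%y. mur y * (w j y * H sg be j y))"
  if "ok sg" "ok be" "j : J" for sg be j
 proof -
  have p: "plot M Q B sg" "sg ` B \<subseteq> D2" "low sg" "plot M Q B be" "be ` B \<subseteq> D2" "low be"
   using \<open>ok sg\<close> \<open>ok be\<close> by (auto simp: ok_def)
  note * = P_double_smooth[OF wC[OF \<open>j : J\<close>] wb p \<open>j : J\<close>]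
  show "Cinf_on Q B (ii rs (%y. mur y * (w j y * H sg be j y)))" unfolding H_def by (rule *(1))
  show "continuous_on B (%y. mur y * (w j y * H sg be j y))" unfolding H_def
   by (intro continuous_on_mult mu_cont Cinf_contB[OF wC[OF \<open>j : J\<close>]] *(2))
 qed
 define T where "T sg be j = (%y. mur y * (w j y * H sg be j y))" for sg be j
 have key: "P (gm 0 y) (gm 1 y) l - P (gm 0 y) \<one>\<^bsub>G\<^esub> l =
   (\<Sum>j\<in>J. w j y * (H (gm 0) (gm 1) j y - H o1 g01 j y - H (gm 0) o1 j y + H o1 (gm 0) j y))" if y: "y : B" for y
 proof -
  have g: "gm 2 y : D2" "gm 0 y : D2" "gm 1 y : D2" by (intro gmD2 y; simp)+
  have gc: "gm 2 y : carrier G" "gm 0 y : carrier G" "gm 1 y : carrier G" using g G_carrier by auto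
  have g1: "gm 2 y : D1" "gm 0 y : D1" "gm 1 y : D1" "gm 2 y \<otimes>\<^bsub>G\<^esub> gm 0 y : D1" using g D2(1,4) by auto
  have oc: "\<one>\<^bsub>G\<^esub> : carrier G" by simp
  have e1: "gm 1 y \<otimes>\<^bsub>G\<^esub> gm 3 z : D1" and e2: "gm 0 y \<otimes>\<^bsub>G\<^esub> gm 3 z : D1" and e3: "gm 0 y \<otimes>\<^bsub>G\<^esub> gm 1 y \<otimes>\<^bsub>G\<^esub> gm 3 z : D1"
   if "z : B" for z using g D2(4,5) gmD2[OF that, of 3] by auto
  have e4: "gm 0 y \<otimes>\<^bsub>G\<^esub> \<one>\<^bsub>G\<^esub> \<otimes>\<^bsub>G\<^esub> gm 3 z : D1" if "z : B" for z using e2[OF that] gc by simp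
  define v where "v = (\<lambda>k\<in>J. P (gm 0 y) (gm 1 y) k - P (gm 0 y) \<one>\<^bsub>G\<^esub> k)"
  define h where "h j = P (gm 2 y \<otimes>\<^bsub>G\<^esub> gm 0 y) (gm 1 y) j - P (gm 2 y) (gm 0 y \<otimes>\<^bsub>G\<^esub> gm 1 y) j
    - P (gm 2 y \<otimes>\<^bsub>G\<^esub> gm 0 y) \<one>\<^bsub>G\<^esub> j + P (gm 2 y) (gm 0 y) j" for j
  have bd: "\<bar>P (gm 0 y) (gm 1 y) k\<bar> <= \<eta>" "\<bar>P (gm 0 y) \<one>\<^bsub>G\<^esub> k\<bar> <= \<eta>" "\<bar>P (gm 2 y \<otimes>\<^bsub>G\<^esub> gm 0 y) (gm 1 y) k\<bar> <= \<eta>"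
   "\<bar>P (gm 2 y) (gm 0 y \<otimes>\<^bsub>G\<^esub> gm 1 y) k\<bar> <= \<eta>" "\<bar>P (gm 2 y \<otimes>\<^bsub>G\<^esub> gm 0 y) \<one>\<^bsub>G\<^esub> k\<bar> <= \<eta>" "\<bar>P (gm 2 y) (gm 0 y) k\<bar> <= \<eta>" if "k : J" for k
   using P_bound[OF g1(2) gc(3) e1 that] P_bound[OF g1(2) oc one_word that] P_bound[OF g1(4) gc(3) e1 that]
    P_bound[OF g1(1) G.m_closed[OF gc(2,3)] e3 that] P_bound[OF g1(4) oc one_word that] P_bound[OF g1(1) gc(2) e2 that] by auto
  have vl: "\<bar>P (gm 0 y) (gm 1 y) k - P (gm 0 y) \<one>\<^bsub>G\<^esub> k\<bar> <= 2 * \<eta>" if "k : J" for k using bd(1,2)[OF that] by linarith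
  have hl: "\<bar>h k\<bar> <= 4 * \<eta>" if "k : J" for k using bd(3-6)[OF that] unfolding h_def by linarith
  have "v : NB (2 * (ta / 8))" unfolding v_def by (rule small_vector[OF vl]) simp_all
  hence v: "v : NB (ta / 2)" using sizes(1) by (simp add: nball_def)
  have "(\<lambda>j\<in>J. h j) : NB (4 * (ta / 8))" by (rule small_vector[OF hl]) simp_all
  hence w: "(\<lambda>j\<in>J. h j) : NB ta" using sizes(1) by (simp add: nball_def)
  have "v l = (\<Sum>j\<in>J. Lm (inv\<^bsub>G\<^esub> gm 2 y) l j * (\<lambda>j\<in>J. h j) j)"
  proof (rule Lm_inverse[OF g(1) v w _ l])
   fix j assume j: "j : J"
   have "(\<Sum>k\<in>J. Lm (gm 2 y) j k * v k) = (\<Sum>k\<in>J. Lm (gm 2 y) j k * P (gm 0 y) (gm 1 y) k) - (\<Sum>k\<in>J. Lm (gm 2 y) j k * P (gm 0 y) \<one>\<^bsub>G\<^esub> k)"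
    unfolding v_def sum_subtractf[symmetric] by (intro sum.cong) (auto simp: right_diff_distrib)
   \<comment> \<open>Subtracting the identities at (r,s,t) and (r,s,1) removes f(r,s), which is only
     continuous.\<close>
   also have "\<dots> = h j"
    using P_cocycle[of "gm 2 y" "gm 0 y" "gm 1 y" j, OF g1(1,2,4) gc(3) e1 e3 j]
     P_cocycle[of "gm 2 y" "gm 0 y" "\<one>\<^bsub>G\<^esub>" j, OF g1(1,2,4) oc one_word e4 j] gc by (simp add: h_def)
   finally show "(\<Sum>k\<in>J. Lm (gm 2 y) j k * v k) = (\<lambda>j\<in>J. h j) j" using j by simp
  qed
  also have "\<dots> = (\<Sum>j\<in>J. w j y * (H (gm 0) (gm 1) j y - H o1 g01 j y - H (gm 0) o1 j y + H o1 (gm 0) j y))"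
   by (rule sum.cong) (use gc in \<open>simp_all add: w_def h_def H_def o1_def g01_def\<close>)
  finally show ?thesis using l by (simp add: v_def)
 qed
 define D where "D x = P (gm 0 x) (gm 1 x) l - P (gm 0 x) \<one>\<^bsub>G\<^esub> l" for x
 have av: "D x = (\<Sum>j\<in>J. ii rs (T (gm 0) (gm 1) j) x - ii rs (T o1 g01 j) x - ii rs (T (gm 0) o1 j) x + ii rs (T o1 (gm 0) j) x)" if x: "x : B" for x
 proof -
  have Tc: "continuous_on B (T sg be j)" if "ok sg" "ok be" "j : J" for sg be j unfolding T_def by (rule Hc[OF that])
  \<comment> \<open>The difference does not contain r, so averaging it over r reproduces it.\<close>
  have "D x = ii rs (%y. mur y * D y) x"
  proof -
   have "ii rs (%y. mur y * D y) x = ii rs (%y. mur y * D x) x"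
   proof (rule average_transfer)
    fix z :: "nat \<times> 'i => real"
    have "gm 0 (%kp. if kp : {2} \<times> I then z kp else x kp) = gm 0 x" "gm 1 (%kp. if kp : {2} \<times> I then z kp else x kp) = gm 1 x"
     by (rule gm_cong, auto)+
    thus "D (%kp. if kp : {2} \<times> I then z kp else x kp) = D x" unfolding D_def by (simp only:)
   qed
   thus ?thesis using average_const[of 2] by simp
  qed
  also have "\<dots> = ii rs (%y. \<Sum>j\<in>J. T (gm 0) (gm 1) j y - T o1 g01 j y - T (gm 0) o1 j y + T o1 (gm 0) j y) x"
  proof (rule iint_cong[OF _ rs_sub x])
   fix y assume "y : B"
   from key[OF this] show "mur y * D y = (\<Sum>j\<in>J. T (gm 0) (gm 1) j y - T o1 g01 j y - T (gm 0) o1 j y + T o1 (gm 0) j y)"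
    unfolding D_def T_def by (simp only: sum_distrib_left right_diff_distrib distrib_left)
  qed
  also have "\<dots> = (\<Sum>j\<in>J. ii rs (%y. T (gm 0) (gm 1) j y - T o1 g01 j y - T (gm 0) o1 j y + T o1 (gm 0) j y) x)"
   by (rule iint_sum[OF _ rs_sub x]) (intro continuous_on_add continuous_on_diff Tc oks)
  also have "\<dots> = (\<Sum>j\<in>J. ii rs (T (gm 0) (gm 1) j) x - ii rs (T o1 g01 j) x - ii rs (T (gm 0) o1 j) x + ii rs (T o1 (gm 0) j) x)"
  proof (rule sum.cong[OF refl])
   fix j assume j: "j : J"
   note t1 = Tc[OF oks(2,3) j] and t2 = Tc[OF oks(1,4) j] and t3 = Tc[OF oks(2,1) j] and t4 = Tc[OF oks(1,2) j]
   show "ii rs (%y. T (gm 0) (gm 1) j y - T o1 g01 j y - T (gm 0) o1 j y + T o1 (gm 0) j y) x =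
     ii rs (T (gm 0) (gm 1) j) x - ii rs (T o1 g01 j) x - ii rs (T (gm 0) o1 j) x + ii rs (T o1 (gm 0) j) x"
    unfolding iint_add[OF continuous_on_diff[OF continuous_on_diff[OF t1 t2] t3] t4 rs_sub x]
     iint_diff[OF continuous_on_diff[OF t1 t2] t3 rs_sub x] iint_diff[OF t1 t2 rs_sub x] ..
  qed
  finally show ?thesis .
 qed
 have TC: "Cinf_on Q B (ii rs (T sg be j))" if "ok sg" "ok be" "j : J" for sg be j unfolding T_def by (rule HC[OF that])
 have "Cinf_on Q B (%x. \<Sum>j\<in>J. ii rs (T (gm 0) (gm 1) j) x - ii rs (T o1 g01 j) x - ii rs (T (gm 0) o1 j) x + ii rs (T o1 (gm 0) j) x)"
  by (intro Cinf_on_sum[OF openB] Cinf_on_add[OF openB] Cinf_on_diff[OF openB] TC oks)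
 hence "Cinf_on Q B D" using Cinf_on_cong[OF openB, of D, OF av] by simp
 thus ?thesis unfolding D_def .
qed

text \<open>\<open>P_cocycle\<close> with c = 1 gives a P(b,1) = P(ab,1) - P(a,b) + f(a,b), so
  \<open>f\<close> minus the coboundary of \<open>bb\<close> has logarithm P(a,b) - P(a,1). What
  remains is to check that every partial product stays in the domain of the logarithm.\<close>

theorem smooth_representative:
 "plot N Q B (%x. f (gm 0 x) (gm 1 x) \<otimes>\<^bsub>A\<^esub>
   inv\<^bsub>A\<^esub> (act (gm 0 x) (bb (gm 1 x)) \<otimes>\<^bsub>A\<^esub> inv\<^bsub>A\<^esub> bb (gm 0 x \<otimes>\<^bsub>G\<^esub> gm 1 x) \<otimes>\<^bsub>A\<^esub> bb (gm 0 x)))"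
proof -
 interpret G: group G by (rule lieM(1))
 note c = sizes
 define v where "v x = (\<lambda>j\<in>J. P (gm 0 x) (gm 1 x) j - P (gm 0 x) \<one>\<^bsub>G\<^esub> j)" for x
 have eq: "v x : NB \<delta> & Eg (v x) = f (gm 0 x) (gm 1 x) \<otimes>\<^bsub>A\<^esub>
   inv\<^bsub>A\<^esub> (act (gm 0 x) (bb (gm 1 x)) \<otimes>\<^bsub>A\<^esub> inv\<^bsub>A\<^esub> bb (gm 0 x \<otimes>\<^bsub>G\<^esub> gm 1 x) \<otimes>\<^bsub>A\<^esub> bb (gm 0 x))" if x: "x : B" for x
 proof -
  define a b where "a = gm 0 x" and "b = gm 1 x"
  have g: "a : D2" "b : D2" unfolding a_def b_def by (intro gmD2 x; simp)+
  have g1: "a : D1" "b : D1" "a \<otimes>\<^bsub>G\<^esub> b : D1" using g D2(1,4) by auto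
  have gc: "a : carrier G" "b : carrier G" using g G_carrier by auto
  have e1: "b \<otimes>\<^bsub>G\<^esub> gm 3 z : D1" "b \<otimes>\<^bsub>G\<^esub> \<one>\<^bsub>G\<^esub> \<otimes>\<^bsub>G\<^esub> gm 3 z : D1"
   if "z : B" for z using g D2(4) gmD2[OF that, of 3] gc by auto
  have in8: "bb g : Eg ` NB (ta / 8)" "!!j. j : J ==> Lg (bb g) j = P g \<one>\<^bsub>G\<^esub> j" if "g : D1" for g
  proof -
   show "bb g : Eg ` NB (ta / 8)" unfolding bb_def using bb_vec[OF that] by (rule imageI)
   have "(\<lambda>j\<in>J. P g \<one>\<^bsub>G\<^esub> j) : NB \<delta>" by (rule NB_\<delta>[OF _ bb_vec[OF that]]) (use c in simp)
   from Lg_Eg[OF this] show "Lg (bb g) j = P g \<one>\<^bsub>G\<^esub> j" if "j : J" for j unfolding bb_def using that by simp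
  qed
  have bv: "(\<lambda>j\<in>J. P b \<one>\<^bsub>G\<^esub> j) : NB ta" "(\<lambda>j\<in>J. P b \<one>\<^bsub>G\<^esub> j) : NB \<eta>0" using bb_vec[OF g1(2)] c by (auto simp: nball_def)
  have s1: "act a (bb b) : Eg ` NB (\<delta> / 8)" unfolding bb_def by (rule act_small[OF g1(1) bv(2)])
  have l1: "Lg (act a (bb b)) j = P (a \<otimes>\<^bsub>G\<^esub> b) \<one>\<^bsub>G\<^esub> j - P a b j + Lg (f a b) j" if j: "j : J" for j
  proof -
   have "Lg (act a (bb b)) j = (\<Sum>k\<in>J. Lm a j k * P b \<one>\<^bsub>G\<^esub> k)"
    unfolding bb_def act_linear[OF g1(1) bv(1) j] by simp
   also have "\<dots> = P (a \<otimes>\<^bsub>G\<^esub> b) \<one>\<^bsub>G\<^esub> j - P a b j + Lg (f a b) j"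
    using P_cocycle[OF g1 G.one_closed one_word e1(2) j] gc by simp
   finally show ?thesis .
  qed
  note i2 = Lg_inv[OF in8(1)[OF g1(3)]]
  have s2: "inv\<^bsub>A\<^esub> bb (a \<otimes>\<^bsub>G\<^esub> b) : Eg ` NB (ta / 8)" by (rule i2(1)) (use c in simp_all)
  have l2: "Lg (inv\<^bsub>A\<^esub> bb (a \<otimes>\<^bsub>G\<^esub> b)) j = - P (a \<otimes>\<^bsub>G\<^esub> b) \<one>\<^bsub>G\<^esub> j" if "j : J" for j
   using i2(2)[OF _ _ that] c in8(2)[OF g1(3) that] by simp
  note m3 = Lg_mult[OF s1 s2]
  have s3: "act a (bb b) \<otimes>\<^bsub>A\<^esub> inv\<^bsub>A\<^esub> bb (a \<otimes>\<^bsub>G\<^esub> b) : Eg ` NB (\<delta> / 8 + ta / 8)" by (rule m3(1)) (use c in simp_all)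
  have l3: "Lg (act a (bb b) \<otimes>\<^bsub>A\<^esub> inv\<^bsub>A\<^esub> bb (a \<otimes>\<^bsub>G\<^esub> b)) j = Lg (f a b) j - P a b j" if "j : J" for j
   using m3(2)[OF _ _ _ that] c l1[OF that] l2[OF that] by simp
  note m4 = Lg_mult[OF s3 in8(1)[OF g1(1)]]
  let ?E = "act a (bb b) \<otimes>\<^bsub>A\<^esub> inv\<^bsub>A\<^esub> bb (a \<otimes>\<^bsub>G\<^esub> b) \<otimes>\<^bsub>A\<^esub> bb a"
  have s4: "?E : Eg ` NB (\<delta> / 8 + ta / 8 + ta / 8)" by (rule m4(1)) (use c in simp_all)
  have l4: "Lg ?E j = Lg (f a b) j - P a b j + P a \<one>\<^bsub>G\<^esub> j" if "j : J" for j
   using m4(2)[OF _ _ _ that] c l3[OF that] in8(2)[OF g1(1) that] by simp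
  note i5 = Lg_inv[OF s4]
  have s5: "inv\<^bsub>A\<^esub> ?E : Eg ` NB (\<delta> / 8 + ta / 8 + ta / 8)" by (rule i5(1)) (use c in simp_all)
  have l5: "Lg (inv\<^bsub>A\<^esub> ?E) j = - (Lg (f a b) j - P a b j + P a \<one>\<^bsub>G\<^esub> j)" if "j : J" for j
   using i5(2)[OF _ _ that] c l4[OF that] by simp
  note m6 = Lg_mult[OF f_small[OF g1(1,2)] s5]
  have s6: "f a b \<otimes>\<^bsub>A\<^esub> inv\<^bsub>A\<^esub> ?E : Eg ` NB (\<eta> + (\<delta> / 8 + ta / 8 + ta / 8))" by (rule m6(1)) (use c in simp_all)
  have l6: "Lg (f a b \<otimes>\<^bsub>A\<^esub> inv\<^bsub>A\<^esub> ?E) j = P a b j - P a \<one>\<^bsub>G\<^esub> j" if "j : J" for j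
   using m6(2)[OF _ _ _ that] c l5[OF that] by simp
  have ll: "\<eta> + (\<delta> / 8 + ta / 8 + ta / 8) <= \<delta>" using c by simp
  have Ev: "Lg (f a b \<otimes>\<^bsub>A\<^esub> inv\<^bsub>A\<^esub> ?E) = v x"
   by (rule extensionalityI[OF Lg_ext[of "f a b \<otimes>\<^bsub>A\<^esub> inv\<^bsub>A\<^esub> ?E"]]) (use l6 in \<open>simp_all add: v_def a_def b_def\<close>)
  have "f a b \<otimes>\<^bsub>A\<^esub> inv\<^bsub>A\<^esub> ?E : Eg ` NB \<delta>" using s6 Eg_NB_mono[OF ll] by blast
  from Eg_Lg[OF this] Lg_in[OF this] show ?thesis unfolding Ev by (simp add: a_def b_def)
 qed
 have "plot N Q B (%x. Eg (v x))"
 proof (rule plot_Eg[OF openB])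
  show "v x : NB \<delta>" if "x : B" for x using eq[OF that] by blast
  show "Cinf_on Q B (%x. v x j)" if "j : J" for j unfolding v_def using difference_smooth[OF that] that by simp
 qed
 thus ?thesis by (rule plot_cong[OF _ lieN(3)]) (use eq in simp)
qed

text \<open>The correcting cochain only has to be continuous near 1, and the average of a continuous
  function over \<open>u\<close> is.\<close>

lemma bb_continuous:
 "continuous_map (subtopology (mtop M) {a : U0. ph0 a : cube I cI ep}) (mtop N) bb"
proof -
 let ?W = "{a : U0. ph0 a : cube I cI ep}"
 have pos: "0 < ep" using ro by simp
 define u where "u a = (\<lambda>kp\<in>Q. ph0 a (snd kp))" for a
 have uB: "u a : B" if "a : ?W" for a using that by (auto simp: u_def mem_cube Qc_def)
 have ch: "continuous_map (subtopology (mtop M) U0) (RR I) ph0" by (rule chart_coord_continuous[OF lieM(2) U0])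
 have uc: "continuous_map (subtopology (mtop M) ?W) (subtopology (RR Q) B) u"
  unfolding continuous_map_in_subtopology continuous_map_componentwise
 proof (intro conjI ballI)
  fix kp assume k: "kp : Q"
  have "continuous_map (subtopology (mtop M) U0) euclideanreal (%a. ph0 a (snd kp))"
   using continuous_map_compose[OF ch continuous_map_product_projection[of "snd kp" I "%_. euclideanreal"]] k by (auto simp: o_def)
  hence "continuous_map (subtopology (mtop M) ?W) euclideanreal (%a. ph0 a (snd kp))"
   by (rule continuous_map_from_subtopology_mono) auto
  thus "continuous_map (subtopology (mtop M) ?W) euclideanreal (%a. u a kp)" using k by (simp add: u_def)
 next
  show "u ` topspace (subtopology (mtop M) ?W) \<subseteq> extensional Q" by (auto simp: u_def)
 next
  show "u : topspace (subtopology (mtop M) ?W) \<rightarrow> B" using uB by auto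
 qed
 have gu: "gm 0 (u a) = a" if "a : ?W" for a
 proof -
  have "(\<lambda>i\<in>I. u a (0, i)) = ph0 a" using phi0_ext[of a] that by (auto simp: u_def fun_eq_iff extensional_def)
  thus ?thesis unfolding gm_def using inv_phi0[of a] that by simp
 qed
 have WD: "a : D1" if "a : ?W" for a using gmD1[OF uB[OF that], of 0] gu[OF that] by simp
 have pg: "plot M Q B (gm 0)" "plot M Q B (%x. \<one>\<^bsub>G\<^esub>)"
  using G_carrier(1)[OF D2(2)] lieM(4) by (auto intro!: plot_const[OF openB] plot_gm)
 have "good (gm 0) (%x. \<one>\<^bsub>G\<^esub>)" unfolding good_def using pg gmD1 one_word by (auto intro: below_gm below_const)
 note cP = P_continuous[OF this]
 have "continuous_map (subtopology (mtop M) ?W) (subtopology (RR J) (NB \<delta>)) (%a. \<lambda>j\<in>J. P a \<one>\<^bsub>G\<^esub> j)"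
  unfolding continuous_map_in_subtopology continuous_map_componentwise
 proof (intro conjI ballI)
  fix j assume j: "j : J"
  have "continuous_map (subtopology (RR Q) B) euclideanreal (%x. P (gm 0 x) \<one>\<^bsub>G\<^esub> j)"
   unfolding continuous_map_powertop_real_iff using cP[OF j] B_ext by (simp add: Int_absorb1)
  from continuous_map_compose[OF uc this]
  have "continuous_map (subtopology (mtop M) ?W) euclideanreal (%a. P (gm 0 (u a)) \<one>\<^bsub>G\<^esub> j)" by (simp add: o_def)
  thus "continuous_map (subtopology (mtop M) ?W) euclideanreal (%a. (\<lambda>j\<in>J. P a \<one>\<^bsub>G\<^esub> j) j)"
   by (rule continuous_map_eq) (use j gu in auto)
 next
  show "(%a. \<lambda>j\<in>J. P a \<one>\<^bsub>G\<^esub> j) ` topspace (subtopology (mtop M) ?W) \<subseteq> extensional J" by auto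
 next
  show "(%a. \<lambda>j\<in>J. P a \<one>\<^bsub>G\<^esub> j) : topspace (subtopology (mtop M) ?W) \<rightarrow> NB \<delta>"
  proof
   fix a assume "a : topspace (subtopology (mtop M) ?W)"
   hence "a : ?W" by auto
   from bb_vec[OF WD[OF this]] show "(\<lambda>j\<in>J. P a \<one>\<^bsub>G\<^esub> j) : NB \<delta>" by (rule NB_\<delta>[rotated]) (use sizes in simp)
  qed
 qed
 moreover have "plot N J (NB \<delta>) (%v. Eg v)"
  by (rule plot_Eg[OF openin_nball[OF finJ]]) (auto intro: Cinf_on_coord)
 ultimately show ?thesis using continuous_map_compose[OF _ plot_cont] by (fastforce simp: o_def bb_def[abs_def])
qed

end

section \<open>Measurable, locally continuous and locally smooth functions on powers\<close>

lemma space_borel_of: "space (borel_of T) = topspace T"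
 unfolding borel_of_def by (rule space_measure_of_conv)

lemma open_sets_borel_of: "openin T O' ==> O' : sets (borel_of T)"
proof -
 assume "openin T O'"
 moreover have "{U. openin T U} \<subseteq> Pow (topspace T)" using openin_subset by blast
 ultimately show ?thesis unfolding borel_of_def by (intro in_measure_of) simp_all
qed

lemma measurable_borel_ofI:
 assumes "f : space S \<rightarrow> topspace T" "!!O'. openin T O' ==> f -` O' \<inter> space S : sets S"
 shows "f : measurable S (borel_of T)"
 unfolding borel_of_def
proof (rule measurable_measure_of)
 show "{U. openin T U} \<subseteq> Pow (topspace T)" using openin_subset by blast
 show "f -` V \<inter> space S : sets S" if "V : {U. openin T U}" for V using assms(2) that by simp
qed (rule assms(1))

lemma measurable_borel_ofD:
 assumes "f : measurable S (borel_of T)"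
 shows "f : space S \<rightarrow> topspace T" "!!O'. openin T O' ==> f -` O' \<inter> space S : sets S"
 using measurable_space[OF assms] measurable_sets[OF assms open_sets_borel_of] by (auto simp: space_borel_of)

lemma continuous_imp_measurable:
 assumes "continuous_map T T' f"
 shows "f : measurable (borel_of T) (borel_of T')"
proof (rule measurable_borel_ofI)
 show "f : space (borel_of T) \<rightarrow> topspace T'"
  using assms by (auto simp: space_borel_of continuous_map_def)
 fix O' assume "openin T' O'"
 hence "openin T {x : topspace T. f x : O'}" using assms by (simp add: continuous_map_def)
 moreover have "f -` O' \<inter> space (borel_of T) = {x : topspace T. f x : O'}" by (auto simp: space_borel_of)
 ultimately show "f -` O' \<inter> space (borel_of T) : sets (borel_of T)" using open_sets_borel_of by metis
qed

text \<open>By second countability an open set of the product is a countable union of basic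
  rectangles, so Borel measurability of pairs follows from the components.\<close>

lemma measurable_pair_borel_of:
 assumes sc: "second_countable T1" "second_countable T2"
  and f: "f : measurable S (borel_of T1)" and g: "g : measurable S (borel_of T2)"
 shows "(%x. (f x, g x)) : measurable S (borel_of (prod_topology T1 T2))"
proof (rule measurable_borel_ofI)
 show "(%x. (f x, g x)) : space S \<rightarrow> topspace (prod_topology T1 T2)"
  using measurable_borel_ofD(1)[OF f] measurable_borel_ofD(1)[OF g] by auto
 fix O' assume O': "openin (prod_topology T1 T2) O'"
 obtain B1 where B1: "countable B1" "!!V. V : B1 ==> openin T1 V" "!!U x. openin T1 U ==> x : U ==> \<exists>V\<in>B1. x : V & V \<subseteq> U"
  using sc(1) unfolding second_countable_def by metis
 obtain B2 where B2: "countable B2" "!!V. V : B2 ==> openin T2 V" "!!U x. openin T2 U ==> x : U ==> \<exists>V\<in>B2. x : V & V \<subseteq> U"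
  using sc(2) unfolding second_countable_def by metis
 define R where "R = {(V, V') : B1 \<times> B2. V \<times> V' \<subseteq> O'}"
 have cR: "countable R" by (rule countable_subset[of _ "B1 \<times> B2"]) (use B1 B2 in \<open>auto simp: R_def\<close>)
 have "(%x. (f x, g x)) -` O' \<inter> space S = (\<Union>(V, V')\<in>R. (f -` V \<inter> space S) \<inter> (g -` V' \<inter> space S))"
 proof (intro equalityI subsetI)
  fix x assume "x : (%x. (f x, g x)) -` O' \<inter> space S"
  hence x: "(f x, g x) : O'" "x : space S" by auto
  obtain U U' where U: "openin T1 U" "openin T2 U'" "f x : U" "g x : U'" "U \<times> U' \<subseteq> O'"
   using O' x(1) unfolding openin_prod_topology_alt by metis
  obtain V where V: "V : B1" "f x : V" "V \<subseteq> U" using B1(3)[OF U(1,3)] by blast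
  obtain V' where V': "V' : B2" "g x : V'" "V' \<subseteq> U'" using B2(3)[OF U(2,4)] by blast
  have "(V, V') : R" using V V' U(5) by (auto simp: R_def)
  thus "x : (\<Union>(V, V')\<in>R. (f -` V \<inter> space S) \<inter> (g -` V' \<inter> space S))" using x(2) V(2) V'(2) by blast
 qed (auto simp: R_def)
 also have "\<dots> : sets S"
 proof (rule sets.countable_UN''[OF cR])
  fix p assume "p : R"
  thus "(case p of (V, V') => (f -` V \<inter> space S) \<inter> (g -` V' \<inter> space S)) : sets S"
   using measurable_borel_ofD(2)[OF f B1(2)] measurable_borel_ofD(2)[OF g B2(2)] by (auto simp: R_def)
 qed
 finally show "(%x. (f x, g x)) -` O' \<inter> space S : sets S" .
qed

text \<open>Turns a primitive defined near the identity into a cochain on the whole group.\<close>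

lemma measurable_extend_by_const:
 assumes W: "openin T W" and f: "continuous_map (subtopology T W) T' f" and c: "c : topspace T'"
 shows "(%x. if x : W then f x else c) : measurable (borel_of T) (borel_of T')"
proof (rule measurable_borel_ofI)
 have WT: "W \<subseteq> topspace T" using W by (rule openin_subset)
 show "(%x. if x : W then f x else c) : space (borel_of T) \<rightarrow> topspace T'"
  using f c WT by (auto simp: space_borel_of continuous_map_def Pi_iff)
 fix O' assume "openin T' O'"
 hence "openin (subtopology T W) {x : topspace (subtopology T W). f x : O'}" using f by (simp add: continuous_map_def)
 hence "openin T {x : topspace (subtopology T W). f x : O'}" using W by (rule openin_trans_full)
 hence 1: "{x : topspace (subtopology T W). f x : O'} : sets (borel_of T)" by (rule open_sets_borel_of)
 have 2: "space (borel_of T) - W : sets (borel_of T)" using open_sets_borel_of[OF W] by blast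
 have "(%x. if x : W then f x else c) -` O' \<inter> space (borel_of T) =
   {x : topspace (subtopology T W). f x : O'} \<union> (if c : O' then space (borel_of T) - W else {})"
  using WT by (auto simp: space_borel_of split: if_splits)
 also have "\<dots> : sets (borel_of T)" using 1 2 by auto
 finally show "(%x. if x : W then f x else c) -` O' \<inter> space (borel_of T) : sets (borel_of T)" .
qed

text \<open>The inverse of a product chart is the tuple of inverse charts of \<open>M\<close>
  applied to the slices, and each of these is a plot by \<open>chart_plot\<close>.\<close>

lemma chart_pow_plot:
 assumes M: "smooth_manifold M" and U: "(U, ph) : matlas (pow_manifold n M)"
 shows "!!j. j < n ==> plot M (midx (pow_manifold n M)) (ph ` U) (%p. inv_into U ph p j)"
  "plot (pow_manifold n M) (midx (pow_manifold n M)) (ph ` U) (inv_into U ph)"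
proof -
 let ?P = "pow_manifold n M"
 have chM: "charted M" by (rule smooth_manifold_charted[OF M])
 have chP: "charted ?P" by (rule charted_pow[OF chM])
 have finI: "finite (midx M)" using M by (simp add: smooth_manifold_def)
 obtain U' ph' where U': "U = (\<Pi>\<^sub>E j\<in>{..<n}. U' j)" "ph = (%x. \<lambda>(j, i)\<in>{..<n} \<times> midx M. ph' j (x j) i)"
  "!!j. j < n ==> (U' j, ph' j) : matlas M"
  using U unfolding pow_manifold_def by auto
 have oU: "openin (mtop ?P) U" "inj_on ph U" using charted_chart[OF chP U] by auto
 have oV: "openin (RR (midx ?P)) (ph ` U)" by (rule charted_chart(3)[OF chP U subset_refl oU(1)])
 have idx: "midx ?P = {..<n} \<times> midx M" by (simp add: pow_manifold_def)
 have slice: "(\<lambda>i\<in>midx M. ph x (j, i)) = ph' j (x j)" if "x : U" "j < n" for x j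
 proof -
  have "x j : U' j" using that by (auto simp: U'(1))
  hence "ph' j (x j) : extensional (midx M)" by (rule charted_extensional[OF chM U'(3)[OF that(2)]])
  thus ?thesis using that(2) by (auto simp: U'(2) fun_eq_iff extensional_def)
 qed
 show comp: "plot M (midx ?P) (ph ` U) (%p. inv_into U ph p j)" if j: "j < n" for j
 proof (rule plot_cong[OF _ chM])
  show "plot M (midx ?P) (ph ` U) (%p. inv_into (U' j) (ph' j) (\<lambda>i\<in>midx M. p (j, i)))"
  proof (rule plot_reparam[OF chart_plot[OF M U'(3)[OF j]] chM finI oV])
   show "(%p. \<lambda>i\<in>midx M. p (j, i)) ` ph ` U \<subseteq> ph' j ` U' j"
   proof clarify
    fix x assume x: "x : U"
    show "(\<lambda>i\<in>midx M. ph x (j, i)) : ph' j ` U' j" unfolding slice[OF x j] using x j by (auto simp: U'(1))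
   qed
   show "Cinf_on (midx ?P) (ph ` U) (%p. (\<lambda>i\<in>midx M. p (j, i)) i)" if "i : midx M" for i
    using that by (simp add: Cinf_on_coord)
  qed
  fix p assume "p : ph ` U"
  then obtain x where x: "x : U" "p = ph x" by blast
  have "inv_into (U' j) (ph' j) (ph' j (x j)) = x j"
   by (rule inv_into_f_f[OF charted_chart(2)[OF chM U'(3)[OF j]]]) (use x j in \<open>auto simp: U'(1)\<close>)
  thus "inv_into (U' j) (ph' j) (\<lambda>i\<in>midx M. p (j, i)) = inv_into U ph p j"
   unfolding x(2) slice[OF x(1) j] inv_into_f_f[OF oU(2) x(1)] .
 qed
 show "plot ?P (midx ?P) (ph ` U) (inv_into U ph)"
 proof (rule plot_tuple[OF oV comp])
  fix p assume "p : ph ` U"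
  hence "inv_into U ph p : U" by (rule inv_into_into)
  thus "inv_into U ph p : extensional {..<n}" by (auto simp: U'(1) PiE_def)
 qed
qed

lemma chart_pow_image_open:
 assumes M: "smooth_manifold M" and U: "(U, ph) : matlas (pow_manifold n M)" and W: "openin (mtop (pow_manifold n M)) W"
 shows "openin (RR (midx (pow_manifold n M))) (ph ` (U \<inter> W))"
proof -
 note ch = charted_pow[OF smooth_manifold_charted[OF M]]
 show ?thesis by (rule charted_chart(3)[OF ch U Int_lower1 openin_Int[OF charted_chart(1)[OF ch U] W]])
qed

lemma smooth_map_continuous: "smooth_map M N f ==> continuous_map (mtop M) (mtop N) f"
 by (simp add: smooth_map_def smooth_map_on_def)

lemma smooth_map_prod_continuous:
 "smooth_map (prod_manifold M M') N f ==> continuous_map (prod_topology (mtop M) (mtop M')) (mtop N) f"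
 using smooth_map_continuous[of "prod_manifold M M'" N f] by (simp add: prod_manifold_def)

lemma mtop_pow: "mtop (pow_manifold n M) = product_topology (%_. mtop M) {..<n}"
 by (simp add: pow_manifold_def)

lemma smooth_map_on_subset:
 assumes "smooth_map_on (pow_manifold n M) K W h" "smooth_manifold M" "charted K" "openin (mtop (pow_manifold n M)) W'" "W' \<subseteq> W"
 shows "!!U ph. (U, ph) : matlas (pow_manifold n M) ==>
   plot K (midx (pow_manifold n M)) (ph ` (U \<inter> W')) (%p. h (inv_into U ph p))"
  "continuous_map (subtopology (mtop (pow_manifold n M)) W') (mtop K) h"
proof -
 let ?P = "pow_manifold n M"
 have chP: "charted ?P" by (rule charted_pow[OF smooth_manifold_charted[OF assms(2)]])
 show "plot K (midx ?P) (ph ` (U \<inter> W')) (%p. h (inv_into U ph p))" if U: "(U, ph) : matlas ?P" for U ph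
 proof (rule plot_compose[OF chP assms(3,1)])
  show "plot ?P (midx ?P) (ph ` (U \<inter> W')) (inv_into U ph)"
   by (rule plot_subset[OF chart_pow_plot(2)[OF assms(2) U] chart_pow_image_open[OF assms(2) U assms(4)]]) auto
  show "inv_into U ph ` ph ` (U \<inter> W') \<subseteq> W"
   using charted_chart(2)[OF chP U] assms(5) by (auto simp: inv_into_f_f)
 qed
 show "continuous_map (subtopology (mtop ?P) W') (mtop K) h"
  using continuous_map_from_subtopology_mono[OF smooth_map_on_charted(2)[OF assms(1)] assms(5)] .
qed

section \<open>Regularity of functions on powers, stable under pointwise operations\<close>

definition tup1 :: "'g => nat => 'g" where "tup1 a = (\<lambda>j\<in>{..<1}. a)"

definition tup2 :: "'g => 'g => nat => 'g" where "tup2 a b = (\<lambda>j\<in>{..<2}. if j = 0 then a else b)"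

lemma tup2_app: "tup2 a b 0 = a" "tup2 a b 1 = b" "tup2 a b (Suc 0) = b" by (simp_all add: tup2_def)

definition meas :: "nat => ('g, 'i) manifold => ('k, 'l) manifold => ((nat => 'g) => 'k) => bool" where
 "meas n M K h \<longleftrightarrow> h : measurable (borel_of (mtop (pow_manifold n M))) (borel_of (mtop K))"

definition cont_near :: "(nat => 'g) => nat => ('g, 'i) manifold => ('k, 'l) manifold => ((nat => 'g) => 'k) => bool" where
 "cont_near e n M K h \<longleftrightarrow> (\<exists>W. openin (mtop (pow_manifold n M)) W & e : W \<and>
   continuous_map (subtopology (mtop (pow_manifold n M)) W) (mtop K) h)"

definition smooth_near :: "(nat => 'g) => nat => ('g, 'i) manifold => ('k, 'l) manifold => ((nat => 'g) => 'k) => bool" where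
 "smooth_near e n M K h \<longleftrightarrow> (\<exists>W. openin (mtop (pow_manifold n M)) W & e : W & smooth_map_on (pow_manifold n M) K W h)"

lemma smooth_near_imp_cont_near: "smooth_near e n M K h ==> cont_near e n M K h"
 unfolding smooth_near_def cont_near_def using smooth_map_on_charted(2) by metis

lemma meas_op1: "smooth_map K K' F ==> meas n M K h ==> meas n M K' (%s. F (h s))"
 unfolding meas_def using measurable_compose[OF _ continuous_imp_measurable[OF smooth_map_continuous]] by blast

lemma meas_op2:
 assumes "smooth_map (prod_manifold K1 K2) K3 F" "second_countable (mtop K1)" "second_countable (mtop K2)"
  "meas n M K1 h1" "meas n M K2 h2"
 shows "meas n M K3 (%s. F (h1 s, h2 s))"
 unfolding meas_def
 by (rule measurable_compose[OF measurable_pair_borel_of[OF assms(2,3) assms(4,5)[unfolded meas_def]]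
   continuous_imp_measurable[OF smooth_map_prod_continuous[OF assms(1)]]])

lemma meas_const: "k : topspace (mtop K) ==> meas n M K (%s. k)"
 unfolding meas_def by (rule continuous_imp_measurable) simp

lemma meas_proj: "j < n ==> meas n M M (%s. s j)"
 unfolding meas_def mtop_pow by (rule continuous_imp_measurable, rule continuous_map_product_projection) simp

lemma meas_cong: "meas n M K h ==> (!!s. s : topspace (mtop (pow_manifold n M)) ==> h s = h' s) ==> meas n M K h'"
 unfolding meas_def by (subst measurable_cong[of _ h' h]) (simp_all add: space_borel_of)

lemma continuous_tup1: "continuous_map T (mtop M) g ==> continuous_map T (mtop (pow_manifold 1 M)) (%s. tup1 (g s))"
 unfolding mtop_pow continuous_map_componentwise by (auto simp: tup1_def)

lemma meas_pre:
 assumes "meas 1 M K h" "meas n M M g"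
 shows "meas n M K (%s. h (tup1 (g s)))"
proof -
 have "tup1 : measurable (borel_of (mtop M)) (borel_of (mtop (pow_manifold 1 M)))"
  using continuous_imp_measurable[OF continuous_tup1[OF continuous_map_id]] by simp
 from measurable_compose[OF measurable_compose[OF assms(2)[unfolded meas_def] this] assms(1)[unfolded meas_def]]
 show ?thesis by (simp add: meas_def)
qed

lemma cont_near_op1:
 assumes "smooth_map K K' F" "cont_near e n M K h"
 shows "cont_near e n M K' (%s. F (h s))"
proof -
 obtain W where W: "openin (mtop (pow_manifold n M)) W" "e : W" "continuous_map (subtopology (mtop (pow_manifold n M)) W) (mtop K) h"
  using assms(2) unfolding cont_near_def by blast
 have "continuous_map (subtopology (mtop (pow_manifold n M)) W) (mtop K') (%s. F (h s))"
  using continuous_map_compose[OF W(3) smooth_map_continuous[OF assms(1)]] by (simp add: o_def)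
 thus ?thesis unfolding cont_near_def using W(1,2) by blast
qed

lemma cont_near_op2:
 assumes "smooth_map (prod_manifold K1 K2) K3 F" "cont_near e n M K1 h1" "cont_near e n M K2 h2"
 shows "cont_near e n M K3 (%s. F (h1 s, h2 s))"
proof -
 let ?T = "mtop (pow_manifold n M)"
 obtain W1 where W1: "openin ?T W1" "e : W1" "continuous_map (subtopology ?T W1) (mtop K1) h1" using assms(2) unfolding cont_near_def by blast
 obtain W2 where W2: "openin ?T W2" "e : W2" "continuous_map (subtopology ?T W2) (mtop K2) h2" using assms(3) unfolding cont_near_def by blast
 have "continuous_map (subtopology ?T (W1 \<inter> W2)) (prod_topology (mtop K1) (mtop K2)) (%s. (h1 s, h2 s))"
  unfolding continuous_map_paired
  using continuous_map_from_subtopology_mono[OF W1(3), of "W1 \<inter> W2"] continuous_map_from_subtopology_mono[OF W2(3), of "W1 \<inter> W2"] by auto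
 from continuous_map_compose[OF this smooth_map_prod_continuous[OF assms(1)]]
 have "continuous_map (subtopology ?T (W1 \<inter> W2)) (mtop K3) (%s. F (h1 s, h2 s))" by (simp add: o_def)
 thus ?thesis unfolding cont_near_def using W1(1,2) W2(1,2) by (intro exI[of _ "W1 \<inter> W2"]) auto
qed

lemma cont_near_const: "k : topspace (mtop K) ==> e : topspace (mtop (pow_manifold n M)) ==> cont_near e n M K (%s. k)"
 unfolding cont_near_def by (intro exI[of _ "topspace (mtop (pow_manifold n M))"]) auto

lemma cont_near_proj:
 assumes "j < n" "e : topspace (mtop (pow_manifold n M))"
 shows "cont_near e n M M (%s. s j)"
proof -
 have "continuous_map (mtop (pow_manifold n M)) (mtop M) (%s. s j)"
  unfolding mtop_pow by (rule continuous_map_product_projection) (use assms(1) in simp)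
 thus ?thesis unfolding cont_near_def
  by (intro exI[of _ "topspace (mtop (pow_manifold n M))"] conjI openin_topspace assms(2) continuous_map_from_subtopology)
qed

lemma cont_near_cong:
 assumes "cont_near e n M K h" "!!s. s : topspace (mtop (pow_manifold n M)) ==> h s = h' s"
 shows "cont_near e n M K h'"
proof -
 let ?T = "mtop (pow_manifold n M)"
 obtain W where W: "openin ?T W" "e : W" "continuous_map (subtopology ?T W) (mtop K) h" using assms(1) unfolding cont_near_def by blast
 have "continuous_map (subtopology ?T W) (mtop K) h'" by (rule continuous_map_eq[OF W(3)]) (use assms(2) in auto)
 thus ?thesis unfolding cont_near_def using W by blast
qed

lemma preimage_open_in:
 assumes "openin T W" "continuous_map (subtopology T W) T' g" "openin T' O'"
 shows "openin T {s : W. g s : O'}"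
proof -
 have e: "topspace (subtopology T W) = W" using openin_subset[OF assms(1)] by auto
 from openin_continuous_map_preimage[OF assms(2,3)] have "openin (subtopology T W) {s : W. g s : O'}" unfolding e .
 thus ?thesis by (rule openin_trans_full[OF _ assms(1)])
qed

lemma cont_near_pre:
 assumes "cont_near (tup1 (g e)) 1 M K h" "cont_near e n M M g"
 shows "cont_near e n M K (%s. h (tup1 (g s)))"
proof -
 let ?T = "mtop (pow_manifold n M)"
 obtain W1 where W1: "openin (mtop (pow_manifold 1 M)) W1" "tup1 (g e) : W1" "continuous_map (subtopology (mtop (pow_manifold 1 M)) W1) (mtop K) h"
  using assms(1) unfolding cont_near_def by blast
 obtain W2 where W2: "openin ?T W2" "e : W2" "continuous_map (subtopology ?T W2) (mtop M) g" using assms(2) unfolding cont_near_def by blast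
 note c = continuous_tup1[OF W2(3)]
 let ?W = "{s : W2. tup1 (g s) : W1}"
 have "continuous_map (subtopology ?T ?W) (subtopology (mtop (pow_manifold 1 M)) W1) (%s. tup1 (g s))"
  unfolding continuous_map_in_subtopology using continuous_map_from_subtopology_mono[OF c, of ?W] by auto
 from continuous_map_compose[OF this W1(3)] have "continuous_map (subtopology ?T ?W) (mtop K) (%s. h (tup1 (g s)))" by (simp add: o_def)
 thus ?thesis unfolding cont_near_def using preimage_open_in[OF W2(1) c W1(1)] W1(2) W2(2) by (intro exI[of _ ?W]) auto
qed

lemma smooth_near_op2:
 assumes F: "smooth_map (prod_manifold K1 K2) K3 F" and M: "smooth_manifold M" and K: "charted K1" "charted K2" "charted K3"
  and h: "smooth_near e n M K1 h1" "smooth_near e n M K2 h2"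
 shows "smooth_near e n M K3 (%s. F (h1 s, h2 s))"
proof -
 let ?P = "pow_manifold n M"
 obtain W1 where W1: "openin (mtop ?P) W1" "e : W1" "smooth_map_on ?P K1 W1 h1" using h(1) unfolding smooth_near_def by blast
 obtain W2 where W2: "openin (mtop ?P) W2" "e : W2" "smooth_map_on ?P K2 W2 h2" using h(2) unfolding smooth_near_def by blast
 let ?W = "W1 \<inter> W2"
 have oW: "openin (mtop ?P) ?W" using W1 W2 by auto
 note s1 = smooth_map_on_subset[OF W1(3) M K(1) oW Int_lower1] and s2 = smooth_map_on_subset[OF W2(3) M K(2) oW Int_lower2]
 have "smooth_map_on ?P K3 ?W (%s. F (h1 s, h2 s))"
 proof (rule smooth_map_onI[OF oW _ charted_pow[OF smooth_manifold_charted[OF M]]])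
  have "continuous_map (subtopology (mtop ?P) ?W) (prod_topology (mtop K1) (mtop K2)) (%s. (h1 s, h2 s))"
   unfolding continuous_map_paired using s1(2) s2(2) by blast
  from continuous_map_compose[OF this smooth_map_prod_continuous[OF F]]
  show "continuous_map (subtopology (mtop ?P) ?W) (mtop K3) (%s. F (h1 s, h2 s))" by (simp add: o_def)
  fix U ph assume U: "(U, ph) : matlas ?P"
  show "plot K3 (midx ?P) (ph ` (U \<inter> ?W)) (%p. F (h1 (inv_into U ph p), h2 (inv_into U ph p)))"
   by (rule plot_smooth_map[OF charted_prod[OF K(1,2)] K(3) F plot_pair[OF s1(1)[OF U] s2(1)[OF U]]])
 qed
 thus ?thesis unfolding smooth_near_def using oW W1(2) W2(2) by blast
qed

lemma smooth_near_op1: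
 assumes F: "smooth_map K1 K3 F" and M: "smooth_manifold M" and K: "charted K1" "charted K3" and h: "smooth_near e n M K1 h1"
 shows "smooth_near e n M K3 (%s. F (h1 s))"
proof -
 let ?P = "pow_manifold n M"
 obtain W where W: "openin (mtop ?P) W" "e : W" "smooth_map_on ?P K1 W h1" using h unfolding smooth_near_def by blast
 note s1 = smooth_map_on_subset[OF W(3) M K(1) W(1) subset_refl]
 have "smooth_map_on ?P K3 W (%s. F (h1 s))"
 proof (rule smooth_map_onI[OF W(1) _ charted_pow[OF smooth_manifold_charted[OF M]]])
  from continuous_map_compose[OF s1(2) smooth_map_continuous[OF F]]
  show "continuous_map (subtopology (mtop ?P) W) (mtop K3) (%s. F (h1 s))" by (simp add: o_def)
  fix U ph assume U: "(U, ph) : matlas ?P"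
  show "plot K3 (midx ?P) (ph ` (U \<inter> W)) (%p. F (h1 (inv_into U ph p)))"
   by (rule plot_smooth_map[OF K F s1(1)[OF U]])
 qed
 thus ?thesis unfolding smooth_near_def using W by blast
qed

lemma smooth_near_const:
 assumes M: "smooth_manifold M" and k: "k : topspace (mtop K)" and e: "e : topspace (mtop (pow_manifold n M))"
 shows "smooth_near e n M K (%s. k)"
 unfolding smooth_near_def
proof (intro exI[of _ "topspace (mtop (pow_manifold n M))"] conjI e openin_topspace)
 show "smooth_map_on (pow_manifold n M) K (topspace (mtop (pow_manifold n M))) (%s. k)"
 proof (rule smooth_map_onI[OF openin_topspace _ charted_pow[OF smooth_manifold_charted[OF M]]])
  fix U ph assume U: "(U, ph) : matlas (pow_manifold n M)"
  show "plot K (midx (pow_manifold n M)) (ph ` (U \<inter> topspace (mtop (pow_manifold n M)))) (%p. k)"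
   by (rule plot_const[OF chart_pow_image_open[OF M U openin_topspace] k])
 qed (use k in simp)
qed

lemma smooth_near_proj:
 assumes M: "smooth_manifold M" and j: "j < n" and e: "e : topspace (mtop (pow_manifold n M))"
 shows "smooth_near e n M M (%s. s j)"
 unfolding smooth_near_def
proof (intro exI[of _ "topspace (mtop (pow_manifold n M))"] conjI e openin_topspace)
 show "smooth_map_on (pow_manifold n M) M (topspace (mtop (pow_manifold n M))) (%s. s j)"
 proof (rule smooth_map_onI[OF openin_topspace _ charted_pow[OF smooth_manifold_charted[OF M]]])
  show "continuous_map (subtopology (mtop (pow_manifold n M)) (topspace (mtop (pow_manifold n M)))) (mtop M) (%s. s j)"
   unfolding mtop_pow by (rule continuous_map_from_subtopology, rule continuous_map_product_projection) (use j in simp)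
  fix U ph assume U: "(U, ph) : matlas (pow_manifold n M)"
  show "plot M (midx (pow_manifold n M)) (ph ` (U \<inter> topspace (mtop (pow_manifold n M)))) (%p. inv_into U ph p j)"
   by (rule plot_subset[OF chart_pow_plot(1)[OF M U j] chart_pow_image_open[OF M U openin_topspace]]) auto
 qed
qed

lemma smooth_near_pre:
 assumes M: "smooth_manifold M" and K: "charted K" and h: "smooth_near (tup1 (g e)) 1 M K h" and g: "smooth_near e n M M g"
 shows "smooth_near e n M K (%s. h (tup1 (g s)))"
proof -
 let ?P = "pow_manifold n M" and ?P1 = "pow_manifold 1 M"
 have chM: "charted M" by (rule smooth_manifold_charted[OF M])
 obtain W1 where W1: "openin (mtop ?P1) W1" "tup1 (g e) : W1" "smooth_map_on ?P1 K W1 h" using h unfolding smooth_near_def by blast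
 obtain W2 where W2: "openin (mtop ?P) W2" "e : W2" "smooth_map_on ?P M W2 g" using g unfolding smooth_near_def by blast
 let ?W = "{s : W2. tup1 (g s) : W1}"
 note c = continuous_tup1[OF smooth_map_on_charted(2)[OF W2(3)]]
 have oW: "openin (mtop ?P) ?W" by (rule preimage_open_in[OF W2(1) c W1(1)])
 have "smooth_map_on ?P K ?W (%s. h (tup1 (g s)))"
 proof (rule smooth_map_onI[OF oW _ charted_pow[OF chM]])
  have "continuous_map (subtopology (mtop ?P) ?W) (subtopology (mtop ?P1) W1) (%s. tup1 (g s))"
   unfolding continuous_map_in_subtopology using continuous_map_from_subtopology_mono[OF c, of ?W] by auto
  from continuous_map_compose[OF this smooth_map_on_charted(2)[OF W1(3)]]
  show "continuous_map (subtopology (mtop ?P) ?W) (mtop K) (%s. h (tup1 (g s)))" by (simp add: o_def)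
  fix U ph assume U: "(U, ph) : matlas ?P"
  have p: "plot M (midx ?P) (ph ` (U \<inter> ?W)) (%p. g (inv_into U ph p))"
   by (rule smooth_map_on_subset(1)[OF W2(3) M chM oW _ U]) auto
  have "plot ?P1 (midx ?P) (ph ` (U \<inter> ?W)) (%p. tup1 (g (inv_into U ph p)))"
   by (rule plot_tuple[OF plot_open[OF p]]) (use p in \<open>auto simp: tup1_def\<close>)
  thus "plot K (midx ?P) (ph ` (U \<inter> ?W)) (%p. h (tup1 (g (inv_into U ph p))))"
  proof (rule plot_compose[OF charted_pow[OF chM] K W1(3)])
   show "(%p. tup1 (g (inv_into U ph p))) ` ph ` (U \<inter> ?W) \<subseteq> W1"
    using charted_chart(2)[OF charted_pow[OF chM] U] by (auto simp: inv_into_f_f)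
  qed
 qed
 thus ?thesis unfolding smooth_near_def using oW W1(2) W2(2) by blast
qed

lemma smooth_near_cong:
 assumes "smooth_near e n M K h" "!!s. s : topspace (mtop (pow_manifold n M)) ==> h s = h' s" and M: "smooth_manifold M" and K: "charted K"
 shows "smooth_near e n M K h'"
proof -
 let ?P = "pow_manifold n M"
 obtain W where W: "openin (mtop ?P) W" "e : W" "smooth_map_on ?P K W h" using assms(1) unfolding smooth_near_def by blast
 note s = smooth_map_on_subset[OF W(3) M K W(1) subset_refl]
 have WT: "W \<subseteq> topspace (mtop ?P)" using W(1) by (rule openin_subset)
 have "smooth_map_on ?P K W h'"
 proof (rule smooth_map_onI[OF W(1) _ charted_pow[OF smooth_manifold_charted[OF M]]])
  show "continuous_map (subtopology (mtop ?P) W) (mtop K) h'" by (rule continuous_map_eq[OF s(2)]) (use assms(2) in auto)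
  fix U ph assume U: "(U, ph) : matlas ?P"
  show "plot K (midx ?P) (ph ` (U \<inter> W)) (%p. h' (inv_into U ph p))"
  proof (rule plot_cong[OF s(1)[OF U] K])
   fix p assume "p : ph ` (U \<inter> W)"
   hence "inv_into U ph p : W" using charted_chart(2)[OF charted_pow[OF smooth_manifold_charted[OF M]] U] by (auto simp: inv_into_f_f)
   thus "h (inv_into U ph p) = h' (inv_into U ph p)" using WT by (intro assms(2)) auto
  qed
 qed
 thus ?thesis unfolding smooth_near_def using W by blast
qed

section \<open>The cochain complexes\<close>

text \<open>The first isomorphism theorem for the map from \<open>K\<close> to the quotient of
  \<open>K'\<close> by \<open>B'\<close>: \<open>ker\<close> computes its kernel and
  \<open>surj\<close> says that \<open>K'\<close> is the product of \<open>B'\<close> and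
  \<open>K\<close>.\<close>

lemma quotient_inclusion_iso:
 assumes P: "comm_group P" and K: "subgroup K P" "subgroup K' P" and B: "subgroup B' P"
  and sub: "K \<subseteq> K'" "B' \<subseteq> K'" and ker: "B' \<inter> K = B"
  and surj: "!!f. f : K' ==> \<exists>h\<in>B'. \<exists>k\<in>K. f = h \<otimes>\<^bsub>P\<^esub> k"
 shows "(%c. the_elem ((%f. B' #>\<^bsub>P\<lparr>carrier := K'\<rparr>\<^esub> f) ` c)) : iso (P\<lparr>carrier := K\<rparr> Mod B) (P\<lparr>carrier := K'\<rparr> Mod B')"
proof -
 interpret P: comm_group P by (rule P)
 define Z where "Z = P\<lparr>carrier := K\<rparr>"
 define Z' where "Z' = P\<lparr>carrier := K'\<rparr>"
 define h where "h f = B' #>\<^bsub>Z'\<^esub> f" for f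
 have gZ: "group Z" and gZ': "group Z'" unfolding Z_def Z'_def
  using subgroup.subgroup_is_group[OF K(1) P.group_axioms] subgroup.subgroup_is_group[OF K(2) P.group_axioms] .
 interpret Z': group Z' by (rule gZ')
 have cZ': "comm_group Z'"
  by (rule group.group_comm_groupI[OF gZ']) (use subgroup.subset[OF K(2)] in \<open>auto simp: Z'_def intro!: P.m_comm\<close>)
 have sB: "subgroup B' Z'" unfolding Z'_def by (rule P.subgroup_incl[OF B K(2) sub(2)])
 have nB: "B' \<lhd> Z'" by (rule comm_group.subgroup_imp_normal[OF cZ' sB])
 have gQ: "group (Z' Mod B')" by (rule normal.factorgroup_is_group[OF nB])
 have h': "h : hom Z' (Z' Mod B')" unfolding h_def[abs_def] by (rule normal.r_coset_hom_Mod[OF nB])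
 have "h : hom Z (Z' Mod B')"
 proof (rule homI)
  fix x assume "x : carrier Z"
  hence "x : carrier Z'" using sub by (auto simp: Z_def Z'_def)
  thus "h x : carrier (Z' Mod B')" using h' by (auto simp: hom_def)
 next
  fix x y assume "x : carrier Z" "y : carrier Z"
  hence "x : carrier Z'" "y : carrier Z'" using sub by (auto simp: Z_def Z'_def)
  hence "h (x \<otimes>\<^bsub>Z'\<^esub> y) = h x \<otimes>\<^bsub>Z' Mod B'\<^esub> h y" using h' by (auto simp: hom_def)
  thus "h (x \<otimes>\<^bsub>Z\<^esub> y) = h x \<otimes>\<^bsub>Z' Mod B'\<^esub> h y" by (simp add: Z_def Z'_def)
 qed
 then interpret H: group_hom Z "Z' Mod B'" h using gZ gQ by (simp add: group_hom_def group_hom_axioms_def)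
 have one: "\<one>\<^bsub>Z' Mod B'\<^esub> = B'" by (simp add: FactGroup_def)
 have "kernel Z (Z' Mod B') h = B' \<inter> K"
 proof (intro equalityI subsetI)
  fix x assume "x : kernel Z (Z' Mod B') h"
  hence x: "x : K" "B' #>\<^bsub>Z'\<^esub> x = B'" by (simp_all add: kernel_def one h_def Z_def)
  hence "x : B'" using Z'.coset_join1[OF x(2) _ sB] sub(1) by (auto simp: Z'_def)
  thus "x : B' \<inter> K" using x by simp
 next
  fix x assume x: "x : B' \<inter> K"
  hence "B' #>\<^bsub>Z'\<^esub> x = B'" using Z'.coset_join2[OF _ sB] sub(1) by (auto simp: Z'_def)
  thus "x : kernel Z (Z' Mod B') h" using x by (simp add: kernel_def one h_def Z_def)
 qed
 hence k: "kernel Z (Z' Mod B') h = B" using ker by simp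
 have "h ` carrier Z = carrier (Z' Mod B')"
 proof
  show "h ` carrier Z \<subseteq> carrier (Z' Mod B')" by auto
  show "carrier (Z' Mod B') \<subseteq> h ` carrier Z"
  proof
   fix c assume "c : carrier (Z' Mod B')"
   then obtain f where f: "f : K'" "c = B' #>\<^bsub>Z'\<^esub> f" by (auto simp: FactGroup_def RCOSETS_def Z'_def)
   obtain b k where bk: "b : B'" "k : K" "f = b \<otimes>\<^bsub>P\<^esub> k" using surj[OF f(1)] by blast
   have "f : B' #>\<^bsub>Z'\<^esub> k" using bk by (auto simp: r_coset_def Z'_def)
   hence "B' #>\<^bsub>Z'\<^esub> k = B' #>\<^bsub>Z'\<^esub> f" by (rule Z'.repr_independence[OF _ _ sB]) (use bk sub in \<open>auto simp: Z'_def\<close>)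
   thus "c : h ` carrier Z" using bk(2) f(2) by (auto simp: h_def Z_def)
  qed
 qed
 from H.FactGroup_iso_set[OF this] show ?thesis unfolding k unfolding h_def[abs_def] unfolding Z_def Z'_def .
qed

locale module_cochains =
 fixes G :: "('g, 'c) monoid_scheme" and M :: "('g, 'i) manifold"
  and A :: "('a, 'd) monoid_scheme" and N :: "('a, 'j) manifold" and act :: "'g => 'a => 'a"
 assumes lieG: "lie_group G M" and mod: "smooth_module G M A N act"
begin

lemma A: "comm_group A" and lieA: "lie_group A N" using mod by (auto simp: smooth_module_def)

sublocale A: comm_group A by (rule A)

lemmas lieM = lie_groupD[OF lieG] and lieN = lie_groupD[OF lieA] and modD = smooth_moduleD[OF mod lieG]

sublocale G: group G by (rule lieM(1))

lemma act_smooth: "smooth_map (prod_manifold M N) N (%(g, a). act g a)" using mod by (simp add: smooth_module_def)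

lemma act_one: "g : carrier G ==> act g \<one>\<^bsub>A\<^esub> = \<one>\<^bsub>A\<^esub>"
 using modD(2)[of g "\<one>\<^bsub>A\<^esub>" "\<one>\<^bsub>A\<^esub>"] modD(1)[of g "\<one>\<^bsub>A\<^esub>"] by (simp add: A.r_cancel_one')

lemma act_inv: "g : carrier G ==> a : carrier A ==> act g (inv\<^bsub>A\<^esub> a) = inv\<^bsub>A\<^esub> act g a"
 using modD(2)[of g "inv\<^bsub>A\<^esub> a" a] modD(1)[of g a] modD(1)[of g "inv\<^bsub>A\<^esub> a"] act_one[of g]
 by (intro A.inv_equality[symmetric]) simp_all

lemma second_countable_MN: "second_countable (mtop M)" "second_countable (mtop N)"
 using lieM(2) lieN(2) by (simp_all add: smooth_manifold_def)

abbreviation "T n \<equiv> tuples G n"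
abbreviation "PG n \<equiv> product_group (tuples G n) (%_. A)"
abbreviation "d n \<equiv> coboundary G A act n"
abbreviation "lcm' n \<equiv> lcm_cochains G M A N n"
abbreviation "lsm' n \<equiv> lsm_cochains G M A N n"

lemma topspace_pow: "topspace (mtop (pow_manifold n M)) = T n"
 by (simp add: mtop_pow tuples_def lieM(4))

lemma id_in: "id_tuple G n : T n" by (auto simp: id_tuple_def tuples_def)

lemma id_top: "id_tuple G n : topspace (mtop (pow_manifold n M))" by (simp add: topspace_pow id_in)

lemma PG: "comm_group (PG n)"
 by (rule group.group_comm_groupI[OF product_group]) (auto simp: A.m_comm PiE_iff intro!: restrict_ext)

lemma lcm_iff: "f : lcm' n \<longleftrightarrow> f : carrier (PG n) & meas n M N f & cont_near (id_tuple G n) n M N f"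
 by (auto simp: lcm_cochains_def measurable_cochains_def meas_def cont_near_def)

lemma lsm_iff: "f : lsm' n \<longleftrightarrow> f : carrier (PG n) & meas n M N f & smooth_near (id_tuple G n) n M N f"
 by (auto simp: lsm_cochains_def measurable_cochains_def meas_def smooth_near_def)

lemma lsm_subset_lcm: "lsm' n \<subseteq> lcm' n"
 by (auto simp: lsm_iff lcm_iff smooth_near_imp_cont_near)

lemma cochainD: "f : carrier (PG n) ==> s : T n ==> f s : carrier A" by (auto simp: PiE_iff)

lemma restrict_carrier: "(!!s. s : T n ==> h s : carrier A) ==> restrict h (T n) : carrier (PG n)" by auto

lemma lcmI:
 assumes "!!s. s : T n ==> h s : carrier A" "meas n M N h" "cont_near (id_tuple G n) n M N h"
 shows "restrict h (T n) : lcm' n"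
 unfolding lcm_iff
 using restrict_carrier[of n h, OF assms(1)] meas_cong[OF assms(2), of "restrict h (T n)"] cont_near_cong[OF assms(3), of "restrict h (T n)"]
 by (simp add: topspace_pow)

lemma lsmI:
 assumes "!!s. s : T n ==> h s : carrier A" "meas n M N h" "smooth_near (id_tuple G n) n M N h"
 shows "restrict h (T n) : lsm' n"
 unfolding lsm_iff
 using restrict_carrier[of n h, OF assms(1)] meas_cong[OF assms(2), of "restrict h (T n)"]
  smooth_near_cong[OF assms(3) _ lieM(2) lieN(3), of "restrict h (T n)"]
 by (simp add: topspace_pow)

lemma meas_rules:
 "meas n M N f ==> meas n M N g ==> meas n M N (%s. f s \<otimes>\<^bsub>A\<^esub> g s)"
 "meas n M N f ==> meas n M N (%s. inv\<^bsub>A\<^esub> f s)"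
 "meas n M M u ==> meas n M N f ==> meas n M N (%s. act (u s) (f s))"
 "meas n M M u ==> meas n M M v ==> meas n M M (%s. u s \<otimes>\<^bsub>G\<^esub> v s)"
 using meas_op2[OF lieN(5) second_countable_MN(2,2), of n M f g] meas_op1[OF lieN(6), of n M f]
  meas_op2[OF act_smooth second_countable_MN, of n M u f] meas_op2[OF lieM(5) second_countable_MN(1,1), of n M u v] by simp_all

lemma cont_rules:
 "cont_near e n M N f ==> cont_near e n M N g ==> cont_near e n M N (%s. f s \<otimes>\<^bsub>A\<^esub> g s)"
 "cont_near e n M N f ==> cont_near e n M N (%s. inv\<^bsub>A\<^esub> f s)"
 "cont_near e n M M u ==> cont_near e n M N f ==> cont_near e n M N (%s. act (u s) (f s))"
 "cont_near e n M M u ==> cont_near e n M M v ==> cont_near e n M M (%s. u s \<otimes>\<^bsub>G\<^esub> v s)"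
 using cont_near_op2[OF lieN(5), of e n M f g] cont_near_op1[OF lieN(6), of e n M f]
  cont_near_op2[OF act_smooth, of e n M u f] cont_near_op2[OF lieM(5), of e n M u v] by simp_all

lemma smooth_rules:
 "smooth_near e n M N f ==> smooth_near e n M N g ==> smooth_near e n M N (%s. f s \<otimes>\<^bsub>A\<^esub> g s)"
 "smooth_near e n M N f ==> smooth_near e n M N (%s. inv\<^bsub>A\<^esub> f s)"
 "smooth_near e n M M u ==> smooth_near e n M N f ==> smooth_near e n M N (%s. act (u s) (f s))"
 "smooth_near e n M M u ==> smooth_near e n M M v ==> smooth_near e n M M (%s. u s \<otimes>\<^bsub>G\<^esub> v s)"
 using smooth_near_op2[OF lieN(5) lieM(2) lieN(3,3,3), of e n f g] smooth_near_op1[OF lieN(6) lieM(2) lieN(3,3), of e n f]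
  smooth_near_op2[OF act_smooth lieM(2,3) lieN(3,3), of e n u f] smooth_near_op2[OF lieM(5) lieM(2,3,3,3), of e n u v] by simp_all

lemma inv_PG: "f : carrier (PG n) ==> inv\<^bsub>PG n\<^esub> f = (\<lambda>s\<in>T n. inv\<^bsub>A\<^esub> f s)"
 by (rule inv_product_group) (simp_all add: A.group_axioms)

lemma subgroup_lcm: "subgroup (lcm' n) (PG n)"
proof -
 interpret P: comm_group "PG n" by (rule PG)
 show ?thesis
 proof (rule P.subgroupI)
  show "lcm' n \<subseteq> carrier (PG n)" unfolding lcm_iff by (rule subsetI) (simp only: lcm_iff)
  have "(\<lambda>s\<in>T n. \<one>\<^bsub>A\<^esub>) : lcm' n"
   by (rule lcmI[OF _ meas_const cont_near_const[OF _ id_top]]) (simp_all add: lieN(4))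
  thus "lcm' n ~= {}" by blast
  fix f assume f: "f : lcm' n"
  hence f': "f : carrier (PG n)" "meas n M N f" "cont_near (id_tuple G n) n M N f" by (simp_all only: lcm_iff)
  show "inv\<^bsub>PG n\<^esub> f : lcm' n" unfolding inv_PG[OF f'(1)]
   by (rule lcmI[OF _ meas_rules(2)[OF f'(2)] cont_rules(2)[OF f'(3)]]) (simp add: cochainD[OF f'(1)])
  fix g assume g: "g : lcm' n"
  hence g': "g : carrier (PG n)" "meas n M N g" "cont_near (id_tuple G n) n M N g" by (simp_all only: lcm_iff)
  show "f \<otimes>\<^bsub>PG n\<^esub> g : lcm' n" unfolding mult_product_group
   by (rule lcmI[OF _ meas_rules(1)[OF f'(2) g'(2)] cont_rules(1)[OF f'(3) g'(3)]]) (simp add: cochainD[OF f'(1)] cochainD[OF g'(1)])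
 qed
qed

lemma subgroup_lsm: "subgroup (lsm' n) (PG n)"
proof -
 interpret P: comm_group "PG n" by (rule PG)
 show ?thesis
 proof (rule P.subgroupI)
  show "lsm' n \<subseteq> carrier (PG n)" by (rule subsetI) (simp only: lsm_iff)
  have "(\<lambda>s\<in>T n. \<one>\<^bsub>A\<^esub>) : lsm' n"
   by (rule lsmI[OF _ meas_const smooth_near_const[OF lieM(2) _ id_top]]) (simp_all add: lieN(4))
  thus "lsm' n ~= {}" by blast
  fix f assume f: "f : lsm' n"
  hence f': "f : carrier (PG n)" "meas n M N f" "smooth_near (id_tuple G n) n M N f" by (simp_all only: lsm_iff)
  show "inv\<^bsub>PG n\<^esub> f : lsm' n" unfolding inv_PG[OF f'(1)]
   by (rule lsmI[OF _ meas_rules(2)[OF f'(2)] smooth_rules(2)[OF f'(3)]]) (simp add: cochainD[OF f'(1)])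
  fix g assume g: "g : lsm' n"
  hence g': "g : carrier (PG n)" "meas n M N g" "smooth_near (id_tuple G n) n M N g" by (simp_all only: lsm_iff)
  show "f \<otimes>\<^bsub>PG n\<^esub> g : lsm' n" unfolding mult_product_group
   by (rule lsmI[OF _ meas_rules(1)[OF f'(2) g'(2)] smooth_rules(1)[OF f'(3) g'(3)]]) (simp add: cochainD[OF f'(1)] cochainD[OF g'(1)])
 qed
qed

section \<open>The coboundary as a homomorphism and in low degrees\<close>

lemma tuplesD: "s : T n ==> j < n ==> s j : carrier G" by (auto simp: tuples_def)

lemma tup_in: "a : carrier G ==> tup1 a : T 1" "a : carrier G ==> b : carrier G ==> tup2 a b : T 2"
 by (auto simp: tup1_def tup2_def tuples_def)

lemma tup2_ext: "h : extensional {..<2} ==> h 0 = a ==> h 1 = b ==> h = tup2 a b"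
 by (rule extensionalityI[of _ "{..<2}"]) (auto simp: tup2_def less_2_cases_iff)

lemma tup2_eta: "s : T 2 ==> tup2 (s 0) (s 1) = s"
 by (rule extensionalityI[of _ "{..<2}"]) (auto simp: tup2_def tuples_def PiE_iff less_2_cases_iff)

lemma tup1_eta: "s : T 1 ==> tup1 (s 0) = s"
 by (rule extensionalityI[of _ "{..<1}"]) (auto simp: tup1_def tuples_def PiE_iff)

lemma face_in:
 assumes s: "s : T (n + 1)"
 shows "(\<lambda>j\<in>{..<n}. s (j + 1)) : T n" "(\<lambda>j\<in>{..<n}. s j) : T n" "i : {1..n} ==> inner_face G n i s : T n"
 using tuplesD[OF s] by (auto simp: tuples_def inner_face_def)

lemma d_hom: "d n : hom (PG n) (PG (n + 1))"
proof (rule homI)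
 fix f assume f: "f : carrier (PG n)"
 note fc = cochainD[OF f]
 show "d n f : carrier (PG (n + 1))"
  unfolding coboundary_def
 proof (rule restrict_carrier)
  fix s assume s: "s : T (n + 1)"
  note fi = face_in[OF s] and s0 = tuplesD[OF s, of 0, simplified]
  show "act (s 0) (f (\<lambda>j\<in>{..<n}. s (j + 1))) \<otimes>\<^bsub>A\<^esub> (\<Otimes>\<^bsub>A\<^esub>i\<in>{1..n}. f (inner_face G n i s) [^]\<^bsub>A\<^esub> ((- 1) ^ i :: int))
    \<otimes>\<^bsub>A\<^esub> f (\<lambda>j\<in>{..<n}. s j) [^]\<^bsub>A\<^esub> ((- 1) ^ (n + 1) :: int) : carrier A"
   by (intro A.m_closed A.finprod_closed A.int_pow_closed modD(1) s0 fc fi Pi_I)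
 qed
next
 fix f g assume f: "f : carrier (PG n)" and g: "g : carrier (PG n)"
 note fc = cochainD[OF f] and gc = cochainD[OF g]
 show "d n (f \<otimes>\<^bsub>PG n\<^esub> g) = d n f \<otimes>\<^bsub>PG (n + 1)\<^esub> d n g"
  unfolding mult_product_group
 proof (rule extensionalityI[of _ "T (n + 1)"])
  fix s assume s: "s : T (n + 1)"
  note fi = face_in[OF s] and s0 = tuplesD[OF s, of 0, simplified]
  \<comment> \<open>Outer and inner faces in a single sequence within \<open>T n\<close>, so that
    membership facts are available uniformly.\<close>
  define u where "u i = (if i = 0 then (\<lambda>j\<in>{..<n}. s (j + 1)) else if i <= n then inner_face G n i s else (\<lambda>j\<in>{..<n}. s j))" for i
  have uT: "u i : T n" for i using fi by (auto simp: u_def)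
  have D: "d n h s = act (s 0) (h (u 0)) \<otimes>\<^bsub>A\<^esub> (\<Otimes>\<^bsub>A\<^esub>i\<in>{1..n}. h (u i) [^]\<^bsub>A\<^esub> ((- 1) ^ i :: int)) \<otimes>\<^bsub>A\<^esub> h (u (n + 1)) [^]\<^bsub>A\<^esub> ((- 1) ^ (n + 1) :: int)"
   if h: "h : carrier (PG n)" for h
  proof -
   have "(\<Otimes>\<^bsub>A\<^esub>i\<in>{1..n}. h (inner_face G n i s) [^]\<^bsub>A\<^esub> ((- 1) ^ i :: int)) = (\<Otimes>\<^bsub>A\<^esub>i\<in>{1..n}. h (u i) [^]\<^bsub>A\<^esub> ((- 1) ^ i :: int))"
    by (rule A.finprod_cong') (use cochainD[OF h uT] in \<open>auto simp: u_def\<close>)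
   thus ?thesis using s by (simp add: coboundary_def u_def)
  qed
  have fg: "(\<lambda>s\<in>T n. f s \<otimes>\<^bsub>A\<^esub> g s) : carrier (PG n)" by (rule restrict_carrier) (simp add: fc gc)
  have "(\<Otimes>\<^bsub>A\<^esub>i\<in>{1..n}. (f (u i) \<otimes>\<^bsub>A\<^esub> g (u i)) [^]\<^bsub>A\<^esub> ((- 1) ^ i :: int)) =
    (\<Otimes>\<^bsub>A\<^esub>i\<in>{1..n}. f (u i) [^]\<^bsub>A\<^esub> ((- 1) ^ i :: int) \<otimes>\<^bsub>A\<^esub> g (u i) [^]\<^bsub>A\<^esub> ((- 1) ^ i :: int))"
   by (rule A.finprod_cong') (use fc[OF uT] gc[OF uT] in \<open>auto simp: A.int_pow_distrib\<close>)
  also have "\<dots> = (\<Otimes>\<^bsub>A\<^esub>i\<in>{1..n}. f (u i) [^]\<^bsub>A\<^esub> ((- 1) ^ i :: int)) \<otimes>\<^bsub>A\<^esub> (\<Otimes>\<^bsub>A\<^esub>i\<in>{1..n}. g (u i) [^]\<^bsub>A\<^esub> ((- 1) ^ i :: int))"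
   by (rule A.finprod_multf) (use fc[OF uT] gc[OF uT] in auto)
  finally have p: "(\<Otimes>\<^bsub>A\<^esub>i\<in>{1..n}. (f (u i) \<otimes>\<^bsub>A\<^esub> g (u i)) [^]\<^bsub>A\<^esub> ((- 1) ^ i :: int)) =
    (\<Otimes>\<^bsub>A\<^esub>i\<in>{1..n}. f (u i) [^]\<^bsub>A\<^esub> ((- 1) ^ i :: int)) \<otimes>\<^bsub>A\<^esub> (\<Otimes>\<^bsub>A\<^esub>i\<in>{1..n}. g (u i) [^]\<^bsub>A\<^esub> ((- 1) ^ i :: int))" .
  have pc: "(\<Otimes>\<^bsub>A\<^esub>i\<in>{1..n}. f (u i) [^]\<^bsub>A\<^esub> ((- 1) ^ i :: int)) : carrier A" "(\<Otimes>\<^bsub>A\<^esub>i\<in>{1..n}. g (u i) [^]\<^bsub>A\<^esub> ((- 1) ^ i :: int)) : carrier A"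
   using fc[OF uT] gc[OF uT] by (auto intro!: A.finprod_closed)
  show "d n (\<lambda>s\<in>T n. f s \<otimes>\<^bsub>A\<^esub> g s) s = (\<lambda>s\<in>T (n + 1). d n f s \<otimes>\<^bsub>A\<^esub> d n g s) s"
   unfolding restrict_apply'[OF s] D[OF fg] D[OF f] D[OF g] restrict_apply'[OF uT] p
    modD(2)[OF s0 fc[OF uT] gc[OF uT]] A.int_pow_distrib[OF fc[OF uT] gc[OF uT]]
   using modD(1)[OF s0 fc[OF uT, of 0]] modD(1)[OF s0 gc[OF uT, of 0]] pc A.int_pow_closed[OF fc[OF uT]] A.int_pow_closed[OF gc[OF uT]]
   by (simp add: A.m_ac)
 qed (simp_all add: coboundary_def)
qed

lemma d_group_hom: "group_hom (PG n) (PG (n + 1)) (d n)"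
 using d_hom comm_group.axioms(2)[OF PG] by (simp add: group_hom_def group_hom_axioms_def)

lemma d1:
 assumes b: "b : carrier (PG 1)" and s: "s : T 2"
 shows "d 1 b s = act (s 0) (b (tup1 (s 1))) \<otimes>\<^bsub>A\<^esub> inv\<^bsub>A\<^esub> b (tup1 (s 0 \<otimes>\<^bsub>G\<^esub> s 1)) \<otimes>\<^bsub>A\<^esub> b (tup1 (s 0))"
proof -
 have sc: "s 0 : carrier G" "s 1 : carrier G" using tuplesD[OF s] by auto
 have e: "(\<lambda>j\<in>{..<1}. s (j + 1)) = tup1 (s 1)" "(\<lambda>j\<in>{..<1}. s j) = tup1 (s 0)" "inner_face G 1 1 s = tup1 (s 0 \<otimes>\<^bsub>G\<^esub> s 1)"
  by (auto simp: tup1_def inner_face_def fun_eq_iff)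
 have c: "b (tup1 (s 0 \<otimes>\<^bsub>G\<^esub> s 1)) : carrier A" "b (tup1 (s 0)) : carrier A" using cochainD[OF b tup_in(1)] sc by auto
 have "(\<Otimes>\<^bsub>A\<^esub>i\<in>{1..1::nat}. b (inner_face G 1 i s) [^]\<^bsub>A\<^esub> ((- 1) ^ i :: int)) = inv\<^bsub>A\<^esub> b (tup1 (s 0 \<otimes>\<^bsub>G\<^esub> s 1))"
 proof -
  have i1: "{1..1::nat} = insert 1 {}" by simp
  have "(\<Otimes>\<^bsub>A\<^esub>i\<in>{1..1::nat}. b (inner_face G 1 i s) [^]\<^bsub>A\<^esub> ((- 1) ^ i :: int)) = b (inner_face G 1 1 s) [^]\<^bsub>A\<^esub> ((- 1) ^ 1 :: int) \<otimes>\<^bsub>A\<^esub> \<one>\<^bsub>A\<^esub>"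
   unfolding i1 by (subst A.finprod_insert) (use c in \<open>simp_all add: e[unfolded One_nat_def]\<close>)
  thus ?thesis unfolding e using c A.int_pow_neg[OF c(1), of 1] by (simp add: A.int_pow_1)
 qed
 note p = this
 have s': "s : T (1 + 1)" using s by (simp only: one_add_one)
 have n2: "((- 1) ^ (1 + 1) :: int) = 1" by simp
 show ?thesis unfolding coboundary_def restrict_apply'[OF s'] p e n2 A.int_pow_1[OF c(2)] ..
qed

lemma d2:
 assumes f: "f : carrier (PG 2)" and s: "s : T 3"
 shows "d 2 f s = act (s 0) (f (tup2 (s 1) (s 2))) \<otimes>\<^bsub>A\<^esub> (inv\<^bsub>A\<^esub> f (tup2 (s 0 \<otimes>\<^bsub>G\<^esub> s 1) (s 2)) \<otimes>\<^bsub>A\<^esub> f (tup2 (s 0) (s 1 \<otimes>\<^bsub>G\<^esub> s 2)))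
  \<otimes>\<^bsub>A\<^esub> inv\<^bsub>A\<^esub> f (tup2 (s 0) (s 1))"
proof -
 have sc: "s 0 : carrier G" "s 1 : carrier G" "s 2 : carrier G" using tuplesD[OF s] by auto
 have e: "(\<lambda>j\<in>{..<2}. s (j + 1)) = tup2 (s 1) (s 2)" "(\<lambda>j\<in>{..<2}. s j) = tup2 (s 0) (s 1)"
  "inner_face G 2 1 s = tup2 (s 0 \<otimes>\<^bsub>G\<^esub> s 1) (s 2)" "inner_face G 2 2 s = tup2 (s 0) (s 1 \<otimes>\<^bsub>G\<^esub> s 2)"
  by (rule tup2_ext; simp add: inner_face_def numeral_2_eq_2)+
 have c: "f (tup2 (s 0 \<otimes>\<^bsub>G\<^esub> s 1) (s 2)) : carrier A" "f (tup2 (s 0) (s 1 \<otimes>\<^bsub>G\<^esub> s 2)) : carrier A" "f (tup2 (s 0) (s 1)) : carrier A"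
  using cochainD[OF f tup_in(2)] sc by auto
 have i12: "{1..2::nat} = insert 1 (insert 2 {})" by auto
 have m: "x [^]\<^bsub>A\<^esub> (- 1 :: int) = inv\<^bsub>A\<^esub> x" if "x : carrier A" for x using A.int_pow_neg[OF that, of 1] that by (simp add: A.int_pow_1)
 have "(\<Otimes>\<^bsub>A\<^esub>i\<in>{1..2::nat}. f (inner_face G 2 i s) [^]\<^bsub>A\<^esub> ((- 1) ^ i :: int)) =
   f (inner_face G 2 1 s) [^]\<^bsub>A\<^esub> ((- 1) ^ 1 :: int) \<otimes>\<^bsub>A\<^esub> (f (inner_face G 2 2 s) [^]\<^bsub>A\<^esub> ((- 1) ^ 2 :: int) \<otimes>\<^bsub>A\<^esub> \<one>\<^bsub>A\<^esub>)"
  unfolding i12 by (subst A.finprod_insert; (subst A.finprod_insert)?) (use c in \<open>simp_all add: e[unfolded One_nat_def]\<close>)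
 also have "\<dots> = inv\<^bsub>A\<^esub> f (tup2 (s 0 \<otimes>\<^bsub>G\<^esub> s 1) (s 2)) \<otimes>\<^bsub>A\<^esub> f (tup2 (s 0) (s 1 \<otimes>\<^bsub>G\<^esub> s 2))"
  unfolding e using c by (simp add: m A.int_pow_1)
 finally have p: "(\<Otimes>\<^bsub>A\<^esub>i\<in>{1..2::nat}. f (inner_face G 2 i s) [^]\<^bsub>A\<^esub> ((- 1) ^ i :: int)) =
   inv\<^bsub>A\<^esub> f (tup2 (s 0 \<otimes>\<^bsub>G\<^esub> s 1) (s 2)) \<otimes>\<^bsub>A\<^esub> f (tup2 (s 0) (s 1 \<otimes>\<^bsub>G\<^esub> s 2))" .
 have s': "s : T (2 + 1)" using s by simp
 have n3: "((- 1) ^ (2 + 1) :: int) = - 1" by simp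
 show ?thesis unfolding coboundary_def restrict_apply'[OF s'] p e n3 m[OF c(3)] ..
qed

lemma cocycle_identity:
 assumes f: "f : carrier (PG 2)" and xyz: "x : carrier G" "y : carrier G" "z : carrier G" and dz: "d 2 f = \<one>\<^bsub>PG 3\<^esub>"
 shows "act x (f (tup2 y z)) \<otimes>\<^bsub>A\<^esub> f (tup2 x (y \<otimes>\<^bsub>G\<^esub> z)) = f (tup2 (x \<otimes>\<^bsub>G\<^esub> y) z) \<otimes>\<^bsub>A\<^esub> f (tup2 x y)"
proof -
 define s where "s = (\<lambda>j\<in>{..<3::nat}. if j = 0 then x else if j = 1 then y else z)"
 have s: "s : T 3" "s 0 = x" "s 1 = y" "s 2 = z" using xyz by (auto simp: s_def tuples_def)
 have c: "act x (f (tup2 y z)) : carrier A" "f (tup2 x (y \<otimes>\<^bsub>G\<^esub> z)) : carrier A" "f (tup2 (x \<otimes>\<^bsub>G\<^esub> y) z) : carrier A" "f (tup2 x y) : carrier A"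
  using xyz by (auto intro!: modD(1) cochainD[OF f] tup_in)
 have "\<one>\<^bsub>A\<^esub> = d 2 f s" unfolding dz using s(1) by simp
 also have "\<dots> = (act x (f (tup2 y z)) \<otimes>\<^bsub>A\<^esub> f (tup2 x (y \<otimes>\<^bsub>G\<^esub> z))) \<otimes>\<^bsub>A\<^esub> inv\<^bsub>A\<^esub> (f (tup2 (x \<otimes>\<^bsub>G\<^esub> y) z) \<otimes>\<^bsub>A\<^esub> f (tup2 x y))"
  unfolding d2[OF f s(1)] s using c by (simp add: A.inv_mult A.m_ac)
 finally show ?thesis using A.inv_equality[of "act x (f (tup2 y z)) \<otimes>\<^bsub>A\<^esub> f (tup2 x (y \<otimes>\<^bsub>G\<^esub> z))" "inv\<^bsub>A\<^esub> (f (tup2 (x \<otimes>\<^bsub>G\<^esub> y) z) \<otimes>\<^bsub>A\<^esub> f (tup2 x y))"] c by simp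
qed

text \<open>Twelve factors cancelling in six pairs. The inverses are first treated as independent
  letters, which makes the rearrangement purely associative and commutative.\<close>

lemma telescope:
 assumes "p : carrier A" "q : carrier A" "r : carrier A" "u : carrier A" "v : carrier A" "w : carrier A"
 shows "(p \<otimes>\<^bsub>A\<^esub> inv\<^bsub>A\<^esub> q \<otimes>\<^bsub>A\<^esub> r) \<otimes>\<^bsub>A\<^esub> (inv\<^bsub>A\<^esub> (p \<otimes>\<^bsub>A\<^esub> inv\<^bsub>A\<^esub> u \<otimes>\<^bsub>A\<^esub> v) \<otimes>\<^bsub>A\<^esub> (q \<otimes>\<^bsub>A\<^esub> inv\<^bsub>A\<^esub> u \<otimes>\<^bsub>A\<^esub> w)) \<otimes>\<^bsub>A\<^esub> inv\<^bsub>A\<^esub> (r \<otimes>\<^bsub>A\<^esub> inv\<^bsub>A\<^esub> v \<otimes>\<^bsub>A\<^esub> w) = \<one>\<^bsub>A\<^esub>"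
proof -
 have ac: "(p \<otimes>\<^bsub>A\<^esub> q' \<otimes>\<^bsub>A\<^esub> r) \<otimes>\<^bsub>A\<^esub> ((p' \<otimes>\<^bsub>A\<^esub> u \<otimes>\<^bsub>A\<^esub> v') \<otimes>\<^bsub>A\<^esub> (q \<otimes>\<^bsub>A\<^esub> u' \<otimes>\<^bsub>A\<^esub> w)) \<otimes>\<^bsub>A\<^esub> (r' \<otimes>\<^bsub>A\<^esub> v \<otimes>\<^bsub>A\<^esub> w') =
   (p \<otimes>\<^bsub>A\<^esub> p') \<otimes>\<^bsub>A\<^esub> ((q \<otimes>\<^bsub>A\<^esub> q') \<otimes>\<^bsub>A\<^esub> ((r \<otimes>\<^bsub>A\<^esub> r') \<otimes>\<^bsub>A\<^esub> ((u \<otimes>\<^bsub>A\<^esub> u') \<otimes>\<^bsub>A\<^esub> ((v \<otimes>\<^bsub>A\<^esub> v') \<otimes>\<^bsub>A\<^esub> (w \<otimes>\<^bsub>A\<^esub> w')))))"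
  if "p' : carrier A" "q' : carrier A" "r' : carrier A" "u' : carrier A" "v' : carrier A" "w' : carrier A" for p' q' r' u' v' w'
  using assms that by (simp add: A.m_ac)
 from ac[of "inv\<^bsub>A\<^esub> p" "inv\<^bsub>A\<^esub> q" "inv\<^bsub>A\<^esub> r" "inv\<^bsub>A\<^esub> u" "inv\<^bsub>A\<^esub> v" "inv\<^bsub>A\<^esub> w"]
 show ?thesis using assms by (simp add: A.inv_mult)
qed

text \<open>The six letters of \<open>telescope\<close> are the values of \<open>b\<close> on the
  entries and products of a triple, some of them moved by the action; \<open>q\<close> and
  \<open>u\<close> agree with two faces thanks to associativity in \<open>G\<close>.\<close>

lemma d2_d1:
 assumes b: "b : carrier (PG 1)"
 shows "d 2 (d 1 b) = \<one>\<^bsub>PG 3\<^esub>"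
proof (rule extensionalityI[of _ "T 3"])
 have db: "d 1 b : carrier (PG 2)" using hom_carrier[OF d_hom[of 1]] b unfolding one_add_one by blast
 have "d 2 (d 1 b) : extensional (T (2 + 1))" by (simp only: coboundary_def restrict_extensional)
 thus "d 2 (d 1 b) : extensional (T 3)" by simp
 show "\<one>\<^bsub>PG 3\<^esub> : extensional (T 3)" by simp
 fix s assume s: "s : T 3"
 define x y z where "x = s 0" and "y = s 1" and "z = s 2"
 have c: "x : carrier G" "y : carrier G" "z : carrier G" using tuplesD[OF s] by (auto simp: x_def y_def z_def)
 have bc: "b (tup1 a) : carrier A" if "a : carrier G" for a using that by (intro cochainD[OF b] tup_in)
 have D: "d 1 b (tup2 a a') = act a (b (tup1 a')) \<otimes>\<^bsub>A\<^esub> inv\<^bsub>A\<^esub> b (tup1 (a \<otimes>\<^bsub>G\<^esub> a')) \<otimes>\<^bsub>A\<^esub> b (tup1 a)"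
  if "a : carrier G" "a' : carrier G" for a a'
  using d1[OF b tup_in(2)[OF that]] by (simp only: tup2_app)
 have e1: "act x (d 1 b (tup2 y z)) = act (x \<otimes>\<^bsub>G\<^esub> y) (b (tup1 z)) \<otimes>\<^bsub>A\<^esub> inv\<^bsub>A\<^esub> act x (b (tup1 (y \<otimes>\<^bsub>G\<^esub> z))) \<otimes>\<^bsub>A\<^esub> act x (b (tup1 y))"
  unfolding D[OF c(2,3)] using c bc modD(1) by (simp add: modD(2) modD(3) act_inv)
 have as: "x \<otimes>\<^bsub>G\<^esub> (y \<otimes>\<^bsub>G\<^esub> z) = x \<otimes>\<^bsub>G\<^esub> y \<otimes>\<^bsub>G\<^esub> z" using c by (simp add: G.m_assoc)
 have "d 2 (d 1 b) s = \<one>\<^bsub>A\<^esub>"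
  unfolding d2[OF db s] x_def[symmetric] y_def[symmetric] z_def[symmetric] e1
   D[OF G.m_closed[OF c(1,2)] c(3)] D[OF c(1) G.m_closed[OF c(2,3)]] D[OF c(1,2)] as
  by (rule telescope) (use c bc in \<open>auto intro!: modD(1)\<close>)
 thus "d 2 (d 1 b) s = \<one>\<^bsub>PG 3\<^esub> s" using s by simp
qed

lemma id_faces: "tup1 (id_tuple G 2 0) = id_tuple G 1" "tup1 (id_tuple G 2 1) = id_tuple G 1"
 "tup1 (id_tuple G 2 0 \<otimes>\<^bsub>G\<^esub> id_tuple G 2 1) = id_tuple G 1"
 by (simp_all add: tup1_def id_tuple_def)

lemma d1_closed: "b : lcm' 1 ==> d 1 b : lcm' 2" "b : lsm' 1 ==> d 1 b : lsm' 2"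
proof -
 define D where "D b s = act (s 0) (b (tup1 (s 1))) \<otimes>\<^bsub>A\<^esub> inv\<^bsub>A\<^esub> b (tup1 (s 0 \<otimes>\<^bsub>G\<^esub> s 1)) \<otimes>\<^bsub>A\<^esub> b (tup1 (s 0))" for b :: "(nat => 'g) => 'a" and s :: "nat => 'g"
 have e: "d 1 b = restrict (D b) (T 2)" and Dc: "!!s. s : T 2 ==> D b s : carrier A" if b: "b : carrier (PG 1)" for b
 proof -
  show "d 1 b = restrict (D b) (T 2)"
  proof (rule extensionalityI[of _ "T 2"])
   have "d 1 b : extensional (T (1 + 1))" by (simp only: coboundary_def restrict_extensional)
   thus "d 1 b : extensional (T 2)" by (simp only: one_add_one)
  qed (simp_all add: d1[OF b, unfolded One_nat_def] D_def)
  have db: "d 1 b : carrier (PG 2)" using hom_carrier[OF d_hom[of 1]] b unfolding one_add_one by blast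
  show "D b s : carrier A" if "s : T 2" for s using cochainD[OF db that] d1[OF b that] by (simp add: D_def)
 qed
 have pj: "meas 2 M M (%s. s 0)" "meas 2 M M (%s. s 1)" by (rule meas_proj, simp)+
 have cj: "cont_near (id_tuple G 2) 2 M M (%s. s 0)" "cont_near (id_tuple G 2) 2 M M (%s. s 1)"
  by (rule cont_near_proj[OF _ id_top], simp)+
 have sj: "smooth_near (id_tuple G 2) 2 M M (%s. s 0)" "smooth_near (id_tuple G 2) 2 M M (%s. s 1)"
  by (rule smooth_near_proj[OF lieM(2) _ id_top], simp)+
 have Dm: "meas 2 M N (D b)" if "meas 1 M N b" for b unfolding D_def
  by (intro meas_rules pj meas_pre[OF that])
 have Dk: "cont_near (id_tuple G 2) 2 M N (D b)" if "cont_near (id_tuple G 1) 1 M N b" for b unfolding D_def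
  by (intro cont_rules cj cont_near_pre; simp only: id_faces that)
 have Ds: "smooth_near (id_tuple G 2) 2 M N (D b)" if "smooth_near (id_tuple G 1) 1 M N b" for b unfolding D_def
  by (intro smooth_rules sj smooth_near_pre[OF lieM(2) lieN(3)]; simp only: id_faces that)
 show "b : lcm' 1 ==> d 1 b : lcm' 2"
 proof -
  assume "b : lcm' 1"
  hence b: "b : carrier (PG 1)" "meas 1 M N b" "cont_near (id_tuple G 1) 1 M N b" by (simp_all only: lcm_iff)
  show "d 1 b : lcm' 2" unfolding e[OF b(1)] by (rule lcmI[OF Dc[OF b(1)] Dm[OF b(2)] Dk[OF b(3)]])
 qed
 show "b : lsm' 1 ==> d 1 b : lsm' 2"
 proof -
  assume "b : lsm' 1"
  hence b: "b : carrier (PG 1)" "meas 1 M N b" "smooth_near (id_tuple G 1) 1 M N b" by (simp_all only: lsm_iff)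
  show "d 1 b : lsm' 2" unfolding e[OF b(1)] by (rule lsmI[OF Dc[OF b(1)] Dm[OF b(2)] Ds[OF b(3)]])
 qed
qed

definition const_cochain :: "'a => (nat => 'g) => 'a" where "const_cochain c = (\<lambda>s\<in>T 1. c)"

lemma const_cochain:
 assumes c: "c : carrier A"
 shows "const_cochain c : lsm' 1" "a : carrier G ==> const_cochain c (tup1 a) = c"
 unfolding const_cochain_def
 using lsmI[OF _ meas_const smooth_near_const[OF lieM(2) _ id_top], of 1 c] tup_in(1)[of a] c by (simp_all add: lieN(4))

text \<open>The two premises are what the analysis provides. The first exceeds injectivity: it does
  not replace the primitive but shows the given one to be smooth, which identifies the intersection
  of coboundaries with smooth cocycles.\<close>

lemma natural_map_iso:
 assumes inj: "!!b. b : lcm' 1 ==> d 1 b : lsm' 2 ==> b : lsm' 1"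
  and surj: "!!f. f : lcm' 2 ==> d 2 f = \<one>\<^bsub>PG 3\<^esub> ==> \<exists>b\<in>lcm' 1. f \<otimes>\<^bsub>PG 2\<^esub> inv\<^bsub>PG 2\<^esub> d 1 b : lsm' 2"
 shows "natural_map G M A N act 2 : iso (H_lsm G M A N act 2) (H_lcm G M A N act 2)"
proof -
 interpret P: comm_group "PG 2" by (rule PG)
 interpret d2: group_hom "PG 2" "PG 3" "d 2" using d_group_hom[of 2] by simp
 interpret d1: group_hom "PG 1" "PG 2" "d 1" using d_group_hom[of 1] unfolding one_add_one .
 define KK where "KK = kernel (PG 2) (PG 3) (d 2)"
 have sK: "subgroup KK (PG 2)" unfolding KK_def by (rule d2.subgroup_kernel)
 have KI: "f : KK \<longleftrightarrow> f : carrier (PG 2) & d 2 f = \<one>\<^bsub>PG 3\<^esub>" for f by (simp only: KK_def kernel_def mem_Collect_eq)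
 have co: "cocycles G A act C 2 = C 2 \<inter> KK" if "C 2 \<subseteq> carrier (PG 2)" for C
 proof -
  have "cocycles G A act C 2 = {f : C 2. d 2 f = \<one>\<^bsub>PG 3\<^esub>}"
   by (simp add: cocycles_def kernel_def cochain_group_def del: one_product_group)
  thus ?thesis using that KI by blast
 qed
 have cb: "coboundaries G A act C 2 = d 1 ` C 1" for C by (simp add: coboundaries_def numeral_2_eq_2)
 have in2: "lcm' 2 \<subseteq> carrier (PG 2)" "lsm' 2 \<subseteq> carrier (PG 2)" and in1: "lcm' 1 \<subseteq> carrier (PG 1)"
  using subgroup.subset[OF subgroup_lcm] subgroup.subset[OF subgroup_lsm] by auto
 have dK: "d 1 b : KK" if "b : lcm' 1" for b
  using d1_closed(1)[OF that] in2(1) d2_d1[of b] in1 that unfolding KI by blast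
 have "(%c. the_elem ((%f. d 1 ` lcm' 1 #>\<^bsub>PG 2\<lparr>carrier := lcm' 2 \<inter> KK\<rparr>\<^esub> f) ` c)) \<in>
   iso (PG 2\<lparr>carrier := lsm' 2 \<inter> KK\<rparr> Mod d 1 ` lsm' 1) (PG 2\<lparr>carrier := lcm' 2 \<inter> KK\<rparr> Mod d 1 ` lcm' 1)"
 proof (rule quotient_inclusion_iso[OF PG])
  show "subgroup (lsm' 2 \<inter> KK) (PG 2)" "subgroup (lcm' 2 \<inter> KK) (PG 2)"
   by (intro P.subgroups_Inter_pair subgroup_lsm subgroup_lcm sK)+
  show "subgroup (d 1 ` lcm' 1) (PG 2)" by (rule d1.subgroup_img_is_subgroup[OF subgroup_lcm])
  show "lsm' 2 \<inter> KK \<subseteq> lcm' 2 \<inter> KK" using lsm_subset_lcm by blast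
  show "d 1 ` lcm' 1 \<subseteq> lcm' 2 \<inter> KK" using d1_closed(1) dK by blast
  show "d 1 ` lcm' 1 \<inter> (lsm' 2 \<inter> KK) = d 1 ` lsm' 1"
  proof (intro equalityI subsetI)
   fix f assume "f : d 1 ` lcm' 1 \<inter> (lsm' 2 \<inter> KK)"
   then obtain b where "b : lcm' 1" "f = d 1 b" "d 1 b : lsm' 2" by blast
   thus "f : d 1 ` lsm' 1" using inj[of b] by blast
  next
   fix f assume "f : d 1 ` lsm' 1"
   then obtain b where b: "b : lsm' 1" "f = d 1 b" by blast
   hence "b : lcm' 1" using lsm_subset_lcm by blast
   thus "f : d 1 ` lcm' 1 \<inter> (lsm' 2 \<inter> KK)" using b d1_closed(2)[OF b(1)] dK by blast
  qed
  fix f assume "f : lcm' 2 \<inter> KK"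
  hence f: "f : lcm' 2" "f : KK" "f : carrier (PG 2)" "d 2 f = \<one>\<^bsub>PG 3\<^esub>" using KI by blast+
  obtain b where b: "b : lcm' 1" "f \<otimes>\<^bsub>PG 2\<^esub> inv\<^bsub>PG 2\<^esub> d 1 b : lsm' 2" using surj[OF f(1,4)] by blast
  have bK: "d 1 b : KK" "d 1 b : carrier (PG 2)" using dK[OF b(1)] KI by blast+
  have k: "f \<otimes>\<^bsub>PG 2\<^esub> inv\<^bsub>PG 2\<^esub> d 1 b : KK"
   by (intro subgroup.m_closed[OF sK f(2)] subgroup.m_inv_closed[OF sK bK(1)])
  have "d 1 b \<otimes>\<^bsub>PG 2\<^esub> (f \<otimes>\<^bsub>PG 2\<^esub> inv\<^bsub>PG 2\<^esub> d 1 b) = d 1 b \<otimes>\<^bsub>PG 2\<^esub> (inv\<^bsub>PG 2\<^esub> d 1 b \<otimes>\<^bsub>PG 2\<^esub> f)"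
   by (simp only: P.m_comm[OF f(3) P.inv_closed[OF bK(2)]])
  also have "\<dots> = (d 1 b \<otimes>\<^bsub>PG 2\<^esub> inv\<^bsub>PG 2\<^esub> d 1 b) \<otimes>\<^bsub>PG 2\<^esub> f"
   by (rule P.m_assoc[OF bK(2) P.inv_closed[OF bK(2)] f(3), symmetric])
  also have "\<dots> = f" unfolding P.r_inv[OF bK(2)] by (rule P.l_one[OF f(3)])
  finally show "\<exists>h\<in>d 1 ` lcm' 1. \<exists>k\<in>lsm' 2 \<inter> KK. f = h \<otimes>\<^bsub>PG 2\<^esub> k" using b k by (metis IntI image_eqI)
 qed
 thus ?thesis
  unfolding natural_map_def inclusion_map_def[abs_def] H_lsm_def H_lcm_def cohomology_def cb
   co[of "lcm_cochains G M A N", OF in2(1)] co[of "lsm_cochains G M A N", OF in2(2)] by (simp only: cochain_group_def)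
qed

end

section \<open>Existence of adapted neighbourhoods\<close>

lemma open_rectangle:
 assumes "continuous_map (prod_topology T1 T2) T' f" "openin T' O'" "x : topspace T1" "y : topspace T2" "f (x, y) : O'"
 obtains V1 V2 where "openin T1 V1" "openin T2 V2" "x : V1" "y : V2" "!!a b. a : V1 ==> b : V2 ==> f (a, b) : O'"
proof -
 have "openin (prod_topology T1 T2) {p : topspace (prod_topology T1 T2). f p : O'}"
  by (rule openin_continuous_map_preimage[OF assms(1,2)])
 moreover have "(x, y) : {p : topspace (prod_topology T1 T2). f p : O'}" using assms by simp
 ultimately obtain V1 V2 where V: "openin T1 V1" "openin T2 V2" "x : V1" "y : V2" "V1 \<times> V2 \<subseteq> {p : topspace (prod_topology T1 T2). f p : O'}"
  unfolding openin_prod_topology_alt by meson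
 show thesis by (rule that[OF V(1-4)]) (use V(5) in blast)
qed

text \<open>A neighbourhood intersected with its inverse is symmetric, and continuity of
  multiplication at (1,1) controls the products.\<close>

lemma lie_group_neighbourhood:
 assumes G: "lie_group G M" and O': "openin (mtop M) O'" "\<one>\<^bsub>G\<^esub> : O'"
 obtains V where "openin (mtop M) V" "\<one>\<^bsub>G\<^esub> : V" "V \<subseteq> O'" "!!a. a : V ==> inv\<^bsub>G\<^esub> a : V"
  "!!a b. a : V ==> b : V ==> a \<otimes>\<^bsub>G\<^esub> b : O'"
proof -
 note D = lie_groupD[OF G]
 interpret G: group G by (rule D(1))
 have one: "\<one>\<^bsub>G\<^esub> : topspace (mtop M)" using D(4) by simp
 have mo: "(%(x, y). x \<otimes>\<^bsub>G\<^esub> y) (\<one>\<^bsub>G\<^esub>, \<one>\<^bsub>G\<^esub>) : O'" using O'(2) by simp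
 obtain V1 V2 where V: "openin (mtop M) V1" "openin (mtop M) V2" "\<one>\<^bsub>G\<^esub> : V1" "\<one>\<^bsub>G\<^esub> : V2"
  "!!a b. a : V1 ==> b : V2 ==> (%(x, y). x \<otimes>\<^bsub>G\<^esub> y) (a, b) : O'"
  using open_rectangle[OF smooth_map_prod_continuous[OF D(5)] O'(1) one one mo] by blast
 define W where "W = O' \<inter> V1 \<inter> V2"
 have W: "openin (mtop M) W" "\<one>\<^bsub>G\<^esub> : W" using V O' by (auto simp: W_def)
 define V' where "V' = W \<inter> {x : topspace (mtop M). inv\<^bsub>G\<^esub> x : W}"
 show thesis
 proof (rule that[of V'])
  show "openin (mtop M) V'" unfolding V'_def
   by (intro openin_Int W openin_continuous_map_preimage[OF smooth_map_continuous[OF D(6)]])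
  show "\<one>\<^bsub>G\<^esub> : V'" using W D(4) by (simp add: V'_def)
  show "V' \<subseteq> O'" by (auto simp: V'_def W_def)
  show "inv\<^bsub>G\<^esub> a : V'" if "a : V'" for a
  proof -
   have "a : carrier G" "a : W" "inv\<^bsub>G\<^esub> a : W" using that D(4) by (auto simp: V'_def)
   thus ?thesis using D(4) by (simp add: V'_def)
  qed
  show "a \<otimes>\<^bsub>G\<^esub> b : O'" if "a : V'" "b : V'" for a b using V(5)[of a b] that by (auto simp: V'_def W_def)
 qed
qed

context coh
begin

text \<open>Continuity of the action at the pair of units; the extra factor 1/8 in both radii is the
  reserve used by later sums.\<close>

lemma small_action:
 obtains Da \<eta>0 where "openin (mtop M) Da" "\<one>\<^bsub>G\<^esub> : Da" "Da \<subseteq> U0" "0 < \<eta>0" "8 * \<eta>0 <= \<delta>"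
  "!!g v. g : Da ==> v : NB \<eta>0 ==> act g (Eg v) : Eg ` NB (\<delta> / 8)"
proof -
 interpret A: comm_group A by (rule A)
 interpret G: group G by (rule lieM(1))
 have z: "(\<lambda>j\<in>J. 0) : NB p" if "0 < p" for p using that by (simp add: nball_def nrm_def)
 have oE: "openin (mtop N) (Eg ` NB (\<delta> / 8))" by (rule openin_Eg) (use rho0 in simp)
 have "\<one>\<^bsub>A\<^esub> : Eg ` NB (\<delta> / 8)" using imageI[OF z[of "\<delta> / 8"], of Eg] rho0 by (simp add: Eg_zero)
 hence m1: "(%(g, a). act g a) (\<one>\<^bsub>G\<^esub>, \<one>\<^bsub>A\<^esub>) : Eg ` NB (\<delta> / 8)" using smooth_moduleD(4)[OF mod lieG, of "\<one>\<^bsub>A\<^esub>"] by simp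
 have tp: "\<one>\<^bsub>G\<^esub> : topspace (mtop M)" "\<one>\<^bsub>A\<^esub> : topspace (mtop N)" using lieM(4) lieN(4) by simp_all
 have sm: "smooth_map (prod_manifold M N) N (%(g, a). act g a)" using mod by (simp add: smooth_module_def)
 obtain V1 V2 where V: "openin (mtop M) V1" "openin (mtop N) V2" "\<one>\<^bsub>G\<^esub> : V1" "\<one>\<^bsub>A\<^esub> : V2"
  "!!a b. a : V1 ==> b : V2 ==> (%(g, a). act g a) (a, b) : Eg ` NB (\<delta> / 8)"
  using open_rectangle[OF smooth_map_prod_continuous[OF sm] oE tp m1] by blast
 have "plot N J (NB \<delta>) (%v. Eg v)"
  by (rule plot_Eg[OF openin_nball[OF finJ]]) (auto intro: Cinf_on_coord)
 from plot_preimage_open[OF this V(2)] have "openin (RR J) {v : NB \<delta>. Eg v : V2}" .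
 moreover have "(\<lambda>j\<in>J. 0) : {v : NB \<delta>. Eg v : V2}" using z[OF rho0] V(4) by (simp add: Eg_zero)
 ultimately obtain c where c: "c > 0" "cube J (\<lambda>j\<in>J. 0) c \<subseteq> {v : NB \<delta>. Eg v : V2}" using openin_contains_cube[OF finJ] by blast
 define \<eta>0 where "\<eta>0 = min c (\<delta> / 8)"
 show thesis
 proof (rule that[of "V1 \<inter> U0" \<eta>0])
  show "openin (mtop M) (V1 \<inter> U0)" using V(1) chart0(1) by (rule openin_Int)
  show "\<one>\<^bsub>G\<^esub> : V1 \<inter> U0" using V(3) one0 by simp
  show "0 < \<eta>0" "8 * \<eta>0 <= \<delta>" using c(1) rho0 by (auto simp: \<eta>0_def)
  fix g v assume g: "g : V1 \<inter> U0" and v: "v : NB \<eta>0"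
  have "v : cube J (%_. 0) c" using v nball_subset_cube[OF finJ, of \<eta>0] cube_mono[of \<eta>0 c J "%_. 0"] by (auto simp: \<eta>0_def)
  hence "v : cube J (\<lambda>j\<in>J. 0) c" by (simp add: mem_cube)
  hence "Eg v : V2" using c(2) by blast
  thus "act g (Eg v) : Eg ` NB (\<delta> / 8)" using V(5)[of g "Eg v"] g by simp
 qed simp
qed

text \<open>Three nested symmetric neighbourhoods, each squaring into the next larger set: two
  levels provide the triple products in \<open>D1\<close>, and the innermost gives products of two
  slots in \<open>D2\<close>.\<close>

lemma small_box:
 assumes D1: "openin (mtop M) D1" "D1 \<subseteq> U0" "\<one>\<^bsub>G\<^esub> : D1"
 obtains D2 ep ro where "coh_box A N U ps r s \<delta> L e G M act U0 ph0 D1 D2 ep ro"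
  "!!x k l. x : qbox ep ==> k < 4 ==> l < 4 ==> gm k x \<otimes>\<^bsub>G\<^esub> gm l x : D2"
proof -
 obtain V where V: "openin (mtop M) V" "\<one>\<^bsub>G\<^esub> : V" "V \<subseteq> D1" "!!a. a : V ==> inv\<^bsub>G\<^esub> a : V" "!!a b. a : V ==> b : V ==> a \<otimes>\<^bsub>G\<^esub> b : D1"
  using lie_group_neighbourhood[OF lieG D1(1,3)] by blast
 obtain D2 where D2: "openin (mtop M) D2" "\<one>\<^bsub>G\<^esub> : D2" "D2 \<subseteq> V" "!!a. a : D2 ==> inv\<^bsub>G\<^esub> a : D2" "!!a b. a : D2 ==> b : D2 ==> a \<otimes>\<^bsub>G\<^esub> b : V"
  using lie_group_neighbourhood[OF lieG V(1,2)] by blast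
 obtain D3 where D3: "openin (mtop M) D3" "\<one>\<^bsub>G\<^esub> : D3" "D3 \<subseteq> D2" "!!a. a : D3 ==> inv\<^bsub>G\<^esub> a : D3" "!!a b. a : D3 ==> b : D3 ==> a \<otimes>\<^bsub>G\<^esub> b : D2"
  using lie_group_neighbourhood[OF lieG D2(1,2)] by blast
 have s: "D3 \<subseteq> U0" using D3(3) D2(3) V(3) D1(2) by blast
 have "openin (RR I) (ph0 ` D3)" by (rule charted_chart(3)[OF lieM(3) U0 s D3(1)])
 from openin_contains_cube[OF finI this imageI[OF D3(2)]] obtain ep where e: "ep > 0" "cube I cI ep \<subseteq> ph0 ` D3" by blast
 have g3: "gm k x : D3" if x: "x : qbox ep" and k: "k < 4" for k x
 proof -
  obtain a where a: "a : D3" "(\<lambda>i\<in>I. x (k, i)) = ph0 a" using slice_box[OF x k] e(2) by blast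
  have "a : U0" using a(1) s by blast
  from inv_phi0[OF this] show ?thesis unfolding gm_def a(2) using a(1) by simp
 qed
 show thesis
 proof (rule that[of D2 ep "ep / 2"])
  show "coh_box A N U ps r s \<delta> L e G M act U0 ph0 D1 D2 ep (ep / 2)"
  proof (rule coh_box.intro[OF coh_axioms coh_box_axioms.intro])
   show "cube I cI ep \<subseteq> ph0 ` U0" using e(2) s by blast
   show "D2 \<subseteq> D1" using D2(3) V(3) by blast
   show "gm k x : D2" if "x : qbox ep" "k < 4" for x k using g3[OF that] D3(3) by blast
   show "a \<otimes>\<^bsub>G\<^esub> b : D1" if "a : D2" "b : D2" for a b using D2(5)[OF that] V(3) by blast
   show "a \<otimes>\<^bsub>G\<^esub> b \<otimes>\<^bsub>G\<^esub> c : D1" if "a : D2" "b : D2" "c : D2" for a b c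
    using V(5)[OF D2(5)[OF that(1,2)]] D2(3) that(3) by blast
  qed (use e D1 D2 in auto)
  show "gm k x \<otimes>\<^bsub>G\<^esub> gm l x : D2" if "x : qbox ep" "k < 4" "l < 4" for x k l
   by (rule D3(5)[OF g3[OF that(1,2)] g3[OF that(1,3)]])
 qed
qed

lemma Lg_coord_continuous:
 assumes "continuous_map T (mtop N) h" "!!x. x : topspace T ==> h x : Eg ` NB p" "p <= \<delta>" "j : J"
 shows "continuous_map T euclideanreal (%x. Lg (h x) j)"
proof -
 have "continuous_map T (subtopology (mtop N) (Eg ` NB \<delta>)) h"
  unfolding continuous_map_in_subtopology using assms(1,2) Eg_NB_mono[OF assms(3)] by blast
 from continuous_map_compose[OF continuous_map_compose[OF this Lg_continuous'] continuous_map_product_projection[OF assms(4)]]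
 show ?thesis by (simp add: o_def)
qed

end

context coh_box
begin

text \<open>The group elements that can occupy a slot of the box.\<close>

definition Weps :: "'g set" where "Weps = {a : U0. ph0 a : cube I cI ep}"

lemma Weps_open: "openin (mtop M) Weps"
 unfolding Weps_def by (rule chart_preimage_open[OF lieM(2) U0 openin_cube[OF finI]])

lemma one_Weps: "\<one>\<^bsub>G\<^esub> : Weps"
 unfolding Weps_def using one0 phi0_ext[OF one0] ro by (simp add: mem_cube)

text \<open>Back from the box to powers of the group: a tuple with entries in \<open>Weps\<close> is
  placed in the first \<open>n\<close> slots, and smoothness is carried along this
  placement.\<close>

lemma plot_imp_smooth_map_on:
 assumes H: "plot N Q B H" and n: "n <= 4" and W: "openin (mtop (pow_manifold n M)) W" "!!s k. s : W ==> k < n ==> s k : Weps"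
  and h: "!!s x. s : W ==> x : B ==> (!!k. k < n ==> gm k x = s k) ==> h s = H x"
 shows "smooth_map_on (pow_manifold n M) N W h"
proof -
 let ?P = "pow_manifold n M"
 have chP: "charted ?P" by (rule charted_pow[OF lieM(3)])
 \<comment> \<open>Slots from \<open>n\<close> on are filled with the coordinates of the
   unit.\<close>
 define u where "u s = (\<lambda>kp\<in>Q. if fst kp < n then ph0 (s (fst kp)) (snd kp) else cI (snd kp))" for s :: "nat => 'g"
 have sU: "s k : U0" "ph0 (s k) : cube I cI ep" if "s : W" "k < n" for s k using W(2)[OF that] by (auto simp: Weps_def)
 have uB: "u s : B" if s: "s : W" for s
  unfolding mem_cube
 proof (intro conjI ballI)
  fix kp assume k: "kp : Q"
  show "\<bar>u s kp - Qc kp\<bar> < ep"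
  proof (cases "fst kp < n")
   case True
   have "snd kp : I" using k by auto
   thus ?thesis using sU(2)[OF s True] True k by (simp add: u_def Qc_def mem_cube)
  next
   case False
   thus ?thesis using ro k by (simp add: u_def Qc_def)
  qed
 qed (simp add: u_def)
 have g: "gm k (u s) = s k" if s: "s : W" and k: "k < n" for s k
 proof -
  have "(\<lambda>i\<in>I. u s (k, i)) = ph0 (s k)" using phi0_ext[OF sU(1)[OF s k]] k n by (auto simp: u_def fun_eq_iff extensional_def)
  thus ?thesis unfolding gm_def using inv_phi0[OF sU(1)[OF s k]] by simp
 qed
 have hH: "h s = H (u s)" if "s : W" for s by (rule h[OF that uB[OF that] g[OF that]])
 have WT: "W \<subseteq> topspace (mtop ?P)" by (rule openin_subset[OF W(1)])
 have ch: "continuous_map (subtopology (mtop M) U0) (RR I) ph0" by (rule chart_coord_continuous[OF lieM(2) U0])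
 have uc: "continuous_map (subtopology (mtop ?P) W) (subtopology (RR Q) B) u"
  unfolding continuous_map_in_subtopology continuous_map_componentwise
 proof (intro conjI ballI)
  fix kp assume k: "kp : Q"
  hence i: "snd kp : I" by auto
  show "continuous_map (subtopology (mtop ?P) W) euclideanreal (%s. u s kp)"
  proof (cases "fst kp < n")
   case True
   have "continuous_map (mtop ?P) (mtop M) (%s. s (fst kp))"
    unfolding mtop_pow by (rule continuous_map_product_projection) (use True in simp)
   hence "continuous_map (subtopology (mtop ?P) W) (subtopology (mtop M) U0) (%s. s (fst kp))"
    unfolding continuous_map_in_subtopology using continuous_map_from_subtopology sU(1)[OF _ True] by auto
   from continuous_map_compose[OF continuous_map_compose[OF this ch] continuous_map_product_projection[OF i]]
   have "continuous_map (subtopology (mtop ?P) W) euclideanreal (%s. ph0 (s (fst kp)) (snd kp))" by (simp add: o_def)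
   thus ?thesis using k True by (simp add: u_def)
  next
   case False
   thus ?thesis using k by (simp add: u_def)
  qed
 next
  show "u ` topspace (subtopology (mtop ?P) W) \<subseteq> extensional Q" by (auto simp: u_def)
 next
  show "u : topspace (subtopology (mtop ?P) W) \<rightarrow> B" using uB by auto
 qed
 show ?thesis
 proof (rule smooth_map_onI[OF W(1) _ chP])
  have "continuous_map (subtopology (mtop ?P) W) (mtop N) (%s. H (u s))"
   using continuous_map_compose[OF uc plot_cont[OF H]] by (simp add: o_def)
  thus "continuous_map (subtopology (mtop ?P) W) (mtop N) h" by (rule continuous_map_eq) (use hH in auto)
  fix U' ph assume U': "(U', ph) : matlas ?P"
  note oV = chart_pow_image_open[OF lieM(2) U' W(1)]
  have inW: "inv_into U' ph p : W" if "p : ph ` (U' \<inter> W)" for p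
   using that charted_chart(2)[OF chP U'] by (auto simp: inv_into_f_f)
  show "plot N (midx ?P) (ph ` (U' \<inter> W)) (%p. h (inv_into U' ph p))"
  proof (rule plot_cong[OF _ lieN(3)])
   show "plot N (midx ?P) (ph ` (U' \<inter> W)) (%p. H (u (inv_into U' ph p)))"
   proof (rule plot_reparam[OF H lieN(3) finQ oV])
    show "(%p. u (inv_into U' ph p)) ` ph ` (U' \<inter> W) \<subseteq> B" using uB inW by blast
    fix kp assume k: "kp : Q"
    show "Cinf_on (midx ?P) (ph ` (U' \<inter> W)) (%p. u (inv_into U' ph p) kp)"
    proof (cases "fst kp < n")
     case True
     have "plot M (midx ?P) (ph ` (U' \<inter> W)) (%p. inv_into U' ph p (fst kp))"
      by (rule plot_subset[OF chart_pow_plot(1)[OF lieM(2) U' True] oV]) auto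
     hence "Cinf_on (midx ?P) (ph ` (U' \<inter> W)) (%p. ph0 (inv_into U' ph p (fst kp)) (snd kp))"
      by (rule plot_chart[OF _ U0]) (use sU(1)[OF inW True] k in auto)
     thus ?thesis using k True by (simp add: u_def)
    next
     case False
     thus ?thesis using k by (simp add: u_def Cinf_on_const)
    qed
   qed
   show "H (u (inv_into U' ph p)) = h (inv_into U' ph p)" if "p : ph ` (U' \<inter> W)" for p
    using hH[OF inW[OF that]] by simp
  qed
 qed
qed

end

section \<open>Regularity of cochains\<close>

lemma continuous_tup2: "continuous_map (prod_topology (mtop M) (mtop M)) (mtop (pow_manifold 2 M)) (%(a, b). tup2 a b)"
 unfolding mtop_pow continuous_map_componentwise
proof (intro conjI ballI)
 show "(%(a, b). tup2 a b) ` topspace (prod_topology (mtop M) (mtop M)) \<subseteq> extensional {..<2}" by (auto simp: tup2_def)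
 fix k :: nat assume "k : {..<2}"
 hence "k = 0 \<or> k = 1" by auto
 thus "continuous_map (prod_topology (mtop M) (mtop M)) (mtop M) (%x. (case x of (a, b) => tup2 a b) k)"
  by (elim disjE) (simp_all only: case_prod_unfold tup2_app continuous_map_fst continuous_map_snd)
qed

lemma id_tuple_tup: "id_tuple G 1 = tup1 \<one>\<^bsub>G\<^esub>" "id_tuple G 2 = tup2 \<one>\<^bsub>G\<^esub> \<one>\<^bsub>G\<^esub>"
 by (auto simp: id_tuple_def tup1_def tup2_def fun_eq_iff)

context coh
begin

interpretation MC: module_cochains G M A N act by unfold_locales (rule lieG, rule mod)

text \<open>Normalisation at 1 puts \<open>b\<close> in the domain of the logarithm near 1. All
  requirements (small action, small values of \<open>b\<close>, smooth coboundary on pairs) are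
  collected in \<open>D1\<close> before the box is chosen.\<close>

lemma smooth_normalised_cochain:
 assumes b: "b : lcm_cochains G M A N 1" and db: "coboundary G A act 1 b : lsm_cochains G M A N 2"
  and b1: "b (tup1 \<one>\<^bsub>G\<^esub>) = \<one>\<^bsub>A\<^esub>"
 shows "b : lsm_cochains G M A N 1"
proof -
 let ?P = "pow_manifold 1 M"
 have bF: "b : carrier (product_group (tuples G 1) (%_. A))" "meas 1 M N b" "cont_near (id_tuple G 1) 1 M N b"
  using b unfolding MC.lcm_iff by blast+
 obtain W where W: "openin (mtop ?P) W" "id_tuple G 1 : W" "continuous_map (subtopology (mtop ?P) W) (mtop N) b"
  using bF(3) unfolding cont_near_def by blast
 have "smooth_near (id_tuple G 2) 2 M N (coboundary G A act 1 b)" using db unfolding MC.lsm_iff by blast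
 then obtain W2 where W2: "openin (mtop (pow_manifold 2 M)) W2" "id_tuple G 2 : W2" "smooth_map_on (pow_manifold 2 M) N W2 (coboundary G A act 1 b)"
  unfolding smooth_near_def by blast
 obtain Da \<eta>0 where Da: "openin (mtop M) Da" "\<one>\<^bsub>G\<^esub> : Da" "Da \<subseteq> U0" and e0: "0 < \<eta>0" "8 * \<eta>0 <= \<delta>"
  and sm: "!!g v. g : Da ==> v : NB \<eta>0 ==> act g (Eg v) : Eg ` NB (\<delta> / 8)" using small_action by blast
 \<comment> \<open>This anticipates the \<open>\<eta>\<close> of the locale instance below (compared
   in \<open>De\<close>): it has to be known before \<open>D1\<close>, since \<open>b\<close> must
   have values of this size there.\<close>
 define \<eta> where "\<eta> = \<eta>0 / 2 / (8 * (real (card J) + 1))"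
 have \<eta>: "0 < \<eta>" using e0 by (simp add: \<eta>_def)
 have "\<eta> <= \<eta>0 / 2 / 8" unfolding \<eta>_def by (rule divide_left_mono) (use e0 in auto)
 hence \<eta>d: "\<eta> <= \<delta>" using e0 by simp
 have oE: "openin (mtop N) (Eg ` NB \<eta>)" by (rule openin_Eg[OF \<eta>d])
 have oneE: "\<one>\<^bsub>A\<^esub> : Eg ` NB \<eta>" using imageI[of "\<lambda>j\<in>J. 0" "NB \<eta>" Eg] \<eta> by (simp add: Eg_zero nball_def nrm_def)
 define O1 where "O1 = {s : W. b s : Eg ` NB \<eta>}"
 have O1: "openin (mtop ?P) O1" "tup1 \<one>\<^bsub>G\<^esub> : O1" unfolding O1_def
  using preimage_open_in[OF W(1,3) oE] W(2)[unfolded id_tuple_tup] oneE b1 by simp_all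
 have ct1: "continuous_map (mtop M) (mtop ?P) tup1" using continuous_tup1[OF continuous_map_id, of M] by simp
 have o2: "(%(a, b). tup2 a b) (\<one>\<^bsub>G\<^esub>, \<one>\<^bsub>G\<^esub>) : W2" using W2(2) by (simp add: id_tuple_tup)
 have tp: "\<one>\<^bsub>G\<^esub> : topspace (mtop M)" using lieM(4) MC.G.one_closed by simp
 obtain V1 V2 where V: "openin (mtop M) V1" "openin (mtop M) V2" "\<one>\<^bsub>G\<^esub> : V1" "\<one>\<^bsub>G\<^esub> : V2"
  "!!a b. a : V1 ==> b : V2 ==> (%(a, b). tup2 a b) (a, b) : W2"
  using open_rectangle[OF continuous_tup2 W2(1) tp tp o2] by blast
 define D1 where "D1 = Da \<inter> {a : topspace (mtop M). tup1 a : O1} \<inter> V1 \<inter> V2"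
 have D1: "openin (mtop M) D1" "D1 \<subseteq> U0" "\<one>\<^bsub>G\<^esub> : D1" unfolding D1_def
  using openin_continuous_map_preimage[OF ct1 O1(1)] Da V O1(2) tp by auto
 obtain D2 ep ro where bx: "coh_box A N U ps r s \<delta> L e G M act U0 ph0 D1 D2 ep ro"
  and pr: "!!x k l. x : qbox ep ==> k < 4 ==> l < 4 ==> gm k x \<otimes>\<^bsub>G\<^esub> gm l x : D2"
  using small_box[OF D1] by blast
 interpret D: coh_data A N U ps r s \<delta> L e G M act U0 ph0 D1 D2 ep ro \<eta>0
  by (rule coh_data.intro[OF bx coh_data_axioms.intro[OF e0 _ pr]]) (use sm in \<open>auto simp: D1_def\<close>)
 have De: "D.\<eta> = \<eta>" by (simp add: D.\<eta>_def D.ta_def \<eta>_def)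
 have tD: "tup1 a : W" "b (tup1 a) : Eg ` NB \<eta>" if "a : D1" for a using that by (auto simp: D1_def O1_def)
 have "plot N Q (qbox ep) (%x. b (tup1 (gm 0 x)))"
 proof (rule D.smooth_primitive[where b = "%a. b (tup1 a)"])
  fix j assume j: "j : J"
  have "continuous_map (subtopology (mtop M) D1) (subtopology (mtop ?P) W) tup1"
   unfolding continuous_map_in_subtopology using continuous_map_from_subtopology[OF ct1] tD(1) by auto
  from continuous_map_compose[OF this W(3)] have "continuous_map (subtopology (mtop M) D1) (mtop N) (%a. b (tup1 a))" by (simp add: o_def)
  thus "continuous_map (subtopology (mtop M) D1) euclideanreal (%a. Lg (b (tup1 a)) j)"
   by (rule Lg_coord_continuous[OF _ _ \<eta>d j]) (use tD(2) in auto)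
 next
  show "b (tup1 a) : Eg ` NB D.\<eta>" if "a : D1" for a unfolding De by (rule tD(2)[OF that])
 next
  have p2: "plot (pow_manifold 2 M) Q (qbox ep) (%x. tup2 (gm 0 x) (gm 3 x))"
  proof (rule plot_tuple[OF D.openB])
   fix k :: nat assume "k < 2"
   hence "k = 0 \<or> k = 1" by auto
   thus "plot M Q (qbox ep) (%x. tup2 (gm 0 x) (gm 3 x) k)"
    by (elim disjE) (simp_all only: tup2_app D.plot_gm[of 0, simplified] D.plot_gm[of 3, simplified])
  qed (simp add: tup2_def)
  have "plot N Q (qbox ep) (%x. coboundary G A act 1 b (tup2 (gm 0 x) (gm 3 x)))"
  proof (rule plot_compose[OF charted_pow[OF lieM(3)] lieN(3) W2(3) p2])
   have "tup2 (gm 0 x) (gm 3 x) : W2" if "x : qbox ep" for x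
    using V(5)[of "gm 0 x" "gm 3 x"] D.gmD1[OF that, of 0] D.gmD1[OF that, of 3] by (simp add: D1_def)
   thus "(%x. tup2 (gm 0 x) (gm 3 x)) ` qbox ep \<subseteq> W2" by blast
  qed
  thus "plot N Q (qbox ep) (%x. act (gm 0 x) (b (tup1 (gm 3 x))) \<otimes>\<^bsub>A\<^esub> inv\<^bsub>A\<^esub> b (tup1 (gm 0 x \<otimes>\<^bsub>G\<^esub> gm 3 x)) \<otimes>\<^bsub>A\<^esub> b (tup1 (gm 0 x)))"
  proof (rule plot_cong[OF _ lieN(3)])
   fix x assume x: "x : qbox ep"
   have "gm 0 x : carrier G" "gm 3 x : carrier G" by (intro D.G_carrier(2) D.gmD1 x; simp)+
   from MC.d1[OF bF(1) MC.tup_in(2)[OF this]]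
   show "coboundary G A act 1 b (tup2 (gm 0 x) (gm 3 x)) =
    act (gm 0 x) (b (tup1 (gm 3 x))) \<otimes>\<^bsub>A\<^esub> inv\<^bsub>A\<^esub> b (tup1 (gm 0 x \<otimes>\<^bsub>G\<^esub> gm 3 x)) \<otimes>\<^bsub>A\<^esub> b (tup1 (gm 0 x))"
    by (simp only: tup2_app)
  qed
 qed
 hence "smooth_map_on ?P N {s : topspace (mtop ?P). s 0 : D.Weps} b"
 proof (rule D.plot_imp_smooth_map_on)
  have "continuous_map (mtop ?P) (mtop M) (%s. s 0)" unfolding mtop_pow by (rule continuous_map_product_projection) simp
  from openin_continuous_map_preimage[OF this D.Weps_open]
  show "openin (mtop ?P) {s : topspace (mtop ?P). s 0 : D.Weps}" .
  fix s x assume s: "s : {s : topspace (mtop ?P). s 0 : D.Weps}" and g: "!!k. k < 1 ==> gm k x = s k"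
  have "tup1 (s 0) = s" by (rule MC.tup1_eta) (use s MC.topspace_pow in auto)
  thus "b s = b (tup1 (gm 0 x))" using g[of 0] by simp
 qed auto
 moreover have "id_tuple G 1 : {s : topspace (mtop ?P). s 0 : D.Weps}" using MC.id_top D.one_Weps by (auto simp: id_tuple_def)
 moreover have "openin (mtop ?P) {s : topspace (mtop ?P). s 0 : D.Weps}" using calculation(1) by (rule smooth_map_on_charted(1))
 ultimately have "smooth_near (id_tuple G 1) 1 M N b" unfolding smooth_near_def by blast
 thus ?thesis unfolding MC.lsm_iff using bF(1,2) by blast
qed

text \<open>Locally the primitive is \<open>bb\<close>. To be a cochain it must be measurable and
  defined on all of \<open>G\<close>, while only its germ at 1 influences the smoothness of the
  corrected cocycle.\<close>

lemma smooth_normalised_cocycle: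
 assumes f: "f : lcm_cochains G M A N 2" and df: "coboundary G A act 2 f = \<one>\<^bsub>product_group (tuples G 3) (%_. A)\<^esub>"
  and f1: "f (tup2 \<one>\<^bsub>G\<^esub> \<one>\<^bsub>G\<^esub>) = \<one>\<^bsub>A\<^esub>"
 shows "\<exists>b\<in>lcm_cochains G M A N 1. f \<otimes>\<^bsub>product_group (tuples G 2) (%_. A)\<^esub>
   inv\<^bsub>product_group (tuples G 2) (%_. A)\<^esub> coboundary G A act 1 b : lsm_cochains G M A N 2"
proof -
 let ?P = "pow_manifold 2 M" and ?P1 = "pow_manifold 1 M" and ?PG = "product_group (tuples G 2) (%_. A)"
 interpret PG: comm_group ?PG by (rule MC.PG)
 have fF: "f : carrier ?PG" "meas 2 M N f" "cont_near (id_tuple G 2) 2 M N f"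
  using f unfolding MC.lcm_iff by blast+
 obtain W where W: "openin (mtop ?P) W" "id_tuple G 2 : W" "continuous_map (subtopology (mtop ?P) W) (mtop N) f"
  using fF(3) unfolding cont_near_def by blast
 obtain Da \<eta>0 where Da: "openin (mtop M) Da" "\<one>\<^bsub>G\<^esub> : Da" "Da \<subseteq> U0" and e0: "0 < \<eta>0" "8 * \<eta>0 <= \<delta>"
  and sm: "!!g v. g : Da ==> v : NB \<eta>0 ==> act g (Eg v) : Eg ` NB (\<delta> / 8)" using small_action by blast
 define \<eta> where "\<eta> = \<eta>0 / 2 / (8 * (real (card J) + 1))"
 have \<eta>: "0 < \<eta>" using e0 by (simp add: \<eta>_def)
 have "\<eta> <= \<eta>0 / 2 / 8" unfolding \<eta>_def by (rule divide_left_mono) (use e0 in auto)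
 hence \<eta>d: "\<eta> <= \<delta>" using e0 by simp
 have oE: "openin (mtop N) (Eg ` NB \<eta>)" by (rule openin_Eg[OF \<eta>d])
 have oneE: "\<one>\<^bsub>A\<^esub> : Eg ` NB \<eta>" using imageI[of "\<lambda>j\<in>J. 0" "NB \<eta>" Eg] \<eta> by (simp add: Eg_zero nball_def nrm_def)
 define O2 where "O2 = {s : W. f s : Eg ` NB \<eta>}"
 have O2: "openin (mtop ?P) O2" unfolding O2_def by (rule preimage_open_in[OF W(1,3) oE])
 have o2: "(%(a, b). tup2 a b) (\<one>\<^bsub>G\<^esub>, \<one>\<^bsub>G\<^esub>) : O2" using W(2) f1 oneE by (simp add: id_tuple_tup O2_def)
 have tp: "\<one>\<^bsub>G\<^esub> : topspace (mtop M)" using lieM(4) MC.G.one_closed by simp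
 obtain V1 V2 where V: "openin (mtop M) V1" "openin (mtop M) V2" "\<one>\<^bsub>G\<^esub> : V1" "\<one>\<^bsub>G\<^esub> : V2"
  "!!a b. a : V1 ==> b : V2 ==> (%(a, b). tup2 a b) (a, b) : O2"
  using open_rectangle[OF continuous_tup2 O2 tp tp o2] by blast
 define D1 where "D1 = Da \<inter> V1 \<inter> V2"
 have D1: "openin (mtop M) D1" "D1 \<subseteq> U0" "\<one>\<^bsub>G\<^esub> : D1" unfolding D1_def using Da V by auto
 have tD: "tup2 a c : W" "f (tup2 a c) : Eg ` NB \<eta>" if "a : D1" "c : D1" for a c
  using V(5)[of a c] that by (auto simp: D1_def O2_def)
 obtain D2 ep ro where bx: "coh_box A N U ps r s \<delta> L e G M act U0 ph0 D1 D2 ep ro"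
  and pr: "!!x k l. x : qbox ep ==> k < 4 ==> l < 4 ==> gm k x \<otimes>\<^bsub>G\<^esub> gm l x : D2"
  using small_box[OF D1] by blast
 interpret D: coh_data A N U ps r s \<delta> L e G M act U0 ph0 D1 D2 ep ro \<eta>0
  by (rule coh_data.intro[OF bx coh_data_axioms.intro[OF e0 _ pr]]) (use sm in \<open>auto simp: D1_def\<close>)
 have De: "D.\<eta> = \<eta>" by (simp add: D.\<eta>_def D.ta_def \<eta>_def)
 interpret C: coh_cocycle A N U ps r s \<delta> L e G M act U0 ph0 D1 D2 ep ro \<eta>0 "%a c. f (tup2 a c)"
 proof (rule coh_cocycle.intro[OF D.coh_data_axioms coh_cocycle_axioms.intro])
  fix j assume j: "j : J"
  have "continuous_map D.TT (subtopology (mtop ?P) W) (%(a, c). tup2 a c)"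
   unfolding continuous_map_in_subtopology using continuous_map_from_subtopology[OF continuous_tup2] tD(1) by auto
  from continuous_map_compose[OF this W(3)] have "continuous_map D.TT (mtop N) (%p. f (tup2 (fst p) (snd p)))"
   by (simp add: o_def case_prod_unfold)
  hence "continuous_map D.TT euclideanreal (%p. Lg (f (tup2 (fst p) (snd p))) j)"
   by (rule Lg_coord_continuous[OF _ _ \<eta>d j]) (use tD(2) in auto)
  thus "continuous_map D.TT euclideanreal (%(a, c). Lg (f (tup2 a c)) j)" by (simp add: case_prod_unfold)
 next
  show "f (tup2 a c) : Eg ` NB D.\<eta>" if "a : D1" "c : D1" for a c unfolding De by (rule tD(2)[OF that])
 next
  fix a c g assume "a : D1" "c : D1" "g : D1"
  thus "act a (f (tup2 c g)) \<otimes>\<^bsub>A\<^esub> f (tup2 a (c \<otimes>\<^bsub>G\<^esub> g)) = f (tup2 (a \<otimes>\<^bsub>G\<^esub> c) g) \<otimes>\<^bsub>A\<^esub> f (tup2 a c)"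
   by (intro MC.cocycle_identity[OF fF(1) _ _ _ df] D.G_carrier(2))
 qed
 have bbc: "continuous_map (subtopology (mtop M) D.Weps) (mtop N) C.bb" unfolding D.Weps_def by (rule C.bb_continuous)
 have WT: "D.Weps \<subseteq> topspace (mtop M)" by (rule openin_subset[OF D.Weps_open])
 have bbA: "C.bb a : carrier A" if "a : D.Weps" for a
  using bbc that WT lieN(4) by (auto simp: continuous_map_def Pi_iff)
 \<comment> \<open>Outside the neighbourhood on which \<open>bb\<close> is known to be continuous
   the unit is taken.\<close>
 define g where "g a = (if a : D.Weps then C.bb a else \<one>\<^bsub>A\<^esub>)" for a
 define b where "b = (\<lambda>s\<in>tuples G 1. g (s 0))"
 have pc: "continuous_map (mtop (pow_manifold n M)) (mtop M) (%s. s j)" if "j < n" for n j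
  unfolding mtop_pow by (rule continuous_map_product_projection) (use that in simp)
 have bl: "b : lcm_cochains G M A N 1" unfolding b_def
 proof (rule MC.lcmI)
  show "g (s 0) : carrier A" for s using bbA by (simp add: g_def MC.A.one_closed)
  have "g : measurable (borel_of (mtop M)) (borel_of (mtop N))" unfolding g_def
   by (rule measurable_extend_by_const[OF D.Weps_open bbc]) (use lieN(4) MC.A.one_closed in simp)
  from measurable_compose[OF continuous_imp_measurable[OF pc[of 0 1]] this]
  show "meas 1 M N (%s. g (s 0))" by (simp add: meas_def)
  let ?W = "{s : topspace (mtop ?P1). s 0 : D.Weps}"
  have "continuous_map (subtopology (mtop ?P1) ?W) (subtopology (mtop M) D.Weps) (%s. s 0)"
   unfolding continuous_map_in_subtopology using continuous_map_from_subtopology[OF pc[of 0 1]] by auto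
  from continuous_map_compose[OF this bbc] have "continuous_map (subtopology (mtop ?P1) ?W) (mtop N) (%s. C.bb (s 0))" by (simp add: o_def)
  hence "continuous_map (subtopology (mtop ?P1) ?W) (mtop N) (%s. g (s 0))" by (rule continuous_map_eq) (auto simp: g_def)
  moreover have "openin (mtop ?P1) ?W" by (rule openin_continuous_map_preimage[OF pc D.Weps_open]) simp
  moreover have "id_tuple G 1 : ?W" using MC.id_top D.one_Weps by (auto simp: id_tuple_def)
  ultimately show "cont_near (id_tuple G 1) 1 M N (%s. g (s 0))" unfolding cont_near_def by blast
 qed
 have bF: "b : carrier (product_group (tuples G 1) (%_. A))" using bl unfolding MC.lcm_iff by blast
 have bt: "b (tup1 a) = C.bb a" if "a : D.Weps" for a
  using that MC.tup_in(1)[of a] WT lieM(4) by (auto simp: b_def g_def tup1_def)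
 note dl = MC.d1_closed(1)[OF bl]
 have dF: "coboundary G A act 1 b : carrier ?PG" using dl unfolding MC.lcm_iff by blast
 define h where "h = f \<otimes>\<^bsub>?PG\<^esub> inv\<^bsub>?PG\<^esub> coboundary G A act 1 b"
 have "h : lcm_cochains G M A N 2" unfolding h_def
  by (intro subgroup.m_closed[OF MC.subgroup_lcm f] subgroup.m_inv_closed[OF MC.subgroup_lcm dl])
 hence hF: "h : carrier ?PG" "meas 2 M N h" unfolding MC.lcm_iff by blast+
 have hs: "h s = f s \<otimes>\<^bsub>A\<^esub> inv\<^bsub>A\<^esub> coboundary G A act 1 b s" if "s : tuples G 2" for s
  unfolding h_def MC.inv_PG[OF dF] using that by simp
 \<comment> \<open>The coboundary of \<open>b\<close> involves the two entries and their product;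
   \<open>b\<close> agrees with \<open>bb\<close> only on \<open>Weps\<close>, so all three must lie
   there.\<close>
 let ?W = "{s : topspace (mtop ?P). s 0 : D.Weps} \<inter> {s : topspace (mtop ?P). s 1 : D.Weps} \<inter> {s : topspace (mtop ?P). s 0 \<otimes>\<^bsub>G\<^esub> s 1 : D.Weps}"
 have mc: "continuous_map (mtop ?P) (mtop M) (%s. s 0 \<otimes>\<^bsub>G\<^esub> s 1)"
 proof -
  have "continuous_map (mtop ?P) (prod_topology (mtop M) (mtop M)) (%s. (s 0, s 1))"
   unfolding continuous_map_paired using pc[of 0 2] pc[of 1 2] by simp
  from continuous_map_compose[OF this smooth_map_prod_continuous[OF lieM(5)]] show ?thesis by (simp add: o_def)
 qed
 have oW: "openin (mtop ?P) ?W"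
  by (intro openin_Int openin_continuous_map_preimage[OF pc D.Weps_open] openin_continuous_map_preimage[OF mc D.Weps_open]) simp_all
 have "smooth_map_on ?P N ?W h"
 proof (rule D.plot_imp_smooth_map_on[OF C.smooth_representative _ oW])
  show "s k : D.Weps" if "s : ?W" "k < 2" for s k
  proof -
   have "k = 0 \<or> k = 1" using that(2) by auto
   thus ?thesis using that(1) by (elim disjE) auto
  qed
  fix s x assume s: "s : ?W" and gx: "!!k. k < 2 ==> gm k x = s k"
  have g01: "gm 0 x = s 0" "gm 1 x = s 1" using gx by simp_all
  have sT: "s : tuples G 2" using s unfolding MC.topspace_pow by blast
  show "h s = f (tup2 (gm 0 x) (gm 1 x)) \<otimes>\<^bsub>A\<^esub>
    inv\<^bsub>A\<^esub> (act (gm 0 x) (C.bb (gm 1 x)) \<otimes>\<^bsub>A\<^esub> inv\<^bsub>A\<^esub> C.bb (gm 0 x \<otimes>\<^bsub>G\<^esub> gm 1 x) \<otimes>\<^bsub>A\<^esub> C.bb (gm 0 x))"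
   unfolding hs[OF sT] MC.d1[OF bF sT] g01 MC.tup2_eta[OF sT] using bt[of "s 0"] bt[of "s 1"] bt[of "s 0 \<otimes>\<^bsub>G\<^esub> s 1"] s by simp
 qed simp
 moreover have "id_tuple G 2 : ?W" using MC.id_top[of 2] D.one_Weps MC.G.one_closed by (auto simp: id_tuple_def)
 ultimately have "smooth_near (id_tuple G 2) 2 M N h" unfolding smooth_near_def using oW by blast
 hence "h : lsm_cochains G M A N 2" unfolding MC.lsm_iff using hF by blast
 thus ?thesis using bl unfolding h_def by blast
qed

end

section \<open>Reduction to normalised cochains\<close>

context module_cochains
begin

lemma log_chart:
 obtains U ps r s \<delta> L e U0 ph0 where "coh A N U ps r s \<delta> L e G M act U0 ph0"
proof -
 have tp: "\<one>\<^bsub>G\<^esub> : topspace (mtop M)" "\<one>\<^bsub>A\<^esub> : topspace (mtop N)" using lieM(4) lieN(4) by simp_all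
 obtain U ps where U: "(U, ps) : matlas N" "\<one>\<^bsub>A\<^esub> : U" using charted_cover[OF lieN(3) tp(2)] by blast
 obtain U0 ph0 where U0: "(U0, ph0) : matlas M" "\<one>\<^bsub>G\<^esub> : U0" using charted_cover[OF lieM(3) tp(1)] by blast
 interpret ab_chart A N U ps by (rule ab_chart.intro[OF A lieA U])
 obtain r s \<delta> L e where "log_group A N U ps r s \<delta> L e" using log_group_exists by blast
 hence "coh A N U ps r s \<delta> L e G M act U0 ph0" by (rule coh.intro[OF _ coh_axioms.intro[OF lieG mod U0]])
 thus thesis by (rule that)
qed

text \<open>At the pair of units the coboundary of the constant c is c - c + c. Its coboundary can
  thus be used to normalise a 2-cochain.\<close>

lemma d1_const: "c : carrier A ==> d 1 (const_cochain c) (tup2 \<one>\<^bsub>G\<^esub> \<one>\<^bsub>G\<^esub>) = c"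
proof -
 assume c: "c : carrier A"
 have k: "const_cochain c : carrier (PG 1)" using const_cochain(1)[OF c] unfolding lsm_iff by blast
 show ?thesis using d1[OF k tup_in(2)[OF G.one_closed G.one_closed]] c
  by (simp only: tup2_app G.l_one[OF G.one_closed] const_cochain(2)[OF c G.one_closed] modD(4)[OF c] A.r_inv[OF c] A.l_one[OF c])
qed

text \<open>Subtracting the constant cochain \<open>b 1\<close> makes \<open>b\<close> small near the identity, so that
 the logarithm applies; constant cochains and their coboundaries are smooth.\<close>

lemma lcm_cochain_smooth:
 assumes b: "b : lcm' 1" and db: "d 1 b : lsm' 2"
 shows "b : lsm' 1"
proof -
 interpret P1: comm_group "PG 1" by (rule PG)
 interpret P2: comm_group "PG 2" by (rule PG)
 interpret d1: group_hom "PG 1" "PG 2" "d 1" using d_group_hom[of 1] unfolding one_add_one .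
 have bF: "b : carrier (PG 1)" using b unfolding lcm_iff by blast
 define c where "c = b (tup1 \<one>\<^bsub>G\<^esub>)"
 have c: "c : carrier A" unfolding c_def by (rule cochainD[OF bF tup_in(1)[OF G.one_closed]])
 note k = const_cochain(1)[OF c]
 have kF: "const_cochain c : carrier (PG 1)" using k unfolding lsm_iff by blast
 have kl: "const_cochain c : lcm' 1" by (rule subsetD[OF lsm_subset_lcm k])
 define b' where "b' = b \<otimes>\<^bsub>PG 1\<^esub> inv\<^bsub>PG 1\<^esub> const_cochain c"
 have b'l: "b' : lcm' 1" unfolding b'_def by (intro subgroup.m_closed[OF subgroup_lcm b] subgroup.m_inv_closed[OF subgroup_lcm kl])
 have "d 1 b' = d 1 b \<otimes>\<^bsub>PG 2\<^esub> inv\<^bsub>PG 2\<^esub> d 1 (const_cochain c)"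
  unfolding b'_def by (simp only: d1.hom_mult[OF bF P1.inv_closed[OF kF]] d1.hom_inv[OF kF])
 hence db': "d 1 b' : lsm' 2"
  using subgroup.m_closed[OF subgroup_lsm db subgroup.m_inv_closed[OF subgroup_lsm d1_closed(2)[OF k]]] by simp
 have b'1: "b' (tup1 \<one>\<^bsub>G\<^esub>) = \<one>\<^bsub>A\<^esub>"
  unfolding b'_def inv_PG[OF kF] using tup_in(1)[OF G.one_closed] const_cochain(2)[OF c G.one_closed] c
  by (simp add: c_def[symmetric] del: One_nat_def)
 obtain U ps r s \<delta> L e U0 ph0 where "coh A N U ps r s \<delta> L e G M act U0 ph0" by (rule log_chart)
 from coh.smooth_normalised_cochain[OF this b'l db' b'1] have "b' : lsm' 1" .
 hence "b' \<otimes>\<^bsub>PG 1\<^esub> const_cochain c : lsm' 1" by (rule subgroup.m_closed[OF subgroup_lsm _ k])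
 moreover have "b' \<otimes>\<^bsub>PG 1\<^esub> const_cochain c = b"
  unfolding b'_def P1.m_assoc[OF bF P1.inv_closed[OF kF] kF] P1.l_inv[OF kF] by (rule P1.r_one[OF bF])
 ultimately show ?thesis by simp
qed

text \<open>The coboundary of a constant normalises \<open>f\<close> at (1,1); the primitive for
  \<open>f\<close> is then that constant cochain times the one found for the normalised
  cocycle.\<close>

lemma lcm_cocycle_smooth_representative:
 assumes f: "f : lcm' 2" and df: "d 2 f = \<one>\<^bsub>PG 3\<^esub>"
 shows "\<exists>b\<in>lcm' 1. f \<otimes>\<^bsub>PG 2\<^esub> inv\<^bsub>PG 2\<^esub> d 1 b : lsm' 2"
proof -
 interpret P1: comm_group "PG 1" by (rule PG)
 interpret P2: comm_group "PG 2" by (rule PG)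
 interpret P3: comm_group "PG 3" by (rule PG)
 interpret d1: group_hom "PG 1" "PG 2" "d 1" using d_group_hom[of 1] unfolding one_add_one .
 interpret d2: group_hom "PG 2" "PG 3" "d 2" using d_group_hom[of 2] by simp
 have fF: "f : carrier (PG 2)" using f unfolding lcm_iff by blast
 have t1: "tup2 \<one>\<^bsub>G\<^esub> \<one>\<^bsub>G\<^esub> : T 2" by (rule tup_in(2)[OF G.one_closed G.one_closed])
 define c where "c = f (tup2 \<one>\<^bsub>G\<^esub> \<one>\<^bsub>G\<^esub>)"
 have c: "c : carrier A" unfolding c_def by (rule cochainD[OF fF t1])
 define k where "k = const_cochain c"
 have kl: "k : lcm' 1" unfolding k_def by (rule subsetD[OF lsm_subset_lcm const_cochain(1)[OF c]])
 hence kF: "k : carrier (PG 1)" unfolding lcm_iff by blast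
 note dkl = d1_closed(1)[OF kl] and dkF = d1.hom_closed[OF kF]
 define f' where "f' = f \<otimes>\<^bsub>PG 2\<^esub> inv\<^bsub>PG 2\<^esub> d 1 k"
 have f'l: "f' : lcm' 2" unfolding f'_def by (intro subgroup.m_closed[OF subgroup_lcm f] subgroup.m_inv_closed[OF subgroup_lcm dkl])
 have df': "d 2 f' = \<one>\<^bsub>PG 3\<^esub>"
  unfolding f'_def by (simp only: d2.hom_mult[OF fF P2.inv_closed[OF dkF]] d2.hom_inv[OF dkF] df d2_d1[OF kF] P3.inv_one P3.l_one[OF P3.one_closed])
 have f'1: "f' (tup2 \<one>\<^bsub>G\<^esub> \<one>\<^bsub>G\<^esub>) = \<one>\<^bsub>A\<^esub>"
  unfolding f'_def inv_PG[OF dkF] using t1 d1_const[OF c] c by (simp add: c_def[symmetric] k_def del: One_nat_def)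
 obtain U ps r s \<delta> L e U0 ph0 where "coh A N U ps r s \<delta> L e G M act U0 ph0" by (rule log_chart)
 from coh.smooth_normalised_cocycle[OF this f'l df' f'1]
 obtain b where b: "b : lcm' 1" "f' \<otimes>\<^bsub>PG 2\<^esub> inv\<^bsub>PG 2\<^esub> d 1 b : lsm' 2" by blast
 have bF: "b : carrier (PG 1)" using b(1) unfolding lcm_iff by blast
 note dbF = d1.hom_closed[OF bF]
 have "f \<otimes>\<^bsub>PG 2\<^esub> inv\<^bsub>PG 2\<^esub> d 1 (k \<otimes>\<^bsub>PG 1\<^esub> b) = f' \<otimes>\<^bsub>PG 2\<^esub> inv\<^bsub>PG 2\<^esub> d 1 b"
  unfolding f'_def d1.hom_mult[OF kF bF] P2.inv_mult[OF dkF dbF]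
  by (rule P2.m_assoc[OF fF P2.inv_closed[OF dkF] P2.inv_closed[OF dbF], symmetric])
 thus ?thesis using b(2) subgroup.m_closed[OF subgroup_lcm kl b(1)] by (intro bexI[of _ "k \<otimes>\<^bsub>PG 1\<^esub> b"]) (simp_all only:)
qed

end

theorem theorem3:
  fixes G :: "('g, 'c) monoid_scheme" and M :: "('g, 'i) manifold"
    and A :: "('a, 'd) monoid_scheme" and N :: "('a, 'j) manifold"
    and act :: "'g \<Rightarrow> 'a \<Rightarrow> 'a"
  assumes "lie_group G M"
    and "smooth_module G M A N act"
  shows "natural_map G M A N act 2 \<in> iso (H_lsm G M A N act 2) (H_lcm G M A N act 2)"
proof -
 interpret module_cochains G M A N act by (rule module_cochains.intro[OF assms])
 show ?thesis by (rule natural_map_iso[OF lcm_cochain_smooth lcm_cocycle_smooth_representative])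
qed

end
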